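(* Fix non-negative integers $n_\bullet, n_\circ, n_{{\bullet\!\!\!\bigcirc}}, n_{{\circ\!\!\!\bigcirc}}$. Then $$\sum_{\mathcal T}(-1)^{n(\mathcal T)} \;=\; \#\{\text{rooted planar bicubic maps with hard particles } \mathcal M\} \;=\; \#\{\text{rooted good trees}\},$$ where: the left sum runs over all rooted admissible trees $\mathcal T$ having exactly $n_\bullet$ black-empty, $n_\circ$ white-empty, $n_{{\bullet\!\!\!\bigcirc}}$ black-occupied and $n_{{\circ\!\!\!\bigcirc}}$ white-occupied inner vertices, and $n(\mathcal T)$ is the number of NHP inner edges of $\mathcal T$; the middle count is over rooted planar bicubic maps with hard particles having $n_\bullet+1$ black-empty, $n_\circ$ white-empty, $n_{{\bullet\!\!\!\bigcirc}}$ black-occupied and $n_{{\circ\!\!\!\bigcirc}}$ white-occupied vertices; the right count is over rooted good trees with the same vertex numbers as in the left sum.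
   Context: A planar bicubic map with hard particles is a planar map (considered up to orientation-preserving homeomorphism of the sphere) all of whose vertices have degree 3, each vertex being coloured black or white, every edge joining a black to a white vertex, and each vertex being either empty or occupied by a particle, such that no edge has both endpoints occupied. It is rooted if it has a marked oriented edge (the root edge) whose origin (the root vertex) is a black-empty vertex. A blossom tree is a plane tree whose inner vertices are black or white, all of degree 3, whose inner edges all join a black to a white inner vertex, and whose remaining (degree-one) ends are of two kinds: buds, attached only to black inner vertices and given charge $-1$, and leaves, attached only to white inner vertices and given charge $+1$; the total charge (#leaves $-$ #buds) is $3$. Removing an inner edge $e$ splits the tree into two parts; let $q_\circ$ (resp. $q_\bullet$) be the total charge of buds and leaves in the part containing the white (resp. black) endpoint of $e$; then $q_\circ+q_\bullet=3$, $q_\circ\equiv 2 \bmod 3$. The edge $e$ is regular if $q_\circ\ge 0$ and $q_\bullet\le 1$ (equivalently $q_\circ\ge 2$), and non-regular otherwise. Closing procedure: walking counterclockwise around the tree gives a cyclic sequence of buds and leaves; repeatedly join each bud that is immediately followed (among not yet matched buds and leaves) by a leaf into a new edge (drawn without crossings), until no such pair remains. Exactly three leaves remain unmatched; connect them to a new black vertex placed in the outer face. The result is a planar bicubic map. A rooted blossom tree is one with a distinguished leaf among the three unmatched ones; its closing is rooted at the edge from the new black vertex to this leaf's endpoint. Trees with particles: each inner vertex of a blossom tree may additionally be empty or occupied; an inner edge is HP if at most one of its endpoints is occupied and NHP if both are. When closing, the occupancy of vertices is kept and the new black vertex is empty. An admissible tree is a blossom tree with particles in which every HP inner edge is regular and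 every NHP inner edge is non-regular. A good tree is a blossom tree with particles in which every inner edge is HP and regular and whose closing produces a map with no edge having both endpoints occupied. *)

theory Defs
  imports Main
begin

section \<open>Combinatorial maps (rotation systems)\<close>

text \<open>A map is encoded by its darts (half-edges) 0..nd-1, a permutation sg giving the
counterclockwise cyclic order of darts around each vertex, and a fixed-point-free involution
al pairing the two darts of each edge. Vertices = orbits of sg, edges = orbits of al,
faces = orbits of sg o al. Both permutations are the identity outside the dart set.\<close>

record cmap =
  nd :: nat
  sg :: "nat \<Rightarrow> nat"
  al :: "nat \<Rightarrow> nat"

definition orb :: "(nat \<Rightarrow> nat) \<Rightarrow> nat \<Rightarrow> nat set" where
  "orb f x = {(f ^^ k) x | k. True}"

definition verts :: "'a cmap_scheme \<Rightarrow> nat set set" where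
  "verts M = {orb (sg M) x | x. x < nd M}"

definition edges :: "'a cmap_scheme \<Rightarrow> nat set set" where
  "edges M = {orb (al M) x | x. x < nd M}"

definition faces :: "'a cmap_scheme \<Rightarrow> nat set set" where
  "faces M = {orb (sg M \<circ> al M) x | x. x < nd M}"

definition map_steps :: "'a cmap_scheme \<Rightarrow> (nat \<times> nat) set" where
  "map_steps M = {(x, sg M x) | x. x < nd M} \<union> {(x, al M x) | x. x < nd M}"

definition wf_cmap :: "'a cmap_scheme \<Rightarrow> bool" where
  "wf_cmap M \<longleftrightarrow>
     bij_betw (sg M) {..<nd M} {..<nd M} \<and> (\<forall>x. nd M \<le> x \<longrightarrow> sg M x = x) \<and>
     bij_betw (al M) {..<nd M} {..<nd M} \<and> (\<forall>x. nd M \<le> x \<longrightarrow> al M x = x) \<and>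
     (\<forall>x<nd M. al M (al M x) = x \<and> al M x \<noteq> x)"

definition connected_cmap :: "'a cmap_scheme \<Rightarrow> bool" where
  "connected_cmap M \<longleftrightarrow> (\<forall>x<nd M. \<forall>y<nd M. (x, y) \<in> (map_steps M)\<^sup>*)"

text \<open>Planar map: connected, and of genus 0 (Euler's formula V - E + F = 2).\<close>
definition planar_cmap :: "'a cmap_scheme \<Rightarrow> bool" where
  "planar_cmap M \<longleftrightarrow> wf_cmap M \<and> connected_cmap M \<and>
     int (card (verts M)) - int (card (edges M)) + int (card (faces M)) = 2"

text \<open>Degree of the vertex carrying dart x.\<close>
definition deg :: "'a cmap_scheme \<Rightarrow> nat \<Rightarrow> nat" where
  "deg M x = card (orb (sg M) x)"

section \<open>Rooted planar bicubic maps with hard particles\<close>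

text \<open>blk x: the vertex of dart x is black (otherwise white); occ x: it is occupied.
rt: the root dart (root edge oriented away from the root vertex).\<close>

record bmap = cmap +
  blk :: "nat \<Rightarrow> bool"
  occ :: "nat \<Rightarrow> bool"
  rt :: nat

definition rooted_bicubic_hp :: "bmap \<Rightarrow> bool" where
  "rooted_bicubic_hp M \<longleftrightarrow> planar_cmap M \<and>
     (\<forall>x<nd M. blk M (sg M x) = blk M x \<and> occ M (sg M x) = occ M x) \<and>
     (\<forall>x<nd M. deg M x = 3) \<and>
     (\<forall>x<nd M. blk M (al M x) \<noteq> blk M x) \<and>
     (\<forall>x<nd M. \<not> (occ M x \<and> occ M (al M x))) \<and>
     rt M < nd M \<and> blk M (rt M) \<and> \<not> occ M (rt M)"

text \<open>Number of vertices of the given colour (True = black) and occupancy.\<close>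
definition nverts_bm :: "bmap \<Rightarrow> bool \<Rightarrow> bool \<Rightarrow> nat" where
  "nverts_bm M b p = card {orb (sg M) x | x. x < nd M \<and> blk M x = b \<and> occ M x = p}"

text \<open>Isomorphism: orientation-preserving relabelling of darts preserving all structure.\<close>
definition bmap_iso :: "bmap \<Rightarrow> bmap \<Rightarrow> bool" where
  "bmap_iso M M' \<longleftrightarrow> nd M = nd M' \<and> (\<exists>f. bij_betw f {..<nd M} {..<nd M'} \<and>
     (\<forall>x<nd M. f (sg M x) = sg M' (f x) \<and> f (al M x) = al M' (f x) \<and>
        blk M' (f x) = blk M x \<and> occ M' (f x) = occ M x) \<and> f (rt M) = rt M')"

definition bmaps :: "nat \<Rightarrow> nat \<Rightarrow> nat \<Rightarrow> nat \<Rightarrow> bmap set" where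
  "bmaps be we bo wo = {M. rooted_bicubic_hp M \<and>
     nverts_bm M True False = be \<and> nverts_bm M False False = we \<and>
     nverts_bm M True True = bo \<and> nverts_bm M False True = wo}"

text \<open>Isomorphism classes of rooted maps with the given vertex numbers.\<close>
definition bmap_classes :: "nat \<Rightarrow> nat \<Rightarrow> nat \<Rightarrow> nat \<Rightarrow> bmap set set" where
  "bmap_classes be we bo wo =
     bmaps be we bo wo // {(M, M'). M \<in> bmaps be we bo wo \<and> M' \<in> bmaps be we bo wo \<and> bmap_iso M M'}"

section \<open>Blossom trees with particles\<close>

datatype vkind = Inner | Bud | Leaf

text \<open>A blossom tree is a plane tree (a planar map which is a tree); buds and leaves are its
vertices of degree one, marked by kind. blk/occ are only meaningful on inner vertices.
rtl is the dart of the distinguished leaf (for rooted trees).\<close>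

record btree = cmap +
  kind :: "nat \<Rightarrow> vkind"
  tblk :: "nat \<Rightarrow> bool"
  tocc :: "nat \<Rightarrow> bool"
  rtl :: nat

definition inner :: "btree \<Rightarrow> nat \<Rightarrow> bool" where
  "inner T x \<longleftrightarrow> kind T x = Inner"

definition inner_edge_dart :: "btree \<Rightarrow> nat \<Rightarrow> bool" where
  "inner_edge_dart T x \<longleftrightarrow> x < nd T \<and> inner T x \<and> inner T (al T x)"

definition blossom_tree :: "btree \<Rightarrow> bool" where
  "blossom_tree T \<longleftrightarrow> planar_cmap T \<and>
     int (card (verts T)) = int (card (edges T)) + 1 \<and>
     (\<forall>x<nd T. kind T (sg T x) = kind T x \<and> tblk T (sg T x) = tblk T x \<and>
                 tocc T (sg T x) = tocc T x) \<and>
     (\<forall>x<nd T. inner T x \<longrightarrow> deg T x = 3) \<and>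
     (\<forall>x<nd T. \<not> inner T x \<longrightarrow> deg T x = 1) \<and>
     (\<forall>x. inner_edge_dart T x \<longrightarrow> tblk T (al T x) \<noteq> tblk T x) \<and>
     (\<forall>x<nd T. kind T x = Bud \<longrightarrow> inner T (al T x) \<and> tblk T (al T x)) \<and>
     (\<forall>x<nd T. kind T x = Leaf \<longrightarrow> inner T (al T x) \<and> \<not> tblk T (al T x)) \<and>
     int (card {x. x < nd T \<and> kind T x = Leaf}) - int (card {x. x < nd T \<and> kind T x = Bud}) = 3"

text \<open>Total charge (leaves +1, buds -1) of a set of darts.\<close>
definition charge :: "btree \<Rightarrow> nat set \<Rightarrow> int" where
  "charge T S = int (card {y \<in> S. kind T y = Leaf}) - int (card {y \<in> S. kind T y = Bud})"

text \<open>The part of the tree containing (the vertex of) dart x after removing the edge of x.\<close>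
definition side :: "btree \<Rightarrow> nat \<Rightarrow> nat set" where
  "side T x = {y. y < nd T \<and> (x, y) \<in>
     ({(z, sg T z) | z. z < nd T} \<union> {(z, al T z) | z. z < nd T \<and> z \<noteq> x \<and> z \<noteq> al T x})\<^sup>*}"

text \<open>For an inner edge, given by its dart w at the white endpoint: q_white and q_black.\<close>
definition q_white :: "btree \<Rightarrow> nat \<Rightarrow> int" where
  "q_white T w = charge T (side T w)"

definition q_black :: "btree \<Rightarrow> nat \<Rightarrow> int" where
  "q_black T w = charge T (side T (al T w))"

definition regular_edge :: "btree \<Rightarrow> nat \<Rightarrow> bool" where
  "regular_edge T w \<longleftrightarrow> q_white T w \<ge> 0 \<and> q_black T w \<le> 1"

definition HP_edge :: "btree \<Rightarrow> nat \<Rightarrow> bool" where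
  "HP_edge T x \<longleftrightarrow> \<not> (tocc T x \<and> tocc T (al T x))"

text \<open>White darts of inner edges (one per inner edge).\<close>
definition white_inner_dart :: "btree \<Rightarrow> nat \<Rightarrow> bool" where
  "white_inner_dart T w \<longleftrightarrow> inner_edge_dart T w \<and> \<not> tblk T w"

text \<open>Number of NHP inner edges.\<close>
definition n_NHP :: "btree \<Rightarrow> nat" where
  "n_NHP T = card {{x, al T x} | x. inner_edge_dart T x \<and> \<not> HP_edge T x}"

subsection \<open>Closing procedure\<close>

text \<open>Face permutation: iterating it walks counterclockwise around the tree; the buds and
leaves (darts of non-inner vertices) met along the way form the cyclic sequence.\<close>
definition phi :: "btree \<Rightarrow> nat \<Rightarrow> nat" where
  "phi T = sg T \<circ> al T"

definition ends :: "btree \<Rightarrow> nat set" where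
  "ends T = {x. x < nd T \<and> \<not> inner T x}"

text \<open>The element of U immediately following y in the cyclic sequence.\<close>
definition next_in :: "btree \<Rightarrow> nat set \<Rightarrow> nat \<Rightarrow> nat" where
  "next_in T U y = (phi T ^^ (LEAST k. 0 < k \<and> (phi T ^^ k) y \<in> U)) y"

definition unmatched :: "btree \<Rightarrow> (nat \<times> nat) set \<Rightarrow> nat set" where
  "unmatched T P = ends T - (fst ` P \<union> snd ` P)"

text \<open>States reachable by the closing procedure: P is the set of (bud, leaf) pairs already
joined into new edges.\<close>
inductive closing_run :: "btree \<Rightarrow> (nat \<times> nat) set \<Rightarrow> bool" for T where
  start: "closing_run T {}"
| join: "closing_run T P \<Longrightarrow> b \<in> unmatched T P \<Longrightarrow> kind T b = Bud \<Longrightarrow>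
         next_in T (unmatched T P) b = l \<Longrightarrow> kind T l = Leaf \<Longrightarrow>
         closing_run T (insert (b, l) P)"

text \<open>Final matching of the closing procedure (no bud/leaf pair can be joined any more).\<close>
definition closing_matching :: "btree \<Rightarrow> (nat \<times> nat) set \<Rightarrow> bool" where
  "closing_matching T P \<longleftrightarrow> closing_run T P \<and>
     \<not> (\<exists>b \<in> unmatched T P. kind T b = Bud \<and> kind T (next_in T (unmatched T P) b) = Leaf)"

text \<open>Rooted: the distinguished leaf is one of the leaves left unmatched by the closing.\<close>
definition rooted_blossom_tree :: "btree \<Rightarrow> bool" where
  "rooted_blossom_tree T \<longleftrightarrow> blossom_tree T \<and> rtl T < nd T \<and> kind T (rtl T) = Leaf \<and>
     (\<forall>P. closing_matching T P \<longrightarrow> rtl T \<in> unmatched T P)"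

definition admissible :: "btree \<Rightarrow> bool" where
  "admissible T \<longleftrightarrow> blossom_tree T \<and>
     (\<forall>w. white_inner_dart T w \<longrightarrow>
        (HP_edge T w \<longrightarrow> regular_edge T w) \<and> (\<not> HP_edge T w \<longrightarrow> \<not> regular_edge T w))"

text \<open>Edges of the closed map: the inner edges of T (occupancy unchanged), one new edge
between the inner vertices of b and l for each matched pair (b, l), and the edges from the
new empty black vertex to the three unmatched leaves (which can never join two occupied
vertices). Good: all inner edges HP and regular, and the closing has no edge with both
endpoints occupied.\<close>
definition good :: "btree \<Rightarrow> bool" where
  "good T \<longleftrightarrow> blossom_tree T \<and>
     (\<forall>w. white_inner_dart T w \<longrightarrow> HP_edge T w \<and> regular_edge T w) \<and>
     (\<forall>P. closing_matching T P \<longrightarrow>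
        (\<forall>(b, l) \<in> P. \<not> (tocc T (al T b) \<and> tocc T (al T l))))"

text \<open>Number of inner vertices of the given colour (True = black) and occupancy.\<close>
definition nverts_bt :: "btree \<Rightarrow> bool \<Rightarrow> bool \<Rightarrow> nat" where
  "nverts_bt T b p = card {orb (sg T) x | x. x < nd T \<and> inner T x \<and> tblk T x = b \<and> tocc T x = p}"

definition btree_iso :: "btree \<Rightarrow> btree \<Rightarrow> bool" where
  "btree_iso T T' \<longleftrightarrow> nd T = nd T' \<and> (\<exists>f. bij_betw f {..<nd T} {..<nd T'} \<and>
     (\<forall>x<nd T. f (sg T x) = sg T' (f x) \<and> f (al T x) = al T' (f x) \<and>
        kind T' (f x) = kind T x \<and>
        (inner T x \<longrightarrow> tblk T' (f x) = tblk T x \<and> tocc T' (f x) = tocc T x)) \<and>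
     f (rtl T) = rtl T')"

definition tree_set :: "(btree \<Rightarrow> bool) \<Rightarrow> nat \<Rightarrow> nat \<Rightarrow> nat \<Rightarrow> nat \<Rightarrow> btree set" where
  "tree_set Q be we bo wo = {T. rooted_blossom_tree T \<and> Q T \<and>
     nverts_bt T True False = be \<and> nverts_bt T False False = we \<and>
     nverts_bt T True True = bo \<and> nverts_bt T False True = wo}"

text \<open>Isomorphism classes of rooted trees satisfying Q with the given inner vertex numbers.\<close>
definition tree_classes :: "(btree \<Rightarrow> bool) \<Rightarrow> nat \<Rightarrow> nat \<Rightarrow> nat \<Rightarrow> nat \<Rightarrow> btree set set" where
  "tree_classes Q be we bo wo =
     tree_set Q be we bo wo // {(T, T'). T \<in> tree_set Q be we bo wo \<and> T' \<in> tree_set Q be we bo wo \<and> btree_iso T T'}"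

end

theory Submission
  imports Defs
begin

text \<open>
  Opening a rooted bicubic map M splits the root vertex into three leaves and cuts some edges. The trees
  obtained this way correspond to spanning arborescences of the dual digraph, in which every edge of M is
  crossed with its black end on a fixed side, rooted at the faces around the root vertex: the cut edges
  are the arcs of the arborescence, and closing the tree recovers M. Counting leaves minus buds along the
  contour gives a height on the faces of M, and an uncut edge is regular iff its arc is no shortcut
  for the heights, ties being broken by the contour order. Hence, if a set S of arcs is forbidden and all faces
  remain reachable, there is exactly one cut set avoiding S for which all other uncut edges are regular:
  the leftmost geodesic arborescence.

  With S empty this matches good trees with maps. For admissible trees, inclusion-exclusion turns the
  signed sum over the trees closing to M into the sum of (-1)^|S| over the sets S of doubly occupied
  edges whose removal leaves all faces reachable. If there is a doubly occupied edge, then some such edge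
  points into a face that is reachable without any of them; toggling it cancels the sum.
\<close>

section \<open>Orbits, components and the genus inequality\<close>

text \<open>The only topological input is the inequality V - E + F <= 2c, valid for every rotation
  system with c components. It is applied three times: it makes every closing planar, it separates
  the three faces at the root vertex, and it shows that deleting an edge of a tree cuts the contour
  into exactly the two sides of the edge. In a bipartite cubic tree the charge behind an inner edge
  is fixed modulo 3, so an irregular arc descends by at least 1, and a descent of more than 1 is at
  least 4. This is why the two thresholds of \<open>regular_arc\<close> amount to one comparison
  with a tie rule. The obstacle in the signed sum is that the tree and the role of its edges vary
  together. It is overcome by exempting a set S of edges both from being cut and from being regular.
  For a fixed cut set the exempt sets that fit form a Boolean interval, from the irregular uncut
  arcs to the uncut conflicts, and its signed sum vanishes unless the two ends coincide, which is
  admissibility.\<close>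

lemma orb_self [simp]: "x \<in> orb f x"
  unfolding orb_def by (rule CollectI, rule exI[of _ 0]) simp

lemma orb_step: "y \<in> orb f x \<Longrightarrow> f y \<in> orb f x"
  unfolding orb_def by clarsimp (metis funpow.simps(2) o_apply)

lemma orb_pow: "(f ^^ k) x \<in> orb f x"
  unfolding orb_def by auto

lemma orb_subset:
  assumes "x \<in> A" "\<And>y. y \<in> A \<Longrightarrow> f y \<in> A"
  shows "orb f x \<subseteq> A"
proof -
  have "(f ^^ k) x \<in> A" for k
    by (induction k) (use assms in auto)
  then show ?thesis by (auto simp: orb_def)
qed

lemma orb_mono: "y \<in> orb f x \<Longrightarrow> orb f y \<subseteq> orb f x"
  by (rule orb_subset) (auto intro: orb_step)

lemma orb_eq:
  assumes "finite D" "bij_betw f D D" "x \<in> D" "y \<in> orb f x"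
  shows "orb f y = orb f x"
proof -
  have in_D: "orb f z \<subseteq> D" if "z \<in> D" for z
    using that assms(2) by (intro orb_subset) (auto dest: bij_betwE)
  have image: "f ` orb f z = orb f (f z)" for z
  proof -
    have "f ((f ^^ k) z) = (f ^^ k) (f z)" for k
      by (simp add: funpow_swap1)
    then show ?thesis unfolding orb_def by (auto simp: image_iff) (metis)+
  qed
  have one: "orb f (f z) = orb f z" if "z \<in> D" for z
  proof -
    have fin: "finite (orb f z)" using in_D[OF that] assms(1) finite_subset by blast
    have "f ` orb f z \<subseteq> orb f z" by (auto intro: orb_step)
    moreover have "inj_on f (orb f z)"
      using assms(2) in_D[OF that] by (meson bij_betw_def inj_on_subset)
    ultimately have "f ` orb f z = orb f z" using endo_inj_surj fin by blast
    then show ?thesis using image by simp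
  qed
  have "orb f ((f ^^ k) x) = orb f x \<and> (f ^^ k) x \<in> D" for k
  proof (induction k)
    case (Suc k)
    then show ?case using one[of "(f ^^ k) x"] assms(2) by (auto dest: bij_betwE)
  qed (use assms in simp)
  moreover obtain k where "y = (f ^^ k) x" using assms(4) by (auto simp: orb_def)
  ultimately show ?thesis by simp
qed

text \<open>Turns the degree condition, a cardinality, into equations for the permutation that the
  simplifier can use.\<close>

lemma orb_card_3D:
  assumes D: "bij_betw f D D" "x \<in> D" and card: "card (orb f x) = 3"
  shows "f (f (f x)) = x \<and> f x \<noteq> x \<and> f (f x) \<noteq> x \<and> orb f x = {x, f x, f (f x)}"
proof -
  have inj: "f y = f z \<longleftrightarrow> y = z" if "y \<in> D" "z \<in> D" for y z
    using D(1) that by (auto simp: bij_betw_def inj_on_def)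
  have fD: "f x \<in> D" "f (f x) \<in> D" using D by (auto dest: bij_betwE)
  have ne1: "f x \<noteq> x"
  proof
    assume "f x = x"
    then have "orb f x \<subseteq> {x}" by (intro orb_subset) auto
    then have "card (orb f x) \<le> 1" using card_mono[of "{x}" "orb f x"] by simp
    then show False using card by simp
  qed
  have ne2: "f (f x) \<noteq> x"
  proof
    assume "f (f x) = x"
    then have "orb f x \<subseteq> {x, f x}" by (intro orb_subset) auto
    then have "card (orb f x) \<le> card {x, f x}" by (intro card_mono) auto
    then show False using card by (simp add: card_insert_if split: if_splits)
  qed
  have ne3: "f (f x) \<noteq> f x" using ne1 inj D fD by simp
  have sub: "{x, f x, f (f x)} \<subseteq> orb f x" by (simp add: orb_step)
  have "finite (orb f x)" using card card.infinite by fastforce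
  then have eq: "orb f x = {x, f x, f (f x)}"
    using sub card ne1 ne2 ne3 by (intro card_subset_eq[symmetric]) (auto simp: card_insert_if)
  have "f (f (f x)) \<in> orb f x" by (simp add: orb_step)
  then have "f (f (f x)) = x"
    unfolding eq using ne1 ne2 ne3 D fD inj by auto
  then show ?thesis using ne1 ne2 eq by blast
qed

lemma orb_card_3I:
  assumes "f (f (f x)) = x" "f x \<noteq> x" "f (f x) \<noteq> x" "f (f x) \<noteq> f x"
  shows "card (orb f x) = 3"
proof -
  have "orb f x = {x, f x, f (f x)}"
  proof
    show "orb f x \<subseteq> {x, f x, f (f x)}" by (rule orb_subset) (use assms in auto)
    show "{x, f x, f (f x)} \<subseteq> orb f x" by (simp add: orb_step)
  qed
  then show ?thesis using assms by (simp add: card_insert_if)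
qed

section \<open>Connected components of a relation and their number\<close>

definition linked :: "('a \<times> 'a) set \<Rightarrow> 'a \<Rightarrow> 'a set" where
  "linked r x = {y. (x, y) \<in> (r \<union> r\<inverse>)\<^sup>*}"

definition ncomp :: "'a set \<Rightarrow> ('a \<times> 'a) set \<Rightarrow> nat" where
  "ncomp D r = card (linked r ` D)"

lemma linked_refl [simp]: "x \<in> linked r x"
  by (simp add: linked_def)

lemma linked_sym: "y \<in> linked r x \<Longrightarrow> x \<in> linked r y"
proof -
  have "((r \<union> r\<inverse>)\<^sup>*)\<inverse> = (r \<union> r\<inverse>)\<^sup>*"
    by (metis Un_commute converse_Un converse_converse rtrancl_converse)
  then show "y \<in> linked r x \<Longrightarrow> x \<in> linked r y"
    unfolding linked_def by blast
qed

lemma linked_trans: "y \<in> linked r x \<Longrightarrow> z \<in> linked r y \<Longrightarrow> z \<in> linked r x"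
  unfolding linked_def by (auto intro: rtrancl_trans)

lemma linked_eq: "y \<in> linked r x \<Longrightarrow> linked r y = linked r x"
  using linked_sym linked_trans by fast

lemma linked_pair: "(x, y) \<in> r \<Longrightarrow> y \<in> linked r x"
  unfolding linked_def by auto

lemma linked_subset:
  assumes "\<And>a b. (a, b) \<in> r \<Longrightarrow> b \<in> linked s a"
  shows "linked r x \<subseteq> linked s x"
proof
  fix y assume "y \<in> linked r x"
  then have "(x, y) \<in> (r \<union> r\<inverse>)\<^sup>*" by (simp add: linked_def)
  then show "y \<in> linked s x"
    by (induction rule: rtrancl_induct)
      (auto intro: linked_trans assms linked_sym[OF assms])
qed

lemma linked_closed:
  assumes "x \<in> A" "\<And>a b. (a, b) \<in> r \<Longrightarrow> a \<in> A \<longleftrightarrow> b \<in> A"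
  shows "linked r x \<subseteq> A"
proof
  fix y assume "y \<in> linked r x"
  then have "(x, y) \<in> (r \<union> r\<inverse>)\<^sup>*" by (simp add: linked_def)
  then show "y \<in> A" by (induction rule: rtrancl_induct) (use assms in auto)
qed

lemma linked_insert_same:
  assumes "b \<in> linked r a"
  shows "linked (insert (a, b) r) x = linked r x"
proof
  show "linked (insert (a, b) r) x \<subseteq> linked r x"
    by (rule linked_subset) (use assms linked_pair in fastforce)
  show "linked r x \<subseteq> linked (insert (a, b) r) x"
    by (rule linked_subset) (simp add: linked_pair)
qed

lemma linked_insert:
  "linked (insert (a, b) r) x =
    (if x \<in> linked r a \<union> linked r b then linked r a \<union> linked r b else linked r x)"
proof -
  let ?r = "insert (a, b) r"
  have up: "linked r z \<subseteq> linked ?r z" for z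
    by (rule linked_subset) (simp add: linked_pair)
  have ab: "b \<in> linked ?r a" by (simp add: linked_pair)
  show ?thesis
  proof (cases "x \<in> linked r a \<union> linked r b")
    case True
    have "linked ?r x \<subseteq> linked r a \<union> linked r b"
    proof (rule linked_closed[OF True])
      fix u v assume "(u, v) \<in> ?r"
      then show "u \<in> linked r a \<union> linked r b \<longleftrightarrow> v \<in> linked r a \<union> linked r b"
        using linked_trans linked_sym linked_pair[of u v r] linked_refl by fast
    qed
    moreover have "linked ?r x = linked ?r a"
      using True up ab by (metis UnE linked_eq subsetD)
    moreover have "linked r a \<union> linked r b \<subseteq> linked ?r a"
      using up ab linked_eq by (metis le_sup_iff)
    ultimately show ?thesis using True by auto
  next
    case False
    have "linked ?r x \<subseteq> linked r x"
    proof (rule linked_closed)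
      fix u v assume "(u, v) \<in> ?r"
      then consider "u = a" "v = b" | "v \<in> linked r u" by (auto dest: linked_pair)
      then show "u \<in> linked r x \<longleftrightarrow> v \<in> linked r x"
      proof cases
        case 1
        then show ?thesis using False linked_sym[of a r x] linked_sym[of b r x] by auto
      next
        case 2
        then have "linked r v = linked r u" by (rule linked_eq)
        then show ?thesis using linked_sym[of _ r x] linked_sym[of x r] by blast
      qed
    qed simp
    then show ?thesis using False up[of x] by auto
  qed
qed

lemma linked_Union:
  assumes "\<And>a b. (a, b) \<in> r \<Longrightarrow> b \<in> linked s a"
  shows "\<Union>(linked s ` linked r x) = linked s x"
  using linked_subset[OF assms, of r x] linked_eq linked_refl by fastforce

text \<open>Each component of \<open>s\<close> is a union of components of \<open>r\<close>, which
  gives a surjection from the components of \<open>r\<close> to those of \<open>s\<close>.\<close>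

lemma ncomp_mono:
  assumes "finite D" "\<And>a b. (a, b) \<in> r \<Longrightarrow> b \<in> linked s a"
  shows "ncomp D s \<le> ncomp D r"
proof -
  have "linked s ` D = (\<lambda>c. \<Union>(linked s ` c)) ` (linked r ` D)"
    using linked_Union[OF assms(2)] by (simp add: image_image)
  then show ?thesis unfolding ncomp_def using assms(1) by (metis card_image_le finite_imageI)
qed

lemma ncomp_insert_diff:
  assumes "finite D" "a \<in> D" "b \<in> D" "b \<notin> linked r a"
  shows "ncomp D r = Suc (ncomp D (insert (a, b) r))"
proof -
  let ?A = "linked r a" and ?B = "linked r b" and ?r = "insert (a, b) r"
  have ne: "?A \<noteq> ?B" using assms(4) by (metis linked_refl)
  have AB: "?A \<union> ?B \<notin> linked r ` D"
  proof
    assume "?A \<union> ?B \<in> linked r ` D"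
    then obtain x where x: "linked r x = ?A \<union> ?B" by auto
    then have "a \<in> linked r x" "b \<in> linked r x" by auto
    then have "linked r a = linked r b" by (simp add: linked_eq)
    then show False using ne by simp
  qed
  have "linked ?r ` D = insert (?A \<union> ?B) (linked r ` D - {?A, ?B})"
  proof (intro equalityI subsetI)
    fix c assume "c \<in> linked ?r ` D"
    then obtain x where x: "x \<in> D" "c = linked ?r x" by auto
    show "c \<in> insert (?A \<union> ?B) (linked r ` D - {?A, ?B})"
    proof (cases "x \<in> ?A \<union> ?B")
      case False
      then have "linked r x \<noteq> ?A" "linked r x \<noteq> ?B" using linked_refl[of x r] by force+
      then show ?thesis using x False by (simp add: linked_insert)
    qed (use x in \<open>simp add: linked_insert\<close>)
  next
    fix c assume c: "c \<in> insert (?A \<union> ?B) (linked r ` D - {?A, ?B})"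
    show "c \<in> linked ?r ` D"
    proof (cases "c = ?A \<union> ?B")
      case True
      then have "c = linked ?r a" unfolding linked_insert by simp
      then show ?thesis using assms(2) by blast
    next
      case False
      then obtain x where x: "x \<in> D" "c = linked r x" "c \<noteq> ?A" "c \<noteq> ?B" using c by auto
      then have "x \<notin> ?A \<union> ?B" using linked_eq by (metis UnE)
      then have "c = linked ?r x" using x unfolding linked_insert by simp
      then show ?thesis using x by blast
    qed
  qed
  then have "ncomp D ?r = Suc (card (linked r ` D - {?A, ?B}))"
    unfolding ncomp_def using AB assms(1) by (simp add: card_insert_if)
  moreover have "card (linked r ` D - {?A, ?B}) = card (linked r ` D) - 2"
    using assms ne by (subst card_Diff_subset) auto
  moreover have "card (linked r ` D) \<ge> 2"
  proof -
    have "card {?A, ?B} \<le> card (linked r ` D)" using assms by (intro card_mono) auto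
    then show ?thesis using ne by simp
  qed
  ultimately show ?thesis by (simp add: ncomp_def)
qed

lemma ncomp_insert_ge:
  assumes "finite D" "a \<in> D" "b \<in> D"
  shows "ncomp D r \<le> Suc (ncomp D (insert (a, b) r))"
proof (cases "b \<in> linked r a")
  case True
  then have "ncomp D (insert (a, b) r) = ncomp D r"
    unfolding ncomp_def by (simp add: linked_insert_same cong: image_cong)
  then show ?thesis by simp
qed (use ncomp_insert_diff[OF assms] in simp)

text \<open>The surjection from the components of \<open>r\<close> to those of \<open>s\<close> is
  injective once the two counts agree, so no component of \<open>s\<close> falls apart in
  \<open>r\<close>.\<close>

lemma linked_eq_of_ncomp_eq:
  assumes "finite D" "\<And>a b. (a, b) \<in> r \<Longrightarrow> b \<in> linked s a" "ncomp D r = ncomp D s"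
    "x \<in> D" "linked s x \<subseteq> D"
  shows "linked r x = linked s x"
proof
  show "linked r x \<subseteq> linked s x" by (rule linked_subset[OF assms(2)])
  let ?h = "\<lambda>c. \<Union>(linked s ` c)"
  have h: "?h (linked r z) = linked s z" for z by (rule linked_Union[OF assms(2)])
  have "?h ` (linked r ` D) = linked s ` D" using h by (simp add: image_image)
  then have inj: "inj_on ?h (linked r ` D)"
    using assms(1,3) unfolding ncomp_def by (metis eq_card_imp_inj_on finite_imageI)
  show "linked s x \<subseteq> linked r x"
  proof
    fix y assume y: "y \<in> linked s x"
    then have "?h (linked r y) = ?h (linked r x)" using linked_eq[OF y] by (simp only: h)
    then have "linked r y = linked r x"
      using inj assms(4,5) y by (meson imageI inj_onD subsetD)
    then show "y \<in> linked r x" using linked_refl[of y r] by simp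
  qed
qed

definition graph_on :: "'a set \<Rightarrow> ('a \<Rightarrow> 'a) \<Rightarrow> ('a \<times> 'a) set" where
  "graph_on D f = {(x, f x) | x. x \<in> D}"

lemma graph_on_iff [simp]: "(x, y) \<in> graph_on D f \<longleftrightarrow> x \<in> D \<and> y = f x"
  by (auto simp: graph_on_def)

lemma orb_in:
  assumes "bij_betw f D D" "x \<in> D"
  shows "orb f x \<subseteq> D"
  using assms by (intro orb_subset) (auto dest: bij_betwE)

lemma linked_graph_on:
  assumes "finite D" "bij_betw f D D" "x \<in> D"
  shows "linked (graph_on D f) x = orb f x"
proof
  show "orb f x \<subseteq> linked (graph_on D f) x"
  proof -
    have "orb f x \<subseteq> linked (graph_on D f) x \<inter> D"
      by (rule orb_subset)
        (use assms in \<open>auto intro: linked_trans[OF _ linked_pair] dest: bij_betwE\<close>)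
    then show ?thesis by blast
  qed
  show "linked (graph_on D f) x \<subseteq> orb f x"
  proof (rule linked_closed)
    fix a b assume ab: "(a, b) \<in> graph_on D f"
    then have "orb f b = orb f a" using assms by (intro orb_eq[of D]) (auto intro: orb_step)
    then show "a \<in> orb f x \<longleftrightarrow> b \<in> orb f x"
      using orb_mono[of _ f x] orb_self by blast
  qed simp
qed

lemma ncomp_graph_on:
  assumes "finite D" "bij_betw f D D"
  shows "ncomp D (graph_on D f) = card (orb f ` D)"
  unfolding ncomp_def using linked_graph_on[OF assms] by (simp cong: image_cong)

text \<open>From \<open>x\<close> the map \<open>g\<close> jumps to \<open>f y\<close> and then runs
  along the \<open>f\<close>-cycle of \<open>y\<close>, which avoids \<open>x\<close> and on which
  \<open>g\<close> differs from \<open>f\<close> only at \<open>y\<close>.\<close>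

lemma orb_swap_merges:
  assumes "finite D" "bij_betw f D D" "x \<in> D" "y \<in> D" "y \<notin> orb f x"
    "g x = f y" "\<And>z. z \<noteq> x \<Longrightarrow> z \<noteq> y \<Longrightarrow> g z = f z"
  shows "y \<in> orb g x"
proof -
  have yf: "y \<in> orb f (f y)"
    using orb_eq[OF assms(1,2,4) orb_step[OF orb_self]] by simp
  then obtain k where k: "(f ^^ k) (f y) = y" unfolding orb_def by (auto simp: eq_commute)
  define n where "n = (LEAST n. (f ^^ n) (f y) = y)"
  have n: "(f ^^ n) (f y) = y" unfolding n_def using k by (rule LeastI)
  have nmin: "(f ^^ j) (f y) \<noteq> y" if "j < n" for j
    using that not_less_Least unfolding n_def by blast
  have notx: "(f ^^ j) (f y) \<noteq> x" for j
  proof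
    assume "(f ^^ j) (f y) = x"
    then have "x \<in> orb f (f y)" using orb_pow by metis
    then have "x \<in> orb f y" using orb_mono[OF orb_step[OF orb_self]] by blast
    then have "orb f x = orb f y" by (rule orb_eq[OF assms(1,2,4)])
    then show False using assms(5) by simp
  qed
  have "(f ^^ j) (f y) \<in> orb g x" if "j \<le> n" for j
    using that
  proof (induction j)
    case 0
    then show ?case using orb_step[OF orb_self, of g x] assms(6) by simp
  next
    case (Suc j)
    then have "(f ^^ j) (f y) \<in> orb g x" by simp
    moreover have "g ((f ^^ j) (f y)) = f ((f ^^ j) (f y))"
      using assms(7) notx nmin Suc.prems by simp
    ultimately show ?case using orb_step[of "(f ^^ j) (f y)" g x] by simp
  qed
  then have "(f ^^ n) (f y) \<in> orb g x" by simp
  then show ?thesis using n by simp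
qed

text \<open>With a link between \<open>x\<close> and \<open>y\<close> added, \<open>g\<close>
  connects everything that \<open>f\<close> connects, and one link lowers the number of components
  by at most one.\<close>

lemma ncomp_graph_swap_le:
  assumes "finite D" "x \<in> D" "y \<in> D" "x \<noteq> y"
    "g x = f y" "g y = f x" "\<And>z. z \<noteq> x \<Longrightarrow> z \<noteq> y \<Longrightarrow> g z = f z"
  shows "ncomp D (graph_on D g) \<le> Suc (ncomp D (graph_on D f))"
proof -
  let ?R = "insert (x, y) (graph_on D g)"
  have "b \<in> linked ?R a" if "(a, b) \<in> graph_on D f" for a b
  proof -
    have xy: "y \<in> linked ?R x" and yx: "x \<in> linked ?R y"
      by (simp_all add: linked_pair linked_sym)
    have step: "g a \<in> linked ?R a" if "a \<in> D" for a using that by (simp add: linked_pair)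
    show ?thesis
    proof (cases "a = x \<or> a = y")
      case True
      then show ?thesis
        using that assms step[of x] step[of y] linked_trans[OF xy] linked_trans[OF yx] by auto
    next
      case False
      then show ?thesis using that assms(7)[of a] step[of a] by simp
    qed
  qed
  then have "ncomp D ?R \<le> ncomp D (graph_on D f)" using ncomp_mono assms(1) by blast
  then show ?thesis using ncomp_insert_ge[OF assms(1-3), of "graph_on D g"] by simp
qed

text \<open>Here the swap joins the two cycles, so \<open>g\<close> already connects all that
  \<open>f\<close> together with the link connects, and that link is not redundant for
  \<open>f\<close>.\<close>

lemma ncomp_graph_swap_merge:
  assumes "finite D" "bij_betw f D D" "x \<in> D" "y \<in> D" "y \<notin> orb f x" "bij_betw g D D"
    "g x = f y" "g y = f x" "\<And>z. z \<noteq> x \<Longrightarrow> z \<noteq> y \<Longrightarrow> g z = f z"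
  shows "Suc (ncomp D (graph_on D g)) \<le> ncomp D (graph_on D f)"
proof -
  let ?G = "graph_on D g" and ?R = "insert (x, y) (graph_on D f)"
  have xy: "y \<in> linked ?G x"
    using orb_swap_merges[OF assms(1-5,7,9)] linked_graph_on[OF assms(1,6,3)] by blast
  have step: "g a \<in> linked ?G a" if "a \<in> D" for a using that by (simp add: linked_pair)
  have "b \<in> linked ?G a" if "(a, b) \<in> ?R" for a b
  proof -
    from that consider "a = x" "b = y" | "a \<in> D" "b = f a" by auto
    then show ?thesis
    proof cases
      case 2
      show ?thesis
      proof (cases "a = x \<or> a = y")
        case True
        then show ?thesis
          using 2 assms step[of x] step[of y] linked_trans[OF xy] linked_trans[OF linked_sym[OF xy]]
          by auto
      next
        case False
        then show ?thesis using 2 assms(9)[of a] step[of a] by simp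
      qed
    qed (simp add: xy)
  qed
  then have "ncomp D ?G \<le> ncomp D ?R" using ncomp_mono assms(1) by blast
  moreover have "ncomp D (graph_on D f) = Suc (ncomp D ?R)"
    using assms linked_graph_on[OF assms(1,2,3)] by (intro ncomp_insert_diff) auto
  ultimately show ?thesis by simp
qed

lemma bij_betw_involution:
  assumes "\<And>x. x \<in> D \<Longrightarrow> a x \<in> D \<and> a (a x) = x"
  shows "bij_betw a D D"
  by (rule bij_betw_byWitness[where f' = a]) (use assms in auto)

text \<open>Reconnecting the two ends of one edge multiplies the face permutation by a transposition:
  either it splits a face, or it merges two faces and lowers the number of components by at most one.\<close>
theorem genus_inequality:
  fixes D :: "nat set"
  assumes "finite D" "bij_betw s D D" "\<And>x. x \<in> D \<Longrightarrow> a x \<in> D \<and> a (a x) = x"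
  shows "2 * (ncomp D (graph_on D s) + ncomp D (graph_on D (s \<circ> a)))
           \<le> 4 * ncomp D (graph_on D s \<union> graph_on D a) + card {x \<in> D. a x \<noteq> x}"
  using assms(3)
proof (induction "card {x \<in> D. a x \<noteq> x}" arbitrary: a rule: less_induct)
  case less
  let ?S = "graph_on D s"
  show ?case
  proof (cases "\<forall>x\<in>D. a x = x")
    case True
    have "graph_on D (s \<circ> a) = ?S" using True by (auto simp: graph_on_def)
    moreover have "ncomp D ?S \<le> ncomp D (?S \<union> graph_on D a)"
    proof (rule ncomp_mono[OF assms(1)])
      fix u v assume "(u, v) \<in> ?S \<union> graph_on D a"
      then show "v \<in> linked ?S u" using True by (auto intro: linked_pair)
    qed
    ultimately show ?thesis by simp
  next
    case False
    then obtain x where x: "x \<in> D" "a x \<noteq> x" by blast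
    define y where "y = a x"
    have y: "y \<in> D" "a y = x" "x \<noteq> y" using x less.prems by (auto simp: y_def)
    \<comment> \<open>The edge is deleted by making its two darts fixed points of the involution.
      The vertices stay as they are; only faces and components change.\<close>
    define a' where "a' = a(x := x, y := y)"
    have nxy: "z \<noteq> x \<Longrightarrow> z \<noteq> y \<Longrightarrow> z \<in> D \<Longrightarrow> a z \<noteq> x \<and> a z \<noteq> y" for z
      using less.prems[of z] y by (metis y_def)
    have a': "a' z \<in> D \<and> a' (a' z) = z" if "z \<in> D" for z
      using that less.prems[of z] x y nxy[of z] by (auto simp: a'_def)
    have sub: "{z \<in> D. a z \<noteq> z} = insert x (insert y {z \<in> D. a' z \<noteq> z})"
      using x y by (auto simp: a'_def y_def)
    have "x \<notin> {z \<in> D. a' z \<noteq> z}" "y \<notin> {z \<in> D. a' z \<noteq> z}" by (auto simp: a'_def)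
    then have cd: "card {z \<in> D. a z \<noteq> z} = card {z \<in> D. a' z \<noteq> z} + 2"
      unfolding sub using y assms(1) by (simp add: card_insert_if)
    let ?F = "graph_on D (s \<circ> a)" and ?F' = "graph_on D (s \<circ> a')"
    let ?R = "?S \<union> graph_on D a" and ?R' = "?S \<union> graph_on D a'"
    have IH: "2 * (ncomp D ?S + ncomp D ?F') \<le> 4 * ncomp D ?R' + card {z \<in> D. a' z \<noteq> z}"
      by (rule less.hyps) (use cd a' in auto)
    have bij: "bij_betw (s \<circ> a) D D" "bij_betw (s \<circ> a') D D"
      using bij_betw_trans[OF bij_betw_involution[OF less.prems] assms(2)]
        bij_betw_trans[OF bij_betw_involution[OF a'] assms(2)] by auto
    have sw: "(s \<circ> a) x = (s \<circ> a') y" "(s \<circ> a) y = (s \<circ> a') x"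
      "\<And>z. z \<noteq> x \<Longrightarrow> z \<noteq> y \<Longrightarrow> (s \<circ> a) z = (s \<circ> a') z"
      using y by (auto simp: a'_def y_def)
    have "ncomp D (insert (x, y) ?R') \<le> ncomp D ?R"
    proof (rule ncomp_mono[OF assms(1)])
      fix u v assume uv: "(u, v) \<in> ?R"
      show "v \<in> linked (insert (x, y) ?R') u"
      proof (cases "(u, v) \<in> ?S")
        case False
        then have v: "u \<in> D" "v = a u" using uv by auto
        have "y \<in> linked (insert (x, y) ?R') x" by (simp add: linked_pair)
        then show ?thesis
          using v linked_sym linked_pair[of u "a' u" "insert (x, y) ?R'"] y
          by (cases "u = x \<or> u = y") (auto simp: a'_def y_def)
      qed (simp add: linked_pair)
    qed
    then have R: "ncomp D (insert (x, y) ?R') \<le> ncomp D ?R" .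
    show ?thesis
    proof (cases "y \<in> orb (s \<circ> a') x")
      case True
      have "y \<in> linked ?F' x" using True linked_graph_on[OF assms(1) bij(2) x(1)] by simp
      moreover have "linked ?F' x \<subseteq> linked ?R' x"
      proof (rule linked_subset)
        fix u v assume "(u, v) \<in> ?F'"
        then have u: "u \<in> D" "v = s (a' u)" by auto
        then have "a' u \<in> linked ?R' u" "v \<in> linked ?R' (a' u)"
          using a' by (auto intro: linked_pair)
        then show "v \<in> linked ?R' u" by (rule linked_trans)
      qed
      ultimately have "ncomp D (insert (x, y) ?R') = ncomp D ?R'"
        unfolding ncomp_def by (simp add: linked_insert_same subset_iff cong: image_cong)
      moreover have "ncomp D ?F \<le> Suc (ncomp D ?F')"
        using ncomp_graph_swap_le[OF assms(1) x(1) y(1) y(3), of "s \<circ> a" "s \<circ> a'"] sw by simp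
      ultimately show ?thesis using IH R cd by simp
    next
      case False
      have "Suc (ncomp D ?F) \<le> ncomp D ?F'"
        using ncomp_graph_swap_merge[OF assms(1) bij(2) x(1) y(1) False bij(1)] sw by simp
      moreover have "ncomp D ?R' \<le> Suc (ncomp D (insert (x, y) ?R'))"
        using ncomp_insert_ge[OF assms(1) x(1) y(1)] .
      ultimately show ?thesis using IH R cd by simp
    qed
  qed
qed

lemma card_eq_mult_orbits:
  assumes "finite D" "bij_betw f D D" "A \<subseteq> D" "\<And>x. x \<in> A \<Longrightarrow> f x \<in> A"
    "\<And>x. x \<in> A \<Longrightarrow> card (orb f x) = k"
  shows "card A = k * card (orb f ` A)"
proof -
  have A: "orb f x \<subseteq> A" if "x \<in> A" for x using orb_subset[of x A f] that assms(4) by blast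
  have "card (\<Union>(orb f ` A)) = sum card (orb f ` A)"
  proof (rule card_Union_disjoint)
    show "pairwise disjnt (orb f ` A)"
    proof (rule pairwiseI)
      fix a b assume "a \<in> orb f ` A" "b \<in> orb f ` A" "a \<noteq> b"
      then show "disjnt a b"
        using orb_eq[OF assms(1,2)] assms(3) unfolding disjnt_iff by (metis imageE subsetD)
    qed
    show "finite a" if "a \<in> orb f ` A" for a
      using that A assms(1,3) by (metis finite_subset imageE)
  qed
  moreover have "\<Union>(orb f ` A) = A" using A by auto
  moreover have "sum card (orb f ` A) = k * card (orb f ` A)"
    using assms(5) by (subst sum.cong[OF refl, of _ card "\<lambda>_. k"]) auto
  ultimately show ?thesis by simp
qed

section \<open>Positions along a single cycle\<close>

definition pos_of :: "(nat \<Rightarrow> nat) \<Rightarrow> nat \<Rightarrow> nat \<Rightarrow> nat" where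
  "pos_of f r x = (LEAST k. (f ^^ k) r = x)"

locale cyclic =
  fixes D :: "nat set" and f :: "nat \<Rightarrow> nat" and r :: nat
  assumes fin: "finite D" and bij: "bij_betw f D D" and rD: "r \<in> D"
    and transitive: "\<And>x. x \<in> D \<Longrightarrow> x \<in> orb f r"
begin

abbreviation "pos \<equiv> pos_of f r"

lemma pow_in: "(f ^^ k) r \<in> D"
  using orb_in[OF bij rD] orb_pow by blast

lemma pow_pos [simp]: "x \<in> D \<Longrightarrow> (f ^^ pos x) r = x"
  using transitive[of x] unfolding pos_of_def orb_def by (auto intro: LeastI)

lemma pos_inj: "x \<in> D \<Longrightarrow> y \<in> D \<Longrightarrow> pos x = pos y \<Longrightarrow> x = y"
  using pow_pos by metis

lemma pos_le: "(f ^^ k) r = x \<Longrightarrow> pos x \<le> k"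
  unfolding pos_of_def by (rule Least_le)

lemma pos_root [simp]: "pos r = 0"
  using pos_le[of 0 r] by simp

text \<open>The least return time enumerates \<open>D\<close> without repetition, hence equals
  \<open>card D\<close>.\<close>

lemma period: "(f ^^ card D) r = r \<and> inj_on (\<lambda>k. (f ^^ k) r) {..<card D}"
proof -
  have "r \<in> orb f (f r)" using orb_eq[OF fin bij rD orb_step[OF orb_self]] by simp
  then obtain k where "(f ^^ k) (f r) = r" unfolding orb_def by (auto simp: eq_commute)
  then have ex: "0 < Suc k \<and> (f ^^ Suc k) r = r" by (simp add: funpow_swap1)
  define p where "p = (LEAST p. 0 < p \<and> (f ^^ p) r = r)"
  have p: "0 < p" "(f ^^ p) r = r" using LeastI[of "\<lambda>p. 0 < p \<and> (f ^^ p) r = r", OF ex] by (auto simp: p_def)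
  have pmin: "\<not> (0 < q \<and> (f ^^ q) r = r)" if "q < p" for q
    using that not_less_Least unfolding p_def by blast
  have modp: "(f ^^ k) r = (f ^^ (k mod p)) r" for k
    using funpow_mod_eq[OF p(2), of k] by simp
  have Deq: "D = (\<lambda>k. (f ^^ k) r) ` {..<p}"
  proof
    show "D \<subseteq> (\<lambda>k. (f ^^ k) r) ` {..<p}"
    proof
      fix x assume "x \<in> D"
      then have "x = (f ^^ (pos x mod p)) r" using modp pow_pos by metis
      then show "x \<in> (\<lambda>k. (f ^^ k) r) ` {..<p}" using p by auto
    qed
  qed (use pow_in in auto)
  have inj: "inj_on (\<lambda>k. (f ^^ k) r) {..<p}"
  proof (rule linorder_inj_onI)
    fix i j assume ij: "i < j" "i \<in> {..<p}" "j \<in> {..<p}"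
    show "(f ^^ i) r \<noteq> (f ^^ j) r"
    proof
      assume eq: "(f ^^ i) r = (f ^^ j) r"
      have "(f ^^ (p - j + i)) r = (f ^^ (p - j)) ((f ^^ i) r)" by (simp add: funpow_add)
      also have "\<dots> = (f ^^ (p - j + j)) r" using eq by (simp add: funpow_add)
      also have "\<dots> = r" using ij p by simp
      finally show False using pmin[of "p - j + i"] ij by auto
    qed
  qed auto
  have "card D = p" using Deq card_image[OF inj] by simp
  then show ?thesis using p inj by simp
qed

lemma card_pos: "0 < card D"
  using fin rD card_gt_0_iff by blast

lemma pos_pow: "k < card D \<Longrightarrow> pos ((f ^^ k) r) = k"
  using period pos_le[of k] pow_pos[OF pow_in, of k] unfolding inj_on_def
  by (metis le_less_trans lessThan_iff refl)

lemma pos_less: "x \<in> D \<Longrightarrow> pos x < card D"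
proof -
  assume x: "x \<in> D"
  have "(f ^^ (pos x mod card D)) r = x"
    using funpow_mod_eq[where f = f and n = "card D" and x = r and m = "pos x"] period x by simp
  then have "pos x \<le> pos x mod card D" by (rule pos_le)
  then show ?thesis using card_pos by (metis le_less_trans mod_less_divisor)
qed

lemma f_in: "x \<in> D \<Longrightarrow> f x \<in> D"
  using bij by (auto dest: bij_betwE)

lemma pos_step: "x \<in> D \<Longrightarrow> pos (f x) = (if Suc (pos x) = card D then 0 else Suc (pos x))"
proof -
  assume x: "x \<in> D"
  have e: "f x = (f ^^ Suc (pos x)) r" using x by simp
  show ?thesis
  proof (cases "Suc (pos x) = card D")
    case True
    then show ?thesis using e period by simp
  next
    case False
    then have "Suc (pos x) < card D" using pos_less[OF x] by simp
    then show ?thesis using False e pos_pow[of "Suc (pos x)"] by simp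
  qed
qed

lemma pos_0D: "x \<in> D \<Longrightarrow> pos x = 0 \<Longrightarrow> x = r"
  using pos_inj[OF _ rD] by simp

lemma pos_SucE:
  assumes "x \<in> D" "pos x = Suc k"
  obtains y where "y \<in> D" "pos y = k" "x = f y"
proof -
  have "k < card D" using pos_less assms by fastforce
  then have "pos ((f ^^ k) r) = k" by (rule pos_pow)
  moreover have "x = f ((f ^^ k) r)" using pow_pos[OF assms(1)] assms(2) by simp
  ultimately show ?thesis using that pow_in by blast
qed

text \<open>The hypothesis covers all earlier positions because, at the later end of a matched pair,
  the arguments go back to the earlier end.\<close>

lemma pos_induct [consumes 1, case_names root step]:
  assumes "x \<in> D" "P r"
    "\<And>x. x \<in> D \<Longrightarrow> Suc (pos x) < card D \<Longrightarrow> (\<And>y. y \<in> D \<Longrightarrow> pos y \<le> pos x \<Longrightarrow> P y) \<Longrightarrow> P (f x)"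
  shows "P x"
  using assms(1)
proof (induction "pos x" arbitrary: x rule: less_induct)
  case less
  show ?case
  proof (cases "pos x")
    case 0
    then show ?thesis using pos_0D[OF less.prems] assms(2) by simp
  next
    case (Suc k)
    then obtain y where y: "y \<in> D" "pos y = k" "x = f y" using pos_SucE less.prems by blast
    have "P (f y)"
      using y Suc pos_less[OF less.prems] by (intro assms(3)) (auto intro: less.hyps)
    then show ?thesis using y by simp
  qed
qed

end

section \<open>Opening a bicubic map along a cut set\<close>

lemma verts_eq: "verts M = orb (sg M) ` {..<nd M}"
  and edges_eq: "edges M = orb (al M) ` {..<nd M}"
  and faces_eq: "faces M = orb (sg M \<circ> al M) ` {..<nd M}"
  unfolding verts_def edges_def faces_def by auto

lemma wf_cmapD:
  assumes "wf_cmap M"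
  shows "bij_betw (sg M) {..<nd M} {..<nd M}" "bij_betw (al M) {..<nd M} {..<nd M}"
    "bij_betw (sg M \<circ> al M) {..<nd M} {..<nd M}"
    "x < nd M \<Longrightarrow> al M (al M x) = x" "x < nd M \<Longrightarrow> al M x \<noteq> x"
    "x < nd M \<Longrightarrow> al M x < nd M" "x < nd M \<Longrightarrow> sg M x < nd M"
  using assms bij_betw_trans[of "al M" "{..<nd M}" "{..<nd M}" "sg M" "{..<nd M}"]
  unfolding wf_cmap_def by (auto dest: bij_betwE)

lemma card_edges:
  assumes "wf_cmap M"
  shows "nd M = 2 * card (edges M)"
proof -
  have "card (orb (al M) x) = 2" if x: "x < nd M" for x
  proof -
    have "orb (al M) x = {x, al M x}"
    proof
      show "orb (al M) x \<subseteq> {x, al M x}"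
        by (rule orb_subset) (use x wf_cmapD[OF assms] in auto)
      show "{x, al M x} \<subseteq> orb (al M) x" by (simp add: orb_step)
    qed
    then show ?thesis using wf_cmapD(5)[OF assms x] by (simp add: card_insert_if)
  qed
  then have "card {..<nd M} = 2 * card (orb (al M) ` {..<nd M})"
    using wf_cmapD[OF assms] by (intro card_eq_mult_orbits[of "{..<nd M}"]) auto
  then show ?thesis by (simp add: edges_eq)
qed

lemma ncomp_connected:
  assumes "wf_cmap M" "connected_cmap M" "0 < nd M"
  shows "ncomp {..<nd M} (graph_on {..<nd M} (sg M) \<union> graph_on {..<nd M} (al M)) = 1"
proof -
  let ?D = "{..<nd M}" and ?R = "graph_on {..<nd M} (sg M) \<union> graph_on {..<nd M} (al M)"
  have R: "map_steps M = ?R" unfolding map_steps_def graph_on_def by auto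
  have L: "linked ?R x = linked ?R 0" if "x < nd M" for x
  proof -
    have "(0, x) \<in> ?R\<^sup>*" using assms that unfolding connected_cmap_def R by auto
    then have "(0, x) \<in> (?R \<union> ?R\<inverse>)\<^sup>*" by (rule rtrancl_mono[THEN subsetD, rotated]) auto
    then have "x \<in> linked ?R 0" by (simp add: linked_def)
    then show ?thesis by (rule linked_eq)
  qed
  have "linked ?R ` ?D = (\<lambda>_. linked ?R 0) ` ?D" by (rule image_cong[OF refl], rule L) simp
  also have "\<dots> = {linked ?R 0}" using assms(3) by (intro image_constant[of 0]) simp
  finally have "linked ?R ` ?D = {linked ?R 0}" .
  then show ?thesis by (simp add: ncomp_def)
qed

lemma euler_le:
  assumes "wf_cmap M" "connected_cmap M" "0 < nd M"
  shows "2 * (card (verts M) + card (faces M)) \<le> 4 + nd M"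
proof -
  have "{x \<in> {..<nd M}. al M x \<noteq> x} = {..<nd M}" using wf_cmapD(5)[OF assms(1)] by auto
  then have cd: "card {x \<in> {..<nd M}. al M x \<noteq> x} = nd M" by simp
  have "2 * (ncomp {..<nd M} (graph_on {..<nd M} (sg M)) +
      ncomp {..<nd M} (graph_on {..<nd M} (sg M \<circ> al M))) \<le>
    4 * ncomp {..<nd M} (graph_on {..<nd M} (sg M) \<union> graph_on {..<nd M} (al M)) +
      card {x \<in> {..<nd M}. al M x \<noteq> x}"
    by (rule genus_inequality) (use wf_cmapD[OF assms(1)] in auto)
  then show ?thesis
    unfolding ncomp_connected[OF assms] cd
    by (simp add: ncomp_graph_on wf_cmapD[OF assms(1)] verts_eq faces_eq)
qed

definition fperm :: "'a cmap_scheme \<Rightarrow> nat \<Rightarrow> nat" where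
  "fperm M = sg M \<circ> al M"

lemma fperm_apply [simp]: "fperm M x = sg M (al M x)"
  by (simp add: fperm_def)

lemma faces_fperm: "faces M = orb (fperm M) ` {..<nd M}"
  by (simp only: faces_eq fperm_def)

text \<open>Planarity and the particle rule are kept apart: planarity is derived for every map with
  a valid cut set, and the trees of the signed sum may close to maps with doubly occupied
  edges.\<close>

definition bicubic :: "bmap \<Rightarrow> bool" where
  "bicubic M \<longleftrightarrow> wf_cmap M \<and>
     (\<forall>x<nd M. blk M (sg M x) = blk M x \<and> occ M (sg M x) = occ M x) \<and>
     (\<forall>x<nd M. deg M x = 3) \<and>
     (\<forall>x<nd M. blk M (al M x) \<noteq> blk M x) \<and>
     rt M < nd M \<and> blk M (rt M) \<and> \<not> occ M (rt M)"

definition root_darts :: "bmap \<Rightarrow> nat set" where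
  "root_darts M = {rt M, sg M (rt M), sg M (sg M (rt M))}"

text \<open>A cut set C opens M into a tree: the root vertex is split into three leaves and the edges
  in C are cut. The permutation contour walks around the opened map, skipping the ends of cut edges.\<close>

definition cutset :: "bmap \<Rightarrow> nat set \<Rightarrow> bool" where
  "cutset M C \<longleftrightarrow> C \<subseteq> {..<nd M} \<and> (\<forall>x\<in>C. al M x \<in> C) \<and> C \<inter> root_darts M = {}"

definition contour :: "bmap \<Rightarrow> nat set \<Rightarrow> nat \<Rightarrow> nat" where
  "contour M C x = (let y = (if x \<in> C then x else al M x) in if y \<in> root_darts M then y else sg M y)"

abbreviation cpos :: "bmap \<Rightarrow> nat set \<Rightarrow> nat \<Rightarrow> nat" where
  "cpos M C \<equiv> pos_of (contour M C) (rt M)"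

definition between :: "bmap \<Rightarrow> nat set \<Rightarrow> nat \<Rightarrow> nat set" where
  "between M C x = {y. y < nd M \<and> cpos M C x < cpos M C y \<and> cpos M C y < cpos M C (al M x)}"

text \<open>The clauses say that the opened map is connected with a single contour, has the edge
  count of a tree, has its cut ends matched by the closing, and meets its root leaves in the order
  opposite to \<open>sg\<close> at the root vertex. The dart count is V = E + 1: the tree has
  \<open>nd M + card C\<close> darts and \<open>(nd M - 3) / 3 + 3 + card C\<close>
  vertices.\<close>

definition valid_cut :: "bmap \<Rightarrow> nat set \<Rightarrow> bool" where
  "valid_cut M C \<longleftrightarrow> cutset M C \<and> (\<forall>x<nd M. x \<in> orb (contour M C) (rt M)) \<and>
     nd M = 3 * card C + 6 \<and>
     (\<forall>x\<in>C. blk M x \<longrightarrow> cpos M C x < cpos M C (al M x) \<and> between M C x \<inter> root_darts M = {} \<and>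
        (\<forall>y\<in>between M C x. y \<in> C \<longrightarrow> al M y \<in> between M C x)) \<and>
     cpos M C (sg M (sg M (rt M))) < cpos M C (sg M (rt M))"

text \<open>Charge collected on the contour step that leaves \<open>x\<close>: the stub behind a
  black cut dart becomes a bud, behind a white one a leaf, and a dart facing the root vertex leads
  to a root leaf.\<close>

definition weight :: "bmap \<Rightarrow> nat set \<Rightarrow> nat \<Rightarrow> int" where
  "weight M C x = (if x \<in> C then (if blk M x then - 1 else 1) else if al M x \<in> root_darts M then 1 else 0)"

definition leg :: "bmap \<Rightarrow> nat \<Rightarrow> int" where
  "leg M x = (if al M x \<in> root_darts M then 1 else 0)"

text \<open>Charge met on the contour before \<open>x\<close>. The starting leaf is charged only on
  the very last step, so the heights at the three root darts are 0, 1 and 2.\<close>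

definition height :: "bmap \<Rightarrow> nat set \<Rightarrow> nat \<Rightarrow> int" where
  "height M C x = (\<Sum>z | z < nd M \<and> cpos M C z < cpos M C x. weight M C z)"

text \<open>The height that remains when matched pairs are ignored: the number of root leaves
  passed, not counting the starting one.\<close>

definition sector :: "bmap \<Rightarrow> nat set \<Rightarrow> nat \<Rightarrow> int" where
  "sector M C x = (\<Sum>z | z < nd M \<and> cpos M C z < cpos M C x. leg M z)"

section \<open>Local structure of a bicubic map\<close>

locale bicubic_map =
  fixes M :: bmap
  assumes bicubic: "bicubic M"
begin

abbreviation "D \<equiv> {..<nd M}"
abbreviation "s \<equiv> sg M"
abbreviation "a \<equiv> al M"
abbreviation "r \<equiv> rt M"
abbreviation "black \<equiv> blk M"
abbreviation "V0 \<equiv> root_darts M"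

lemma wf: "wf_cmap M" using bicubic by (simp add: bicubic_def)

lemma s_in [simp]: "x < nd M \<Longrightarrow> s x < nd M"
  and a_in [simp]: "x < nd M \<Longrightarrow> a x < nd M"
  and aa [simp]: "x < nd M \<Longrightarrow> a (a x) = x"
  and a_neq [simp]: "x < nd M \<Longrightarrow> a x \<noteq> x"
  and bij_s: "bij_betw s D D" and bij_a: "bij_betw a D D"
  and bij_phi: "bij_betw (fperm M) D D"
  using wf_cmapD[OF wf] unfolding fperm_def by auto

lemma black_s [simp]: "x < nd M \<Longrightarrow> black (s x) = black x"
  and occ_s [simp]: "x < nd M \<Longrightarrow> occ M (s x) = occ M x"
  and black_a [simp]: "x < nd M \<Longrightarrow> black (a x) \<longleftrightarrow> \<not> black x"
  and card_orb: "x < nd M \<Longrightarrow> card (orb s x) = 3"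
  and r_in [simp]: "r < nd M" and black_r [simp]: "black r" and occ_r [simp]: "\<not> occ M r"
  using bicubic by (auto simp: bicubic_def deg_def)

lemma s_inj: "x < nd M \<Longrightarrow> y < nd M \<Longrightarrow> s x = s y \<longleftrightarrow> x = y"
  using bij_s unfolding bij_betw_def inj_on_def by blast

lemma a_inj: "x < nd M \<Longrightarrow> y < nd M \<Longrightarrow> a x = a y \<longleftrightarrow> x = y"
  using aa by metis

lemma s_cycle:
  "x < nd M \<Longrightarrow> s (s (s x)) = x \<and> s x \<noteq> x \<and> s (s x) \<noteq> x \<and> orb s x = {x, s x, s (s x)}"
  using orb_card_3D[OF bij_s] card_orb by simp

lemma sss [simp]: "x < nd M \<Longrightarrow> s (s (s x)) = x"
  and s_neq [simp]: "x < nd M \<Longrightarrow> s x \<noteq> x" and ss_neq [simp]: "x < nd M \<Longrightarrow> s (s x) \<noteq> x"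
  using s_cycle by auto

lemma V0_in [simp]: "x \<in> V0 \<Longrightarrow> x < nd M"
  and V0_black [simp]: "x \<in> V0 \<Longrightarrow> black x"
  and V0_occ [simp]: "x \<in> V0 \<Longrightarrow> \<not> occ M x"
  and r_V0 [simp]: "r \<in> V0" and sr_V0 [simp]: "s r \<in> V0" and ssr_V0 [simp]: "s (s r) \<in> V0"
  by (auto simp: root_darts_def)

lemma card_V0: "card V0 = 3"
proof -
  have "s (s r) \<noteq> s r" using s_inj by simp
  then have "card {s r, s (s r)} = 2" by (simp add: card_insert_if eq_commute)
  moreover have "r \<notin> {s r, s (s r)}" using s_neq[OF r_in] ss_neq[OF r_in] by (metis empty_iff insert_iff)
  ultimately show ?thesis by (simp add: root_darts_def)
qed

lemma V0_s [simp]: "x < nd M \<Longrightarrow> s x \<in> V0 \<longleftrightarrow> x \<in> V0"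
proof
  assume x: "x < nd M" "s x \<in> V0"
  then have "s (s (s x)) \<in> V0" using sss[OF r_in] unfolding root_darts_def by (elim insertE emptyE) auto
  then show "x \<in> V0" using x by simp
qed (auto simp: root_darts_def)

lemma V0_a [simp]: "x \<in> V0 \<Longrightarrow> a x \<notin> V0"
  using V0_black V0_in black_a by metis

text \<open>The three moves of the contour: turning past the stub of a cut edge without crossing it,
  stopping at a root leaf, and an ordinary face step.\<close>

lemma contour_cases:
  assumes "cutset M C" "x < nd M"
  obtains (cut) "x \<in> C" "a x \<in> C" "x \<notin> V0" "a x \<notin> V0" "contour M C x = s x"
    | (leg) "x \<notin> C" "a x \<notin> C" "a x \<in> V0" "x \<notin> V0" "\<not> black x" "contour M C x = a x"
    | (other) "x \<notin> C" "a x \<notin> C" "a x \<notin> V0" "contour M C x = s (a x)"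
proof -
  have C: "\<And>y. y \<in> C \<Longrightarrow> a y \<in> C \<and> y \<notin> V0 \<and> y < nd M"
    using assms(1) by (auto simp: cutset_def)
  show thesis
  proof (cases "x \<in> C")
    case True
    then show thesis using C[of x] C[of "a x"] that(1) by (simp add: contour_def)
  next
    case False
    then have n: "a x \<notin> C" using C[of "a x"] assms(2) by auto
    show thesis
    proof (cases "a x \<in> V0")
      case True
      then show thesis
        using that(2) False n V0_a[of "a x"] V0_black[OF True] black_a[OF assms(2)] assms(2) by (simp add: contour_def)
    qed (use that(3) False n in \<open>simp add: contour_def\<close>)
  qed
qed

lemma bij_contour:
  assumes "cutset M C"
  shows "bij_betw (contour M C) D D"
proof -
  let ?f = "\<lambda>x. if x \<in> C then x else a x" and ?g = "\<lambda>y. if y \<in> V0 then y else s y"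
  have C: "\<And>y. y \<in> C \<Longrightarrow> a y \<in> C \<and> y < nd M" using assms by (auto simp: cutset_def)
  have "bij_betw ?f D D"
  proof (rule bij_betw_involution)
    fix x assume x: "x \<in> D"
    have "a x \<in> C \<longleftrightarrow> x \<in> C" using C x by (metis aa lessThan_iff)
    then show "?f x \<in> D \<and> ?f (?f x) = x" using x by auto
  qed
  moreover have "bij_betw ?g D D"
  proof -
    have "inj_on ?g D"
    proof (rule inj_onI)
      fix x y assume "x \<in> D" "y \<in> D" "?g x = ?g y"
      then show "x = y" using V0_s[of x] V0_s[of y] s_inj by (auto split: if_splits)
    qed
    moreover have "?g ` D \<subseteq> D" by auto
    ultimately show ?thesis using endo_inj_surj[of D ?g] by (simp only: bij_betw_def finite_lessThan)
  qed
  ultimately have "bij_betw (?g \<circ> ?f) D D" by (rule bij_betw_trans)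
  moreover have "?g \<circ> ?f = contour M C" by (auto simp: contour_def fun_eq_iff Let_def)
  ultimately show ?thesis by simp
qed

lemma card_black_cut: "cutset M C \<Longrightarrow> 2 * card {x \<in> C. black x} = card C"
proof -
  assume c: "cutset M C"
  then have C: "\<And>x. x \<in> C \<Longrightarrow> x < nd M \<and> a x \<in> C" by (auto simp: cutset_def)
  have fin: "finite C" using c finite_subset by (auto simp: cutset_def)
  have "card C = card ({x \<in> C. black x} \<union> {x \<in> C. \<not> black x})" by (rule arg_cong[of _ _ card]) auto
  also have "\<dots> = card {x \<in> C. black x} + card {x \<in> C. \<not> black x}"
    using fin by (intro card_Un_disjoint) auto
  also have "card {x \<in> C. \<not> black x} = card {x \<in> C. black x}"
    by (rule bij_betw_same_card[of a], rule bij_betw_byWitness[where f' = a]) (auto simp: C)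
  finally show ?thesis by simp
qed

lemma cyclic_contour:
  assumes "cutset M C" "\<forall>x<nd M. x \<in> orb (contour M C) r"
  shows "cyclic D (contour M C) r"
  using assms bij_contour by unfold_locales auto

end

section \<open>Heights and pockets of a valid cut set\<close>

locale valid_map = bicubic_map +
  fixes C :: "nat set"
  assumes valid: "valid_cut M C"
begin

abbreviation "psi \<equiv> contour M C"
abbreviation "p \<equiv> cpos M C"
abbreviation "h \<equiv> height M C"
abbreviation "sec \<equiv> sector M C"

lemma cutset: "cutset M C" using valid by (simp add: valid_cut_def)

lemma C_in [simp]: "x \<in> C \<Longrightarrow> x < nd M" and C_a: "x \<in> C \<Longrightarrow> a x \<in> C"
  and C_V0 [simp]: "x \<in> C \<Longrightarrow> x \<notin> V0"
  using cutset by (auto simp: cutset_def)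

lemma C_a_iff [simp]: "x < nd M \<Longrightarrow> a x \<in> C \<longleftrightarrow> x \<in> C"
  using C_a aa by metis

lemma finC [simp]: "finite C" using cutset finite_subset by (auto simp: cutset_def)

sublocale cyc: cyclic D psi r
  using valid by (intro cyclic_contour) (auto simp: valid_cut_def)

lemma psi_in [simp]: "x < nd M \<Longrightarrow> psi x < nd M"
  using cyc.f_in by auto

lemma p_r [simp]: "p r = 0" by (rule cyc.pos_root)

lemma p_inj: "x < nd M \<Longrightarrow> y < nd M \<Longrightarrow> p x = p y \<longleftrightarrow> x = y"
  using cyc.pos_inj by auto

lemma p_pos: "x < nd M \<Longrightarrow> x \<noteq> r \<Longrightarrow> 0 < p x"
  using cyc.pos_0D by fastforce

lemma psi_ar: "psi (a r) = r"
  using contour_cases[OF cutset, of "a r"] C_V0[of r] C_a_iff[of r] by (metis aa r_V0 r_in a_in)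

text \<open>The walk closes up along the edge of the starting leaf. Every other dart therefore has
  its successor at the next position, without wrapping around.\<close>

lemma p_ar: "Suc (p (a r)) = nd M"
  using cyc.pos_step[of "a r"] psi_ar by (simp split: if_splits)

lemma p_step: "x < nd M \<Longrightarrow> x \<noteq> a r \<Longrightarrow> p (psi x) = Suc (p x)"
  using cyc.pos_step[of x] p_ar p_inj[of x "a r"] by (auto split: if_splits)

lemma p_lt: "x < nd M \<Longrightarrow> x \<noteq> a r \<Longrightarrow> p x < p (a r)"
  using cyc.pos_less[of x] p_ar p_inj[of x "a r"] by fastforce

lemma p_le: "x < nd M \<Longrightarrow> p x \<le> p (a r)"
  using p_lt[of x] by (cases "x = a r") auto

lemma ar_C: "a r \<notin> C" using C_V0[of r] C_a_iff[of r] by auto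

lemma C_step: "x \<in> C \<Longrightarrow> psi x = s x \<and> p (s x) = Suc (p x)"
  using contour_cases[OF cutset C_in] p_step[of x] C_in ar_C by metis

lemma leg_step: "v \<in> V0 \<Longrightarrow> v \<noteq> r \<Longrightarrow> psi (a v) = v \<and> p v = Suc (p (a v))"
proof -
  assume v: "v \<in> V0" "v \<noteq> r"
  then have "psi (a v) = v"
    using contour_cases[OF cutset, of "a v"] by (metis C_V0 C_a_iff V0_in a_in aa)
  moreover have "a v \<noteq> a r" using v a_inj by simp
  ultimately show ?thesis using p_step[of "a v"] v by simp
qed

lemma other_step:
  assumes "x < nd M" "x \<notin> C" "a x \<notin> V0"
  shows "psi x = s (a x) \<and> p (s (a x)) = Suc (p x)"
proof -
  have "psi x = s (a x)" using contour_cases[OF cutset assms(1)] assms by metis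
  moreover have "x \<noteq> a r" using assms by auto
  ultimately show ?thesis using p_step[of x] assms by simp
qed

lemma pair_less: "x \<in> C \<Longrightarrow> black x \<Longrightarrow> p x < p (a x)"
  using valid by (simp add: valid_cut_def)

lemma white_less: "x \<in> C \<Longrightarrow> \<not> black x \<Longrightarrow> p (a x) < p x"
  using pair_less[of "a x"] C_a by simp

lemma between_V0: "x \<in> C \<Longrightarrow> black x \<Longrightarrow> y < nd M \<Longrightarrow> p x < p y \<Longrightarrow> p y < p (a x) \<Longrightarrow> y \<notin> V0"
  using valid unfolding valid_cut_def between_def by blast

lemma between_C:
  "x \<in> C \<Longrightarrow> black x \<Longrightarrow> y \<in> C \<Longrightarrow> p x < p y \<Longrightarrow> p y < p (a x) \<Longrightarrow> p x < p (a y) \<and> p (a y) < p (a x)"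
  using valid C_in[of y] unfolding valid_cut_def between_def by blast

text \<open>A step to a root leaf inside a pair would put the root dart itself inside the pair; the
  step to the starting leaf comes last and lies beyond every pair.\<close>

lemma between_leg:
  assumes "x \<in> C" "black x" "y < nd M" "p x < p y" "p y < p (a x)"
  shows "a y \<notin> V0"
proof
  assume ay: "a y \<in> V0"
  have "a y \<noteq> r"
  proof
    assume "a y = r"
    then have "y = a r" using assms(3) by (metis aa)
    then show False using p_le[of "a x"] assms by simp
  qed
  then have "p (a y) = Suc (p y)" using leg_step[OF ay] assms(3) by simp
  moreover have "p (a y) \<noteq> p (a x)" using p_inj[of "a y" "a x"] ay assms C_V0[OF C_a[OF assms(1)]] by auto
  ultimately show False using between_V0[OF assms(1,2), of "a y"] assms ay by simp
qed

lemma order_V0: "p (s (s r)) < p (s r)"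
  using valid by (simp add: valid_cut_def)

lemma card_C: "nd M = 3 * card C + 6"
  using valid by (simp add: valid_cut_def)

lemma V0_cases [consumes 1, case_names r0 r1 r2]:
  assumes "v \<in> V0" "v = r \<Longrightarrow> P" "v = s (s r) \<Longrightarrow> P" "v = s r \<Longrightarrow> P"
  shows P
  using assms by (auto simp: root_darts_def)

lemma sum_prefix_step:
  assumes "x < nd M" "x \<noteq> a r"
  shows "(\<Sum>z | z < nd M \<and> p z < p (psi x). f z) = (\<Sum>z | z < nd M \<and> p z < p x. f z) + (f x :: int)"
proof -
  have "{z. z < nd M \<and> p z < p (psi x)} = insert x {z. z < nd M \<and> p z < p x}"
    using p_step[OF assms] assms(1) p_inj[OF _ assms(1)] by (auto simp: less_Suc_eq)
  then show ?thesis by simp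
qed

lemma h_step: "x < nd M \<Longrightarrow> x \<noteq> a r \<Longrightarrow> h (psi x) = h x + weight M C x"
  unfolding height_def by (rule sum_prefix_step)

lemma sec_step: "x < nd M \<Longrightarrow> x \<noteq> a r \<Longrightarrow> sec (psi x) = sec x + leg M x"
  unfolding sector_def by (rule sum_prefix_step)

lemma sec_mono: "p x \<le> p y \<Longrightarrow> sec x \<le> sec y"
  unfolding sector_def by (rule sum_mono2) (auto simp: leg_def)

lemma h_r [simp]: "h r = 0" and sec_r [simp]: "sec r = 0"
  unfolding height_def sector_def by simp_all

lemma sum_cut_zero:
  assumes "A \<subseteq> C" "\<And>z. z \<in> A \<Longrightarrow> a z \<in> A"
  shows "(\<Sum>z\<in>A. weight M C z) = 0"
proof -
  have A: "z < nd M" "z \<in> C" if "z \<in> A" for z using that assms C_in by auto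
  have "(\<Sum>z\<in>A. weight M C z) = (\<Sum>z\<in>A. weight M C (a z))"
    by (rule sum.reindex_bij_witness[of _ a a]) (use A assms in auto)
  also have "\<dots> = (\<Sum>z\<in>A. - weight M C z)"
    by (rule sum.cong) (use A assms in \<open>auto simp: weight_def\<close>)
  finally show ?thesis by (simp add: sum_negf)
qed

text \<open>Every pair begun before such a position has been completed, and the two weights of a
  complete pair cancel.\<close>

lemma h_eq_sec:
  assumes "\<And>z. z \<in> C \<Longrightarrow> p z < p x \<Longrightarrow> p (a z) < p x"
  shows "h x = sec x"
proof -
  let ?A = "{z. z < nd M \<and> p z < p x}" and ?B = "{z \<in> C. p z < p x}"
  have "h x = (\<Sum>z\<in>?A. (if z \<in> C then weight M C z else 0) + leg M z)"
    unfolding height_def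
  proof (rule sum.cong)
    fix z assume "z \<in> {z. z < nd M \<and> p z < p x}"
    then show "weight M C z = (if z \<in> C then weight M C z else 0) + leg M z"
      using C_V0[OF C_a[of z]] by (auto simp: weight_def leg_def)
  qed simp
  also have "\<dots> = (\<Sum>z\<in>?A. (if z \<in> C then weight M C z else 0)) + sec x"
    by (simp add: sum.distrib sector_def)
  also have "(\<Sum>z\<in>?A. (if z \<in> C then weight M C z else 0)) = (\<Sum>z\<in>?B. weight M C z)"
    by (rule sum.mono_neutral_cong_right) auto
  also have "\<dots> = 0" by (rule sum_cut_zero) (use assms C_a in auto)
  finally show ?thesis by simp
qed

lemma C_before_V0:
  assumes "v \<in> V0" "z \<in> C" "p z < p v"
  shows "p (a z) < p v"
proof (cases "black z")
  case True
  have "p (a z) \<noteq> p v" using p_inj[of "a z" v] assms C_V0[OF C_a[OF assms(2)]] by auto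
  then show ?thesis
    using between_V0[OF assms(2) True, of v] assms by (metis V0_in linorder_neqE_nat)
next
  case False
  then show ?thesis using white_less[OF assms(2)] assms by simp
qed

lemma h_V0: "v \<in> V0 \<Longrightarrow> h v = sec v"
  by (rule h_eq_sec) (rule C_before_V0)

lemma h_ar: "h (a r) = sec (a r)"
proof (rule h_eq_sec)
  fix z assume "z \<in> C"
  then have "a z \<in> C" by (rule C_a)
  then have "a z \<noteq> a r" using ar_C by metis
  then show "p (a z) < p (a r)" using p_lt[of "a z"] \<open>a z \<in> C\<close> by simp
qed

lemma ssr_ne [simp]: "s (s r) \<noteq> s r" using s_inj by simp

lemma sec_V0: "sec (s (s r)) = 1" "sec (s r) = 2" "sec (a r) = 2"
proof -
  have l: "{z. z < nd M \<and> a z \<in> V0} = {a r, a (s r), a (s (s r))}"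
    using aa by (auto simp: root_darts_def) (metis aa)+
  have sec: "sec x = (\<Sum>z\<in>{z \<in> {a r, a (s r), a (s (s r))}. p z < p x}. 1)" for x
    unfolding sector_def l[symmetric]
    by (rule sum.mono_neutral_cong_right) (auto simp: leg_def)
  have ne: "a r \<noteq> a (s r)" "a r \<noteq> a (s (s r))" "a (s r) \<noteq> a (s (s r))"
    using a_inj ssr_ne s_neq[OF r_in] ss_neq[OF r_in] by (metis r_in s_in)+
  have e: "p (s r) = Suc (p (a (s r)))" "p (s (s r)) = Suc (p (a (s (s r))))"
    using leg_step[of "s r"] leg_step[of "s (s r)"] by simp_all
  have n: "p (a (s r)) \<noteq> p (a r)" "p (a (s (s r))) \<noteq> p (a r)"
    using p_inj ne by simp_all
  have lt: "p (a (s r)) < p (a r)" "p (a (s (s r))) < p (a r)" "p (s r) \<le> p (a r)" "p (s (s r)) \<le> p (a r)"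
    using p_lt p_le ne by simp_all
  have "{z \<in> {a r, a (s r), a (s (s r))}. p z < p (s (s r))} = {a (s (s r))}"
    using e lt order_V0 by auto
  then show "sec (s (s r)) = 1" unfolding sec by simp
  have "{z \<in> {a r, a (s r), a (s (s r))}. p z < p (s r)} = {a (s r), a (s (s r))}"
    using e lt order_V0 by auto
  then show "sec (s r) = 2" unfolding sec using ne by (simp add: card_insert_if)
  have "{z \<in> {a r, a (s r), a (s (s r))}. p z < p (a r)} = {a (s r), a (s (s r))}"
    using e lt order_V0 by auto
  then show "sec (a r) = 2" unfolding sec using ne by (simp add: card_insert_if)
qed

lemma leg_vals: "h (a (s r)) = 1" "h (a (s (s r))) = 0" "sec (a (s r)) = 1" "sec (a (s (s r))) = 0"
proof -
  have "v \<in> V0 \<Longrightarrow> v \<noteq> r \<Longrightarrow> h v = h (a v) + 1 \<and> sec v = sec (a v) + 1" for v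
  proof -
    assume v: "v \<in> V0" "v \<noteq> r"
    have "a v \<noteq> a r" using v a_inj by simp
    moreover have "a v \<notin> C" using v C_V0[of v] by auto
    ultimately show "h v = h (a v) + 1 \<and> sec v = sec (a v) + 1"
      using leg_step[OF v] h_step[of "a v"] sec_step[of "a v"] v by (simp add: weight_def leg_def)
  qed
  from this[of "s r"] this[of "s (s r)"] show "h (a (s r)) = 1" "h (a (s (s r))) = 0"
    "sec (a (s r)) = 1" "sec (a (s (s r))) = 0"
    using sec_V0 h_V0[of "s r"] h_V0[of "s (s r)"] by auto
qed

lemma h_root [simp]: "h (s (s r)) = 1" "h (s r) = 2"
  using h_V0 sec_V0 by auto

text \<open>Strictly between a bud and its leaf there are only complete pairs and no root leaf, so
  the level just after the bud is found again just before the leaf.\<close>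

lemma pair_level:
  assumes "x \<in> C" "black x"
  shows "h (s x) = h x - 1" "h (a x) = h x - 1" "h (s (a x)) = h x" "sec (a x) = sec x"
    "sec (s x) = sec x" "sec (s (a x)) = sec x"
proof -
  have axC: "a x \<in> C" using assms C_a by simp
  then have xar: "x \<noteq> a r" "a x \<noteq> a r" using assms ar_C by metis+
  have w: "weight M C x = - 1" "leg M x = 0" "weight M C (a x) = 1" "leg M (a x) = 0"
    using assms axC by (auto simp: weight_def leg_def)
  show sx: "h (s x) = h x - 1" and secx: "sec (s x) = sec x"
    using h_step[of x] sec_step[of x] C_step[OF assms(1)] xar w assms by auto
  let ?J = "{z. z < nd M \<and> p x < p z \<and> p z < p (a x)}"
  have split: "(\<Sum>z | z < nd M \<and> p z < p (a x). f z) =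
      (\<Sum>z | z < nd M \<and> p z < p x. f z) + f x + (\<Sum>z\<in>?J. f z)" for f :: "nat \<Rightarrow> int"
  proof -
    have eq: "{z. z < nd M \<and> p z < p (a x)} = {z. z < nd M \<and> p z < p x} \<union> (insert x ?J)"
      using pair_less[OF assms] p_inj[of x] assms(1) C_in[of x] by (auto simp: not_less le_less)
    have "(\<Sum>z | z < nd M \<and> p z < p (a x). f z) =
        (\<Sum>z | z < nd M \<and> p z < p x. f z) + (\<Sum>z\<in>insert x ?J. f z)"
      unfolding eq by (rule sum.union_disjoint) auto
    also have "(\<Sum>z\<in>insert x ?J. f z) = f x + (\<Sum>z\<in>?J. f z)" by simp
    finally show ?thesis by simp
  qed
  have "(\<Sum>z\<in>?J. leg M z) = 0"
    by (rule sum.neutral) (use between_leg[OF assms] in \<open>auto simp: leg_def\<close>)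
  then show "sec (a x) = sec x" unfolding sector_def split using w by simp
  then show "sec (s (a x)) = sec x"
    using sec_step[of "a x"] C_step[OF axC] xar w assms by auto
  have "(\<Sum>z\<in>?J. weight M C z) = (\<Sum>z\<in>{z \<in> C. p x < p z \<and> p z < p (a x)}. weight M C z)"
    by (rule sum.mono_neutral_right)
      (use between_leg[OF assms] in \<open>auto simp: weight_def\<close>)
  also have "\<dots> = 0"
    by (rule sum_cut_zero) (use between_C[OF assms] C_a in auto)
  finally show "h (a x) = h x - 1" unfolding height_def split using w by simp
  then show "h (s (a x)) = h x"
    using h_step[of "a x"] C_step[OF axC] xar w assms by auto
qed

text \<open>This makes heights a function on the faces of the map. The face step from
  \<open>x\<close> to \<open>s (a x)\<close> is a contour step without charge, or it jumps across a
  matched pair, or it passes the root vertex, where the three values are checked one by one.\<close>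

lemma h_face_sec_face:
  assumes "x < nd M"
  shows "h (s (a x)) = h x \<and> sec (s (a x)) = sec x"
proof -
  from cutset assms show ?thesis
  proof (cases rule: contour_cases)
    case cut
    show ?thesis
    proof (cases "black x")
      case True
      then show ?thesis using pair_level[of x] cut by simp
    next
      case False
      then have "black (a x)" using assms by simp
      then show ?thesis using pair_level[of "a x"] cut assms by simp
    qed
  next
    case leg
    from leg(3) show ?thesis
    proof (cases rule: V0_cases)
      case r0
      then have "x = a r" using assms by (metis aa)
      then show ?thesis using h_ar sec_V0 by simp
    next
      case r1
      then have "x = a (s (s r))" using assms by (metis aa)
      then show ?thesis using leg_vals by simp
    next
      case r2
      then have "x = a (s r)" using assms by (metis aa)
      then show ?thesis using leg_vals sec_V0 by simp
    qed
  next
    case other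
    then have "x \<noteq> a r" by auto
    then show ?thesis
      using other h_step[OF assms] sec_step[OF assms] by (simp add: weight_def leg_def)
  qed
qed

lemma h_face [simp]: "x < nd M \<Longrightarrow> h (s (a x)) = h x"
  and sec_face [simp]: "x < nd M \<Longrightarrow> sec (s (a x)) = sec x"
  using h_face_sec_face by auto

lemma h_a: "x < nd M \<Longrightarrow> h (a x) = h (s x)"
  and sec_a: "x < nd M \<Longrightarrow> sec (a x) = sec (s x)"
  using h_face[of "a x"] sec_face[of "a x"] by auto

text \<open>Call the positions after a bud up to its leaf a pocket. Face steps cannot leave it,
  because pairs are nested and no root leaf is inside; a pocket is thus a union of faces.\<close>

lemma pocket_face:
  assumes "x \<in> C" "black x" "z < nd M" "p x < p z" "p z \<le> p (a x)"
  shows "p x < p (s (a z)) \<and> p (s (a z)) \<le> p (a x)"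
proof (cases "z = a x")
  case True
  then show ?thesis using C_step[OF assms(1)] pair_less[OF assms(1,2)] assms by simp
next
  case False
  then have lt: "p z < p (a x)" using assms p_inj[of z "a x"] by auto
  show ?thesis
  proof (cases "z \<in> C")
    case True
    then have "p x < p (a z) \<and> p (a z) < p (a x)" using between_C[OF assms(1,2)] assms lt by simp
    then show ?thesis using C_step[OF C_a[OF True]] by simp
  next
    case F: False
    then show ?thesis using other_step[OF assms(3) F] between_leg[OF assms(1-4) lt] assms lt by simp
  qed
qed

text \<open>A leaf inside the pocket returns only to the level before its bud, which lies in the
  pocket as well; no other step inside goes up.\<close>

lemma pocket_level:
  assumes "x \<in> C" "black x" "z < nd M" "p x < p z" "p z \<le> p (a x)"
  shows "h z \<le> h x - 1"
proof -
  have "z \<in> D" using assms by simp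
  then have "p x < p z \<longrightarrow> p z \<le> p (a x) \<longrightarrow> h z \<le> h x - 1"
  proof (induction rule: cyc.pos_induct)
    case root
    then show ?case by simp
  next
    case (step y)
    show ?case
    proof (intro impI)
      assume y: "p x < p (psi y)" "p (psi y) \<le> p (a x)"
      have yD: "y < nd M" "y \<noteq> a r" using step p_ar by auto
      have py: "p (psi y) = Suc (p y)" using p_step yD by simp
      show "h (psi y) \<le> h x - 1"
      proof (cases "y = x")
        case True
        then show ?thesis using C_step[OF assms(1)] pair_level[OF assms(1,2)] by simp
      next
        case False
        then have py2: "p x < p y" "p y < p (a x)" using py y p_inj[of x y] assms yD by auto
        then have IH: "h y \<le> h x - 1" using step.IH[of y] step.hyps by simp
        show ?thesis
        proof (cases "y \<in> C \<and> \<not> black y")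
          case True
          then have "p x < p (a y)" "p (a y) < p y"
            using between_C[OF assms(1,2)] py2 white_less by auto
          then have "h (a y) \<le> h x - 1" using step.IH[of "a y"] py2 yD by simp
          then show ?thesis using C_step[of y] True h_a[of y] by simp
        next
          case F: False
          then have "weight M C y \<le> 0"
            using between_leg[OF assms(1,2) _ py2] yD by (auto simp: weight_def)
          then show ?thesis using h_step[OF yD] IH by simp
        qed
      qed
    qed
  qed
  then show ?thesis using assms by simp
qed

text \<open>A matched leaf only restores the level before its earlier bud, and any other step adds
  no more to \<open>h\<close> than to \<open>sec\<close>.\<close>

lemma h_le_sec:
  assumes "x < nd M"
  shows "h x \<le> sec x"
proof -
  have "x \<in> D" using assms by simp
  then show ?thesis
  proof (induction rule: cyc.pos_induct)
    case root
    then show ?case by simp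
  next
    case (step y)
    have yD: "y < nd M" "y \<noteq> a r" using step p_ar by auto
    show ?case
    proof (cases "y \<in> C \<and> \<not> black y")
      case True
      then have "p (a y) < p y" using white_less by auto
      then have "h (a y) \<le> sec (a y)" "sec (a y) \<le> sec (psi y)"
        using step.IH[of "a y"] yD p_step[OF yD] by (auto intro: sec_mono)
      then show ?thesis using C_step[of y] True h_a[of y] by simp
    next
      case False
      then have "weight M C y \<le> leg M y" by (auto simp: weight_def leg_def)
      then show ?thesis using h_step[OF yD] sec_step[OF yD] step.IH[of y] step.hyps by simp
    qed
  qed
qed

lemma sec_le_2: "x < nd M \<Longrightarrow> sec x \<le> 2"
  using sec_mono[OF p_le] sec_V0 by metis

lemma orb_phi_inv:
  assumes "x < nd M" "y \<in> orb (fperm M) x" "\<And>z. z < nd M \<Longrightarrow> P z \<Longrightarrow> P (s (a z))" "P x"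
  shows "P y"
proof -
  have "orb (fperm M) x \<subseteq> {z. z < nd M \<and> P z}" by (rule orb_subset) (use assms in auto)
  then show ?thesis using assms by auto
qed

lemma h_orb: "x < nd M \<Longrightarrow> y \<in> orb (fperm M) x \<Longrightarrow> h y = h x \<and> sec y = sec x \<and> y < nd M"
  by (rule orb_phi_inv[where P = "\<lambda>y. h y = h x \<and> sec y = sec x \<and> y < nd M"]) auto

lemma pocket_orb:
  assumes "x \<in> C" "black x" "z \<in> orb (fperm M) (s x)"
  shows "p x < p z \<and> p z \<le> p (a x)"
  by (rule orb_phi_inv[OF _ assms(3), where P = "\<lambda>z. p x < p z \<and> p z \<le> p (a x)"])
    (use assms pocket_face[OF assms(1,2)] C_step[OF assms(1)] pair_less[OF assms(1,2)] in auto)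

lemma pocket_V0: "x \<in> C \<Longrightarrow> black x \<Longrightarrow> z \<in> orb (fperm M) (s x) \<Longrightarrow> z \<notin> V0"
  using pocket_orb[of x z] between_V0[of x z] p_inj[of z "a x"] h_orb[of "s x" z] C_V0[OF C_a[of x]]
  by (metis C_in a_in le_neq_implies_less s_in)

text \<open>Each black cut dart enters a face of its own, because that face lies within its pocket.
  The three root faces are told apart by \<open>sec\<close>, and no pocket contains a root
  dart.\<close>

lemma card_faces_ge: "card C + 6 \<le> 2 * card (faces M)"
proof -
  let ?B = "{x \<in> C. black x}" and ?F = "\<lambda>x. orb (fperm M) x"
  have inj1: "inj_on (\<lambda>x. ?F (s x)) ?B"
  proof (rule inj_onI)
    fix x y assume x: "x \<in> ?B" and y: "y \<in> ?B" and e: "?F (s x) = ?F (s y)"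
    have "s y \<in> ?F (s x)" "s x \<in> ?F (s y)" using e orb_self by metis+
    then have "p x < p (s y)" "p y < p (s x)" using pocket_orb x y by auto
    then have "p x = p y" using C_step x y by auto
    then show "x = y" using p_inj x y by auto
  qed
  have inj2: "inj_on ?F V0"
  proof (rule inj_onI)
    fix x y assume x: "x \<in> V0" and y: "y \<in> V0" and e: "?F x = ?F y"
    have "y \<in> ?F x" using e by auto
    then have "sec y = sec x" using h_orb x by auto
    with x y show "x = y" using sec_V0 by (auto simp: root_darts_def)
  qed
  have disj: "(\<lambda>x. ?F (s x)) ` ?B \<inter> ?F ` V0 = {}"
  proof (rule ccontr)
    assume "\<not> ?thesis"
    then obtain x v where "x \<in> ?B" "v \<in> V0" "?F (s x) = ?F v" by auto
    then show False using pocket_V0[of x v] orb_self[of v] by auto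
  qed
  have "(\<lambda>x. ?F (s x)) ` ?B \<union> ?F ` V0 \<subseteq> faces M"
    by (auto simp: faces_fperm)
  then have "card ((\<lambda>x. ?F (s x)) ` ?B \<union> ?F ` V0) \<le> card (faces M)"
    by (rule card_mono[rotated]) (simp add: faces_fperm)
  moreover have "card ((\<lambda>x. ?F (s x)) ` ?B \<union> ?F ` V0) = card ?B + 3"
  proof -
    have "finite V0" by (simp add: root_darts_def)
    then have "card ((\<lambda>x. ?F (s x)) ` ?B \<union> ?F ` V0) = card ((\<lambda>x. ?F (s x)) ` ?B) + card (?F ` V0)"
      using disj by (intro card_Un_disjoint) auto
    then show ?thesis using card_image[OF inj1] card_image[OF inj2] card_V0 by simp
  qed
  ultimately show ?thesis using card_black_cut[OF cutset] by simp
qed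

lemma card_verts: "nd M = 3 * card (verts M)"
  using card_eq_mult_orbits[OF _ bij_s, of D 3] card_orb by (auto simp: verts_eq)

text \<open>The contour visits all darts, so the map is connected and V - E + F is at most 2. The
  lower bound on the number of faces supplies the converse.\<close>

theorem planar: "planar_cmap M"
proof -
  have step: "(x, psi x) \<in> (map_steps M)\<^sup>*" if x: "x < nd M" for x
  proof -
    have "(x, a x) \<in> (map_steps M)\<^sup>*" "(x, s x) \<in> (map_steps M)\<^sup>*" "(a x, s (a x)) \<in> (map_steps M)\<^sup>*"
      using x by (auto simp: map_steps_def intro!: r_into_rtrancl)
    then show ?thesis by (cases rule: contour_cases[OF cutset x]) (auto intro: rtrancl_trans)
  qed
  have walk: "(x, y) \<in> (map_steps M)\<^sup>*" if x: "x < nd M" and y: "y \<in> orb psi x" for x y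
  proof -
    have "orb psi x \<subseteq> {y. y < nd M \<and> (x, y) \<in> (map_steps M)\<^sup>*}"
      by (rule orb_subset) (use x step in \<open>auto intro: rtrancl_trans\<close>)
    then show ?thesis using y by auto
  qed
  have "(x, y) \<in> (map_steps M)\<^sup>*" if "x < nd M" "y < nd M" for x y
  proof -
    have "r \<in> orb psi x"
      using orb_eq[OF cyc.fin cyc.bij, of r x] cyc.transitive that by auto
    moreover have "y \<in> orb psi r" using cyc.transitive that by auto
    ultimately show ?thesis using walk that r_in rtrancl_trans by metis
  qed
  then have con: "connected_cmap M" by (simp add: connected_cmap_def)
  have "nd M > 0" using r_in by linarith
  then have "2 * (card (verts M) + card (faces M)) \<le> 4 + nd M"
    using euler_le[OF wf con] by simp
  then show ?thesis
    using wf con card_faces_ge card_C card_verts card_edges[OF wf] by (simp add: planar_cmap_def)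
qed

end

section \<open>Cut sets as arborescences of the dual\<close>

definition arcs :: "bmap \<Rightarrow> nat set" where
  "arcs M = {x. x < nd M \<and> blk M x \<and> x \<notin> root_darts M}"

text \<open>The charge on the white side of the opened edge is \<open>h (s x) - h x\<close> if the
  black end comes first on the contour and 3 more otherwise, so both branches ask for a charge of at
  least 2. As the difference is -1 modulo 3, they forbid a descent of more than 1 and, if the black
  end comes first, also a descent of exactly 1.\<close>

definition regular_arc :: "bmap \<Rightarrow> nat set \<Rightarrow> nat \<Rightarrow> bool" where
  "regular_arc M C x \<longleftrightarrow>
     (if cpos M C x < cpos M C (al M x) then height M C x + 2 \<le> height M C (sg M x)
      else height M C x - 1 \<le> height M C (sg M x))"

text \<open>With the arcs in \<open>S\<close> deleted from the dual graph, this describes its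
  leftmost geodesic arborescence: heights are minus the distances, up to the offsets of the root
  faces, and ties are settled by the contour.\<close>

definition fits :: "bmap \<Rightarrow> nat set \<Rightarrow> nat set \<Rightarrow> bool" where
  "fits M S C \<longleftrightarrow> valid_cut M C \<and> C \<inter> S = {} \<and> (\<forall>x\<in>arcs M - C - S. regular_arc M C x)"

text \<open>The faces of M carry a directed graph: each black dart x points from the face of x to the face
  of sg x. The black darts of an arborescence are the arcs of a spanning forest of this graph rooted
  at the faces of the root vertex, as witnessed by the decreasing face labelling g.\<close>
definition arborescence :: "bmap \<Rightarrow> nat set \<Rightarrow> (nat \<Rightarrow> int) \<Rightarrow> bool" where
  "arborescence M C g \<longleftrightarrow> cutset M C \<and> (\<forall>x<nd M. g (sg M (al M x)) = g x) \<and>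
     (\<forall>x\<in>C. blk M x \<longrightarrow> g (sg M x) < g x \<and> orb (fperm M) (sg M x) \<inter> root_darts M = {}) \<and>
     (\<forall>x\<in>C. \<forall>y\<in>C. blk M x \<longrightarrow> blk M y \<longrightarrow> sg M y \<in> orb (fperm M) (sg M x) \<longrightarrow> x = y) \<and>
     (\<forall>x<nd M. orb (fperm M) x \<inter> root_darts M = {} \<longrightarrow>
        (\<exists>y\<in>C. blk M y \<and> sg M y \<in> orb (fperm M) x))"

context valid_map begin

text \<open>Going along the contour, \<open>h\<close> drops by exactly 1 at a bud, and elsewhere
  face constancy fixes both functions. A labelling that drops by at most 1, or by at least 1, on cut
  arcs therefore stays on one side of \<open>h\<close>; the sign \<open>e\<close> merges both
  comparisons into one induction.\<close>

lemma compare_height: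
  assumes e: "e = 1 \<or> e = (- 1 :: int)"
    and g: "\<And>x. x < nd M \<Longrightarrow> g (s (a x)) = g x" "g r = 0" "g (s (s r)) = 1" "g (s r) = 2"
    and cut: "\<And>x. x \<in> C \<Longrightarrow> black x \<Longrightarrow> 0 \<le> e * (g (s x) - g x + 1)"
    and x: "x < nd M"
  shows "0 \<le> e * (g x - h x)"
proof -
  have "x \<in> D" using x by simp
  then show ?thesis
  proof (induction rule: cyc.pos_induct)
    case root
    then show ?case using g by simp
  next
    case (step y)
    have y: "y < nd M" using step by simp
    have ar: "y \<noteq> a r" using step p_ar by auto
    have IHy: "0 \<le> e * (g y - h y)" using step by simp
    from cutset y show ?case
    proof (cases rule: contour_cases)
      case cu: cut
      show ?thesis
      proof (cases "black y")
        case True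
        have "h (s y) = h y - 1" using pair_level[OF cu(1) True] by simp
        moreover have "0 \<le> e * (g (s y) - g y + 1)" using cut cu True by simp
        ultimately show ?thesis using cu(5) IHy e by auto
      next
        case False
        then have "p (a y) < p y" using white_less cu by simp
        then have "0 \<le> e * (g (a y) - h (a y))" using step.IH[of "a y"] y by simp
        moreover have "g (s y) = g (a y)" using g(1)[of "a y"] y by simp
        ultimately show ?thesis using cu h_a[OF y] by simp
      qed
    next
      case leg
      from leg(3) have "g (a y) = h (a y)"
        by (cases rule: V0_cases) (use g in auto)
      then show ?thesis using leg by simp
    next
      case other
      then show ?thesis using g(1)[OF y] IHy y by simp
    qed
  qed
qed

lemma height_eq:
  assumes g: "\<And>x. x < nd M \<Longrightarrow> g (s (a x)) = g x" "g r = 0" "g (s (s r)) = 1" "g (s r) = (2::int)"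
    and cut: "\<And>x. x \<in> C \<Longrightarrow> black x \<Longrightarrow> g (s x) = g x - 1"
    and x: "x < nd M"
  shows "g x = h x"
proof -
  have "0 \<le> 1 * (g x - h x)" by (rule compare_height) (use assms in auto)
  moreover have "0 \<le> - 1 * (g x - h x)" by (rule compare_height) (use assms in auto)
  ultimately show ?thesis by simp
qed

text \<open>Consider the first dart of the face on the contour. A face step, or the turn past a
  white stub, would put an earlier dart on the same face, so the preceding step turns past a black
  stub.\<close>

lemma face_entered:
  assumes "x < nd M" "orb (fperm M) x \<inter> V0 = {}"
  shows "\<exists>y\<in>C. black y \<and> s y \<in> orb (fperm M) x"
proof -
  let ?O = "orb (fperm M) x"
  have O: "?O \<subseteq> D" using orb_in[OF bij_phi] assms by simp
  define z where "z = (ARG_MIN p z. z \<in> ?O)"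
  have z: "z \<in> ?O" "\<And>y. y \<in> ?O \<Longrightarrow> p z \<le> p y"
    unfolding z_def using arg_min_nat_lemma[of "\<lambda>z. z \<in> ?O" x p] by auto
  have pred: "u \<in> ?O" if "u < nd M" "s (a u) \<in> ?O" for u
  proof -
    have "orb (fperm M) (s (a u)) = orb (fperm M) u"
      using orb_eq[OF _ bij_phi, of u "s (a u)"] that orb_step[OF orb_self, of "fperm M" u] by simp
    moreover have "orb (fperm M) (s (a u)) = ?O"
      using orb_eq[OF _ bij_phi, of x "s (a u)"] assms that by simp
    ultimately show ?thesis using orb_self by metis
  qed
  have zD: "z \<in> D" and "z \<noteq> r" using z O assms by auto
  then obtain k where "p z = Suc k" using p_pos[of z] by (metis gr0_conv_Suc lessThan_iff)
  then obtain u where u: "u < nd M" "p u = k" "z = psi u" using cyc.pos_SucE[OF zD] by auto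
  then have pu: "p u < p z" using \<open>p z = Suc k\<close> by simp
  from cutset u(1) show ?thesis
  proof (cases rule: contour_cases)
    case cut
    show ?thesis
    proof (cases "black u")
      case True
      then show ?thesis using cut z u by auto
    next
      case False
      then have "p (a u) < p u" using white_less cut by simp
      moreover have "a u \<in> ?O" using pred[of "a u"] u cut z by simp
      ultimately show ?thesis using z(2)[of "a u"] pu by simp
    qed
  next
    case leg
    then show ?thesis using z u assms by auto
  next
    case other
    then have "u \<in> ?O" using pred[of u] u z(1) by simp
    then show ?thesis using z(2)[of u] pu by simp
  qed
qed

lemma arborescence_height: "arborescence M C h"
  unfolding arborescence_def
proof (intro conjI ballI allI impI)
  fix x y assume xy: "x \<in> C" "y \<in> C" "black x" "black y" "s y \<in> orb (fperm M) (s x)"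
  have "s x \<in> orb (fperm M) (s y)"
    using orb_eq[OF _ bij_phi, of "s x" "s y"] xy by simp
  then have "p x < p (s y)" "p y < p (s x)" using pocket_orb xy by auto
  then have "p x = p y" using C_step xy by auto
  then show "x = y" using p_inj xy by auto
next
  fix x assume "x \<in> C" "black x"
  then show "orb (fperm M) (s x) \<inter> V0 = {}" using pocket_V0 by auto
qed (use cutset pair_level face_entered in auto)

end

section \<open>Uniqueness of the cut set for a given forbidden set\<close>

context bicubic_map begin

text \<open>The cut arcs of either set descend by at most 1 in the heights of the other, so both
  heights agree. Then the contours agree step by step: at a first disagreement a black dart cut on
  one side would be an uncut tie with its black end first on the other, which
  \<open>regular_arc\<close> forbids, and a white dart is decided by its earlier partner.\<close>

lemma fits_unique:
  assumes "fits M S C1" "fits M S C2"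
  shows "C1 = C2"
proof -
  have val: "valid_cut M C1" "valid_cut M C2" using assms by (auto simp: fits_def)
  interpret A: valid_map M C1 by unfold_locales (rule val)
  interpret B: valid_map M C2 by unfold_locales (rule val)
  have arc: "height M C x - 1 \<le> height M C (s x)"
    if "fits M S C" "x \<in> C'" "black x" "fits M S C'" for C C' x
  proof -
    interpret V: valid_map M C by unfold_locales (use that in \<open>simp add: fits_def\<close>)
    interpret V': valid_map M C' by unfold_locales (use that in \<open>simp add: fits_def\<close>)
    show ?thesis
    proof (cases "x \<in> C")
      case True
      then show ?thesis using V.pair_level that by simp
    next
      case False
      have "x \<notin> S" using that by (auto simp: fits_def)
      moreover have "x \<in> arcs M" using that by (simp add: arcs_def)
      ultimately have "regular_arc M C x" using that False by (simp add: fits_def)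
      then show ?thesis by (auto simp: regular_arc_def split: if_splits)
    qed
  qed
  have heq: "height M C1 x = height M C2 x" if x: "x < nd M" for x
  proof -
    have "0 \<le> 1 * (height M C1 x - height M C2 x)"
    proof (rule B.compare_height)
      show "0 \<le> 1 * (height M C1 (s y) - height M C1 y + 1)" if "y \<in> C2" "black y" for y
        using arc[OF assms(1) that assms(2)] by simp
    qed (use x in auto)
    moreover have "0 \<le> 1 * (height M C2 x - height M C1 x)"
    proof (rule A.compare_height)
      show "0 \<le> 1 * (height M C2 (s y) - height M C2 y + 1)" if "y \<in> C1" "black y" for y
        using arc[OF assms(2) that assms(1)] by simp
    qed (use x in auto)
    ultimately show ?thesis by simp
  qed
  have no_first: "x \<in> C'"
    if f: "fits M S C" "fits M S C'" and he: "\<And>x. x < nd M \<Longrightarrow> height M C x = height M C' x"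
      and xC: "x \<in> C" and px: "cpos M C x = k" "cpos M C' x = k"
      and agree: "\<And>z. z < nd M \<Longrightarrow> cpos M C z < k \<or> cpos M C' z < k \<Longrightarrow>
        cpos M C z = cpos M C' z \<and> (z \<in> C \<longleftrightarrow> z \<in> C')"
    for C C' x k
  proof (rule ccontr)
    assume nx: "x \<notin> C'"
    interpret V: valid_map M C by unfold_locales (use f in \<open>simp add: fits_def\<close>)
    interpret V': valid_map M C' by unfold_locales (use f in \<open>simp add: fits_def\<close>)
    have xD: "x < nd M" using xC by simp
    show False
    proof (cases "black x")
      case True
      have "x \<notin> S" using f xC by (auto simp: fits_def)
      then have reg: "regular_arc M C' x"
        using f True xC xD nx by (simp add: fits_def arcs_def)
      have lt: "k < cpos M C (a x)" using V.pair_less[OF xC True] px by simp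
      have "\<not> cpos M C' (a x) < k" using agree[of "a x"] lt xD by auto
      moreover have "cpos M C' (a x) \<noteq> k" using px V'.p_inj[of "a x" x] xD by auto
      ultimately have "cpos M C' x < cpos M C' (a x)" using px by simp
      then have "height M C' x + 2 \<le> height M C' (s x)" using reg by (simp add: regular_arc_def)
      then show False using V.pair_level[OF xC True] he[OF xD] he[of "s x"] xD by simp
    next
      case False
      have "cpos M C (a x) < k" using V.white_less[OF xC False] px by simp
      then have "a x \<in> C'" using agree[of "a x"] V.C_a[OF xC] xD by simp
      then show False using nx xD by simp
    qed
  qed
  have main: "\<forall>z<nd M. (cpos M C1 z = k \<longleftrightarrow> cpos M C2 z = k) \<and>
      (cpos M C1 z = k \<longrightarrow> (z \<in> C1 \<longleftrightarrow> z \<in> C2))" for k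
  proof (induction k rule: less_induct)
    case (less k)
    have agree: "cpos M C1 z = cpos M C2 z \<and> (z \<in> C1 \<longleftrightarrow> z \<in> C2)"
      if "z < nd M" "cpos M C1 z < k \<or> cpos M C2 z < k" for z
      using less that by metis
    have same: "cpos M C1 z = k \<longleftrightarrow> cpos M C2 z = k" if z: "z < nd M" for z
    proof (cases k)
      case 0
      then show ?thesis using A.cyc.pos_0D[of z] B.cyc.pos_0D[of z] A.p_r B.p_r z by auto
    next
      case (Suc j)
      have step: "cpos M C' z = k"
        if v: "valid_cut M C" "valid_cut M C'" and pz: "cpos M C z = k"
          and ag: "\<And>z. z < nd M \<Longrightarrow> cpos M C z < k \<Longrightarrow> cpos M C z = cpos M C' z \<and> (z \<in> C \<longleftrightarrow> z \<in> C')"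
        for C C'
      proof -
        interpret V: valid_map M C by unfold_locales (rule v)
        interpret V': valid_map M C' by unfold_locales (rule v)
        obtain y where y: "y < nd M" "cpos M C y = j" "z = contour M C y"
          using V.cyc.pos_SucE[of z j] pz Suc z by auto
        have agy: "cpos M C y = cpos M C' y \<and> (y \<in> C \<longleftrightarrow> y \<in> C')" by (rule ag) (use y Suc in auto)
        then have "contour M C' y = contour M C y" by (simp add: contour_def)
        then have e: "cpos M C' y = j" "contour M C' y = z" using agy y by auto
        have "y \<noteq> a r" using V.p_ar y V.cyc.pos_less[of z] pz Suc z by auto
        then show ?thesis using V'.p_step[of y] e y Suc by simp
      qed
      show ?thesis using step[OF val(1,2)] step[OF val(2,1)] agree by metis
    qed
    show ?case
    proof (intro allI impI conjI)
      fix z assume z: "z < nd M"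
      show "cpos M C1 z = k \<longleftrightarrow> cpos M C2 z = k" using same z by simp
      assume pz: "cpos M C1 z = k"
      then have pz2: "cpos M C2 z = k" using same z by simp
      show "z \<in> C1 \<longleftrightarrow> z \<in> C2"
      proof
        assume "z \<in> C1"
        then show "z \<in> C2"
          using no_first[OF assms heq _ pz pz2] agree by blast
      next
        assume "z \<in> C2"
        then show "z \<in> C1"
          using no_first[OF assms(2,1) heq[symmetric] _ pz2 pz] agree by metis
      qed
    qed
  qed
  show ?thesis
  proof (rule set_eqI)
    fix z show "z \<in> C1 \<longleftrightarrow> z \<in> C2"
      using main[of "cpos M C1 z"] A.C_in B.C_in by blast
  qed
qed

end

section \<open>From arborescences of the dual to valid cut sets\<close>

locale planar_bicubic = bicubic_map +
  assumes planar: "planar_cmap M"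
begin

lemma connected: "connected_cmap M" and euler: "2 * (card (verts M) + card (faces M)) = 4 + nd M"
  using planar card_edges[OF wf] by (auto simp: planar_cmap_def)

abbreviation "fp \<equiv> fperm M"
abbreviation "face \<equiv> orb fp"

lemma face_eq: "x < nd M \<Longrightarrow> y \<in> face x \<Longrightarrow> face y = face x"
  using orb_eq[OF finite_lessThan bij_phi, of x y] by simp

lemma face_in: "x < nd M \<Longrightarrow> y \<in> face x \<Longrightarrow> y < nd M"
  using orb_in[OF bij_phi, of x] by auto

lemma face_sym: "x < nd M \<Longrightarrow> y \<in> face x \<Longrightarrow> x \<in> face y"
  using face_eq orb_self by metis

lemma connected_induct:
  assumes "r \<in> A" "\<And>x. x < nd M \<Longrightarrow> x \<in> A \<Longrightarrow> s x \<in> A \<and> a x \<in> A" "x < nd M"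
  shows "x \<in> A"
proof -
  have "(r, x) \<in> (map_steps M)\<^sup>*" using connected assms by (simp add: connected_cmap_def)
  then show ?thesis
    by (induction rule: rtrancl_induct) (use assms in \<open>auto simp: map_steps_def\<close>)
qed

lemma dvd3_card:
  assumes "A \<subseteq> D" "\<And>x. x \<in> A \<Longrightarrow> s x \<in> A"
  shows "3 dvd card A"
proof -
  have "card A = 3 * card (orb s ` A)"
    by (rule card_eq_mult_orbits[OF _ bij_s]) (use assms card_orb in auto)
  then show ?thesis by simp
qed

lemma card_verts: "nd M = 3 * card (verts M)"
  using card_eq_mult_orbits[OF _ bij_s, of D 3] card_orb by (auto simp: verts_eq)

text \<open>Splitting the root vertex into three leaves keeps the map connected (a component contains a
  number of root darts divisible by 3), so by the genus inequality it must lose two faces.\<close>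
lemma root_faces_distinct: "inj_on face V0"
proof (rule ccontr)
  assume not_inj: "\<not> inj_on face V0"
  define s' where "s' = (\<lambda>y. if y \<in> V0 then y else s y)"
  define t where "t = s' \<circ> a"
  have t_apply: "t y = s' (a y)" for y by (simp add: t_def)
  have bij_s': "bij_betw s' D D"
  proof -
    have "inj_on s' D"
    proof (rule inj_onI)
      fix x y assume "x \<in> D" "y \<in> D" "s' x = s' y"
      then show "x = y" using V0_s[of x] V0_s[of y] s_inj by (auto simp: s'_def split: if_splits)
    qed
    moreover have "s' ` D \<subseteq> D" by (auto simp: s'_def)
    ultimately show ?thesis using endo_inj_surj[of D s'] by (simp only: bij_betw_def finite_lessThan)
  qed
  let ?R = "graph_on D s' \<union> graph_on D a"
  define A where "A = linked ?R r"
  have A_D: "A \<subseteq> D" unfolding A_def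
    by (rule linked_closed) (auto simp: s'_def split: if_splits)
  have A_s': "s' x \<in> A" and A_a: "a x \<in> A" if "x \<in> A" for x
  proof -
    have x: "x < nd M" using that A_D by auto
    have "s' x \<in> linked ?R x" "a x \<in> linked ?R x" using x by (auto intro: linked_pair)
    then show "s' x \<in> A" "a x \<in> A" using that unfolding A_def by (auto intro: linked_trans)
  qed
  have finA: "finite A" using A_D finite_subset by blast
  \<comment> \<open>The involution pairs the white darts of the component with its black ones. Away
    from the root vertex both kinds come in whole vertices, hence in threes.\<close>
  have "3 dvd card {x \<in> A. \<not> black x}"
  proof (rule dvd3_card)
    fix x assume x: "x \<in> {x \<in> A. \<not> black x}"
    then have "x < nd M" "x \<notin> V0" using A_D by auto
    then show "s x \<in> {x \<in> A. \<not> black x}" using A_s'[of x] x by (auto simp: s'_def)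
  qed (use A_D in auto)
  moreover have "3 dvd card {x \<in> A. black x \<and> x \<notin> V0}"
  proof (rule dvd3_card)
    fix x assume x: "x \<in> {x \<in> A. black x \<and> x \<notin> V0}"
    then have "x < nd M" using A_D by auto
    then show "s x \<in> {x \<in> A. black x \<and> x \<notin> V0}" using A_s'[of x] x by (auto simp: s'_def)
  qed (use A_D in auto)
  moreover have "card {x \<in> A. \<not> black x} = card {x \<in> A. black x}"
  proof (rule bij_betw_same_card[of a], rule bij_betw_byWitness[where f' = a])
    show "a ` {x \<in> A. \<not> black x} \<subseteq> {x \<in> A. black x}" using A_a A_D by auto
    show "a ` {x \<in> A. black x} \<subseteq> {x \<in> A. \<not> black x}" using A_a A_D by auto
  qed (use A_D in auto)
  moreover have "card {x \<in> A. black x} = card {x \<in> A. black x \<and> x \<notin> V0} + card (A \<inter> V0)"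
  proof -
    have "{x \<in> A. black x} = {x \<in> A. black x \<and> x \<notin> V0} \<union> (A \<inter> V0)" by auto
    moreover have "card ({x \<in> A. black x \<and> x \<notin> V0} \<union> (A \<inter> V0)) =
        card {x \<in> A. black x \<and> x \<notin> V0} + card (A \<inter> V0)"
      using finA by (intro card_Un_disjoint) auto
    ultimately show ?thesis by simp
  qed
  ultimately have "3 dvd card (A \<inter> V0)" by (simp add: dvd_add_right_iff)
  moreover have "r \<in> A \<inter> V0" by (simp add: A_def)
  then have "0 < card (A \<inter> V0)" using finA card_gt_0_iff by blast
  ultimately have "card V0 \<le> card (A \<inter> V0)" using card_V0 by (simp add: dvd_imp_le)
  moreover have "finite V0" by (simp add: root_darts_def)
  ultimately have "A \<inter> V0 = V0" by (intro card_seteq) auto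
  then have V0A: "V0 \<subseteq> A" by auto
  have DA: "x \<in> A" if "x < nd M" for x
  proof (rule connected_induct[OF _ _ that])
    show "r \<in> A" using V0A by auto
    fix x assume "x < nd M" "x \<in> A"
    then show "s x \<in> A \<and> a x \<in> A" using A_a[of x] A_s'[of x] V0A V0_s[of x] by (auto simp: s'_def split: if_splits)
  qed
  have comp: "ncomp D ?R = 1"
  proof -
    have "linked ?R ` D = (\<lambda>_. linked ?R r) ` D"
      by (rule image_cong[OF refl], rule linked_eq) (use DA A_def in auto)
    also have "\<dots> = {linked ?R r}" by (intro image_constant[of r]) simp
    finally show ?thesis by (simp add: ncomp_def)
  qed
  have orb3: "card (orb s' x) = 3" if x: "x < nd M" "x \<notin> V0" for x
  proof -
    have sx: "s' x = s x" "s' (s x) = s (s x)" "s' (s (s x)) = x" using x by (auto simp: s'_def)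
    have "orb s' x = {x, s x, s (s x)}"
    proof
      show "orb s' x \<subseteq> {x, s x, s (s x)}" by (rule orb_subset) (use sx in auto)
      show "{x, s x, s (s x)} \<subseteq> orb s' x" using orb_step[of x s' x] orb_step[of "s x" s' x] sx by simp
    qed
    then show ?thesis using s_cycle[OF x(1)] card_orb[OF x(1)] by simp
  qed
  have orb1: "orb s' x = {x}" if "x \<in> V0" for x
    using orb_subset[of x "{x}" s'] that by (auto simp: s'_def)
  have V': "card (orb s' ` D) = card (verts M) + 2"
  proof -
    have "D = (D - V0) \<union> V0" by auto
    then have "card (orb s' ` D) = card (orb s' ` (D - V0) \<union> orb s' ` V0)" by (metis image_Un)
    also have "\<dots> = card (orb s' ` (D - V0)) + card (orb s' ` V0)"
    proof (rule card_Un_disjoint)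
      show "orb s' ` (D - V0) \<inter> orb s' ` V0 = {}"
      proof (rule ccontr)
        assume "\<not> ?thesis"
        then obtain x v where "x \<in> D - V0" "v \<in> V0" "orb s' x = orb s' v" by auto
        then show False using orb_self[of x s'] orb1 by auto
      qed
    qed (auto simp: root_darts_def)
    also have "card (orb s' ` V0) = 3"
      using card_image[of "orb s'" V0] orb1 card_V0 by (simp add: inj_on_def)
    finally have 1: "card (orb s' ` D) = card (orb s' ` (D - V0)) + 3" .
    have "card (D - V0) = 3 * card (orb s' ` (D - V0))"
      by (rule card_eq_mult_orbits[OF _ bij_s']) (use orb3 in \<open>auto simp: s'_def\<close>)
    moreover have "card (D - V0) = nd M - 3"
      using card_Diff_subset[of V0 D] card_V0 by (simp add: root_darts_def subset_eq)
    moreover have "3 \<le> nd M" using card_mono[of D V0] card_V0 V0_in by (auto simp: subset_eq)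
    ultimately show ?thesis using 1 card_verts by linarith
  qed
  let ?free = "{face x | x. x < nd M \<and> face x \<inter> V0 = {}}"
  have F: "card (faces M) \<le> card ?free + 2"
  proof -
    have "faces M \<subseteq> ?free \<union> face ` V0"
    proof
      fix c assume "c \<in> faces M"
      then obtain x where x: "x < nd M" "c = face x" by (auto simp: faces_fperm)
      show "c \<in> ?free \<union> face ` V0"
      proof (cases "face x \<inter> V0 = {}")
        case True
        then show ?thesis using x by blast
      next
        case False
        then show ?thesis using face_eq[OF x(1)] x by blast
      qed
    qed
    then have "card (faces M) \<le> card (?free \<union> face ` V0)"
      by (rule card_mono[rotated]) (simp add: root_darts_def)
    also have "\<dots> \<le> card ?free + card (face ` V0)" by (rule card_Un_le)
    finally have le: "card (faces M) \<le> card ?free + card (face ` V0)" .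
    have "card (face ` V0) \<le> 2"
    proof -
      have "card (face ` V0) \<noteq> card V0" using not_inj eq_card_imp_inj_on[of V0 face] by (auto simp: root_darts_def)
      moreover have "card (face ` V0) \<le> card V0" by (rule card_image_le) (simp add: root_darts_def)
      ultimately show ?thesis using card_V0 by simp
    qed
    then show ?thesis using le by linarith
  qed
  \<comment> \<open>The split map keeps each face without root darts and has one more through
    \<open>r\<close>, hence at least \<open>card (faces M) - 1\<close> faces, whereas its two
    additional vertices force a loss of at least two.\<close>
  have F': "Suc (card ?free) \<le> card (orb t ` D)"
  proof -
    have "?free \<subseteq> orb t ` D"
    proof
      fix c assume "c \<in> ?free"
      then obtain x where x: "x < nd M" "face x \<inter> V0 = {}" "c = face x" by blast
      have eq: "t y = fp y" if y: "y \<in> face x" for y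
      proof -
        have "fp y \<notin> V0" using orb_step[OF y] x by blast
        then have "a y \<notin> V0" using face_in[OF x(1) y] by simp
        then show ?thesis by (simp add: s'_def t_apply)
      qed
      have "(t ^^ k) x = (fp ^^ k) x" for k
      proof (induction k)
        case (Suc k)
        then show ?case using eq[OF orb_pow[of k fp x]] by (simp only: funpow.simps o_apply)
      qed simp
      then have "orb t x = face x" by (simp add: orb_def)
      then show "c \<in> orb t ` D" using x by blast
    qed
    moreover have "orb t r \<notin> ?free"
      using orb_self[of r t] r_V0 by blast
    ultimately have "card (insert (orb t r) ?free) \<le> card (orb t ` D)"
      by (intro card_mono) auto
    then show ?thesis using \<open>orb t r \<notin> ?free\<close> by simp
  qed
  have bij': "bij_betw t D D" unfolding t_def using bij_betw_trans[OF bij_a bij_s'] .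
  have "2 * (ncomp D (graph_on D s') + ncomp D (graph_on D t)) \<le> 4 * ncomp D ?R + card {x \<in> D. a x \<noteq> x}"
    unfolding t_def by (rule genus_inequality) (use bij_s' in auto)
  moreover have "{x \<in> D. a x \<noteq> x} = D" by auto
  ultimately have "2 * (card (verts M) + 2 + card (orb t ` D)) \<le> 4 + nd M"
    unfolding comp ncomp_graph_on[OF finite_lessThan bij_s'] ncomp_graph_on[OF finite_lessThan bij'] V'
    by simp
  then show False using F F' euler by simp
qed

text \<open>Records the set of visited darts instead of positions, because pieces of the contour are
  put together before it is known to be a single cycle.\<close>

definition walk :: "nat set \<Rightarrow> nat \<Rightarrow> nat \<Rightarrow> nat set \<Rightarrow> bool" where
  "walk C x y W \<longleftrightarrow> (\<exists>n. (contour M C ^^ n) x = y \<and> W = (\<lambda>j. (contour M C ^^ j) x) ` {..n})"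

lemma walk_refl: "walk C x x {x}"
  unfolding walk_def by (rule exI[of _ 0]) simp

lemma walk_step: "walk C x y W \<Longrightarrow> walk C x (contour M C y) (insert (contour M C y) W)"
  unfolding walk_def
  by clarify (rule_tac x = "Suc n" in exI, simp add: atMost_Suc)

lemma walk_trans:
  assumes "walk C x y W" "walk C y z W'"
  shows "walk C x z (W \<union> W')"
proof -
  let ?f = "contour M C"
  obtain n m where n: "(?f ^^ n) x = y" "W = (\<lambda>j. (?f ^^ j) x) ` {..n}"
    and m: "(?f ^^ m) y = z" "W' = (\<lambda>j. (?f ^^ j) y) ` {..m}" using assms by (auto simp: walk_def)
  have sh: "(?f ^^ j) y = (?f ^^ (n + j)) x" for j using n(1) by (simp add: funpow_add add.commute[of n])
  have "W \<union> W' = (\<lambda>j. (?f ^^ j) x) ` ({..n} \<union> (\<lambda>j. n + j) ` {..m})"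
    unfolding n(2) m(2) sh by (simp add: image_Un image_image)
  also have "{..n} \<union> (\<lambda>j. n + j) ` {..m} = {..n + m}"
  proof
    show "{..n + m} \<subseteq> {..n} \<union> (\<lambda>j. n + j) ` {..m}"
    proof
      fix k assume "k \<in> {..n + m}"
      then show "k \<in> {..n} \<union> (\<lambda>j. n + j) ` {..m}"
        using imageI[of "k - n" "{..m}" "\<lambda>j. n + j"] by (cases "k \<le> n") auto
    qed
  qed auto
  finally show ?thesis unfolding walk_def using sh m(1) by metis
qed

lemma walk_orb: "walk C x y W \<Longrightarrow> x \<in> orb (contour M C) z \<Longrightarrow> W \<subseteq> orb (contour M C) z"
  unfolding walk_def using orb_mono orb_pow by blast

lemma walk_end: "walk C x y W \<Longrightarrow> y \<in> W"
  unfolding walk_def by blast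

text \<open>One turn around a face, from \<open>y\<close> to the dart \<open>e\<close> before it. At
  an uncut dart the contour follows the face; at a black cut dart it makes the excursion given by
  \<open>pocket\<close> and comes back to the next dart of the same face.\<close>

lemma walk_face:
  assumes C: "cutset M C" and y: "y < nd M" "e < nd M" "fp e = y" "face y \<inter> V0 \<subseteq> {y}"
    and steps: "\<And>z. z \<in> face y \<Longrightarrow> z \<noteq> e \<Longrightarrow> (z \<in> C \<longrightarrow> black z) \<and> a z \<notin> V0"
    and pocket: "\<And>z. z \<in> face y \<Longrightarrow> z \<in> C \<Longrightarrow> black z \<Longrightarrow>
      \<exists>W. walk C (s z) (a z) W \<and> W \<subseteq> D \<and> W \<inter> V0 = {} \<and> (\<forall>u\<in>W. u \<in> C \<longrightarrow> u = a z \<or> a u \<in> W)"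
  shows "\<exists>W. walk C y e W \<and> face y \<subseteq> W \<and> W \<subseteq> D \<and> W \<inter> V0 \<subseteq> {y} \<and> (\<forall>u\<in>W. u \<in> C \<longrightarrow> u = e \<or> a u \<in> W)"
proof -
  have "y \<in> face e" using y(3) orb_step[OF orb_self, of fp e] by simp
  then have "e \<in> face y" using face_sym y by simp
  then obtain t0 where "(fp ^^ t0) y = e" by (auto simp: orb_def)
  define t where "t = (LEAST t. (fp ^^ t) y = e)"
  have t: "(fp ^^ t) y = e" unfolding t_def using \<open>(fp ^^ t0) y = e\<close> by (rule LeastI)
  have tmin: "(fp ^^ j) y \<noteq> e" if "j < t" for j using that not_less_Least unfolding t_def by blast
  have "\<exists>W. walk C y ((fp ^^ j) y) W \<and> (\<lambda>i. (fp ^^ i) y) ` {..j} \<subseteq> W \<and> W \<subseteq> D \<and> W \<inter> V0 \<subseteq> {y} \<and>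
      (\<forall>u\<in>W. u \<in> C \<longrightarrow> u = (fp ^^ j) y \<or> a u \<in> W)" if "j \<le> t" for j
    using that
  proof (induction j)
    case 0
    show ?case by (rule exI[of _ "{y}"]) (use y walk_refl in auto)
  next
    case (Suc j)
    define z where "z = (fp ^^ j) y"
    obtain W where W: "walk C y z W" "(\<lambda>i. (fp ^^ i) y) ` {..j} \<subseteq> W" "W \<subseteq> D" "W \<inter> V0 \<subseteq> {y}"
      "\<forall>u\<in>W. u \<in> C \<longrightarrow> u = z \<or> a u \<in> W" using Suc.IH Suc.prems unfolding z_def by (meson Suc_leD)
    have z: "z \<in> face y" "z \<noteq> e" using orb_pow tmin Suc by (auto simp: z_def)
    have zD: "z < nd M" using face_in[of y z] y z by simp
    have nx: "(fp ^^ Suc j) y = fp z" by (simp add: z_def)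
    have phz: "fp z \<in> face y" using orb_step[OF z(1)] .
    have phzV: "fp z \<in> V0 \<longrightarrow> fp z = y" using phz y by auto
    have im: "(\<lambda>i. (fp ^^ i) y) ` {..Suc j} = insert (fp z) ((\<lambda>i. (fp ^^ i) y) ` {..j})"
      by (simp add: atMost_Suc z_def)
    show ?case
    proof (cases "z \<in> C")
      case True
      then have bz: "black z" using steps z by simp
      obtain W1 where W1: "walk C (s z) (a z) W1" "W1 \<subseteq> D" "W1 \<inter> V0 = {}"
        "\<forall>u\<in>W1. u \<in> C \<longrightarrow> u = a z \<or> a u \<in> W1" using pocket[OF z(1) True bz] by blast
      have azC: "a z \<in> C" using True C by (auto simp: cutset_def)
      have c1: "contour M C z = s z" "contour M C (a z) = fp z"
        using True azC C by (auto simp: contour_def cutset_def Let_def)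
      have "walk C y (a z) (insert (s z) W \<union> W1)"
        using walk_trans[OF walk_step[OF W(1)]] W1(1) c1 by metis
      from walk_step[OF this] have wk: "walk C y (fp z) (insert (fp z) (insert (s z) W \<union> W1))"
        using c1 by simp
      have sz: "s z \<in> W1" using W1(1) by (auto simp: walk_def intro!: image_eqI[of _ _ 0])
      show ?thesis unfolding nx
      proof (rule exI, intro conjI)
        show "walk C y (fp z) (insert (fp z) (insert (s z) W \<union> W1))" by (rule wk)
        show "(\<lambda>i. (fp ^^ i) y) ` {..Suc j} \<subseteq> insert (fp z) (insert (s z) W \<union> W1)"
          using W(2) unfolding im by blast
        show "insert (fp z) (insert (s z) W \<union> W1) \<subseteq> D" using W(3) W1(2) zD by auto
        show "insert (fp z) (insert (s z) W \<union> W1) \<inter> V0 \<subseteq> {y}"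
          using W(4) W1(3) sz phzV by blast
        show "\<forall>u\<in>insert (fp z) (insert (s z) W \<union> W1). u \<in> C \<longrightarrow>
            u = fp z \<or> a u \<in> insert (fp z) (insert (s z) W \<union> W1)"
        proof (intro ballI impI)
          fix u assume u: "u \<in> insert (fp z) (insert (s z) W \<union> W1)" "u \<in> C"
          then consider "u = fp z" | "u = z" | "u \<in> W" "a u \<in> W" | "u = a z" | "a u \<in> W1"
            using W(5) W1(4) sz by blast
          then show "u = fp z \<or> a u \<in> insert (fp z) (insert (s z) W \<union> W1)"
            using walk_end[OF W(1)] walk_end[OF W1(1)] zD by cases auto
        qed
      qed
    next
      case False
      then have "a z \<notin> V0" using steps z by simp
      then have c1: "contour M C z = fp z" using False by (simp add: contour_def)
      show ?thesis unfolding nx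
      proof (rule exI, intro conjI)
        show "walk C y (fp z) (insert (fp z) W)" using walk_step[OF W(1)] c1 by simp
        show "(\<lambda>i. (fp ^^ i) y) ` {..Suc j} \<subseteq> insert (fp z) W" using W(2) unfolding im by blast
        show "insert (fp z) W \<subseteq> D" using W(3) zD by auto
        show "insert (fp z) W \<inter> V0 \<subseteq> {y}" using W(4) phzV by blast
        show "\<forall>u\<in>insert (fp z) W. u \<in> C \<longrightarrow> u = fp z \<or> a u \<in> insert (fp z) W"
          using W(5) False by auto
      qed
    qed
  qed
  from this[OF order_refl] obtain W where W: "walk C y e W" "(\<lambda>i. (fp ^^ i) y) ` {..t} \<subseteq> W"
    "W \<subseteq> D" "W \<inter> V0 \<subseteq> {y}" "\<forall>u\<in>W. u \<in> C \<longrightarrow> u = e \<or> a u \<in> W" unfolding t by blast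
  have "face y \<subseteq> (\<lambda>i. (fp ^^ i) y) ` {..t}"
  proof (rule orb_subset)
    show "y \<in> (\<lambda>i. (fp ^^ i) y) ` {..t}" by (rule image_eqI[of _ _ 0]) auto
    fix u assume "u \<in> (\<lambda>i. (fp ^^ i) y) ` {..t}"
    then obtain i where i: "i \<le> t" "u = (fp ^^ i) y" by auto
    show "fp u \<in> (\<lambda>i. (fp ^^ i) y) ` {..t}"
    proof (cases "i = t")
      case True
      then show ?thesis using i t y(3) by (intro image_eqI[of _ _ 0]) auto
    next
      case False
      then show ?thesis using i by (intro image_eqI[of _ _ "Suc i"]) auto
    qed
  qed
  then show ?thesis using W by blast
qed

text \<open>Induction on the label of the entered face: the pocket of \<open>x\<close> is one turn
  around the face of \<open>s x\<close>, and its excursions go through cut arcs into faces with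
  smaller labels.\<close>

lemma pocket_walk:
  assumes arb: "arborescence M C g" and x: "x \<in> C" "black x"
  shows "\<exists>W. walk C (s x) (a x) W \<and> face (s x) \<subseteq> W \<and> W \<subseteq> D \<and> W \<inter> V0 = {} \<and>
    (\<forall>u\<in>W. u \<in> C \<longrightarrow> u = a x \<or> a u \<in> W)"
  using x
proof (induction "card {y \<in> D. g y < g (s x)}" arbitrary: x rule: less_induct)
  case less
  note x = less.prems
  have cs: "cutset M C" and gphi: "\<And>x. x < nd M \<Longrightarrow> g (s (a x)) = g x"
    and dec: "\<And>x. x \<in> C \<Longrightarrow> black x \<Longrightarrow> g (s x) < g x"
    and free: "\<And>x. x \<in> C \<Longrightarrow> black x \<Longrightarrow> face (s x) \<inter> V0 = {}"
    and uniq: "\<And>x y. x \<in> C \<Longrightarrow> y \<in> C \<Longrightarrow> black x \<Longrightarrow> black y \<Longrightarrow> s y \<in> face (s x) \<Longrightarrow> x = y"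
    using arb by (auto simp: arborescence_def)
  have xD: "x < nd M" using x cs by (auto simp: cutset_def)
  have gface: "g z = g (s x)" if "z \<in> face (s x)" for z
  proof -
    have "face (s x) \<subseteq> {z. z < nd M \<and> g z = g (s x)}" by (rule orb_subset) (use xD gphi in auto)
    then show ?thesis using that by auto
  qed
  have "\<exists>W. walk C (s x) (a x) W \<and> face (s x) \<subseteq> W \<and> W \<subseteq> D \<and> W \<inter> V0 \<subseteq> {s x} \<and>
    (\<forall>u\<in>W. u \<in> C \<longrightarrow> u = a x \<or> a u \<in> W)"
  proof (rule walk_face[OF cs])
    fix z assume z: "z \<in> face (s x)" "z \<noteq> a x"
    have zD: "z < nd M" using face_in[of "s x" z] z xD by simp
    have phz: "s (a z) \<in> face (s x)" using orb_step[OF z(1)] by simp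
    \<comment> \<open>A white cut dart on this face is the far end of an arc entering it, and
      \<open>x\<close> is the only such arc.\<close>
    have "black z" if zC: "z \<in> C"
    proof (rule ccontr)
      assume "\<not> black z"
      then have "x = a z" using uniq[of x "a z"] x zC zD phz cs by (auto simp: cutset_def)
      then show False using z(2) zD by simp
    qed
    moreover have "a z \<notin> V0" using phz free[OF x] V0_s[of "a z"] zD by auto
    ultimately show "(z \<in> C \<longrightarrow> black z) \<and> a z \<notin> V0" by simp
  next
    fix z assume z: "z \<in> face (s x)" "z \<in> C" "black z"
    have zD: "z < nd M" using face_in[of "s x" z] z xD by simp
    have "g (s z) < g (s x)" using dec[OF z(2,3)] gface[OF z(1)] by simp
    then have "card {y \<in> D. g y < g (s z)} < card {y \<in> D. g y < g (s x)}"
      using zD by (intro psubset_card_mono psubsetI) (auto simp: set_eq_iff intro!: exI[of _ "s z"])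
    from less.hyps[OF this z(2,3)]
    show "\<exists>W. walk C (s z) (a z) W \<and> W \<subseteq> D \<and> W \<inter> V0 = {} \<and> (\<forall>u\<in>W. u \<in> C \<longrightarrow> u = a z \<or> a u \<in> W)"
      by blast
  qed (use xD free[OF x] in auto)
  moreover have "s x \<notin> V0" using free[OF x] orb_self by blast
  ultimately show ?case by blast
qed

text \<open>The last dart of this face is \<open>a (s (s v))\<close>, and the contour step from it
  stops at the root leaf \<open>s (s v)\<close>. In this way the walk passes from one root face to
  the next.\<close>

lemma root_walk:
  assumes arb: "arborescence M C g" and v: "v \<in> V0"
  shows "\<exists>W. walk C v (a (s (s v))) W \<and> face v \<subseteq> W \<and> W \<subseteq> D \<and> W \<inter> V0 \<subseteq> {v} \<and>
    (\<forall>u\<in>W. u \<in> C \<longrightarrow> a u \<in> W)"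
proof -
  have cs: "cutset M C" and free: "\<And>x. x \<in> C \<Longrightarrow> black x \<Longrightarrow> face (s x) \<inter> V0 = {}"
    using arb by (auto simp: arborescence_def)
  have vD: "v < nd M" using v by simp
  have V0v: "w = v" if "w \<in> face v" "w \<in> V0" for w
    using root_faces_distinct face_eq[OF vD that(1)] that v by (auto dest: inj_onD)
  have "\<exists>W. walk C v (a (s (s v))) W \<and> face v \<subseteq> W \<and> W \<subseteq> D \<and> W \<inter> V0 \<subseteq> {v} \<and>
    (\<forall>u\<in>W. u \<in> C \<longrightarrow> u = a (s (s v)) \<or> a u \<in> W)"
  proof (rule walk_face[OF cs])
    fix z assume z: "z \<in> face v" "z \<noteq> a (s (s v))"
    have zD: "z < nd M" using face_in[of v z] z vD by simp
    have phz: "s (a z) \<in> face v" using orb_step[OF z(1)] by simp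
    have "black z" if zC: "z \<in> C"
    proof (rule ccontr)
      assume nb: "\<not> black z"
      have "a z \<in> C" using zC cs by (auto simp: cutset_def)
      moreover have "v \<in> face (s (a z))" using face_sym[OF vD phz] .
      ultimately show False using free[of "a z"] nb zD v by auto
    qed
    moreover have "a z \<notin> V0"
    proof
      assume "a z \<in> V0"
      then have "s (a z) = v" using V0v[OF phz] zD by simp
      then have "s (s v) = a z" using zD by (metis sss a_in)
      then show False using z(2) zD by simp
    qed
    ultimately show "(z \<in> C \<longrightarrow> black z) \<and> a z \<notin> V0" by simp
  next
    fix z assume z: "z \<in> face v" "z \<in> C" "black z"
    from pocket_walk[OF arb z(2,3)]
    show "\<exists>W. walk C (s z) (a z) W \<and> W \<subseteq> D \<and> W \<inter> V0 = {} \<and> (\<forall>u\<in>W. u \<in> C \<longrightarrow> u = a z \<or> a u \<in> W)"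
      by blast
  qed (use vD V0v in auto)
  moreover have "a (s (s v)) \<notin> C"
    using cs v vD V0_s[of v] V0_s[of "s v"] unfolding cutset_def by (metis Int_iff aa empty_iff s_in)
  ultimately show ?thesis by blast
qed

text \<open>Pocket walks exhibit the matched pairs as nested intervals, and root walks chain the
  three root faces together; what they visit is everything, since each face hangs below a root
  face.\<close>

lemma arborescence_valid:
  assumes arb: "arborescence M C g"
  shows "valid_cut M C"
proof -
  let ?f = "contour M C" and ?p = "cpos M C"
  have cs: "cutset M C" and gphi: "\<And>x. x < nd M \<Longrightarrow> g (s (a x)) = g x"
    and dec: "\<And>x. x \<in> C \<Longrightarrow> black x \<Longrightarrow> g (s x) < g x"
    and free: "\<And>x. x \<in> C \<Longrightarrow> black x \<Longrightarrow> face (s x) \<inter> V0 = {}"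
    and uniq: "\<And>x y. x \<in> C \<Longrightarrow> y \<in> C \<Longrightarrow> black x \<Longrightarrow> black y \<Longrightarrow> s y \<in> face (s x) \<Longrightarrow> x = y"
    and cover: "\<And>x. x < nd M \<Longrightarrow> face x \<inter> V0 = {} \<Longrightarrow> \<exists>y\<in>C. black y \<and> s y \<in> face x"
    using arb by (auto simp: arborescence_def)
  have CD: "x < nd M" "a x \<in> C" "x \<notin> V0" if "x \<in> C" for x using that cs by (auto simp: cutset_def)
  have C_step: "?f x = s x" if "x \<in> C" for x using CD[OF that] that by (simp add: contour_def)
  have leg_step: "?f (a v) = v" if v: "v \<in> V0" for v
  proof -
    have "a v \<notin> C" using CD(2)[of "a v"] CD(3)[of v] v by auto
    then show ?thesis using v by (simp add: contour_def)
  qed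
  let ?O = "orb ?f r"
  have rootO: "face v \<subseteq> ?O" if v: "v \<in> V0" for v
  proof -
    have step: "face v \<subseteq> ?O \<and> s (s v) \<in> ?O" if v: "v \<in> V0" "v \<in> ?O" for v
    proof -
      obtain W where W: "walk C v (a (s (s v))) W" "face v \<subseteq> W" using root_walk[OF arb v(1)] by blast
      have "W \<subseteq> ?O" using walk_orb[OF W(1) v(2)] .
      moreover have "?f (a (s (s v))) \<in> ?O" using walk_end[OF W(1)] \<open>W \<subseteq> ?O\<close> orb_step by blast
      ultimately show ?thesis using W leg_step[of "s (s v)"] v by simp
    qed
    have "face r \<subseteq> ?O" "s (s r) \<in> ?O" using step[of r] by auto
    moreover from this have "face (s (s r)) \<subseteq> ?O" "s r \<in> ?O" using step[of "s (s r)"] by auto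
    moreover from this have "face (s r) \<subseteq> ?O" using step[of "s r"] by auto
    ultimately show ?thesis using v by (auto simp: root_darts_def)
  qed
  \<comment> \<open>Induction downwards in the labels: a face without root darts is entered from a
    face with a larger label.\<close>
  have trans: "x \<in> ?O" if "x < nd M" for x
    using that
  proof (induction "card {y \<in> D. g x < g y}" arbitrary: x rule: less_induct)
    case less
    show ?case
    proof (cases "face x \<inter> V0 = {}")
      case True
      then obtain y where y: "y \<in> C" "black y" "s y \<in> face x" using cover less.prems by blast
      have "face x \<subseteq> {z. z < nd M \<and> g z = g x}" by (rule orb_subset) (use less.prems gphi in auto)
      then have gx: "g (s y) = g x" using y by auto
      then have "card {z \<in> D. g y < g z} < card {z \<in> D. g x < g z}"
        using dec[OF y(1,2)] CD[OF y(1)]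
        by (intro psubset_card_mono psubsetI) (auto simp: set_eq_iff intro!: exI[of _ y])
      then have "y \<in> ?O" using less.hyps CD[OF y(1)] by simp
      then have "s y \<in> ?O" using C_step[OF y(1)] orb_step by metis
      moreover obtain W where "walk C (s y) (a y) W" "face (s y) \<subseteq> W" using pocket_walk[OF arb y(1,2)] by blast
      moreover have "x \<in> face (s y)" using face_sym less.prems y by simp
      ultimately show ?thesis using walk_orb by blast
    next
      case False
      then obtain v where v: "v \<in> V0" "v \<in> face x" by blast
      then have "x \<in> face v" using face_sym less.prems by simp
      then show ?thesis using rootO v by blast
    qed
  qed
  interpret cyc: cyclic D ?f r using cyclic_contour[OF cs] trans by simp
  \<comment> \<open>A walk that misses \<open>r\<close> does not wrap around, so the darts it visits
    fill an interval of positions.\<close>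
  have walk_pos: "W = {z. z < nd M \<and> ?p x \<le> ?p z \<and> ?p z \<le> ?p y}"
    if w: "walk C x y W" "x < nd M" "r \<notin> W" for x y W
  proof -
    obtain n where n: "(?f ^^ n) x = y" "W = (\<lambda>j. (?f ^^ j) x) ` {..n}" using w by (auto simp: walk_def)
    have pj: "?p ((?f ^^ j) x) = ?p x + j \<and> (?f ^^ j) x < nd M" if "j \<le> n" for j
      using that
    proof (induction j)
      case (Suc j)
      then have IH: "?p ((?f ^^ j) x) = ?p x + j" "(?f ^^ j) x < nd M" by auto
      have "(?f ^^ Suc j) x < nd M" using cyc.f_in IH by simp
      moreover have "?p ((?f ^^ Suc j) x) \<noteq> 0"
      proof
        assume "?p ((?f ^^ Suc j) x) = 0"
        then have e: "(?f ^^ Suc j) x = r" using cyc.pos_0D calculation by simp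
        then have "r \<in> W" unfolding n(2) using Suc.prems by (metis atMost_iff image_eqI)
        then show False using w by blast
      qed
      ultimately show ?case using cyc.pos_step[of "(?f ^^ j) x"] IH by (simp split: if_splits)
    qed (use w in simp)
    show ?thesis
    proof (intro equalityI subsetI)
      fix z assume "z \<in> W"
      then show "z \<in> {z. z < nd M \<and> ?p x \<le> ?p z \<and> ?p z \<le> ?p y}"
        using n pj pj[of n] by auto
    next
      fix z assume z: "z \<in> {z. z < nd M \<and> ?p x \<le> ?p z \<and> ?p z \<le> ?p y}"
      then have "?p ((?f ^^ (?p z - ?p x)) x) = ?p z" "(?f ^^ (?p z - ?p x)) x < nd M" "?p z - ?p x \<le> n"
        using pj[of n] pj[of "?p z - ?p x"] n(1) by auto
      then have "(?f ^^ (?p z - ?p x)) x = z" using cyc.pos_inj z by simp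
      then show "z \<in> W" unfolding n(2) using \<open>?p z - ?p x \<le> n\<close> by (metis atMost_iff image_eqI)
    qed
  qed
  have pairs: "?p x < ?p (a x) \<and> between M C x \<inter> V0 = {} \<and>
      (\<forall>y\<in>between M C x. y \<in> C \<longrightarrow> a y \<in> between M C x)" if x: "x \<in> C" "black x" for x
  proof -
    obtain W where W: "walk C (s x) (a x) W" "W \<subseteq> D" "W \<inter> V0 = {}"
      "\<forall>u\<in>W. u \<in> C \<longrightarrow> u = a x \<or> a u \<in> W" using pocket_walk[OF arb x] by blast
    have xD: "x < nd M" using CD x by simp
    have "r \<notin> W" using W(3) by auto
    then have Weq: "W = {z. z < nd M \<and> ?p (s x) \<le> ?p z \<and> ?p z \<le> ?p (a x)}"
      using walk_pos[OF W(1)] xD by simp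
    have "s x \<noteq> r" using free[OF x] orb_self[of "s x" fp] r_V0 by (metis IntI empty_iff)
    then have "?p (s x) \<noteq> 0" using cyc.pos_0D[of "s x"] xD by auto
    then have ps: "?p (s x) = Suc (?p x)"
      using cyc.pos_step[of x] xD C_step[OF x(1)] by (simp split: if_splits)
    have bt: "between M C x \<subseteq> W" "a x \<notin> between M C x" "x \<notin> between M C x"
      unfolding Weq between_def using ps by auto
    have "a y \<in> between M C x" if y: "y \<in> between M C x" "y \<in> C" for y
    proof -
      have "y \<in> W" "y \<noteq> a x" using y bt by auto
      then have ayW: "a y \<in> W" using W(4) y by blast
      have yD: "y < nd M" using CD y by simp
      have "a y \<noteq> a x" using a_inj[OF yD xD] y bt by auto
      then have "?p (a y) \<noteq> ?p (a x)" using cyc.pos_inj xD yD by auto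
      then show ?thesis using ayW ps unfolding Weq between_def by auto
    qed
    moreover have "?p x < ?p (a x)" using walk_end[OF W(1)] ps unfolding Weq by auto
    ultimately show ?thesis using bt W(3) by blast
  qed
  \<comment> \<open>The turn around the face of \<open>r\<close> leads to the leaf
    \<open>s (s r)\<close> without having met \<open>s r\<close>.\<close>
  have order: "?p (s (s r)) < ?p (s r)"
  proof (rule ccontr)
    assume c: "\<not> ?p (s (s r)) < ?p (s r)"
    have ne: "s (s r) \<noteq> s r" "s r \<noteq> r" "s (s r) \<noteq> r" using s_inj by auto
    obtain W where W: "walk C r (a (s (s r))) W" "W \<inter> V0 \<subseteq> {r}" using root_walk[OF arb r_V0] by blast
    then obtain n where n: "(?f ^^ n) r = a (s (s r))" "W = (\<lambda>j. (?f ^^ j) r) ` {..n}" by (auto simp: walk_def)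
    have "?p (s (s r)) \<noteq> ?p (s r)" using cyc.pos_inj[of "s (s r)" "s r"] ne by auto
    then have lt: "?p (s r) < ?p (s (s r))" using c by simp
    have "?p (s (s r)) \<noteq> 0" using cyc.pos_0D[of "s (s r)"] ne by auto
    then have "?p (s (s r)) = Suc (?p (a (s (s r))))"
      using cyc.pos_step[of "a (s (s r))"] leg_step[OF ssr_V0] by (simp split: if_splits)
    moreover have "?p (a (s (s r))) \<le> n" using cyc.pos_le[OF n(1)] .
    ultimately have "?p (s r) \<le> n" using lt by simp
    moreover have "(?f ^^ ?p (s r)) r = s r" using cyc.pow_pos by simp
    ultimately have "s r \<in> W" unfolding n(2) by (metis atMost_iff image_eqI)
    then show False using W ne by auto
  qed
  \<comment> \<open>Every face other than the root faces is entered by exactly one cut arc; Euler's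
    formula converts this number of faces into a number of darts.\<close>
  have count: "nd M = 3 * card C + 6"
  proof -
    let ?B = "{x \<in> C. black x}"
    have inj: "inj_on (\<lambda>x. face (s x)) ?B"
    proof (rule inj_onI)
      fix x y assume xy: "x \<in> ?B" "y \<in> ?B" "face (s x) = face (s y)"
      then have "s y \<in> face (s x)" using orb_self by metis
      then show "x = y" using uniq xy by auto
    qed
    have split: "faces M = (\<lambda>x. face (s x)) ` ?B \<union> face ` V0"
    proof (intro equalityI subsetI)
      fix c assume "c \<in> faces M"
      then obtain x where x: "x < nd M" "c = face x" by (auto simp: faces_fperm)
      show "c \<in> (\<lambda>x. face (s x)) ` ?B \<union> face ` V0"
      proof (cases "face x \<inter> V0 = {}")
        case True
        then obtain y where "y \<in> C" "black y" "s y \<in> face x" using cover x by blast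
        then show ?thesis using face_eq[OF x(1)] x by blast
      next
        case False
        then show ?thesis using face_eq[OF x(1)] x by blast
      qed
    next
      fix c assume "c \<in> (\<lambda>x. face (s x)) ` ?B \<union> face ` V0"
      then show "c \<in> faces M" using CD by (auto simp: faces_fperm)
    qed
    have "(\<lambda>x. face (s x)) ` ?B \<inter> face ` V0 = {}"
    proof (rule ccontr)
      assume "\<not> ?thesis"
      then obtain x v where "x \<in> ?B" "v \<in> V0" "face (s x) = face v" by auto
      then show False using free[of x] orb_self[of v fp] by auto
    qed
    moreover have "finite ?B" using cs finite_subset[of ?B D] by (auto simp: cutset_def)
    moreover have "finite V0" by (simp add: root_darts_def)
    ultimately have "card (faces M) = card ((\<lambda>x. face (s x)) ` ?B) + card (face ` V0)"
      unfolding split by (intro card_Un_disjoint) auto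
    also have "\<dots> = card ?B + 3"
      using card_image[OF inj] card_image[OF root_faces_distinct] card_V0 by simp
    finally show ?thesis using card_black_cut[OF cs] euler card_verts by simp
  qed
  show ?thesis unfolding valid_cut_def using cs trans count pairs order by blast
qed

end

section \<open>Regular cut sets and the signed count\<close>

inductive reach_in :: "bmap \<Rightarrow> nat set \<Rightarrow> nat \<Rightarrow> nat \<Rightarrow> bool" for M S where
  root: "v \<in> root_darts M \<Longrightarrow> reach_in M S 0 v"
| face: "reach_in M S n x \<Longrightarrow> reach_in M S n (sg M (al M x))"
| arc: "reach_in M S n x \<Longrightarrow> x \<in> arcs M \<Longrightarrow> x \<notin> S \<Longrightarrow> reach_in M S (Suc n) (sg M x)"

definition reach :: "bmap \<Rightarrow> nat set \<Rightarrow> nat set" where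
  "reach M S = {x. \<exists>n. reach_in M S n x}"

text \<open>Doubly occupied edges, each named by its black dart. Since the root vertex is empty,
  restricting to \<open>arcs\<close> misses none of them.\<close>

definition conflicts :: "bmap \<Rightarrow> nat set" where
  "conflicts M = {x \<in> arcs M. occ M x \<and> occ M (al M x)}"

lemma reach_root: "v \<in> root_darts M \<Longrightarrow> v \<in> reach M S"
  and reach_face: "x \<in> reach M S \<Longrightarrow> sg M (al M x) \<in> reach M S"
  and reach_arc: "x \<in> reach M S \<Longrightarrow> x \<in> arcs M \<Longrightarrow> x \<notin> S \<Longrightarrow> sg M x \<in> reach M S"
  unfolding reach_def by (auto intro: reach_in.intros)

lemma reach_subset:
  assumes "\<And>v. v \<in> root_darts M \<Longrightarrow> v \<in> A" "\<And>x. x \<in> A \<Longrightarrow> sg M (al M x) \<in> A"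
    "\<And>x. x \<in> A \<Longrightarrow> x \<in> arcs M \<Longrightarrow> x \<notin> S \<Longrightarrow> sg M x \<in> A"
  shows "reach M S \<subseteq> A"
proof -
  have "reach_in M S n x \<Longrightarrow> x \<in> A" for n x
    by (induction rule: reach_in.induct) (use assms in auto)
  then show ?thesis by (auto simp: reach_def)
qed

lemma finite_maximum:
  fixes f :: "'a \<Rightarrow> 'b :: linorder"
  assumes "finite A" "A \<noteq> {}"
  obtains x where "x \<in> A" "\<And>y. y \<in> A \<Longrightarrow> f y \<le> f x"
proof -
  have "Max (f ` A) \<in> f ` A" using assms by (intro Max_in) auto
  then obtain x where x: "x \<in> A" "f x = Max (f ` A)" by auto
  then show thesis using that[of x] assms by simp
qed

lemma sum_powers_2:
  assumes "i \<le> n"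
  shows "(\<Sum>k = i..<n. 2 ^ (n - k)) + 2 = (2::nat) ^ Suc (n - i)"
  using assms
proof (induction rule: inc_induct)
  case (step i)
  have "(\<Sum>k = i..<n. 2 ^ (n - k)) = (2::nat) ^ (n - i) + (\<Sum>k = Suc i..<n. 2 ^ (n - k))"
    using step.hyps by (simp add: sum.atLeast_Suc_lessThan)
  moreover have "Suc (n - Suc i) = n - i" using step.hyps by simp
  ultimately show ?case using step.IH by simp
qed simp

text \<open>Lexicographic comparison of 0-1 words coded as numbers: the weights after position
  \<open>i\<close> add up to less than \<open>2 ^ (n - i)\<close>.\<close>

lemma binary_less:
  fixes f g :: "nat \<Rightarrow> nat"
  assumes "i < n" "\<And>k. k < i \<Longrightarrow> f k = g k" "f i = 0" "g i = 2 ^ (n - i)" "\<And>k. f k \<le> 2 ^ (n - k)"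
  shows "(\<Sum>k<n. f k) < (\<Sum>k<n. g k)"
proof -
  have split: "(\<Sum>k<n. F k) = (\<Sum>k<i. F k) + F i + (\<Sum>k = Suc i..<n. F k)" for F :: "nat \<Rightarrow> nat"
  proof -
    have "(\<Sum>k<n. F k) = (\<Sum>k = 0..<i. F k) + (\<Sum>k = i..<n. F k)"
      using assms(1) by (simp add: sum.atLeastLessThan_concat lessThan_atLeast0)
    then show ?thesis using assms(1) by (simp add: sum.atLeast_Suc_lessThan lessThan_atLeast0)
  qed
  have "(\<Sum>k = Suc i..<n. f k) \<le> (\<Sum>k = Suc i..<n. 2 ^ (n - k))" by (rule sum_mono) (rule assms(5))
  also have "\<dots> < 2 ^ (n - i)"
  proof -
    have "Suc (n - Suc i) = n - i" using assms(1) by simp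
    then show ?thesis using sum_powers_2[of "Suc i" n] assms(1) by simp
  qed
  finally have "(\<Sum>k = Suc i..<n. f k) < g i" using assms(4) by simp
  moreover have "(\<Sum>k<i. f k) = (\<Sum>k<i. g k)" by (rule sum.cong) (use assms(2) in auto)
  ultimately show ?thesis unfolding split[of f] split[of g] using assms(3) by simp
qed

text \<open>Adding or removing \<open>u\<close> is an involution of \<open>F\<close> that reverses
  every sign.\<close>

lemma sum_toggle_zero:
  assumes "\<And>S. S \<in> F \<Longrightarrow> finite S \<and> insert u S \<in> F \<and> S - {u} \<in> F"
  shows "(\<Sum>S\<in>F. (- 1 :: int) ^ card S) = 0"
proof -
  define t where "t S = (if u \<in> S then S - {u} else insert u S)" for S
  have tF: "t S \<in> F" "t (t S) = S" if "S \<in> F" for S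
    using assms[OF that] by (auto simp: t_def insert_absorb)
  have sign: "(- 1 :: int) ^ card (t S) = - ((- 1) ^ card S)" if "S \<in> F" for S
  proof (cases "u \<in> S")
    case True
    then have "card S = Suc (card (t S))" unfolding t_def using assms[OF that] card.remove[of S u] by simp
    then show ?thesis by simp
  next
    case False
    then show ?thesis using assms[OF that] by (simp add: t_def)
  qed
  have "(\<Sum>S\<in>F. (- 1 :: int) ^ card S) = (\<Sum>S\<in>F. (- 1) ^ card (t S))"
    by (rule sum.reindex_bij_witness[of _ t t]) (use tF in auto)
  also have "\<dots> = - (\<Sum>S\<in>F. (- 1 :: int) ^ card S)"
    unfolding sum_negf[symmetric] by (rule sum.cong) (use sign in auto)
  finally show ?thesis by simp
qed

lemma sum_boolean_interval:
  assumes "finite U"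
  shows "(\<Sum>S | L \<subseteq> S \<and> S \<subseteq> U. (- 1 :: int) ^ card S) = (if L = U then (- 1) ^ card U else 0)"
proof (cases "L \<subset> U")
  case True
  then obtain u where u: "u \<in> U" "u \<notin> L" by blast
  have "(\<Sum>S\<in>{S. L \<subseteq> S \<and> S \<subseteq> U}. (- 1 :: int) ^ card S) = 0"
    by (rule sum_toggle_zero[of _ u]) (use u assms finite_subset in auto)
  then show ?thesis using True by auto
next
  case False
  then have "{S. L \<subseteq> S \<and> S \<subseteq> U} = (if L = U then {U} else {})" by auto
  then show ?thesis by simp
qed

context planar_bicubic begin

lemma arcs_black: "x \<in> arcs M \<Longrightarrow> x < nd M \<and> black x \<and> x \<notin> V0"
  by (simp add: arcs_def)

text \<open>The contour is itself a walk in the dual graph that enters new faces only across cut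
  arcs or at root darts.\<close>

lemma valid_reach:
  assumes "valid_cut M C" "C \<inter> S = {}" "x < nd M"
  shows "x \<in> reach M S"
proof -
  interpret V: valid_map M C by unfold_locales (rule assms)
  have "x \<in> D" using assms by simp
  then show ?thesis
  proof (induction rule: V.cyc.pos_induct)
    case root
    then show ?case by (intro reach_root) simp
  next
    case (step y)
    have y: "y < nd M" "y \<in> reach M S" using step by auto
    from V.cutset y(1) show ?case
    proof (cases rule: contour_cases)
      case cut
      show ?thesis
      proof (cases "black y")
        case True
        then have "y \<in> arcs M" "y \<notin> S" using cut y assms by (auto simp: arcs_def)
        then show ?thesis using reach_arc[OF y(2)] cut by simp
      next
        case False
        then have "cpos M C (a y) < cpos M C y" using V.white_less cut by simp
        then have "a y \<in> reach M S" using step.IH[of "a y"] y by simp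
        then show ?thesis using reach_face[of "a y" M S] y cut by simp
      qed
    next
      case leg
      then show ?thesis by (auto intro: reach_root)
    next
      case other
      then show ?thesis using reach_face[OF y(2)] by simp
    qed
  qed
qed

lemma face_disjoint_or_eq: "x < nd M \<Longrightarrow> y < nd M \<Longrightarrow> z \<in> face x \<Longrightarrow> z \<in> face y \<Longrightarrow> face x = face y"
  using face_eq by metis

text \<open>Breadth-first search: every face without root darts chooses an arc into it from a face
  at smaller distance \<open>d\<close>, and \<open>- d\<close> is the decreasing label.\<close>

lemma reach_arborescence:
  assumes reach: "\<And>x. x < nd M \<Longrightarrow> x \<in> reach M S" and S: "S \<subseteq> arcs M"
  shows "\<exists>C g. arborescence M C g \<and> C \<inter> S = {}"
proof -
  define d where "d x = (LEAST n. reach_in M S n x)" for x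
  have d_le: "reach_in M S n x \<Longrightarrow> d x \<le> n" for n x unfolding d_def by (rule Least_le)
  have d_reach: "reach_in M S (d x) x" if x: "x < nd M" for x
  proof -
    obtain n where "reach_in M S n x" using reach[OF x] by (auto simp: reach_def)
    then show ?thesis unfolding d_def by (rule LeastI)
  qed
  have d_face_le: "d y \<le> d x" if "x < nd M" "y \<in> face x" for x y
  proof -
    have "face x \<subseteq> {z. z < nd M \<and> d z \<le> d x}"
    proof (rule orb_subset)
      fix z assume z: "z \<in> {z. z < nd M \<and> d z \<le> d x}"
      then have "d (fp z) \<le> d z" using d_le[OF reach_in.face[OF d_reach]] by simp
      then show "fp z \<in> {z. z < nd M \<and> d z \<le> d x}" using z by simp
    qed (use that in simp)
    then show ?thesis using that by auto
  qed
  have d_face: "d y = d x" if "x < nd M" "y \<in> face x" for x y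
    using d_face_le[OF that] d_face_le[of y x] face_sym[OF that] face_in[OF that] by simp
  \<comment> \<open>Arcs and face steps alternate freely in a path, so the end of its last arc is
    located only up to its face.\<close>
  have struct: "reach_in M S n x \<Longrightarrow> (\<exists>v\<in>V0. x \<in> face v) \<or>
      (\<exists>m y. n = Suc m \<and> reach_in M S m y \<and> y \<in> arcs M \<and> y \<notin> S \<and> x \<in> face (s y))" for n x
  proof (induction rule: reach_in.induct)
    case (root v)
    then show ?case using orb_self by blast
  next
    case (face n x)
    have "fp x = s (a x)" by simp
    then show ?case using face.IH orb_step[of x fp] by metis
  next
    case (arc n x)
    then show ?case using orb_self by blast
  qed
  define F where "F = {face x | x. x < nd M \<and> face x \<inter> V0 = {}}"
  have F_iff: "c \<in> F \<longleftrightarrow> (\<exists>x<nd M. c = face x \<and> face x \<inter> V0 = {})" for c by (auto simp: F_def)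
  define par where "par c = (SOME y. y \<in> arcs M \<and> y \<notin> S \<and> s y \<in> c \<and> d y < d (s y))" for c
  have par: "par c \<in> arcs M \<and> par c \<notin> S \<and> s (par c) \<in> c \<and> d (par c) < d (s (par c))" if "c \<in> F" for c
  proof -
    obtain x where x: "x < nd M" "c = face x" "face x \<inter> V0 = {}" using \<open>c \<in> F\<close> unfolding F_iff by blast
    have "\<not> (\<exists>v\<in>V0. x \<in> face v)"
    proof
      assume "\<exists>v\<in>V0. x \<in> face v"
      then obtain v where "v \<in> V0" "x \<in> face v" by blast
      then have "v \<in> face x" using face_sym[of v x] by simp
      then show False using x \<open>v \<in> V0\<close> by blast
    qed
    then obtain m y where y: "d x = Suc m" "reach_in M S m y" "y \<in> arcs M" "y \<notin> S" "x \<in> face (s y)"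
      using struct[OF d_reach[OF x(1)]] by blast
    have yD: "y < nd M" using y arcs_black by simp
    have sy: "s y \<in> face x" using face_sym[of "s y" x] y yD by simp
    have "d (s y) = d x" by (rule d_face[OF x(1) sy])
    then have "d y < d (s y)" using d_le[OF y(2)] y(1) by simp
    then show ?thesis unfolding par_def
      using someI[of "\<lambda>y. y \<in> arcs M \<and> y \<notin> S \<and> s y \<in> c \<and> d y < d (s y)" y] y sy x by blast
  qed
  define C where "C = par ` F \<union> a ` par ` F"
  have parD: "par c < nd M" "black (par c)" "par c \<notin> V0" if "c \<in> F" for c
    using par[OF that] arcs_black by auto
  have CB: "\<exists>c\<in>F. x = par c" if x: "x \<in> C" "black x" for x
  proof -
    have "x \<notin> a ` par ` F"
    proof
      assume "x \<in> a ` par ` F"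
      then obtain c where "c \<in> F" "x = a (par c)" by blast
      then show False using x parD[of c] by simp
    qed
    then show ?thesis using x unfolding C_def by blast
  qed
  have face_par: "face (s (par c)) = c" if c: "c \<in> F" for c
  proof -
    obtain x where x: "x < nd M" "c = face x" using c unfolding F_iff by blast
    then show ?thesis using face_eq[OF x(1), of "s (par c)"] par[OF c] by blast
  qed
  have "arborescence M C (\<lambda>x. - int (d x))"
    unfolding arborescence_def
  proof (intro conjI allI impI ballI)
    show "cutset M C" unfolding cutset_def
    proof (intro conjI ballI)
      show "C \<subseteq> D" unfolding C_def using parD by auto
      show "a x \<in> C" if "x \<in> C" for x
      proof -
        from that consider c where "c \<in> F" "x = par c" | c where "c \<in> F" "x = a (par c)"
          unfolding C_def by blast
        then show ?thesis using parD unfolding C_def by cases auto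
      qed
      show "C \<inter> V0 = {}"
      proof (rule ccontr)
        assume "C \<inter> V0 \<noteq> {}"
        then obtain x where x: "x \<in> C" "x \<in> V0" by blast
        then obtain c where "c \<in> F" "x = par c" using CB[of x] by auto
        then show False using parD x by auto
      qed
    qed
  next
    fix x assume "x < nd M"
    then show "- int (d (s (a x))) = - int (d x)"
      using d_face[of x "fp x"] orb_step[OF orb_self, of fp x] by simp
  next
    fix x assume x: "x \<in> C" "black x"
    then obtain c where c: "c \<in> F" "x = par c" using CB by blast
    show "- int (d (s x)) < - int (d x)" using par[OF c(1)] c by simp
    show "face (s x) \<inter> V0 = {}" using face_par[OF c(1)] c unfolding F_iff by auto
  next
    fix x y assume xy: "x \<in> C" "y \<in> C" "black x" "black y" "s y \<in> face (s x)"
    then obtain c c' where c: "c \<in> F" "x = par c" "c' \<in> F" "y = par c'" using CB by meson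
    have "face (s y) = face (s x)" using face_eq[of "s x" "s y"] xy parD[OF c(1)] c by simp
    then have "c = c'" using face_par[OF c(1)] face_par[OF c(3)] c by simp
    then show "x = y" using c by simp
  next
    fix x assume x: "x < nd M" "face x \<inter> V0 = {}"
    then have c: "face x \<in> F" unfolding F_iff by blast
    then show "\<exists>y\<in>C. black y \<and> s y \<in> face x"
      using par[OF c] parD[OF c] unfolding C_def by blast
  qed
  moreover have "C \<inter> S = {}"
  proof (rule ccontr)
    assume "C \<inter> S \<noteq> {}"
    then obtain x where x: "x \<in> C" "x \<in> S" by blast
    then obtain c where "c \<in> F" "x = par c" using CB[of x] S arcs_black by blast
    then show False using par x by blast
  qed
  ultimately show ?thesis by blast
qed

text \<open>The new arc takes the place of the only cut arc into the same face. It descends as well,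
  so the old heights still certify an arborescence.\<close>

lemma swap_arc:
  assumes v: "valid_cut M C" and x: "x \<in> arcs M" "x \<notin> C" "face (s x) \<inter> V0 = {}"
    and dec: "height M C (s x) < height M C x"
  obtains x' where "x' \<in> C" "black x'" "s x' \<in> face (s x)"
    "valid_cut M ((C - {x', a x'}) \<union> {x, a x})"
proof -
  interpret V: valid_map M C by unfold_locales (rule v)
  have xD: "x < nd M" "black x" "x \<notin> V0" using x arcs_black by auto
  obtain x' where x': "x' \<in> C" "black x'" "s x' \<in> face (s x)" using V.face_entered[of "s x"] x xD by auto
  have x'D: "x' < nd M" using x' by simp
  have arb: "arborescence M C (height M C)" by (rule V.arborescence_height)
  have uniq: "y = x'" if "y \<in> C" "black y" "s y \<in> face (s x)" for y
  proof -
    have "face (s x') = face (s x)" using face_eq[of "s x" "s x'"] x' xD by simp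
    then have "s y \<in> face (s x')" using that by simp
    then show ?thesis using arb that x' unfolding arborescence_def by metis
  qed
  define C' where "C' = (C - {x', a x'}) \<union> {x, a x}"
  have CB: "y \<in> C' \<and> black y \<longleftrightarrow> (y = x \<or> (y \<in> C \<and> black y \<and> y \<noteq> x'))" for y
    using xD x'D x'(2) by (auto simp: C'_def)
  have "arborescence M C' (height M C)"
    unfolding arborescence_def
  proof (intro conjI allI impI ballI)
    show "cutset M C'" unfolding cutset_def
    proof (intro conjI ballI)
      show "C' \<subseteq> D" unfolding C'_def using xD V.C_in by auto
      have "a x \<notin> V0" using xD V0_black black_a by metis
      then show "C' \<inter> V0 = {}" unfolding C'_def using xD V.C_V0 by auto
      show "a y \<in> C'" if "y \<in> C'" for y
      proof -
        from that consider "y = x" | "y = a x" | "y \<in> C" "y \<noteq> x'" "y \<noteq> a x'" unfolding C'_def by blast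
        then show ?thesis
        proof cases
          case 3
          then have "a y \<noteq> x'" "a y \<noteq> a x'" using x'D V.C_in[of y] a_inj[of y x'] by auto
          then show ?thesis using 3 V.C_a by (simp add: C'_def)
        qed (use xD in \<open>auto simp: C'_def\<close>)
      qed
    qed
  next
    fix y assume "y \<in> C'" "black y"
    then have "y = x \<or> (y \<in> C \<and> black y)" using CB by blast
    then show "height M C (s y) < height M C y" "face (s y) \<inter> V0 = {}"
      using dec x V.pair_level[of y] V.pocket_V0[of y] by auto
  next
    fix y z assume yz: "y \<in> C'" "z \<in> C'" "black y" "black z" "s z \<in> face (s y)"
    have yD: "y < nd M" using yz CB[of y] xD by auto
    have "y = x \<or> (y \<in> C \<and> y \<noteq> x')" "z = x \<or> (z \<in> C \<and> z \<noteq> x')" using CB yz by blast+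
    then consider "y = x" "z = x" | "y = x" "z \<in> C" "z \<noteq> x'" | "z = x" "y \<in> C" "y \<noteq> x'" | "y \<in> C" "z \<in> C" by blast
    then show "y = z"
    proof cases
      case 2
      then show ?thesis using uniq yz by blast
    next
      case 3
      then have "s y \<in> face (s x)" using face_sym[of "s y" "s z"] yz yD by simp
      then show ?thesis using uniq yz 3 by blast
    next
      case 4
      then show ?thesis using arb yz unfolding arborescence_def by metis
    qed simp
  next
    fix z assume z: "z < nd M" "face z \<inter> V0 = {}"
    then obtain y where y: "y \<in> C" "black y" "s y \<in> face z" using V.face_entered by blast
    show "\<exists>y\<in>C'. black y \<and> s y \<in> face z"
    proof (cases "y = x'")
      case True
      then have "face (s x) = face z" using face_disjoint_or_eq[of "s x" z "s x'"] x' y xD z by simp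
      then have "s x \<in> face z" using orb_self by metis
      then show ?thesis using CB[of x] xD by blast
    next
      case False
      then show ?thesis using CB[of y] y by blast
    qed
  qed (use V.h_face in auto)
  then have "valid_cut M C'" by (rule arborescence_valid)
  then show thesis using that x' unfolding C'_def by blast
qed

text \<open>An extremal choice: among the valid cut sets avoiding \<open>S\<close> the total height
  is maximised first, which makes the arborescence geodesic, and then the word of cuts along the
  contour, which makes it leftmost. Swapping in an irregular arc would improve one of the two. The
  residue hypothesis stems from charges of opened trees and is established in
  \<open>counting.mod3\<close>.\<close>

lemma fits_exists:
  assumes mod3: "\<And>C x. valid_cut M C \<Longrightarrow> x \<in> arcs M \<Longrightarrow> 3 dvd height M C (s x) - height M C x + 1"
    and reach: "\<And>x. x < nd M \<Longrightarrow> x \<in> reach M S" and S: "S \<subseteq> arcs M"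
  shows "\<exists>C. fits M S C"
proof -
  let ?A = "{C. valid_cut M C \<and> C \<inter> S = {}}"
  let ?total = "\<lambda>C. \<Sum>x<nd M. height M C x"
  \<comment> \<open>The digit at \<open>k\<close> tells whether the dart at position
    \<open>k\<close> of the contour is cut; with these weights the numerical order is
    lexicographic.\<close>
  let ?word = "\<lambda>C. \<Sum>k<nd M. if (contour M C ^^ k) r \<in> C then 2 ^ (nd M - k) else (0::nat)"
  have "?A \<subseteq> Pow D" by (auto simp: valid_cut_def cutset_def)
  then have finA: "finite ?A" using finite_subset by blast
  have "?A \<noteq> {}" using reach_arborescence[OF reach S] arborescence_valid by blast
  then obtain C0 where C0: "C0 \<in> ?A" "\<And>C. C \<in> ?A \<Longrightarrow> ?total C \<le> ?total C0"
    by (rule finite_maximum[OF finA, of ?total]) blast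
  let ?B = "{C \<in> ?A. ?total C0 \<le> ?total C}"
  have "finite ?B" using finA by (rule rev_finite_subset) blast
  moreover have "?B \<noteq> {}" using C0(1) by blast
  ultimately obtain C where C: "C \<in> ?B" "\<And>C'. C' \<in> ?B \<Longrightarrow> ?word C' \<le> ?word C"
    by (rule finite_maximum[of ?B ?word]) blast
  have v: "valid_cut M C" and CS: "C \<inter> S = {}" using C by auto
  have maxtotal: "?total C' \<le> ?total C" if "C' \<in> ?A" for C' using that C0(2)[of C'] C by auto
  interpret V: valid_map M C by unfold_locales (rule v)
  have "regular_arc M C x" if x: "x \<in> arcs M - C - S" for x
  proof (rule ccontr)
    assume nreg: "\<not> regular_arc M C x"
    have xD: "x < nd M" "black x" "x \<notin> V0" and xarc: "x \<in> arcs M" using x arcs_black by auto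
    have m3: "3 dvd V.h (s x) - V.h x + 1" using mod3[OF v xarc] .
    have dec: "V.h (s x) \<le> V.h x - 1"
    proof (cases "V.p x < V.p (a x)")
      case True
      then have "V.h (s x) - V.h x + 1 < 3" using nreg by (simp add: regular_arc_def)
      then have "V.h (s x) - V.h x + 1 \<le> 0" using m3 by (auto dest: zdvd_imp_le)
      then show ?thesis by simp
    next
      case False
      then show ?thesis using nreg by (simp add: regular_arc_def)
    qed
    \<comment> \<open>On a root face \<open>h\<close> equals \<open>sec\<close>. If the black end
      comes first, a descent contradicts the monotonicity of \<open>sec\<close> together with
      \<open>h <= sec\<close>; otherwise the descent is at least 4, more than the range from 0 to 2
      allows.\<close>
    have free: "face (s x) \<inter> V0 = {}"
    proof (rule ccontr)
      assume "face (s x) \<inter> V0 \<noteq> {}"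
      then obtain w where w: "w \<in> face (s x)" "w \<in> V0" by blast
      then have hw: "V.h (s x) = V.sec (s x)" using V.h_orb[of "s x" w] V.h_V0[of w] xD by auto
      show False
      proof (cases "V.p x < V.p (a x)")
        case True
        then have "V.sec x \<le> V.sec (s x)" using V.sec_mono[of x "a x"] V.sec_a xD by simp
        then show False using V.h_le_sec[OF xD(1)] hw dec by simp
      next
        case False
        then have "V.h (s x) - V.h x + 1 < 0" using nreg by (simp add: regular_arc_def)
        then have "3 \<le> - (V.h (s x) - V.h x + 1)"
          using m3 zdvd_imp_le[of 3 "- (V.h (s x) - V.h x + 1)"] dvd_minus_iff[of 3 "V.h (s x) - V.h x + 1"] by linarith
        moreover have "0 \<le> V.sec (s x)" using V.sec_mono[of r "s x"] by simp
        ultimately show False using V.h_le_sec[OF xD(1)] V.sec_le_2[OF xD(1)] hw by simp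
      qed
    qed
    obtain x' where x': "x' \<in> C" "black x'" "s x' \<in> face (s x)"
      "valid_cut M ((C - {x', a x'}) \<union> {x, a x})"
      using swap_arc[OF v xarc _ free] x dec by auto
    define C' where "C' = (C - {x', a x'}) \<union> {x, a x}"
    have v': "valid_cut M C'" using x' by (simp add: C'_def)
    interpret V': valid_map M C' by unfold_locales (rule v')
    have "a x \<notin> S" using S arcs_black[of "a x"] xD by auto
    then have C'A: "C' \<in> ?A" using v' CS x by (auto simp: C'_def)
    have x'D: "x' < nd M" using x' by simp
    have cutdec: "V.h (s y) \<le> V.h y - 1" if "y \<in> C'" "black y" for y
    proof -
      have "y = x \<or> y \<in> C" using that xD by (auto simp: C'_def)
      then show ?thesis using dec V.pair_level[of y] that by auto
    qed
    have le: "V.h z \<le> V'.h z" if "z < nd M" for z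
    proof -
      have "0 \<le> - 1 * (V.h z - V'.h z)"
      proof (rule V'.compare_height)
        show "0 \<le> - 1 * (V.h (s y) - V.h y + 1)" if "y \<in> C'" "black y" for y
          using cutdec[OF that] by simp
      qed (use that in auto)
      then show ?thesis by simp
    qed
    have xC': "x \<in> C'" by (simp add: C'_def)
    \<comment> \<open>A descent of more than 1 would be repaired by the swap and raise the total
      height.\<close>
    have eq: "V.h (s x) = V.h x - 1"
    proof (rule ccontr)
      assume "V.h (s x) \<noteq> V.h x - 1"
      then have "V.h (s x) < V'.h (s x)"
        using dec le[OF xD(1)] V'.pair_level[OF xC' xD(2)] by simp
      then have "?total C < ?total C'"
        using le xD by (intro sum_strict_mono_ex1) (auto intro!: bexI[of _ "s x"])
      then show False using maxtotal[OF C'A] by simp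
    qed
    have heq: "V.h z = V'.h z" if "z < nd M" for z
    proof (rule V'.height_eq)
      show "V.h (s y) = V.h y - 1" if "y \<in> C'" "black y" for y
      proof -
        have "y = x \<or> y \<in> C" using that xD by (auto simp: C'_def)
        then show ?thesis using eq V.pair_level[of y] that by auto
      qed
    qed (use that in auto)
    have "?total C' = ?total C" by (rule sum.cong) (use heq in auto)
    then have C'B: "C' \<in> ?B" using C'A C by auto
    have first: "V.p x < V.p (a x)" using nreg eq by (auto simp: regular_arc_def split: if_splits)
    have faces: "face (s x') = face (s x)" using face_eq[of "s x" "s x'"] x' xD by simp
    have "s x \<in> face (a x)" using orb_step[OF orb_self, of fp "a x"] xD by simp
    then have "a x \<in> face (s x')" using face_sym[of "a x" "s x"] xD faces by simp
    then have ax: "V.p x' < V.p (a x)" "V.p (a x) \<le> V.p (a x')" using V.pocket_orb[OF x'(1,2)] by auto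
    have hx': "V.h (s x') = V.h (s x)" using V.h_orb[of "s x" "s x'"] x' xD by simp
    \<comment> \<open>Otherwise \<open>x\<close> would lie in the pocket of \<open>x'\<close> and
      thus be no higher than the face to which it descends.\<close>
    have later: "V.p x < V.p x'"
    proof (rule ccontr)
      assume "\<not> V.p x < V.p x'"
      then have "V.p x' < V.p x" using V.p_inj[of x x'] x x' xD x'D by (auto simp: not_less le_less)
      then have "V.h x \<le> V.h x' - 1" using V.pocket_level[OF x'(1,2) xD(1)] first ax by simp
      then show False using hx' eq V.pair_level[OF x'(1,2)] by simp
    qed
    \<comment> \<open>The cut sets differ only at the ends of the edges of \<open>x\<close> and
      \<open>x'\<close>, none of which precedes \<open>x\<close> on the contour.\<close>
    have same: "(contour M C' ^^ k) r = (contour M C ^^ k) r" if "k \<le> V.p x" for k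
      using that
    proof (induction k)
      case (Suc k)
      let ?z = "(contour M C ^^ k) r"
      have "V.p x < card D" using V.cyc.pos_less[of x] xD by simp
      then have "V.p ?z = k" using V.cyc.pos_pow[of k] Suc.prems by simp
      then have "?z \<notin> {x, a x, x', a x'}"
        using Suc.prems first later V.pair_less[OF x'(1,2)] by auto
      then have "?z \<in> C' \<longleftrightarrow> ?z \<in> C" by (auto simp: C'_def)
      then have "contour M C' ?z = contour M C ?z" by (simp add: contour_def)
      then show ?case using Suc by simp
    qed simp
    have "?word C < ?word C'"
    proof (rule binary_less[of "V.p x"])
      show "V.p x < nd M" using V.cyc.pos_less[of x] xD by simp
      fix k assume k: "k < V.p x"
      let ?z = "(contour M C ^^ k) r"
      have "V.p x < card D" using V.cyc.pos_less[of x] xD by simp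
      then have "V.p ?z = k" using V.cyc.pos_pow[of k] k by simp
      then have "?z \<notin> {x, a x, x', a x'}"
        using k first later V.pair_less[OF x'(1,2)] by auto
      then have "?z \<in> C' \<longleftrightarrow> ?z \<in> C" by (auto simp: C'_def)
      then show "(if ?z \<in> C then 2 ^ (nd M - k) else (0::nat)) =
          (if (contour M C' ^^ k) r \<in> C' then 2 ^ (nd M - k) else 0)"
        using same[of k] k by simp
    next
      have px: "(contour M C ^^ V.p x) r = x" using V.cyc.pow_pos xD by simp
      show "(if (contour M C ^^ V.p x) r \<in> C then 2 ^ (nd M - V.p x) else (0::nat)) = 0" using px x by simp
      show "(if (contour M C' ^^ V.p x) r \<in> C' then 2 ^ (nd M - V.p x) else (0::nat)) = 2 ^ (nd M - V.p x)"
        using px same[of "V.p x"] xC' by simp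
    qed auto
    then show False using C(2)[OF C'B] by simp
  qed
  then show ?thesis using v CS by (auto simp: fits_def)
qed

text \<open>Follow the boundary of the reachable region. An arc leaving it is a conflict, so its
  black end is occupied, and around that vertex the boundary also enters the region. At the white
  end of the entering edge some other arc leaves the region and is a conflict, so that vertex is
  occupied too. Hence the entering edge is a conflict that points into the region.\<close>

lemma conflict_into_reach:
  assumes "conflicts M \<noteq> {} \<or> (\<exists>x<nd M. x \<notin> reach M (conflicts M))"
  shows "\<exists>x\<in>conflicts M. s x \<in> reach M (conflicts M)"
proof (cases "\<exists>x<nd M. x \<notin> reach M (conflicts M)")
  case False
  then show ?thesis using assms arcs_black by (fastforce simp: conflicts_def)
next
  case True
  let ?N = "conflicts M"
  let ?X = "reach M ?N"
  have faceX: "s (a x) \<in> ?X \<longleftrightarrow> x \<in> ?X" if x: "x < nd M" for x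
  proof
    assume X: "s (a x) \<in> ?X"
    have "x \<in> face (fp x)" using face_sym[OF x orb_step[OF orb_self]] .
    moreover have "face (fp x) \<subseteq> ?X" by (rule orb_subset) (use X reach_face in auto)
    ultimately show "x \<in> ?X" by blast
  qed (rule reach_face)
  have arcN: "x \<in> ?N" if x: "x < nd M" "black x" "x \<in> ?X" "s x \<notin> ?X" for x
  proof -
    have "x \<notin> V0" using x reach_root[of "s x" M ?N] by auto
    then show ?thesis using x reach_arc[of x M ?N] by (auto simp: arcs_def)
  qed
  \<comment> \<open>Around a vertex, a passage out of the region is answered by a passage back into
    it, at a dart with the same colour and occupation.\<close>
  have rot: "\<exists>z'. z' < nd M \<and> black z' = black z \<and> occ M z' = occ M z \<and> z' \<notin> ?X \<and> s z' \<in> ?X"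
    if z: "z < nd M" "z \<in> ?X" "s z \<notin> ?X" for z
    using z by (cases "s (s z) \<in> ?X") (auto intro: exI[of _ "s z"] exI[of _ "s (s z)"])
  \<comment> \<open>At a white vertex directions are reversed: a rotation into the region means that
    the black dart of that edge is an arc out of it.\<close>
  have white_out: "a y \<in> ?N \<and> a y \<in> ?X \<and> s (a y) \<notin> ?X"
    if y: "y < nd M" "\<not> black y" "y \<notin> ?X" "s y \<in> ?X" for y
    using y faceX[of "a y"] faceX[of y] arcN[of "a y"] by auto
  have black_case: ?thesis if z: "z < nd M" "black z" "z \<in> ?X" "s z \<notin> ?X" for z
  proof -
    have "occ M z" using arcN[OF z] by (simp add: conflicts_def)
    then obtain z' where z': "z' < nd M" "black z'" "occ M z'" "z' \<notin> ?X" "s z' \<in> ?X"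
      using rot[of z] z by auto
    have "a z' \<in> ?X" "s (a z') \<notin> ?X" using z' faceX[of "a z'"] faceX[of z'] by auto
    then obtain y where y: "y < nd M" "\<not> black y" "occ M y = occ M (a z')" "y \<notin> ?X" "s y \<in> ?X"
      using rot[of "a z'"] z' by auto
    then have "occ M (a z')" using white_out[of y] by (auto simp: conflicts_def)
    moreover have "z' \<notin> V0" using z' reach_root by auto
    ultimately have "z' \<in> ?N" using z' by (auto simp: conflicts_def arcs_def)
    then show ?thesis using z' by blast
  qed
  have "\<exists>z<nd M. z \<in> ?X \<and> s z \<notin> ?X"
  proof (rule ccontr)
    assume n: "\<not> ?thesis"
    have "x \<in> ?X" if "x < nd M" for x
    proof (rule connected_induct[OF _ _ that])
      show "r \<in> ?X" by (rule reach_root) simp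
      fix x assume x: "x < nd M" "x \<in> ?X"
      then have "s (a x) \<in> ?X" by (simp add: reach_face)
      then have "s (s (s (a x))) \<in> ?X" using n x by (metis a_in s_in)
      then show "s x \<in> ?X \<and> a x \<in> ?X" using n x by simp
    qed
    then show False using True by blast
  qed
  then obtain z where z: "z < nd M" "z \<in> ?X" "s z \<notin> ?X" by blast
  show ?thesis
  proof (cases "black z")
    case True
    then show ?thesis using black_case z by blast
  next
    case False
    then obtain y where "y < nd M" "\<not> black y" "y \<notin> ?X" "s y \<in> ?X" using rot[OF z] by auto
    then show ?thesis using white_out[of y] black_case[of "a y"] by simp
  qed
qed

lemma reach_antimono: "S \<subseteq> S' \<Longrightarrow> reach M S' \<subseteq> reach M S"
  by (rule reach_subset) (auto intro: reach_root reach_face reach_arc)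

text \<open>An arc whose head can be reached without it contributes nothing new.\<close>

lemma reach_remove:
  assumes "s x \<in> reach M (insert x S)"
  shows "reach M S = reach M (insert x S)"
proof
  show "reach M S \<subseteq> reach M (insert x S)"
  proof (rule reach_subset)
    fix y assume "y \<in> reach M (insert x S)" "y \<in> arcs M" "y \<notin> S"
    then show "s y \<in> reach M (insert x S)" using assms by (cases "y = x") (auto intro: reach_arc)
  qed (auto intro: reach_root reach_face)
qed (rule reach_antimono, blast)

lemma sum_reachable:
  "(\<Sum>S | S \<subseteq> conflicts M \<and> (\<forall>x<nd M. x \<in> reach M S). (- 1 :: int) ^ card S) =
     (if conflicts M = {} then 1 else 0)"
proof (cases "conflicts M = {}")
  case True
  then have "\<forall>x<nd M. x \<in> reach M {}" using conflict_into_reach by auto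
  then have "{S. S \<subseteq> conflicts M \<and> (\<forall>x<nd M. x \<in> reach M S)} = {{}}" using True by auto
  then show ?thesis using True by simp
next
  case False
  then obtain u where u: "u \<in> conflicts M" "s u \<in> reach M (conflicts M)" using conflict_into_reach by blast
  have fin: "finite (conflicts M)" by (simp add: conflicts_def arcs_def)
  have eq: "reach M (insert u S) = reach M (S - {u})" if "S \<subseteq> conflicts M" for S
  proof -
    have "s u \<in> reach M (insert u (S - {u}))"
      using u reach_antimono[of "insert u (S - {u})" "conflicts M"] that by blast
    then show ?thesis using reach_remove[of u "S - {u}"] by simp
  qed
  have "(\<Sum>S\<in>{S. S \<subseteq> conflicts M \<and> (\<forall>x<nd M. x \<in> reach M S)}. (- 1 :: int) ^ card S) = 0"
  proof (rule sum_toggle_zero[of _ u])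
    fix S assume S: "S \<in> {S. S \<subseteq> conflicts M \<and> (\<forall>x<nd M. x \<in> reach M S)}"
    have "reach M S \<subseteq> reach M (S - {u})" by (rule reach_antimono) blast
    then show "finite S \<and> insert u S \<in> {S. S \<subseteq> conflicts M \<and> (\<forall>x<nd M. x \<in> reach M S)} \<and>
        S - {u} \<in> {S. S \<subseteq> conflicts M \<and> (\<forall>x<nd M. x \<in> reach M S)}"
      using S eq[of S] u fin finite_subset by auto
  qed
  then show ?thesis using False by simp
qed

definition admissible_cut :: "nat set \<Rightarrow> bool" where
  "admissible_cut C \<longleftrightarrow> valid_cut M C \<and> (\<forall>x\<in>arcs M - C. regular_arc M C x \<longleftrightarrow> x \<notin> conflicts M)"

text \<open>Double counting of the pairs \<open>(C, S)\<close> with \<open>fits M S C\<close>: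
  summing over \<open>C\<close> first leaves the sets \<open>S\<close> that keep everything
  reachable, summing over \<open>S\<close> first leaves the admissible cut sets.\<close>

theorem signed_count:
  assumes mod3: "\<And>C x. valid_cut M C \<Longrightarrow> x \<in> arcs M \<Longrightarrow> 3 dvd height M C (s x) - height M C x + 1"
  shows "(\<Sum>C | admissible_cut C. (- 1 :: int) ^ card (conflicts M - C)) = (if conflicts M = {} then 1 else 0)"
proof -
  let ?N = "conflicts M"
  let ?V = "{C. valid_cut M C}"
  have NA: "?N \<subseteq> arcs M" by (auto simp: conflicts_def)
  have fN: "finite ?N" by (simp add: conflicts_def arcs_def)
  have "?V \<subseteq> Pow D" by (auto simp: valid_cut_def cutset_def)
  then have fV: "finite ?V" using finite_subset by blast
  have one: "(\<Sum>C\<in>?V. if fits M S C then (- 1 :: int) ^ card S else 0) =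
      (if \<forall>x<nd M. x \<in> reach M S then (- 1) ^ card S else 0)" if S: "S \<subseteq> ?N" for S
  proof (cases "\<forall>x<nd M. x \<in> reach M S")
    case True
    then obtain C0 where C0: "fits M S C0" using fits_exists[OF mod3, of S] S NA by auto
    have "C = C0" if "fits M S C" for C using fits_unique[OF that C0] .
    then have "{C \<in> ?V. fits M S C} = {C0}" using C0 unfolding fits_def by blast
    then have "(\<Sum>C\<in>{C \<in> ?V. fits M S C}. (- 1 :: int) ^ card S) = (- 1) ^ card S" by simp
    then show ?thesis using True sum.inter_filter[OF fV, of "\<lambda>_. (- 1 :: int) ^ card S" "fits M S"] by simp
  next
    case False
    then have "\<not> fits M S C" for C using valid_reach[of C S] by (auto simp: fits_def)
    then show ?thesis using False by auto
  qed
  have two: "(\<Sum>S\<in>Pow ?N. if fits M S C then (- 1 :: int) ^ card S else 0) =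
      (if admissible_cut C then (- 1) ^ card (?N - C) else 0)" if C: "C \<in> ?V" for C
  proof -
    let ?L = "{x \<in> arcs M - C. \<not> regular_arc M C x}"
    have "(\<Sum>S\<in>Pow ?N. if fits M S C then (- 1 :: int) ^ card S else 0) =
        (\<Sum>S\<in>{S \<in> Pow ?N. fits M S C}. (- 1) ^ card S)"
      using fN by (intro sum.inter_filter[symmetric]) simp
    also have "{S \<in> Pow ?N. fits M S C} = {S. ?L \<subseteq> S \<and> S \<subseteq> ?N - C}"
      using C by (auto simp: fits_def)
    also have "(\<Sum>S | ?L \<subseteq> S \<and> S \<subseteq> ?N - C. (- 1 :: int) ^ card S) =
        (if ?L = ?N - C then (- 1) ^ card (?N - C) else 0)"
      by (rule sum_boolean_interval) (use fN in simp)
    also have "?L = ?N - C \<longleftrightarrow> admissible_cut C"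
      using NA C by (auto simp: admissible_cut_def)
    finally show ?thesis .
  qed
  have "(\<Sum>C | admissible_cut C. (- 1 :: int) ^ card (?N - C)) =
      (\<Sum>C\<in>{C \<in> ?V. admissible_cut C}. (- 1) ^ card (?N - C))"
    by (rule sum.cong) (auto simp: admissible_cut_def)
  also have "\<dots> = (\<Sum>C\<in>?V. if admissible_cut C then (- 1) ^ card (?N - C) else 0)"
    using fV by (intro sum.inter_filter)
  also have "\<dots> = (\<Sum>C\<in>?V. \<Sum>S\<in>Pow ?N. if fits M S C then (- 1 :: int) ^ card S else 0)"
    by (rule sum.cong) (use two in auto)
  also have "\<dots> = (\<Sum>S\<in>Pow ?N. \<Sum>C\<in>?V. if fits M S C then (- 1 :: int) ^ card S else 0)"
    by (rule sum.swap)
  also have "\<dots> = (\<Sum>S\<in>Pow ?N. if \<forall>x<nd M. x \<in> reach M S then (- 1) ^ card S else 0)"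
    by (rule sum.cong) (use one in auto)
  also have "\<dots> = (\<Sum>S\<in>{S \<in> Pow ?N. \<forall>x<nd M. x \<in> reach M S}. (- 1) ^ card S)"
    using fN by (intro sum.inter_filter[symmetric]) simp
  also have "{S \<in> Pow ?N. \<forall>x<nd M. x \<in> reach M S} = {S. S \<subseteq> ?N \<and> (\<forall>x<nd M. x \<in> reach M S)}" by auto
  finally show ?thesis using sum_reachable by simp
qed

lemma unique_regular_cut:
  assumes mod3: "\<And>C x. valid_cut M C \<Longrightarrow> x \<in> arcs M \<Longrightarrow> 3 dvd height M C (s x) - height M C x + 1"
    and "conflicts M = {}"
  shows "\<exists>!C. valid_cut M C \<and> (\<forall>x\<in>arcs M - C. regular_arc M C x)"
proof -
  have "\<forall>x<nd M. x \<in> reach M {}" using conflict_into_reach assms(2) by auto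
  then obtain C where "fits M {} C" using fits_exists[OF mod3, of "{}"] by auto
  then show ?thesis using fits_unique[of "{}"] by (auto simp: fits_def)
qed

end

section \<open>Blossom trees and their closing\<close>

definition end_weight :: "btree \<Rightarrow> nat \<Rightarrow> int" where
  "end_weight T x = (case kind T x of Inner \<Rightarrow> 0 | Bud \<Rightarrow> - 1 | Leaf \<Rightarrow> 1)"

lemma charge_eq_sum: "finite A \<Longrightarrow> charge T A = (\<Sum>x\<in>A. end_weight T x)"
proof -
  assume fin: "finite A"
  have "(\<Sum>x\<in>A. end_weight T x) =
      (\<Sum>x\<in>A. (if kind T x = Leaf then 1 else 0) - (if kind T x = Bud then 1 else 0))"
    by (rule sum.cong) (auto simp: end_weight_def split: vkind.split)
  also have "\<dots> = charge T A"
    using fin by (simp add: sum_subtractf charge_def flip: sum.inter_filter)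
  finally show ?thesis by simp
qed

section \<open>Contour, sides and charges of a blossom tree\<close>

locale rooted_tree =
  fixes T :: btree
  assumes blossom: "blossom_tree T" and rtl_lt: "rtl T < nd T" and rtl_Leaf: "kind T (rtl T) = Leaf"
begin

abbreviation "D \<equiv> {..<nd T}"
abbreviation "s \<equiv> sg T"
abbreviation "a \<equiv> al T"

lemma wf: "wf_cmap T" and con: "connected_cmap T"
  using blossom by (auto simp: blossom_tree_def planar_cmap_def)

lemma s_in [simp]: "x < nd T \<Longrightarrow> s x < nd T"
  and a_in [simp]: "x < nd T \<Longrightarrow> a x < nd T"
  and aa [simp]: "x < nd T \<Longrightarrow> a (a x) = x"
  and a_neq [simp]: "x < nd T \<Longrightarrow> a x \<noteq> x"
  and bij_s: "bij_betw s D D" and bij_a: "bij_betw a D D"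
  and bij_phi: "bij_betw (phi T) D D"
  using wf_cmapD[OF wf] unfolding phi_def by auto

lemma phi_apply: "phi T x = s (a x)" by (simp add: phi_def)

lemma kind_s [simp]: "x < nd T \<Longrightarrow> kind T (s x) = kind T x"
  and tblk_s [simp]: "x < nd T \<Longrightarrow> tblk T (s x) = tblk T x"
  and tocc_s [simp]: "x < nd T \<Longrightarrow> tocc T (s x) = tocc T x"
  using blossom by (auto simp: blossom_tree_def)

lemma kind_cases: "kind T x = Inner \<or> kind T x = Bud \<or> kind T x = Leaf"
  by (cases "kind T x") auto

lemma inner_iff: "inner T x \<longleftrightarrow> kind T x = Inner" by (simp add: inner_def)

lemma Bud_a: "x < nd T \<Longrightarrow> kind T x = Bud \<Longrightarrow> kind T (a x) = Inner \<and> tblk T (a x)"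
  and Leaf_a: "x < nd T \<Longrightarrow> kind T x = Leaf \<Longrightarrow> kind T (a x) = Inner \<and> \<not> tblk T (a x)"
  and inner_a: "x < nd T \<Longrightarrow> kind T x = Inner \<Longrightarrow> kind T (a x) = Inner \<Longrightarrow> tblk T (a x) \<longleftrightarrow> \<not> tblk T x"
  using blossom unfolding blossom_tree_def inner_edge_dart_def inner_iff by blast+

lemma card_VE: "2 * card (verts T) = nd T + 2"
proof -
  have "int (card (verts T)) = int (card (edges T)) + 1" using blossom by (simp add: blossom_tree_def)
  then show ?thesis using card_edges[OF wf] by linarith
qed

lemma one_face: "card (orb (phi T) ` D) = 1"
proof -
  have "int (card (verts T)) - int (card (edges T)) + int (card (faces T)) = 2"
    "int (card (verts T)) = int (card (edges T)) + 1"
    using blossom by (auto simp: blossom_tree_def planar_cmap_def)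
  then have "card (faces T) = 1" by linarith
  then show ?thesis by (simp add: faces_eq phi_def)
qed

lemma phi_transitive: "x < nd T \<Longrightarrow> y < nd T \<Longrightarrow> x \<in> orb (phi T) y"
proof -
  assume x: "x < nd T" and y: "y < nd T"
  obtain c where c: "orb (phi T) ` D = {c}" using one_face card_1_singletonE by blast
  have "orb (phi T) x \<in> orb (phi T) ` D" "orb (phi T) y \<in> orb (phi T) ` D" using x y by auto
  then have "orb (phi T) x = orb (phi T) y" unfolding c by simp
  then show ?thesis using orb_self by metis
qed

sublocale cyc: cyclic D "phi T" "rtl T"
  using bij_phi rtl_lt phi_transitive by unfold_locales auto

abbreviation "p \<equiv> pos_of (phi T) (rtl T)"

text \<open>By the genus inequality, removing an edge of a tree leaves two components, and these are
  the two cycles into which the contour splits.\<close>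
lemma side_interval:
  assumes x: "x < nd T" and lt: "p (a x) < p x"
  shows "side T x = {z. z < nd T \<and> p (a x) < p z \<and> p z \<le> p x}"
    and "side T (a x) = D - side T x"
proof -
  define y where "y = a x"
  have y: "y < nd T" "a y = x" "x \<noteq> y" using x a_neq[OF x] by (simp_all add: y_def del: a_neq)
  define b where "b = a(x := x, y := y)"
  have nxy: "z \<noteq> x \<Longrightarrow> z \<noteq> y \<Longrightarrow> z < nd T \<Longrightarrow> a z \<noteq> x \<and> a z \<noteq> y" for z
    using y x aa by (metis y_def)
  have b: "b z \<in> D \<and> b (b z) = z" if "z \<in> D" for z
    using that x y nxy[of z] by (auto simp: b_def)
  define f where "f = s \<circ> b"
  have fx: "f x = phi T y" "f y = phi T x" and fz: "\<And>z. z \<noteq> x \<Longrightarrow> z \<noteq> y \<Longrightarrow> f z = phi T z"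
    using y by (auto simp: f_def b_def phi_apply y_def)
  have bij_f: "bij_betw f D D" unfolding f_def
    using bij_betw_trans[OF bij_betw_involution[OF b] bij_s] by simp
  let ?S = "graph_on D s" and ?R = "graph_on D s \<union> graph_on D b"
  have f_R: "v \<in> linked ?R u" if "(u, v) \<in> graph_on D f" for u v
  proof -
    have u: "u \<in> D" "v = s (b u)" using that by (auto simp: f_def)
    then have "b u \<in> linked ?R u" "v \<in> linked ?R (b u)" using b by (auto intro: linked_pair)
    then show ?thesis by (rule linked_trans)
  qed
  have "{z \<in> D. b z \<noteq> z} = D - {x, y}" using a_neq by (auto simp: b_def)
  then have cd: "card {z \<in> D. b z \<noteq> z} = nd T - 2"
    using x y by (simp add: card_Diff_subset)
  have "2 * (ncomp D ?S + ncomp D (graph_on D f)) \<le> 4 * ncomp D ?R + card {z \<in> D. b z \<noteq> z}"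
    unfolding f_def by (rule genus_inequality) (use b bij_s in auto)
  then have g1: "ncomp D (graph_on D f) + 2 \<le> 2 * ncomp D ?R"
    unfolding cd ncomp_graph_on[OF finite_lessThan bij_s] verts_eq[symmetric]
    using card_VE x y by simp
  have g2: "ncomp D (graph_on D f) \<le> 2"
  proof -
    have "ncomp D (graph_on D f) \<le> Suc (ncomp D (graph_on D (phi T)))"
      by (rule ncomp_graph_swap_le[of D x y]) (use x y fx fz in auto)
    then show ?thesis using one_face by (simp add: ncomp_graph_on[OF finite_lessThan bij_phi])
  qed
  \<comment> \<open>Writing F for the number of cycles of \<open>f\<close> and c for the number of
    components, the bounds are F + 2 <= 2c, F <= 2 and c <= F; they leave only F = c = 2.\<close>
  have "ncomp D ?R \<le> ncomp D (graph_on D f)" by (rule ncomp_mono) (use f_R in auto)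
  then have eq: "ncomp D (graph_on D f) = ncomp D ?R" using g1 g2 by simp
  have R_in: "linked ?R z \<subseteq> D" if "z < nd T" for z
  proof (rule linked_closed)
    fix u v assume "(u, v) \<in> ?R"
    then show "u \<in> D \<longleftrightarrow> v \<in> D" using b by auto
  qed (use that in simp)
  have orb_linked: "orb f z = linked ?R z" if "z < nd T" for z
    using linked_eq_of_ncomp_eq[OF finite_lessThan f_R eq _ R_in] that
      linked_graph_on[OF finite_lessThan bij_f] by simp
  have side: "side T z = linked ?R z" if z: "z = x \<or> z = y" for z
  proof
    let ?Q = "{(u, s u) | u. u < nd T} \<union> {(u, a u) | u. u < nd T \<and> u \<noteq> z \<and> u \<noteq> a z}"
    have zz: "z < nd T" "{z, a z} = {x, y}" using z x y by (auto simp: y_def)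
    show "side T z \<subseteq> linked ?R z"
    proof
      fix v assume "v \<in> side T z"
      then have "(z, v) \<in> ?Q\<^sup>*" by (simp add: side_def)
      then show "v \<in> linked ?R z"
      proof (induction rule: rtrancl_induct)
        case (step u v)
        have "v \<in> linked ?R u"
        proof (cases "v = s u \<and> u < nd T")
          case True
          then show ?thesis by (auto intro: linked_pair)
        next
          case False
          then have "v = a u" "u < nd T" "u \<noteq> z" "u \<noteq> a z" using step.hyps by auto
          then have "v = b u" using zz(2) by (auto simp: b_def)
          then show ?thesis using \<open>u < nd T\<close> by (auto intro: linked_pair)
        qed
        then show ?case using step.IH linked_trans by metis
      qed simp
    qed
    have "orb f z \<subseteq> side T z"
    proof (rule orb_subset)
      show "z \<in> side T z" using zz by (simp add: side_def)
      fix u assume u: "u \<in> side T z"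
      then have uD: "u < nd T" and zu: "(z, u) \<in> ?Q\<^sup>*" by (auto simp: side_def)
      have "(u, b u) \<in> ?Q\<^sup>*"
      proof (cases "u = x \<or> u = y")
        case True
        then show ?thesis by (auto simp: b_def)
      next
        case False
        then have "u \<noteq> z" "u \<noteq> a z" "b u = a u" using zz(2) by (auto simp: b_def)
        then show ?thesis using uD by (intro r_into_rtrancl) auto
      qed
      moreover have "(b u, s (b u)) \<in> ?Q\<^sup>*" using b[of u] uD by (intro r_into_rtrancl) auto
      ultimately have "(z, f u) \<in> ?Q\<^sup>*" using zu unfolding f_def by (auto intro: rtrancl_trans)
      then show "f u \<in> side T z" using bij_f uD by (auto simp: side_def dest: bij_betwE)
    qed
    then show "linked ?R z \<subseteq> side T z" using orb_linked zz by simp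
  qed
  let ?I = "{z. z < nd T \<and> p y < p z \<and> p z \<le> p x}"
  have lt': "p y < p x" using lt by (simp add: y_def)
  have pstep: "p (phi T z) = Suc (p z)" if "z < nd T" "p z < p x" for z
    using cyc.pos_step[of z] that cyc.pos_less[of x] x by auto
  have "orb f x = ?I"
  proof
    show "orb f x \<subseteq> ?I"
    proof (rule orb_subset)
      fix z assume z: "z \<in> ?I"
      show "f z \<in> ?I"
      proof (cases "z = x")
        case True
        then show ?thesis using fx pstep[of y] y lt' cyc.f_in[of y] by simp
      next
        case False
        then have "p z < p x" using z cyc.pos_inj[of z x] x by (auto simp: le_less)
        moreover have "z \<noteq> y" using z by auto
        ultimately show ?thesis using fz[of z] False pstep[of z] z cyc.f_in[of z] by simp
      qed
    qed (use x lt' in simp)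
    have "z \<in> ?I \<longrightarrow> z \<in> orb f x" if "z \<in> D" for z
      using that
    proof (induction rule: cyc.pos_induct)
      case (step u)
      show ?case
      proof
        assume I: "phi T u \<in> ?I"
        have u: "u < nd T" "p (phi T u) = Suc (p u)" using step cyc.pos_step[of u] by auto
        show "phi T u \<in> orb f x"
        proof (cases "u = y")
          case True
          then show ?thesis using fx orb_step[OF orb_self, of f x] by simp
        next
          case False
          then have "p u \<noteq> p y" using cyc.pos_inj[of u y] u y by auto
          then have "u \<in> ?I" "u \<noteq> x" using I u by auto
          then have "u \<in> orb f x" using step.IH[of u] u by simp
          then show ?thesis using orb_step fz[of u] False \<open>u \<noteq> x\<close> by metis
        qed
      qed
    qed simp
    then show "?I \<subseteq> orb f x" by auto
  qed
  then show first: "side T x = {z. z < nd T \<and> p (a x) < p z \<and> p z \<le> p x}"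
    using side[of x] orb_linked[OF x] by (simp add: y_def)
  have sx: "side T x = linked ?R x" and sy: "side T y = linked ?R y" using side by auto
  have "y \<notin> linked ?R x" using first sx by (auto simp: y_def)
  then have disj: "linked ?R x \<inter> linked ?R y = {}" using linked_eq linked_sym by fast
  have "z \<in> linked ?R x \<union> linked ?R y" if z: "z < nd T" for z
  proof -
    have "(x, z) \<in> (map_steps T)\<^sup>*" using con x z by (simp add: connected_cmap_def)
    then show ?thesis
    proof (induction rule: rtrancl_induct)
      case (step u v)
      then consider "u < nd T" "v = s u" | "u < nd T" "v = a u" by (auto simp: map_steps_def)
      then show ?case
      proof cases
        case 1
        then have "v \<in> linked ?R u" by (auto intro: linked_pair)
        then show ?thesis using step.IH linked_trans[of u ?R x v] linked_trans[of u ?R y v] by auto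
      next
        case 2
        show ?thesis
        proof (cases "u = x \<or> u = y")
          case True
          then show ?thesis using 2 y by (auto simp: y_def)
        next
          case False
          then have "v \<in> linked ?R u" using 2 by (auto intro: linked_pair simp: b_def)
          then show ?thesis using step.IH linked_trans[of u ?R x v] linked_trans[of u ?R y v] by auto
        qed
      qed
    qed simp
  qed
  then show "side T (a x) = D - side T x"
    using disj sx sy R_in[OF y(1)] unfolding y_def by fast
qed

lemma side_in: "side T x \<subseteq> D" by (auto simp: side_def)

lemma side_s: "z \<in> side T x \<Longrightarrow> s z \<in> side T x"
proof -
  assume z: "z \<in> side T x"
  let ?Q = "{(u, s u) | u. u < nd T} \<union> {(u, a u) | u. u < nd T \<and> u \<noteq> x \<and> u \<noteq> a x}"
  have "z < nd T" "(x, z) \<in> ?Q\<^sup>*" using z by (auto simp: side_def)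
  moreover have "(z, s z) \<in> ?Q" using z by (auto simp: side_def)
  ultimately have "(x, s z) \<in> ?Q\<^sup>*" by (meson rtrancl.rtrancl_into_rtrancl)
  then show ?thesis using z by (simp add: side_def)
qed

lemma side_a: "z \<in> side T x \<Longrightarrow> z \<noteq> x \<Longrightarrow> z \<noteq> a x \<Longrightarrow> a z \<in> side T x"
proof -
  assume z: "z \<in> side T x" "z \<noteq> x" "z \<noteq> a x"
  let ?Q = "{(u, s u) | u. u < nd T} \<union> {(u, a u) | u. u < nd T \<and> u \<noteq> x \<and> u \<noteq> a x}"
  have "z < nd T" "(x, z) \<in> ?Q\<^sup>*" using z by (auto simp: side_def)
  moreover have "(z, a z) \<in> ?Q" using z by (auto simp: side_def)
  ultimately have "(x, a z) \<in> ?Q\<^sup>*" by (meson rtrancl.rtrancl_into_rtrancl)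
  then show ?thesis using z by (simp add: side_def)
qed

lemma side_self: "x < nd T \<Longrightarrow> x \<in> side T x" by (simp add: side_def)

lemma side_compl: "x < nd T \<Longrightarrow> side T (a x) = D - side T x"
proof -
  assume x: "x < nd T"
  consider "p (a x) < p x" | "p x < p (a x)" using cyc.pos_inj[of x "a x"] x a_neq[OF x] by fastforce
  then show ?thesis
  proof cases
    case 2
    then have "side T x = D - side T (a x)" using side_interval(2)[of "a x"] x by simp
    then show ?thesis using side_in[of "a x"] by auto
  qed (use side_interval x in simp)
qed

lemma total_charge: "charge T D = 3"
proof -
  have "{y \<in> D. kind T y = k} = {x. x < nd T \<and> kind T x = k}" for k by auto
  then show ?thesis using blossom by (simp add: charge_def blossom_tree_def)
qed

lemma charge_compl: "x < nd T \<Longrightarrow> charge T (side T (a x)) = 3 - charge T (side T x)"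
proof -
  assume x: "x < nd T"
  have "charge T D = charge T (side T x) + charge T (D - side T x)"
    using side_in[of x] finite_subset[OF side_in[of x]] sum.subset_diff[of "side T x" D "end_weight T"]
    by (simp add: charge_eq_sum)
  then show ?thesis using side_compl[OF x] total_charge by simp
qed

text \<open>Darts of inner vertices come in threes. On the white side, the white darts other than
  \<open>w\<close> correspond to inner edges and leaves, the black darts to inner edges and buds.
  Subtracting the two counts removes the inner edges and leaves 1 plus the charge.\<close>

lemma charge_mod3:
  assumes w: "white_inner_dart T w"
  shows "3 dvd charge T (side T w) + 1"
proof -
  let ?A = "side T w"
  have wD: "w < nd T" "kind T w = Inner" "\<not> tblk T w" "kind T (a w) = Inner"
    using w by (auto simp: white_inner_dart_def inner_edge_dart_def inner_iff)
  have aw: "a w \<notin> ?A" using side_compl[OF wD(1)] side_self[of "a w"] wD by auto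
  have A: "z < nd T" if "z \<in> ?A" for z using that side_in by auto
  have A_a: "a z \<in> ?A" if "z \<in> ?A" "z \<noteq> w" for z using side_a[OF that] that aw by auto
  have fin: "finite ?A" using side_in finite_subset by blast
  define wh where "wh = {z \<in> ?A. kind T z = Inner \<and> \<not> tblk T z}"
  define bl where "bl = {z \<in> ?A. kind T z = Inner \<and> tblk T z}"
  define lf where "lf = {z \<in> ?A. kind T z = Leaf}"
  define bd where "bd = {z \<in> ?A. kind T z = Bud}"
  define e where "e = {z \<in> bl. kind T (a z) = Inner}"
  have [simp]: "finite wh" "finite bl" "finite lf" "finite bd" "finite e"
    unfolding wh_def bl_def lf_def bd_def e_def by (rule rev_finite_subset[OF fin], blast)+
  have orb3: "card (orb s z) = 3" if "z < nd T" "kind T z = Inner" for z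
    using blossom that by (simp add: blossom_tree_def inner_iff deg_def)
  have "card wh = 3 * card (orb s ` wh)"
    by (rule card_eq_mult_orbits[OF finite_lessThan bij_s]) (use A side_s orb3 in \<open>auto simp: wh_def\<close>)
  moreover have "card bl = 3 * card (orb s ` bl)"
    by (rule card_eq_mult_orbits[OF finite_lessThan bij_s]) (use A side_s orb3 in \<open>auto simp: bl_def\<close>)
  moreover have "card wh = Suc (card e + card lf)"
  proof -
    have "card (wh - {w}) = card (e \<union> lf)"
    proof (rule bij_betw_same_card[of a], rule bij_betw_byWitness[where f' = a])
      show "a ` (wh - {w}) \<subseteq> e \<union> lf"
      proof
        fix u assume "u \<in> a ` (wh - {w})"
        then obtain z where z: "u = a z" "z \<in> ?A" "z \<noteq> w" "kind T z = Inner" "\<not> tblk T z" by (auto simp: wh_def)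
        have "a z \<in> ?A" using A_a z by simp
        then show "u \<in> e \<union> lf"
          using z A[OF z(2)] kind_cases[of "a z"] Bud_a[of "a z"] inner_a[of z]
          by (auto simp: e_def bl_def lf_def)
      qed
      show "a ` (e \<union> lf) \<subseteq> wh - {w}"
      proof
        fix u assume "u \<in> a ` (e \<union> lf)"
        then obtain z where z: "u = a z" "z \<in> e \<union> lf" by auto
        then have zA: "z \<in> ?A" by (auto simp: e_def bl_def lf_def)
        have "z \<noteq> w" using z wD by (auto simp: e_def bl_def lf_def)
        moreover have "a z \<noteq> w" using aw zA A[OF zA] by auto
        ultimately show "u \<in> wh - {w}"
          using z A_a[OF zA] A[OF zA] Leaf_a[of z] inner_a[of z] by (auto simp: e_def bl_def lf_def wh_def)
      qed
    qed (use A in \<open>auto simp: wh_def e_def bl_def lf_def\<close>)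
    moreover have "card (e \<union> lf) = card e + card lf"
      using \<open>finite e\<close> \<open>finite lf\<close> by (rule card_Un_disjoint) (auto simp: e_def bl_def lf_def)
    moreover have "w \<in> wh" using side_self wD by (simp add: wh_def)
    ultimately show ?thesis using card.remove[of wh w] \<open>finite wh\<close> by presburger
  qed
  moreover have "card bl = card e + card bd"
  proof -
    have "card (bl - e) = card bd"
    proof (rule bij_betw_same_card[of a], rule bij_betw_byWitness[where f' = a])
      show "a ` (bl - e) \<subseteq> bd"
      proof
        fix u assume "u \<in> a ` (bl - e)"
        then obtain z where z: "u = a z" "z \<in> ?A" "kind T z = Inner" "tblk T z" "kind T (a z) \<noteq> Inner"
          by (auto simp: bl_def e_def)
        then have "z \<noteq> w" using wD by auto
        then have "a z \<in> ?A" using A_a z by simp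
        then show "u \<in> bd" using z A[OF z(2)] kind_cases[of "a z"] Leaf_a[of "a z"] by (auto simp: bd_def)
      qed
      show "a ` bd \<subseteq> bl - e"
      proof
        fix u assume "u \<in> a ` bd"
        then obtain z where z: "u = a z" "z \<in> ?A" "kind T z = Bud" by (auto simp: bd_def)
        then have "z \<noteq> w" using wD by auto
        then have "a z \<in> ?A" using A_a z by simp
        then show "u \<in> bl - e" using z A[OF z(2)] Bud_a[of z] by (auto simp: bl_def e_def)
      qed
    qed (use A in \<open>auto simp: bl_def bd_def\<close>)
    moreover have "e \<subseteq> bl" by (auto simp: e_def)
    moreover have "card e \<le> card bl" using \<open>e \<subseteq> bl\<close> by (intro card_mono) auto
    ultimately show ?thesis using card_Diff_subset[of e bl] by simp
  qed
  moreover have "charge T ?A = int (card lf) - int (card bd)" by (simp add: charge_def lf_def bd_def)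
  ultimately have "charge T ?A + 1 = 3 * (int (card (orb s ` wh)) - int (card (orb s ` bl)))" by simp
  then show ?thesis by simp
qed

section \<open>The closing procedure as a nested matching\<close>

lemma endsD: "x \<in> ends T \<Longrightarrow> x < nd T \<and> kind T x \<noteq> Inner"
  by (simp add: ends_def inner_iff)

lemma rtl_ends [simp]: "rtl T \<in> ends T" using rtl_lt rtl_Leaf by (simp add: ends_def inner_iff)

text \<open>The cyclic sequence is cut open at the root leaf, so nesting can be stated with linear
  positions. Requiring each end below a pair to be matched below the same pair excludes crossings
  and unmatched ends at once.\<close>

definition noncrossing :: "(nat \<times> nat) set \<Rightarrow> bool" where
  "noncrossing P \<longleftrightarrow>
     (\<forall>b l. (b, l) \<in> P \<longrightarrow> b \<in> ends T \<and> l \<in> ends T \<and> kind T b = Bud \<and> kind T l = Leaf \<and> l \<noteq> rtl T \<and>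
        p b < p l \<and>
        (\<forall>z\<in>ends T. p b < p z \<and> p z < p l \<longrightarrow>
           (\<exists>b' l'. (b', l') \<in> P \<and> (z = b' \<or> z = l') \<and> p b < p b' \<and> p l' < p l))) \<and>
     (\<forall>b l l'. (b, l) \<in> P \<longrightarrow> (b, l') \<in> P \<longrightarrow> l = l') \<and>
     (\<forall>b b' l. (b, l) \<in> P \<longrightarrow> (b', l) \<in> P \<longrightarrow> b = b')"

definition full_matching :: "(nat \<times> nat) set \<Rightarrow> bool" where
  "full_matching P \<longleftrightarrow> noncrossing P \<and> (\<forall>b\<in>ends T. kind T b = Bud \<longrightarrow> (\<exists>l. (b, l) \<in> P))"

lemma next_in_eq:
  assumes "y < nd T" "u \<in> U" "u < nd T" "p y < p u" "\<And>z. z \<in> U \<Longrightarrow> p y < p z \<Longrightarrow> p u \<le> p z"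
  shows "next_in T U y = u"
proof -
  have shift: "(phi T ^^ j) y = (phi T ^^ (p y + j)) (rtl T)" for j
  proof -
    have "(phi T ^^ (p y + j)) (rtl T) = (phi T ^^ j) ((phi T ^^ p y) (rtl T))"
      by (subst add.commute) (simp only: funpow_add o_apply)
    then show ?thesis using cyc.pow_pos[of y] assms(1) by simp
  qed
  have u: "(phi T ^^ (p u - p y)) y = u" unfolding shift using assms cyc.pow_pos[of u] by simp
  have "(LEAST k. 0 < k \<and> (phi T ^^ k) y \<in> U) = p u - p y"
  proof (rule Least_equality)
    show "0 < p u - p y \<and> (phi T ^^ (p u - p y)) y \<in> U" using u assms by simp
    fix k assume k: "0 < k \<and> (phi T ^^ k) y \<in> U"
    show "p u - p y \<le> k"
    proof (rule ccontr)
      assume "\<not> p u - p y \<le> k"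
      then have "p y + k < card D" "p y + k < p u" using cyc.pos_less[of u] assms(3) by auto
      then show False using k assms(5)[of "(phi T ^^ k) y"] cyc.pos_pow[of "p y + k"] unfolding shift by simp
    qed
  qed
  then show ?thesis using u by (simp add: next_in_def)
qed

text \<open>Past the last element of \<open>U\<close> the cyclic sequence resumes at position 0,
  which is the root leaf.\<close>

lemma next_in_wrap:
  assumes "y < nd T" "rtl T \<in> U" "\<And>z. z \<in> U \<Longrightarrow> p z \<le> p y"
  shows "next_in T U y = rtl T"
proof -
  have shift: "(phi T ^^ j) y = (phi T ^^ (p y + j)) (rtl T)" for j
  proof -
    have "(phi T ^^ (p y + j)) (rtl T) = (phi T ^^ j) ((phi T ^^ p y) (rtl T))"
      by (subst add.commute) (simp only: funpow_add o_apply)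
    then show ?thesis using cyc.pow_pos[of y] assms(1) by simp
  qed
  have lt: "p y < card D" using cyc.pos_less[of y] assms by simp
  have u: "(phi T ^^ (card D - p y)) y = rtl T" unfolding shift using lt cyc.period by simp
  have "(LEAST k. 0 < k \<and> (phi T ^^ k) y \<in> U) = card D - p y"
  proof (rule Least_equality)
    show "0 < card D - p y \<and> (phi T ^^ (card D - p y)) y \<in> U" using u assms lt by simp
    fix k assume k: "0 < k \<and> (phi T ^^ k) y \<in> U"
    show "card D - p y \<le> k"
    proof (rule ccontr)
      assume "\<not> card D - p y \<le> k"
      then have "p y + k < card D" by simp
      then show False using k assms(3)[of "(phi T ^^ k) y"] cyc.pos_pow[of "p y + k"] unfolding shift by simp
    qed
  qed
  then show ?thesis using u by (simp add: next_in_def)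
qed

lemma next_in_least:
  assumes "y < nd T" "U \<subseteq> ends T" "u \<in> U" "p y < p u"
  shows "next_in T U y \<in> U \<and> p y < p (next_in T U y) \<and> (\<forall>z\<in>U. p y < p z \<longrightarrow> p (next_in T U y) \<le> p z)"
proof -
  define v where "v = (ARG_MIN p z. z \<in> U \<and> p y < p z)"
  have v: "v \<in> U \<and> p y < p v" "\<And>z. z \<in> U \<and> p y < p z \<Longrightarrow> p v \<le> p z"
    unfolding v_def using arg_min_nat_lemma[of "\<lambda>z. z \<in> U \<and> p y < p z" u p] assms by auto
  then have "next_in T U y = v" using assms endsD by (intro next_in_eq) auto
  then show ?thesis using v by auto
qed

lemma unmatched_ends: "unmatched T P \<subseteq> ends T" by (auto simp: unmatched_def)

text \<open>Every join consumes a fresh bud, so runs have bounded size, and a longest run is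
  stuck.\<close>

lemma closing_exists: "\<exists>P. closing_matching T P"
proof -
  have sub: "closing_run T P \<Longrightarrow> fst ` P \<subseteq> ends T \<and> inj_on fst P" for P
  proof (induction rule: closing_run.induct)
    case (join P b l)
    then show ?case by (auto simp: unmatched_def inj_on_def)
  qed simp
  have finE: "finite (ends T)" by (simp add: ends_def)
  have bound: "closing_run T P \<Longrightarrow> finite P \<and> card P \<le> card (ends T)" for P
    using sub[of P] finE by (metis card_image card_mono finite_imageD finite_subset)
  define m where "m = Max {card P | P. closing_run T P}"
  have "finite {card P | P. closing_run T P}"
    by (rule finite_subset[of _ "{..card (ends T)}"]) (use bound in auto)
  moreover have "{card P | P. closing_run T P} \<noteq> {}" using closing_run.start by blast
  ultimately have "m \<in> {card P | P. closing_run T P}" and le: "\<And>P. closing_run T P \<Longrightarrow> card P \<le> m"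
    unfolding m_def using Max_in[of "{card P | P. closing_run T P}"] Max_ge[of "{card P | P. closing_run T P}"] by blast+
  then obtain P where P: "closing_run T P" "card P = m" by auto
  have "\<not> (\<exists>b \<in> unmatched T P. kind T b = Bud \<and> kind T (next_in T (unmatched T P) b) = Leaf)"
  proof
    assume "\<exists>b \<in> unmatched T P. kind T b = Bud \<and> kind T (next_in T (unmatched T P) b) = Leaf"
    then obtain b where b: "b \<in> unmatched T P" "kind T b = Bud" "kind T (next_in T (unmatched T P) b) = Leaf" by blast
    let ?l = "next_in T (unmatched T P) b"
    have run: "closing_run T (insert (b, ?l) P)" using closing_run.join[OF P(1) b(1,2) refl b(3)] .
    have "(b, ?l) \<notin> P" using b(1) by (force simp: unmatched_def)
    then have "card (insert (b, ?l) P) = Suc m" using P bound[OF P(1)] by simp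
    then show False using le[OF run] by simp
  qed
  then show ?thesis using P by (auto simp: closing_matching_def)
qed

text \<open>Below a pair of the full matching all ends are matched among themselves. If the next
  unmatched end after \<open>b\<close> were a leaf before the partner of \<open>b\<close>, the bud
  of that leaf would also be unmatched and would come still earlier.\<close>

lemma full_run_subset:
  assumes P: "full_matching P" and run: "closing_run T P'"
  shows "P' \<subseteq> P"
  using run
proof (induction rule: closing_run.induct)
  case (join P' b l)
  have nc: "noncrossing P" using P by (simp add: full_matching_def)
  let ?U = "unmatched T P'"
  have bE: "b \<in> ends T" using join unmatched_ends by blast
  then obtain l0 where l0: "(b, l0) \<in> P" using P join by (auto simp: full_matching_def)
  have l0E: "l0 \<in> ends T" "p b < p l0" using nc l0 by (auto simp: noncrossing_def)
  have unm: "z \<in> ?U" if "z \<in> ends T" "\<And>u. (z, u) \<notin> P'" "\<And>u. (u, z) \<notin> P'" for z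
    using that by (force simp: unmatched_def)
  have matched: "z \<notin> ?U" if "(z, u) \<in> P' \<or> (u, z) \<in> P'" for z u using that by (force simp: unmatched_def)
  have partner: "(c, m) \<in> P' \<longleftrightarrow> c \<notin> ?U" "(c, m) \<in> P' \<longleftrightarrow> m \<notin> ?U" if cm: "(c, m) \<in> P" for c m
  proof -
    have k: "kind T c = Bud" "kind T m = Leaf" "c \<in> ends T" "m \<in> ends T" using nc cm by (auto simp: noncrossing_def)
    have kP: "kind T c' = Bud \<and> kind T m' = Leaf" if "(c', m') \<in> P'" for c' m'
      using nc that join.IH by (auto simp: noncrossing_def)
    have c_only: "m' = m" if "(c, m') \<in> P'" for m' using nc cm that join.IH unfolding noncrossing_def by blast
    have m_only: "c' = c" if "(c', m) \<in> P'" for c' using nc cm that join.IH unfolding noncrossing_def by blast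
    show "(c, m) \<in> P' \<longleftrightarrow> c \<notin> ?U"
    proof
      assume "c \<notin> ?U"
      then obtain u where "(c, u) \<in> P' \<or> (u, c) \<in> P'" using unm[OF k(3)] by blast
      then show "(c, m) \<in> P'" using c_only kP k by fastforce
    qed (use matched in blast)
    show "(c, m) \<in> P' \<longleftrightarrow> m \<notin> ?U"
    proof
      assume "m \<notin> ?U"
      then obtain u where "(m, u) \<in> P' \<or> (u, m) \<in> P'" using unm[OF k(4)] by blast
      then show "(c, m) \<in> P'" using m_only kP k by fastforce
    qed (use matched in blast)
  qed
  have l0U: "l0 \<in> ?U" using partner[OF l0] join.hyps by blast
  have nx: "l \<in> ?U" "p b < p l" "\<forall>z\<in>?U. p b < p z \<longrightarrow> p l \<le> p z"
    using next_in_least[OF _ unmatched_ends l0U l0E(2)] join.hyps bE endsD by auto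
  have "l = l0"
  proof (rule ccontr)
    assume ne: "l \<noteq> l0"
    have lE: "l \<in> ends T" using nx unmatched_ends by blast
    have "p l \<le> p l0" using nx(3) l0U l0E by blast
    then have "p l < p l0" using ne cyc.pos_inj[of l l0] lE l0E endsD by (auto simp: le_less)
    then obtain b1 l1 where b1: "(b1, l1) \<in> P" "l = b1 \<or> l = l1" "p b < p b1" "p l1 < p l0"
      using nc l0 lE nx unfolding noncrossing_def by blast
    have "kind T b1 = Bud" using nc b1 by (auto simp: noncrossing_def)
    then have l1: "l = l1" using b1 join.hyps by auto
    then have "p b1 < p l" using nc b1 by (auto simp: noncrossing_def)
    moreover have "b1 \<in> ?U" using partner[OF b1(1)] nx l1 by blast
    ultimately show False using nx(3) b1(3) by fastforce
  qed
  then show ?case using join.IH l0 by simp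
qed simp

text \<open>A run stays inside \<open>P\<close>, and it is not stuck before reaching
  \<open>P\<close>: the shortest missing pair has only matched ends below it and can be
  joined.\<close>

lemma full_matching_closing:
  assumes P: "full_matching P"
  shows "closing_matching T P' \<longleftrightarrow> P' = P"
proof -
  have nc: "noncrossing P" using P by (simp add: full_matching_def)
  have "P' = P" if c: "closing_matching T P'" for P'
  proof (rule ccontr)
    assume ne: "P' \<noteq> P"
    have sub: "P' \<subseteq> P" using full_run_subset[OF P] c by (simp add: closing_matching_def)
    then obtain q0 where q0: "q0 \<in> P - P'" using ne by blast
    define q where "q = (ARG_MIN (\<lambda>q. p (snd q) - p (fst q)) q. q \<in> P - P')"
    have q: "q \<in> P - P'" "\<And>q'. q' \<in> P - P' \<Longrightarrow> p (snd q) - p (fst q) \<le> p (snd q') - p (fst q')"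
      unfolding q_def using arg_min_nat_lemma[of "\<lambda>q. q \<in> P - P'" q0 "\<lambda>q. p (snd q) - p (fst q)"] q0 by auto
    obtain b l where bl: "q = (b, l)" by force
    have blP: "(b, l) \<in> P" "(b, l) \<notin> P'" using q bl by auto
    have k: "b \<in> ends T" "l \<in> ends T" "kind T b = Bud" "kind T l = Leaf" "p b < p l"
      using nc blP by (auto simp: noncrossing_def)
    let ?U = "unmatched T P'"
    have kP: "kind T c = Bud \<and> kind T m = Leaf" if "(c, m) \<in> P'" for c m
      using nc that sub by (auto simp: noncrossing_def)
    have bU: "b \<in> ?U"
    proof -
      have "(b, u) \<notin> P'" for u using nc blP sub unfolding noncrossing_def by blast
      moreover have "(u, b) \<notin> P'" for u using kP[of u b] k by auto
      ultimately show ?thesis using k by (force simp: unmatched_def)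
    qed
    have lU: "l \<in> ?U"
    proof -
      have "(u, l) \<notin> P'" for u using nc blP sub unfolding noncrossing_def by blast
      moreover have "(l, u) \<notin> P'" for u using kP[of l u] k by auto
      ultimately show ?thesis using k by (force simp: unmatched_def)
    qed
    have "next_in T ?U b = l"
    proof (rule next_in_eq)
      fix z assume z: "z \<in> ?U" "p b < p z"
      show "p l \<le> p z"
      proof (rule ccontr)
        assume "\<not> p l \<le> p z"
        moreover have "z \<in> ends T" using z unmatched_ends by blast
        ultimately obtain b1 l1 where b1: "(b1, l1) \<in> P" "z = b1 \<or> z = l1" "p b < p b1" "p l1 < p l"
          using nc blP z unfolding noncrossing_def by (metis not_le)
        have "(b1, l1) \<notin> P'" using z b1 by (force simp: unmatched_def)
        then have "p l - p b \<le> p l1 - p b1" using q(2)[of "(b1, l1)"] b1 bl by simp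
        then show False using b1 k by simp
      qed
    qed (use k lU endsD in auto)
    then show False using c bU k by (auto simp: closing_matching_def)
  qed
  then show ?thesis using closing_exists by blast
qed

lemma full_matching_rooted:
  assumes "full_matching P"
  shows "rooted_blossom_tree T"
proof -
  have "rtl T \<in> unmatched T P"
    using assms rtl_Leaf unfolding full_matching_def noncrossing_def unmatched_def by force
  then show ?thesis
    using full_matching_closing[OF assms] blossom rtl_lt rtl_Leaf by (auto simp: rooted_blossom_tree_def)
qed

text \<open>While the root leaf stays unmatched no join can reach across it, so joins happen within
  the linear order, and a join skips only ends that are already matched.\<close>

lemma closing_run_noncrossing:
  assumes "closing_run T P" "rtl T \<in> unmatched T P"
  shows "noncrossing P"
  using assms
proof (induction rule: closing_run.induct)
  case start
  then show ?case by (simp add: noncrossing_def)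
next
  case (join P b l)
  let ?U = "unmatched T P" and ?P = "insert (b, l) P"
  have rtU: "rtl T \<in> ?U" and lr: "l \<noteq> rtl T" using join.prems by (auto simp: unmatched_def)
  have nc: "noncrossing P" using join.IH rtU by simp
  have bE: "b \<in> ends T" using join unmatched_ends by blast
  have "\<exists>u\<in>?U. p b < p u"
  proof (rule ccontr)
    assume "\<not> ?thesis"
    then have "next_in T ?U b = rtl T" using rtU bE endsD by (intro next_in_wrap) (auto simp: not_less)
    then show False using lr join.hyps by simp
  qed
  then have nx: "l \<in> ?U" "p b < p l" "\<forall>z\<in>?U. p b < p z \<longrightarrow> p l \<le> p z"
    using next_in_least[OF _ unmatched_ends] join.hyps bE endsD by auto
  have lE: "l \<in> ends T" using nx unmatched_ends by blast
  have notU: "z \<notin> ?U" if "(z, u) \<in> P \<or> (u, z) \<in> P" for z u using that by (force simp: unmatched_def)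
  have notP: "(b, u) \<notin> P" "(u, b) \<notin> P" "(l, u) \<notin> P" "(u, l) \<notin> P" for u
    using notU[of b u] notU[of l u] join.hyps(2) nx(1) by blast+
  have inside: "\<exists>b' l'. (b', l') \<in> ?P \<and> (z = b' \<or> z = l') \<and> p b < p b' \<and> p l' < p l"
    if z: "z \<in> ends T" "p b < p z" "p z < p l" for z
  proof -
    have "z \<notin> ?U" using nx z by fastforce
    then obtain b' l' where b': "(b', l') \<in> P" "z = b' \<or> z = l'" using z by (force simp: unmatched_def)
    have ne: "p l' \<noteq> p l" "p b' \<noteq> p b"
      using cyc.pos_inj[of l' l] cyc.pos_inj[of b' b] nc b' notP lE bE endsD unfolding noncrossing_def by (metis lessThan_iff)+
    have lt: "p b' < p l'" using nc b' by (auto simp: noncrossing_def)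
    have "p l' < p l"
    proof (rule ccontr)
      assume "\<not> p l' < p l"
      then have "p b' < p l" "p l < p l'" using ne z b' lt by auto
      then show False using nc b' lE notP unfolding noncrossing_def by metis
    qed
    moreover have "p b < p b'"
    proof (rule ccontr)
      assume "\<not> p b < p b'"
      then have "p b' < p b" "p b < p l'" using ne z b' lt by auto
      then show False using nc b' bE notP unfolding noncrossing_def by metis
    qed
    ultimately show ?thesis using b' by blast
  qed
  show ?case unfolding noncrossing_def
  proof (intro conjI allI impI ballI)
    fix c m assume cm: "(c, m) \<in> ?P"
    show "c \<in> ends T" "m \<in> ends T" "kind T c = Bud" "kind T m = Leaf" "m \<noteq> rtl T" "p c < p m"
      using cm nc bE lE lr nx join.hyps unfolding noncrossing_def by blast+
    fix z assume z: "z \<in> ends T" "p c < p z \<and> p z < p m"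
    show "\<exists>b' l'. (b', l') \<in> ?P \<and> (z = b' \<or> z = l') \<and> p c < p b' \<and> p l' < p m"
    proof (cases "(c, m) = (b, l)")
      case True
      then show ?thesis using inside[of z] z by simp
    next
      case False
      then have "(c, m) \<in> P" using cm by blast
      then show ?thesis using nc z unfolding noncrossing_def by blast
    qed
  next
    fix c m m' assume "(c, m) \<in> ?P" "(c, m') \<in> ?P"
    then show "m = m'" using nc notP unfolding noncrossing_def by blast
  next
    fix c c' m assume "(c, m) \<in> ?P" "(c', m) \<in> ?P"
    then show "c = c'" using nc notP unfolding noncrossing_def by blast
  qed
qed

text \<open>The last unmatched bud would be followed by an unmatched leaf, at the latest by the root
  leaf after wrapping around, and could still be joined.\<close>

lemma rooted_full_matching:
  assumes "rooted_blossom_tree T"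
  obtains P where "full_matching P"
proof -
  obtain P where P: "closing_matching T P" using closing_exists by blast
  let ?U = "unmatched T P"
  have rtU: "rtl T \<in> ?U" using assms P by (simp add: rooted_blossom_tree_def)
  have nc: "noncrossing P" using closing_run_noncrossing P rtU by (simp add: closing_matching_def)
  have "\<exists>l. (b, l) \<in> P" if b: "b \<in> ends T" "kind T b = Bud" for b
  proof (rule ccontr)
    assume n: "\<not> ?thesis"
    have "(u, b) \<notin> P" for u using nc b unfolding noncrossing_def by force
    then have bU: "b \<in> ?U" using n b by (force simp: unmatched_def)
    let ?B = "{z \<in> ?U. kind T z = Bud}"
    have "finite ?B" "?B \<noteq> {}" using bU b unmatched_ends[of P] finite_subset[of ?B D] endsD by fastforce+
    then obtain c where c: "c \<in> ?B" "\<And>z. z \<in> ?B \<Longrightarrow> p z \<le> p c" by (rule finite_maximum[of ?B p]) blast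
    have cE: "c \<in> ends T" using c unmatched_ends by blast
    have "kind T (next_in T ?U c) = Leaf"
    proof (cases "\<exists>u\<in>?U. p c < p u")
      case True
      then have nx: "next_in T ?U c \<in> ?U" "p c < p (next_in T ?U c)"
        using next_in_least[OF _ unmatched_ends] cE endsD by auto
      then have "kind T (next_in T ?U c) \<noteq> Bud" using c(2)[of "next_in T ?U c"] by auto
      moreover have "kind T (next_in T ?U c) \<noteq> Inner" using nx unmatched_ends endsD by blast
      ultimately show ?thesis using kind_cases by blast
    next
      case False
      then have "next_in T ?U c = rtl T" using rtU cE endsD by (intro next_in_wrap) (auto simp: not_less)
      then show ?thesis using rtl_Leaf by simp
    qed
    then show False using P c by (auto simp: closing_matching_def)
  qed
  then have "full_matching P" using nc by (simp add: full_matching_def)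
  then show thesis by (rule that)
qed

end

section \<open>Trees opened from a map\<close>

text \<open>T is the tree obtained by opening M along C: i embeds the darts of M into those of T, and the
  remaining darts of T are the buds and leaves created by the cut edges.\<close>
definition opens_to :: "bmap \<Rightarrow> nat set \<Rightarrow> btree \<Rightarrow> (nat \<Rightarrow> nat) \<Rightarrow> bool" where
  "opens_to M C T i \<longleftrightarrow> inj_on i {..<nd M} \<and>
     (\<forall>x<nd M. i x < nd T) \<and>
     (\<forall>x<nd M. x \<notin> root_darts M \<longrightarrow> kind T (i x) = Inner \<and> sg T (i x) = i (sg M x) \<and>
        tblk T (i x) = blk M x \<and> tocc T (i x) = occ M x) \<and>
     (\<forall>x\<in>root_darts M. kind T (i x) = Leaf \<and> sg T (i x) = i x) \<and>
     (\<forall>x<nd M. x \<notin> C \<longrightarrow> al T (i x) = i (al M x)) \<and>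
     (\<forall>x\<in>C. al T (i x) < nd T \<and> al T (i x) \<notin> i ` {..<nd M} \<and> al T (al T (i x)) = i x \<and>
        sg T (al T (i x)) = al T (i x) \<and> kind T (al T (i x)) = (if blk M x then Bud else Leaf)) \<and>
     (\<forall>y<nd T. y \<in> i ` {..<nd M} \<or> (\<exists>x\<in>C. y = al T (i x))) \<and>
     i (rt M) = rtl T"

text \<open>The matching that closing the opened tree has to reproduce: bud and leaf left behind by
  the same cut edge.\<close>

definition cut_pairs :: "bmap \<Rightarrow> nat set \<Rightarrow> btree \<Rightarrow> (nat \<Rightarrow> nat) \<Rightarrow> (nat \<times> nat) set" where
  "cut_pairs M C T i = {(al T (i x), al T (i (al M x))) | x. x \<in> C \<and> blk M x}"

section \<open>Comparing an opened tree with its map\<close>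

locale opened = bicubic_map +
  fixes C :: "nat set" and T :: btree and i :: "nat \<Rightarrow> nat"
  assumes cut: "cutset M C" and op: "opens_to M C T i" and wfT: "wf_cmap T"
begin

abbreviation "psi \<equiv> contour M C"
abbreviation "e x \<equiv> al T (i x)"

lemma i_inj [simp]: "x < nd M \<Longrightarrow> y < nd M \<Longrightarrow> i x = i y \<longleftrightarrow> x = y"
  using op by (auto simp: opens_to_def inj_on_def)

lemma i_lt [simp]: "x < nd M \<Longrightarrow> i x < nd T"
  and kind_i: "x < nd M \<Longrightarrow> x \<notin> V0 \<Longrightarrow> kind T (i x) = Inner"
  and sg_i: "x < nd M \<Longrightarrow> x \<notin> V0 \<Longrightarrow> sg T (i x) = i (s x)"
  and tblk_i: "x < nd M \<Longrightarrow> x \<notin> V0 \<Longrightarrow> tblk T (i x) = black x"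
  and tocc_i: "x < nd M \<Longrightarrow> x \<notin> V0 \<Longrightarrow> tocc T (i x) = occ M x"
  and kind_V0: "x \<in> V0 \<Longrightarrow> kind T (i x) = Leaf"
  and sg_V0: "x \<in> V0 \<Longrightarrow> sg T (i x) = i x"
  and al_i: "x < nd M \<Longrightarrow> x \<notin> C \<Longrightarrow> al T (i x) = i (a x)"
  and i_r: "i r = rtl T"
  using op by (auto simp: opens_to_def)

lemma C_in [simp]: "x \<in> C \<Longrightarrow> x < nd M" and C_a [simp]: "x \<in> C \<Longrightarrow> a x \<in> C"
  and C_V0 [simp]: "x \<in> C \<Longrightarrow> x \<notin> V0" and finC [simp]: "finite C"
  using cut finite_subset by (auto simp: cutset_def)

lemma V0_C [simp]: "x \<in> V0 \<Longrightarrow> x \<notin> C" using C_V0 by blast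

lemma C_a_iff: "x < nd M \<Longrightarrow> a x \<in> C \<longleftrightarrow> x \<in> C"
  using C_a aa by metis

lemma e_lt [simp]: "x \<in> C \<Longrightarrow> e x < nd T"
  and e_notin: "x \<in> C \<Longrightarrow> e x \<notin> i ` D"
  and al_e [simp]: "x \<in> C \<Longrightarrow> al T (e x) = i x"
  and sg_e [simp]: "x \<in> C \<Longrightarrow> sg T (e x) = e x"
  and kind_e: "x \<in> C \<Longrightarrow> kind T (e x) = (if black x then Bud else Leaf)"
  and T_dart: "y < nd T \<Longrightarrow> y \<in> i ` D \<or> (\<exists>x\<in>C. y = e x)"
  using op by (auto simp: opens_to_def)

lemma e_neq_i: "x \<in> C \<Longrightarrow> y < nd M \<Longrightarrow> e x \<noteq> i y" "x \<in> C \<Longrightarrow> y < nd M \<Longrightarrow> i y \<noteq> e x"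
  using e_notin[of x] imageI[of y D i] by (metis lessThan_iff)+

lemma e_inj [simp]: "x \<in> C \<Longrightarrow> y \<in> C \<Longrightarrow> e x = e y \<longleftrightarrow> x = y"
  using al_e[of x] al_e[of y] i_inj C_in by metis

lemma T_cases [consumes 1, case_names inner root_leaf cut_end]:
  assumes "y < nd T"
  obtains x where "y = i x" "x < nd M" "x \<notin> V0" | x where "y = i x" "x \<in> V0" | x where "y = e x" "x \<in> C"
  using T_dart[OF assms] by auto

lemma DT_eq: "{..<nd T} = i ` D \<union> (\<lambda>x. e x) ` C"
  using T_dart by auto

lemma nd_T: "nd T = nd M + card C"
proof -
  have "nd T = card (i ` D \<union> (\<lambda>x. e x) ` C)" using DT_eq by (metis card_lessThan)
  also have "\<dots> = card (i ` D) + card ((\<lambda>x. e x) ` C)"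
    by (rule card_Un_disjoint) (use e_neq_i in auto)
  also have "card (i ` D) = nd M" using card_image[of i D] by (simp add: inj_on_def)
  also have "card ((\<lambda>x. e x) ` C) = card C" by (rule card_image) (auto simp: inj_on_def)
  finally show ?thesis .
qed

lemma phi_i: "x < nd M \<Longrightarrow> x \<notin> C \<Longrightarrow> phi T (i x) = i (psi x)"
proof -
  assume x: "x < nd M" "x \<notin> C"
  from cut x(1) show ?thesis
    by (cases rule: contour_cases) (use x in \<open>auto simp: phi_def al_i sg_V0 sg_i\<close>)
qed

lemma psi_C: "x \<in> C \<Longrightarrow> psi x = s x"
  by (rule contour_cases[OF cut, of x]) auto

lemma phi_C: "x \<in> C \<Longrightarrow> phi T (i x) = e x" and phi_e: "x \<in> C \<Longrightarrow> phi T (e x) = i (psi x)"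
  by (auto simp: phi_def psi_C sg_i)

lemma psi_in [simp]: "x < nd M \<Longrightarrow> psi x < nd M"
  using bij_contour[OF cut] by (auto dest: bij_betwE)

text \<open>The contour of the tree is the contour of the map with a detour to the stub inserted
  after every cut dart.\<close>

lemma transitive_iff:
  "(\<forall>y<nd T. y \<in> orb (phi T) (rtl T)) \<longleftrightarrow> (\<forall>x<nd M. x \<in> orb psi r)"
proof
  assume L: "\<forall>y<nd T. y \<in> orb (phi T) (rtl T)"
  let ?A = "{y. (\<exists>x\<in>orb psi r. x < nd M \<and> y = i x) \<or> (\<exists>x\<in>orb psi r. x \<in> C \<and> y = e x)}"
  have "orb (phi T) (rtl T) \<subseteq> ?A"
  proof (rule orb_subset)
    show "rtl T \<in> ?A" using i_r[symmetric] orb_self[of r psi] r_in by blast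
    fix y assume "y \<in> ?A"
    then consider x where "x \<in> orb psi r" "x < nd M" "x \<notin> C" "y = i x"
      | x where "x \<in> orb psi r" "x \<in> C" "y = i x" | x where "x \<in> orb psi r" "x \<in> C" "y = e x" by blast
    then show "phi T y \<in> ?A"
    proof cases
      case 1
      then show ?thesis using phi_i orb_step[of _ psi] psi_in by blast
    next
      case 2
      then show ?thesis using phi_C by blast
    next
      case 3
      then show ?thesis using phi_e orb_step[of _ psi] psi_in C_in by blast
    qed
  qed
  then have A: "y < nd T \<Longrightarrow> y \<in> ?A" for y using L by blast
  show "\<forall>x<nd M. x \<in> orb psi r"
  proof (intro allI impI)
    fix x assume x: "x < nd M"
    then have "i x \<in> ?A" using A by simp
    then show "x \<in> orb psi r" using x e_neq_i(2) by auto
  qed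
next
  assume R: "\<forall>x<nd M. x \<in> orb psi r"
  have "orb psi r \<subseteq> {x. x < nd M \<and> i x \<in> orb (phi T) (rtl T)}"
  proof (rule orb_subset)
    show "r \<in> {x. x < nd M \<and> i x \<in> orb (phi T) (rtl T)}" using i_r by simp
    fix x assume x: "x \<in> {x. x < nd M \<and> i x \<in> orb (phi T) (rtl T)}"
    have "i (psi x) \<in> orb (phi T) (rtl T)"
    proof (cases "x \<in> C")
      case True
      then have "e x \<in> orb (phi T) (rtl T)" using x phi_C orb_step[of "i x" "phi T"] by simp
      then show ?thesis using phi_e[OF True] orb_step[of "e x" "phi T"] by simp
    next
      case False
      then show ?thesis using x phi_i orb_step[of "i x" "phi T"] by simp
    qed
    then show "psi x \<in> {x. x < nd M \<and> i x \<in> orb (phi T) (rtl T)}" using x by simp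
  qed
  then have i: "i x \<in> orb (phi T) (rtl T)" if "x < nd M" for x using R that by blast
  show "\<forall>y<nd T. y \<in> orb (phi T) (rtl T)"
  proof (intro allI impI)
    fix y assume "y < nd T"
    then show "y \<in> orb (phi T) (rtl T)"
      by (cases rule: T_cases) (use i phi_C orb_step[of _ "phi T"] in \<open>auto, metis C_in\<close>)
  qed
qed

lemma bij_sgT: "bij_betw (sg T) {..<nd T} {..<nd T}"
  using wf_cmapD[OF wfT] by simp

lemma orb_sgT: "x < nd M \<Longrightarrow> x \<notin> V0 \<Longrightarrow> orb (sg T) (i x) = i ` orb s x"
proof -
  assume x: "x < nd M" "x \<notin> V0"
  have o: "orb s x = {x, s x, s (s x)}" using s_cycle[OF x(1)] by simp
  show ?thesis unfolding o
  proof
    show "orb (sg T) (i x) \<subseteq> i ` {x, s x, s (s x)}"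
      by (rule orb_subset) (use x sg_i in auto)
    have "i x \<in> orb (sg T) (i x)" "i (s x) \<in> orb (sg T) (i x)" "i (s (s x)) \<in> orb (sg T) (i x)"
      using orb_step[of _ "sg T" "i x"] sg_i x by (metis orb_self, metis orb_self, metis orb_self V0_s s_in)
    then show "i ` {x, s x, s (s x)} \<subseteq> orb (sg T) (i x)" by simp
  qed
qed

lemma card_orb_inner: "x < nd M \<Longrightarrow> x \<notin> V0 \<Longrightarrow> card (orb (sg T) (i x)) = 3"
proof -
  assume x: "x < nd M" "x \<notin> V0"
  have "inj_on i (orb s x)" using orb_in[OF bij_s, of x] x by (auto simp: inj_on_def subset_eq)
  then show ?thesis using orb_sgT[OF x] card_orb[OF x(1)] card_image by metis
qed

lemma orb_end: "sg T y = y \<Longrightarrow> orb (sg T) y = {y}"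
  using orb_subset[of y "{y}" "sg T"] by auto

text \<open>The darts away from the root vertex keep their cubic vertices, while the three root
  darts and the stubs are vertices of degree one.\<close>

lemma card_vertsT: "3 * card (verts T) = nd M + 6 + 3 * card C"
proof -
  let ?I = "i ` (D - V0)" and ?E = "i ` V0 \<union> (\<lambda>x. e x) ` C"
  have V0D: "V0 \<subseteq> D" by auto
  have finV: "finite V0" by (simp add: root_darts_def)
  have DT: "{..<nd T} = ?I \<union> ?E" unfolding DT_eq using V0D by blast
  have inj: "inj_on i D" by (auto simp: inj_on_def)
  have orbE: "orb (sg T) y = {y}" if "y \<in> ?E" for y
    using that by (intro orb_end) (auto simp: sg_V0)
  have "verts T = orb (sg T) ` ?I \<union> orb (sg T) ` ?E" unfolding verts_eq DT by (rule image_Un)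
  moreover have "orb (sg T) ` ?I \<inter> orb (sg T) ` ?E = {}"
  proof (rule ccontr)
    assume "\<not> ?thesis"
    then obtain y z where yz: "y \<in> ?I" "z \<in> ?E" "orb (sg T) y = orb (sg T) z" by blast
    from yz(1) have "card (orb (sg T) y) = 3" using card_orb_inner by auto
    moreover have "card (orb (sg T) y) = 1" using yz orbE[of z] by simp
    ultimately show False by simp
  qed
  ultimately have "card (verts T) = card (orb (sg T) ` ?I) + card (orb (sg T) ` ?E)"
    using finV by (simp add: card_Un_disjoint)
  moreover have "card ?I = 3 * card (orb (sg T) ` ?I)"
  proof (rule card_eq_mult_orbits[OF finite_lessThan bij_sgT])
    show "?I \<subseteq> {..<nd T}" by auto
    show "sg T y \<in> ?I" if "y \<in> ?I" for y using that sg_i by auto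
    show "card (orb (sg T) y) = 3" if "y \<in> ?I" for y using that card_orb_inner by auto
  qed
  moreover have "card ?I = nd M - 3"
    using card_image[OF inj_on_subset[OF inj]] card_V0 V0D finV by (simp add: card_Diff_subset)
  moreover have "card (orb (sg T) ` ?E) = card ?E"
    by (rule card_image) (use orbE in \<open>auto simp: inj_on_def\<close>)
  moreover have "card ?E = 3 + card C"
  proof -
    have "card ?E = card (i ` V0) + card ((\<lambda>x. e x) ` C)"
      by (rule card_Un_disjoint) (use finV e_neq_i in auto)
    moreover have "card (i ` V0) = 3" using card_image[OF inj_on_subset[OF inj V0D]] card_V0 by simp
    moreover have "card ((\<lambda>x. e x) ` C) = card C" by (rule card_image) (auto simp: inj_on_def)
    ultimately show ?thesis by simp
  qed
  moreover have "3 \<le> nd M" using card_mono[OF _ V0D] card_V0 by simp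
  ultimately show ?thesis by simp
qed

lemma orbT_connected:
  assumes "\<forall>y<nd T. y \<in> orb (phi T) (rtl T)"
  shows "connected_cmap T" "card (faces T) = 1"
proof -
  have bij: "bij_betw (phi T) {..<nd T} {..<nd T}" using wf_cmapD(3)[OF wfT] by (simp add: phi_def)
  have rl: "rtl T < nd T" using i_r i_lt[OF r_in] by simp
  have orbs: "orb (phi T) y = orb (phi T) (rtl T)" if "y < nd T" for y
    using orb_eq[OF finite_lessThan bij, of "rtl T" y] assms that rl by simp
  have "orb (phi T) ` {..<nd T} = (\<lambda>_. orb (phi T) (rtl T)) ` {..<nd T}"
    by (rule image_cong[OF refl], rule orbs) simp
  also have "\<dots> = {orb (phi T) (rtl T)}" using rl by (intro image_constant[of "rtl T"]) simp
  finally show "card (faces T) = 1" by (simp add: faces_eq phi_def)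
  show "connected_cmap T" unfolding connected_cmap_def
  proof (intro allI impI)
    fix x y assume x: "x < nd T" and y: "y < nd T"
    have "orb (phi T) x \<subseteq> {z. z < nd T \<and> (x, z) \<in> (map_steps T)\<^sup>*}"
    proof (rule orb_subset)
      fix z assume z: "z \<in> {z. z < nd T \<and> (x, z) \<in> (map_steps T)\<^sup>*}"
      have "(z, al T z) \<in> map_steps T" "(al T z, sg T (al T z)) \<in> map_steps T"
        using z wf_cmapD[OF wfT] by (auto simp: map_steps_def)
      then have "(x, phi T z) \<in> (map_steps T)\<^sup>*"
        using z by (auto simp: phi_def intro: rtrancl.rtrancl_into_rtrancl)
      then show "phi T z \<in> {z. z < nd T \<and> (x, z) \<in> (map_steps T)\<^sup>*}"
        using z wf_cmapD[OF wfT] by (auto simp: phi_def)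
    qed (use x in simp)
    moreover have "y \<in> orb (phi T) x" using assms orbs[OF x] y by simp
    ultimately show "(x, y) \<in> (map_steps T)\<^sup>*" by blast
  qed
qed

lemma leaves_buds:
  "int (card {x. x < nd T \<and> kind T x = Leaf}) - int (card {x. x < nd T \<and> kind T x = Bud}) = 3"
proof -
  let ?B = "{x \<in> C. black x}" and ?W = "{x \<in> C. \<not> black x}"
  have inj: "inj_on i D" by (auto simp: inj_on_def)
  have bud: "{x. x < nd T \<and> kind T x = Bud} = (\<lambda>x. e x) ` ?B"
  proof (intro equalityI subsetI)
    fix y assume y: "y \<in> {x. x < nd T \<and> kind T x = Bud}"
    then have "y < nd T" by simp
    then show "y \<in> (\<lambda>x. e x) ` ?B"
      by (cases rule: T_cases) (use y in \<open>auto simp: kind_i kind_V0 kind_e split: if_splits\<close>)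
  qed (auto simp: kind_e)
  have leaf: "{x. x < nd T \<and> kind T x = Leaf} = i ` V0 \<union> (\<lambda>x. e x) ` ?W"
  proof (intro equalityI subsetI)
    fix y assume y: "y \<in> {x. x < nd T \<and> kind T x = Leaf}"
    then have "y < nd T" by simp
    then show "y \<in> i ` V0 \<union> (\<lambda>x. e x) ` ?W"
      by (cases rule: T_cases) (use y in \<open>auto simp: kind_i kind_V0 kind_e split: if_splits\<close>)
  qed (auto simp: kind_e kind_V0)
  have "card (i ` V0 \<union> (\<lambda>x. e x) ` ?W) = card (i ` V0) + card ((\<lambda>x. e x) ` ?W)"
    by (rule card_Un_disjoint) (use e_neq_i in \<open>auto simp: root_darts_def\<close>)
  also have "card (i ` V0) = 3" using card_image[OF inj_on_subset[OF inj, of V0]] card_V0 V0_in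
    by (auto simp: subset_eq)
  also have "card ((\<lambda>x. e x) ` ?W) = card ?W" by (rule card_image) (auto simp: inj_on_def)
  also have "card ?W = card ?B"
    by (rule bij_betw_same_card[of a], rule bij_betw_byWitness[where f' = a]) auto
  finally have "card {x. x < nd T \<and> kind T x = Leaf} = 3 + card ?B" unfolding leaf .
  moreover have "card {x. x < nd T \<and> kind T x = Bud} = card ?B" unfolding bud
    by (rule card_image) (auto simp: inj_on_def)
  ultimately show ?thesis by simp
qed

text \<open>The local conditions hold for every opening. What remains is global: a transitive
  contour gives connectedness and a single face, and the dart count is V = E + 1.\<close>

lemma blossom_iff:
  "blossom_tree T \<longleftrightarrow> (\<forall>x<nd M. x \<in> orb psi r) \<and> nd M = 3 * card C + 6"
proof
  assume b: "blossom_tree T"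
  have VE: "int (card (verts T)) = int (card (edges T)) + 1" using b by (simp add: blossom_tree_def)
  have "card (faces T) = 1" using b VE by (simp add: blossom_tree_def planar_cmap_def)
  then obtain c where c: "orb (phi T) ` {..<nd T} = {c}"
    unfolding faces_eq phi_def[symmetric] using card_1_singletonE by blast
  have rl: "rtl T < nd T" using i_r i_lt[OF r_in] by simp
  have "y \<in> orb (phi T) (rtl T)" if "y < nd T" for y
  proof -
    have "orb (phi T) y \<in> {c}" "orb (phi T) (rtl T) \<in> {c}" using that rl unfolding c[symmetric] by auto
    then show ?thesis using orb_self[of y "phi T"] by simp
  qed
  then have "\<forall>x<nd M. x \<in> orb psi r" using transitive_iff by blast
  moreover have "nd M = 3 * card C + 6" using VE card_vertsT card_edges[OF wfT] nd_T by linarith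
  ultimately show "(\<forall>x<nd M. x \<in> orb psi r) \<and> nd M = 3 * card C + 6" by simp
next
  assume v: "(\<forall>x<nd M. x \<in> orb psi r) \<and> nd M = 3 * card C + 6"
  have tr: "\<forall>y<nd T. y \<in> orb (phi T) (rtl T)" using v transitive_iff by blast
  have VE: "int (card (verts T)) = int (card (edges T)) + 1"
    using v card_vertsT card_edges[OF wfT] nd_T by linarith
  have inner: "x < nd M \<and> x \<notin> V0" if "y = i x" "kind T y = Inner" "x < nd M" for x y
    using that kind_V0[of x] by auto
  show "blossom_tree T" unfolding blossom_tree_def
  proof (intro conjI allI impI)
    show "planar_cmap T" using wfT orbT_connected[OF tr] VE by (simp add: planar_cmap_def)
    show "int (card (verts T)) = int (card (edges T)) + 1" by (rule VE)
    show "int (card {x. x < nd T \<and> kind T x = Leaf}) - int (card {x. x < nd T \<and> kind T x = Bud}) = 3"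
      by (rule leaves_buds)
  next
    fix y assume "y < nd T"
    then show "kind T (sg T y) = kind T y" "tblk T (sg T y) = tblk T y" "tocc T (sg T y) = tocc T y"
      by (cases rule: T_cases; auto simp: sg_i kind_i tblk_i tocc_i sg_V0)+
  next
    fix y assume "y < nd T" "inner T y"
    then show "deg T y = 3"
      by (cases rule: T_cases) (auto simp: deg_def card_orb_inner inner_def kind_V0 kind_e split: if_splits)
  next
    fix y assume "y < nd T" "\<not> inner T y"
    then show "deg T y = 1"
      by (cases rule: T_cases) (auto simp: deg_def inner_def kind_i orb_end sg_V0)
  next
    fix y assume y: "inner_edge_dart T y"
    then have "y < nd T" "kind T y = Inner" "kind T (al T y) = Inner" by (auto simp: inner_edge_dart_def inner_def)
    then show "tblk T (al T y) \<noteq> tblk T y"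
    proof (cases rule: T_cases)
      case (inner x)
      then have "x \<notin> C" using \<open>kind T (al T y) = Inner\<close> kind_e[of x] by (auto split: if_splits)
      then have "al T y = i (a x)" using inner al_i by simp
      moreover have "a x \<notin> V0" using \<open>kind T (al T y) = Inner\<close> calculation kind_V0[of "a x"] by auto
      ultimately show ?thesis using inner tblk_i by simp
    qed (auto simp: kind_V0 kind_e split: if_splits)
  next
    fix y assume y: "y < nd T" "kind T y = Bud"
    from y(1) show "inner T (al T y)" "tblk T (al T y)"
      by (cases rule: T_cases; use y in \<open>auto simp: kind_i kind_V0 kind_e inner_def tblk_i split: if_splits\<close>)+
  next
    fix y assume y: "y < nd T" "kind T y = Leaf"
    from y(1) have "inner T (al T y) \<and> \<not> tblk T (al T y)"
    proof (cases rule: T_cases)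
      case (root_leaf x)
      then show ?thesis using kind_i[of "a x"] tblk_i[of "a x"] al_i[of x] by (simp add: inner_def)
    qed (use y in \<open>auto simp: kind_i kind_e inner_def tblk_i split: if_splits\<close>)
    then show "inner T (al T y)" "\<not> tblk T (al T y)" by auto
  qed
qed

lemma rtl_facts: "rtl T < nd T" "kind T (rtl T) = Leaf"
  using i_r[symmetric] kind_V0[OF r_V0] by auto

end

context opened begin

lemma arc_a:
  assumes "x \<in> arcs M" "x \<notin> C"
  shows "a x \<notin> V0 \<and> a x \<notin> C"
proof -
  have x: "x < nd M" "black x" using assms by (auto simp: arcs_def)
  then have "\<not> black (a x)" by simp
  then have "a x \<notin> V0" using V0_black by blast
  then show ?thesis using C_a_iff x assms by blast
qed

lemma root_leaf_ends: "v \<in> V0 \<Longrightarrow> i v \<in> ends T"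
  by (simp add: ends_def inner_def kind_V0)

lemma cut_ends: "x \<in> C \<Longrightarrow> e x \<in> ends T"
  by (simp add: ends_def inner_def kind_e)

lemma ends_cases:
  assumes "z \<in> ends T"
  obtains v where "z = i v" "v \<in> V0" | x where "z = e x" "x \<in> C"
proof -
  have "z < nd T" "kind T z \<noteq> Inner" using assms by (auto simp: ends_def inner_def)
  then show thesis by (cases rule: T_cases) (use that kind_i in auto)
qed

end

section \<open>Positions and nesting in the tree and in the map\<close>

locale opened_tree = opened +
  assumes blossomT: "blossom_tree T"
begin

sublocale T: rooted_tree T
  by unfold_locales (rule blossomT, rule rtl_facts(1), rule rtl_facts(2))

lemma trans: "\<forall>x<nd M. x \<in> orb psi r" and nd_M: "nd M = 3 * card C + 6"
  using blossom_iff blossomT by auto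

sublocale cyc: cyclic D psi r
  by (rule cyclic_contour[OF cut trans])

abbreviation "p \<equiv> cpos M C"

text \<open>Each cut dart passed before costs one additional step, the visit to its stub.\<close>

lemma pT_i: "x < nd M \<Longrightarrow> T.p (i x) = p x + card {z \<in> C. p z < p x}"
proof -
  assume "x < nd M"
  then have "x \<in> D" by simp
  then show ?thesis
  proof (induction rule: cyc.pos_induct)
    case root
    then show ?case using i_r T.cyc.pos_root cyc.pos_root by simp
  next
    case (step y)
    have y: "y < nd M" "p (psi y) = Suc (p y)" using step cyc.pos_step[of y] by auto
    then have "psi y \<noteq> r" using cyc.pos_root by (metis nat.distinct(1))
    then have ne: "i (psi y) \<noteq> rtl T" using i_r y by (metis i_inj psi_in r_in)
    have Tstep: "T.p (phi T u) = Suc (T.p u)" if "u < nd T" "phi T u \<noteq> rtl T" for u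
      using T.cyc.pos_step[of u] that T.cyc.pos_0D[of "phi T u"] T.cyc.f_in[of u] by (auto split: if_splits)
    have IH: "T.p (i y) = p y + card {z \<in> C. p z < p y}" using step by simp
    show ?case
    proof (cases "y \<in> C")
      case True
      have "e y \<noteq> rtl T" using e_neq_i[OF True r_in] i_r by simp
      then have "T.p (e y) = Suc (T.p (i y))" using Tstep[of "i y"] phi_C[OF True] y by simp
      then have "T.p (i (psi y)) = Suc (Suc (T.p (i y)))"
        using Tstep[of "e y"] phi_e[OF True] ne True by simp
      moreover have "{z \<in> C. p z < p (psi y)} = insert y {z \<in> C. p z < p y}"
        using y True cyc.pos_inj[of _ y] by (auto simp: less_Suc_eq)
      ultimately show ?thesis using IH y by simp
    next
      case False
      then have "T.p (i (psi y)) = Suc (T.p (i y))" using Tstep[of "i y"] phi_i[OF y(1) False] ne y by simp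
      moreover have "{z \<in> C. p z < p (psi y)} = {z \<in> C. p z < p y}"
      proof -
        have "p z \<noteq> p y" if "z \<in> C" for z using cyc.pos_inj[of z y] that False y by auto
        then show ?thesis using y by (auto simp: less_Suc_eq)
      qed
      ultimately show ?thesis using IH y by simp
    qed
  qed
qed

lemma pT_e: "x \<in> C \<Longrightarrow> T.p (e x) = Suc (T.p (i x))"
proof -
  assume x: "x \<in> C"
  have "e x \<noteq> rtl T" using e_neq_i[OF x r_in] i_r by simp
  then show ?thesis
    using T.cyc.pos_step[of "i x"] phi_C[OF x] x T.cyc.pos_0D[of "e x"] by (auto split: if_splits)
qed

lemma pT_mono: "x < nd M \<Longrightarrow> y < nd M \<Longrightarrow> p x < p y \<Longrightarrow> T.p (i x) < T.p (i y)"
proof -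
  assume xy: "x < nd M" "y < nd M" "p x < p y"
  have "card {z \<in> C. p z < p x} \<le> card {z \<in> C. p z < p y}" using xy by (intro card_mono) auto
  then show ?thesis using pT_i xy by simp
qed

lemma pT_ii: "x < nd M \<Longrightarrow> y < nd M \<Longrightarrow> T.p (i x) < T.p (i y) \<longleftrightarrow> p x < p y"
  using pT_mono[of x y] pT_mono[of y x] cyc.pos_inj[of x y]
  by (metis lessThan_iff linorder_neqE_nat not_less_iff_gr_or_eq)

lemma pT_ei: "x \<in> C \<Longrightarrow> y < nd M \<Longrightarrow> T.p (e x) < T.p (i y) \<longleftrightarrow> p x < p y"
proof
  assume x: "x \<in> C" and y: "y < nd M"
  show "p x < p y" if "T.p (e x) < T.p (i y)" using that pT_ii[of x y] pT_e x y by simp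
  assume lt: "p x < p y"
  have "Suc (card {z \<in> C. p z < p x}) \<le> card {z \<in> C. p z < p y}"
  proof -
    have "card (insert x {z \<in> C. p z < p x}) \<le> card {z \<in> C. p z < p y}" using x lt by (intro card_mono) auto
    then show ?thesis by simp
  qed
  then show "T.p (e x) < T.p (i y)" using pT_i pT_e x y lt by simp
qed

lemma pT_ie: "x \<in> C \<Longrightarrow> y < nd M \<Longrightarrow> T.p (i y) < T.p (e x) \<longleftrightarrow> p y \<le> p x"
  using pT_ei[of x y] T.cyc.pos_inj[of "i y" "e x"] e_neq_i(2)[of x y]
  by (metis C_in e_lt i_lt lessThan_iff linorder_neqE_nat not_less not_less_iff_gr_or_eq)

lemma pT_ee: "x \<in> C \<Longrightarrow> y \<in> C \<Longrightarrow> T.p (e x) < T.p (e y) \<longleftrightarrow> p x < p y"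
  using pT_e pT_ii C_in by simp

lemma pairs_iff: "(b, l) \<in> cut_pairs M C T i \<longleftrightarrow> (\<exists>x\<in>C. black x \<and> b = e x \<and> l = e (a x))"
  by (auto simp: cut_pairs_def)

lemma p_neq: "x < nd M \<Longrightarrow> y < nd M \<Longrightarrow> x \<noteq> y \<Longrightarrow> p x \<noteq> p y"
  using cyc.pos_inj by auto

text \<open>The ends of the tree are the root leaves and the stubs, and stubs sit immediately after
  their darts, so nesting in the tree is nesting of cut darts in the map.\<close>

lemma full_matching_iff:
  "T.full_matching (cut_pairs M C T i) \<longleftrightarrow>
     (\<forall>x\<in>C. black x \<longrightarrow> p x < p (a x) \<and> between M C x \<inter> V0 = {} \<and>
        (\<forall>y\<in>between M C x. y \<in> C \<longrightarrow> a y \<in> between M C x))" (is "_ \<longleftrightarrow> ?R")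
proof
  assume L: "T.full_matching (cut_pairs M C T i)"
  show ?R
  proof (intro ballI impI)
    fix x assume x: "x \<in> C" "black x"
    have pr: "(e x, e (a x)) \<in> cut_pairs M C T i" using x pairs_iff by blast
    have lt: "T.p (e x) < T.p (e (a x))"
      and inside: "\<And>z. z \<in> ends T \<Longrightarrow> T.p (e x) < T.p z \<Longrightarrow> T.p z < T.p (e (a x)) \<Longrightarrow>
        \<exists>b l. (b, l) \<in> cut_pairs M C T i \<and> (z = b \<or> z = l) \<and> T.p (e x) < T.p b \<and> T.p l < T.p (e (a x))"
      using L pr unfolding T.full_matching_def T.noncrossing_def by blast+
    have "p x < p (a x)" using lt pT_ee x by simp
    moreover have "between M C x \<inter> V0 = {}"
    proof (rule ccontr)
      assume "\<not> ?thesis"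
      then obtain v where v: "v \<in> V0" "p x < p v" "p v < p (a x)" by (auto simp: between_def)
      have "T.p (e x) < T.p (i v)" "T.p (i v) < T.p (e (a x))" using pT_ei pT_ie x v by auto
      then obtain b l where bl: "(b, l) \<in> cut_pairs M C T i" "i v = b \<or> i v = l"
        using inside[OF root_leaf_ends[OF v(1)]] by blast
      then show False using pairs_iff e_neq_i(2) v(1) by (metis C_a V0_in)
    qed
    moreover have "a y \<in> between M C x" if y: "y \<in> between M C x" "y \<in> C" for y
    proof -
      have "T.p (e x) < T.p (e y)" "T.p (e y) < T.p (e (a x))" using pT_ee x y by (auto simp: between_def)
      then obtain b l where bl: "(b, l) \<in> cut_pairs M C T i" "e y = b \<or> e y = l"
        "T.p (e x) < T.p b" "T.p l < T.p (e (a x))" using inside[OF cut_ends[OF y(2)]] by blast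
      then obtain u where u: "u \<in> C" "black u" "b = e u" "l = e (a u)" using pairs_iff by blast
      have "y = u \<or> y = a u" using bl u y by auto
      then have "a y = a u \<or> a y = u" using u by auto
      moreover have "T.p b < T.p l"
        using L bl(1) unfolding T.full_matching_def T.noncrossing_def by blast
      then have "p u < p (a u)" using u pT_ee by simp
      moreover have "p x < p u" "p (a u) < p (a x)" using bl u x pT_ee by simp_all
      moreover have "u < nd M" "a u < nd M" using u by simp_all
      ultimately show ?thesis unfolding between_def by auto
    qed
    ultimately show "p x < p (a x) \<and> between M C x \<inter> V0 = {} \<and>
        (\<forall>y\<in>between M C x. y \<in> C \<longrightarrow> a y \<in> between M C x)" by blast
  qed
next
  assume R: ?R
  show "T.full_matching (cut_pairs M C T i)" unfolding T.full_matching_def T.noncrossing_def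
  proof (intro conjI allI impI ballI)
    fix b l assume "(b, l) \<in> cut_pairs M C T i"
    then obtain x where x: "x \<in> C" "black x" "b = e x" "l = e (a x)" using pairs_iff by blast
    show "b \<in> ends T" "l \<in> ends T" "kind T b = Bud" "kind T l = Leaf" "l \<noteq> rtl T"
      using x cut_ends kind_e[of x] kind_e[of "a x"] e_neq_i(1)[of "a x" r] i_r by auto
    show "T.p b < T.p l" using R x pT_ee by simp
    fix z assume z: "z \<in> ends T" "T.p b < T.p z \<and> T.p z < T.p l"
    from z(1) show "\<exists>b' l'. (b', l') \<in> cut_pairs M C T i \<and> (z = b' \<or> z = l') \<and> T.p b < T.p b' \<and> T.p l' < T.p l"
    proof (cases rule: ends_cases)
      case (1 v)
      then have "p x < p v" "p v \<le> p (a x)" using z x pT_ei pT_ie by auto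
      moreover have "v \<noteq> a x" using 1 C_V0[OF C_a[OF x(1)]] by auto
      then have "p v \<noteq> p (a x)" using p_neq[of v "a x"] 1 x by simp
      ultimately have "v \<in> between M C x" using 1 by (simp add: between_def)
      then show ?thesis using R x 1 by blast
    next
      case (2 y)
      then have "p x < p y" "p y < p (a x)" using z x pT_ee by auto
      then have yb: "y \<in> between M C x" using 2 by (simp add: between_def)
      then have ayb: "a y \<in> between M C x" using R x 2 by blast
      show ?thesis
      proof (cases "black y")
        case True
        then have "(e y, e (a y)) \<in> cut_pairs M C T i" using pairs_iff 2 by blast
        moreover have "T.p b < T.p (e y)" "T.p (e (a y)) < T.p l"
          using 2 x yb ayb pT_ee by (simp_all add: between_def)
        ultimately show ?thesis using 2 by blast
      next
        case False
        then have "(e (a y), e y) \<in> cut_pairs M C T i" using pairs_iff 2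
          by (metis C_a C_in aa black_a)
        moreover have "T.p b < T.p (e (a y))" "T.p (e y) < T.p l"
          using 2 x yb ayb pT_ee by (simp_all add: between_def)
        ultimately show ?thesis using 2 by blast
      qed
    qed
  next
    fix b l l' assume "(b, l) \<in> cut_pairs M C T i" "(b, l') \<in> cut_pairs M C T i"
    then show "l = l'" unfolding pairs_iff by auto
  next
    fix b b' l assume "(b, l) \<in> cut_pairs M C T i" "(b', l) \<in> cut_pairs M C T i"
    then obtain x x' where "x \<in> C" "x' \<in> C" "b = e x" "b' = e x'" "e (a x) = e (a x')"
      unfolding pairs_iff by blast
    then show "b = b'" using a_inj[of x x'] by simp
  next
    fix b assume b: "b \<in> ends T" "kind T b = Bud"
    from b(1) show "\<exists>l. (b, l) \<in> cut_pairs M C T i"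
    proof (cases rule: ends_cases)
      case (1 v)
      then show ?thesis using b kind_V0 by simp
    next
      case (2 y)
      then have "black y" using b kind_e[of y] by (auto split: if_splits)
      then show ?thesis using 2 pairs_iff by blast
    qed
  qed
qed

end

section \<open>Regularity, occupation and closing read off from the map\<close>

locale opened_valid = opened +
  assumes valid: "valid_cut M C"
begin

sublocale V: valid_map M C by unfold_locales (rule valid)

lemma blossom: "blossom_tree T"
  using blossom_iff valid by (auto simp: valid_cut_def)

sublocale opened_tree M C T i by unfold_locales (rule blossom)

lemma full: "T.full_matching (cut_pairs M C T i)"
  using full_matching_iff valid by (auto simp: valid_cut_def)

lemma rooted: "rooted_blossom_tree T"
  using T.full_matching_rooted[OF full] .

lemma closing_iff: "closing_matching T P \<longleftrightarrow> P = cut_pairs M C T i"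
  using T.full_matching_closing[OF full] .

text \<open>One side of the edge consists of what the contour meets between its two passages along
  the edge, so its charge is the growth of the height over that interval.\<close>

lemma interval_charge:
  assumes x: "x < nd M" "x \<notin> C" "x \<notin> V0" "a x \<notin> V0" and lt: "p x < p (a x)"
  shows "charge T (side T (i (a x))) = V.h (s x) - V.h (s (a x))"
proof -
  define y where "y = a x"
  have y: "y < nd M" "y \<notin> C" "y \<notin> V0" "a y = x" using x C_a_iff by (auto simp: y_def)
  have aiy: "al T (i y) = i x" using al_i y by simp
  let ?J = "{z. z < nd M \<and> p x < p z \<and> p z \<le> p y}"
  have pxy: "p x < p y" using lt by (simp add: y_def)
  have "side T (i y) = {z. z < nd T \<and> T.p (i x) < T.p z \<and> T.p z \<le> T.p (i y)}"
    using T.side_interval(1)[of "i y"] aiy pT_ii[of x y] x y pxy by simp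
  also have "\<dots> = i ` ?J \<union> (\<lambda>z. e z) ` (?J \<inter> C)"
  proof (intro equalityI subsetI)
    fix z assume z: "z \<in> {z. z < nd T \<and> T.p (i x) < T.p z \<and> T.p z \<le> T.p (i y)}"
    then have "z \<in> i ` D \<or> (\<exists>u\<in>C. z = e u)" using T_dart by blast
    then show "z \<in> i ` ?J \<union> (\<lambda>z. e z) ` (?J \<inter> C)"
    proof
      assume "z \<in> i ` D"
      then obtain u where "u < nd M" "z = i u" by auto
      then show ?thesis using z pT_ii[of x u] pT_ii[of y u] x y by (auto simp: not_less[symmetric])
    next
      assume "\<exists>u\<in>C. z = e u"
      then obtain u where u: "u \<in> C" "z = e u" by blast
      have "p u \<noteq> p x" using p_neq[of u x] u x by auto
      then show ?thesis using u z pT_ie[of u x] pT_ie[of u y] x y by (auto simp: not_less[symmetric])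
    qed
  next
    fix z assume "z \<in> i ` ?J \<union> (\<lambda>z. e z) ` (?J \<inter> C)"
    then consider u where "u \<in> ?J" "z = i u" | u where "u \<in> ?J" "u \<in> C" "z = e u" by blast
    then show "z \<in> {z. z < nd T \<and> T.p (i x) < T.p z \<and> T.p z \<le> T.p (i y)}"
    proof cases
      case 1
      then show ?thesis using pT_ii[of x u] pT_ii[of y u] x y by (auto simp: not_less[symmetric])
    next
      case 2
      have "p u \<noteq> p y" using p_neq[of u y] 2 y by auto
      then show ?thesis using 2 pT_ie[of u x] pT_ie[of u y] x y by (auto simp: not_less[symmetric])
    qed
  qed
  finally have side: "side T (i y) = i ` ?J \<union> (\<lambda>z. e z) ` (?J \<inter> C)" .
  have "charge T (side T (i y)) = (\<Sum>z\<in>i ` ?J. end_weight T z) + (\<Sum>z\<in>(\<lambda>z. e z) ` (?J \<inter> C). end_weight T z)"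
    unfolding side
    by (subst charge_eq_sum, simp, rule sum.union_disjoint) (use e_neq_i in auto)
  also have "(\<Sum>z\<in>i ` ?J. end_weight T z) = (\<Sum>z\<in>?J. if z \<in> V0 then 1 else 0)"
    by (subst sum.reindex) (auto simp: inj_on_def end_weight_def kind_i kind_V0 intro!: sum.cong)
  also have "(\<Sum>z\<in>(\<lambda>z. e z) ` (?J \<inter> C). end_weight T z) = (\<Sum>z\<in>?J \<inter> C. if black z then - 1 else 1)"
    by (subst sum.reindex) (auto simp: inj_on_def end_weight_def kind_e intro!: sum.cong)
  \<comment> \<open>The tree charges a root leaf at the root dart, the height already at the dart
    before it. The shift by \<open>a\<close> preserves the interval because neither end of the edge
    is a root dart.\<close>
  also have "(\<Sum>z\<in>?J. if z \<in> V0 then 1 else (0::int)) = (\<Sum>z\<in>?J. leg M z)"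
  proof -
    have "(\<Sum>z\<in>?J. if z \<in> V0 then 1 else (0::int)) = (\<Sum>z\<in>?J \<inter> V0. 1)"
      by (rule sum.mono_neutral_cong_right) auto
    also have "\<dots> = (\<Sum>z\<in>{z \<in> ?J. a z \<in> V0}. 1)"
    proof (rule sum.reindex_bij_witness[of _ a a])
      fix v assume v: "v \<in> ?J \<inter> V0"
      then have "v \<noteq> r" using V.p_r by auto
      then have st: "p v = Suc (p (a v))" using V.leg_step[of v] v by simp
      have "a v \<noteq> x" using v x(4) by auto
      then have "p (a v) \<noteq> p x" using p_neq[of "a v" x] x v by auto
      then show "a v \<in> {z \<in> ?J. a z \<in> V0}" using v st by auto
    next
      fix z assume z: "z \<in> {z \<in> ?J. a z \<in> V0}"
      have "z \<noteq> y" using z y x by auto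
      then have zy: "p z < p y" using z p_neq[of z y] y by auto
      then have "z \<noteq> a r" using V.p_le[of y] y by auto
      then have "a z \<noteq> r" using z by (metis (no_types, lifting) aa mem_Collect_eq)
      then have "p (a z) = Suc (p z)" using V.leg_step[of "a z"] z by simp
      then show "a z \<in> ?J \<inter> V0" using z zy by auto
    qed auto
    also have "\<dots> = (\<Sum>z\<in>?J. leg M z)"
      by (rule sum.mono_neutral_cong_left) (auto simp: leg_def)
    finally show ?thesis .
  qed
  also have "(\<Sum>z\<in>?J. leg M z) + (\<Sum>z\<in>?J \<inter> C. if black z then - 1 else 1) = (\<Sum>z\<in>?J. weight M C z)"
  proof -
    have "(\<Sum>z\<in>?J \<inter> C. if black z then - 1 else (1::int)) = (\<Sum>z\<in>?J. if z \<in> C then (if black z then - 1 else 1) else 0)"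
      by (rule sum.mono_neutral_cong_left) auto
    moreover have "weight M C z = leg M z + (if z \<in> C then (if black z then - 1 else 1) else 0)" if "z < nd M" for z
      using that by (auto simp: weight_def leg_def)
    moreover have "(\<Sum>z\<in>?J. weight M C z) = (\<Sum>z\<in>?J. leg M z + (if z \<in> C then (if black z then - 1 else 1) else 0))"
      by (rule sum.cong) (use calculation in auto)
    ultimately show ?thesis by (simp add: sum.distrib)
  qed
  also have "(\<Sum>z\<in>?J. weight M C z) = V.h (psi y) - V.h (psi x)"
  proof -
    have xs: "x \<noteq> a r" "y \<noteq> a r" using x y by auto
    have e1: "{z. z < nd M \<and> p z < p (psi y)} = {z. z < nd M \<and> p z < p (psi x)} \<union> ?J"
      using V.p_step[of x] V.p_step[of y] x y xs pxy by auto
    have "(\<Sum>z | z < nd M \<and> p z < p (psi y). weight M C z) =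
        (\<Sum>z | z < nd M \<and> p z < p (psi x). weight M C z) + (\<Sum>z\<in>?J. weight M C z)"
      unfolding e1 by (rule sum.union_disjoint) (use V.p_step[of x] x xs in auto)
    then show ?thesis by (simp add: height_def)
  qed
  finally have "charge T (side T (i y)) = V.h (psi y) - V.h (psi x)" .
  moreover have "psi y = s x" "psi x = s y"
    using V.other_step[of y] V.other_step[of x] x y by (auto simp: y_def)
  ultimately show ?thesis by (simp add: y_def)
qed

text \<open>If the black end comes first, the interval between the two passages is the white side.
  Otherwise it is the black side, and the total charge 3 enters.\<close>

lemma arc_charge:
  assumes x: "x \<in> arcs M" "x \<notin> C"
  shows "charge T (side T (i (a x))) = (if p x < p (a x) then V.h (s x) - V.h x else 3 + V.h (s x) - V.h x)"
proof -
  have xD: "x < nd M" "black x" "x \<notin> V0" using x by (auto simp: arcs_def)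
  have ax: "a x \<notin> V0" "a x \<notin> C" using arc_a x by auto
  show ?thesis
  proof (cases "p x < p (a x)")
    case True
    then show ?thesis using interval_charge[OF xD(1) x(2) xD(3) ax(1)] xD V.h_face by simp
  next
    case False
    then have lt: "p (a x) < p (a (a x))" using p_neq[of x "a x"] xD by (metis a_in a_neq aa linorder_neqE_nat)
    have "charge T (side T (i x)) = V.h (s (a x)) - V.h (s x)"
      using interval_charge[of "a x"] lt ax xD by simp
    moreover have "charge T (side T (al T (i x))) = 3 - charge T (side T (i x))"
      using T.charge_compl[of "i x"] xD by simp
    ultimately show ?thesis using al_i[OF xD(1) x(2)] xD False by simp
  qed
qed

lemma white_inner_iff: "white_inner_dart T w \<longleftrightarrow> (\<exists>x\<in>arcs M - C. w = i (a x))"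
proof
  assume w: "white_inner_dart T w"
  then have wk: "w < nd T" "kind T w = Inner" "kind T (al T w) = Inner" "\<not> tblk T w"
    by (auto simp: white_inner_dart_def inner_edge_dart_def inner_def)
  from wk(1) show "\<exists>x\<in>arcs M - C. w = i (a x)"
  proof (cases rule: T_cases)
    case (inner y)
    have "y \<notin> C" using wk inner kind_e[of y] by (auto split: if_splits)
    moreover have "a y \<notin> V0" using wk inner al_i[of y] kind_V0[of "a y"] calculation by auto
    moreover have "\<not> black y" using wk inner tblk_i by simp
    ultimately have "a y \<in> arcs M - C" using inner C_a_iff by (auto simp: arcs_def)
    then show ?thesis using inner by (intro bexI[of _ "a y"]) auto
  qed (use wk kind_V0 kind_e in \<open>auto split: if_splits\<close>)
next
  assume "\<exists>x\<in>arcs M - C. w = i (a x)"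
  then obtain x where x: "x \<in> arcs M" "x \<notin> C" "w = i (a x)" by blast
  then have xD: "x < nd M" "black x" "x \<notin> V0" by (auto simp: arcs_def)
  have ax: "a x \<notin> V0" "a x \<notin> C" using arc_a x by auto
  show "white_inner_dart T w"
    using ax x xD al_i[of "a x"] by (simp add: white_inner_dart_def inner_edge_dart_def inner_def kind_i tblk_i)
qed

lemma regular_iff:
  assumes x: "x \<in> arcs M" "x \<notin> C"
  shows "regular_edge T (i (a x)) \<longleftrightarrow> regular_arc M C x"
proof -
  have xD: "x < nd M" "black x" "x \<notin> V0" using x by (auto simp: arcs_def)
  have "a x \<notin> C" using C_a_iff xD x by simp
  have "q_black T (i (a x)) = 3 - q_white T (i (a x))"
    unfolding q_black_def q_white_def using T.charge_compl[of "i (a x)"] xD by simp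
  then have "regular_edge T (i (a x)) \<longleftrightarrow> 2 \<le> q_white T (i (a x))"
    by (auto simp: regular_edge_def)
  then show ?thesis using arc_charge[OF x] by (auto simp: q_white_def regular_arc_def)
qed

lemma HP_iff:
  assumes x: "x \<in> arcs M" "x \<notin> C"
  shows "HP_edge T (i (a x)) \<longleftrightarrow> x \<notin> conflicts M"
proof -
  have xD: "x < nd M" "black x" "x \<notin> V0" using x by (auto simp: arcs_def)
  have ax: "a x \<notin> V0" "a x \<notin> C" using arc_a x by auto
  show ?thesis using ax x xD al_i[of "a x"] by (auto simp: HP_edge_def conflicts_def tocc_i)
qed

text \<open>A cut arc descends by exactly 1; for an uncut arc the difference is, up to 3, the charge
  on the white side of a tree edge.\<close>

lemma height_mod3:
  assumes x: "x \<in> arcs M"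
  shows "3 dvd V.h (s x) - V.h x + 1"
proof (cases "x \<in> C")
  case True
  then show ?thesis using V.pair_level[of x] x by (simp add: arcs_def)
next
  case False
  have "3 dvd charge T (side T (i (a x))) + 1"
    using T.charge_mod3 white_inner_iff x False by blast
  moreover have "(3::int) dvd 3 + k \<longleftrightarrow> 3 dvd k" for k by simp
  ultimately show ?thesis using arc_charge[OF x False]
    by (metis (no_types, opaque_lifting) add.assoc add_diff_eq)
qed

lemma admissible_iff:
  "admissible T \<longleftrightarrow> (\<forall>x\<in>arcs M - C. regular_arc M C x \<longleftrightarrow> x \<notin> conflicts M)"
  unfolding admissible_def white_inner_iff using blossom regular_iff HP_iff by auto

text \<open>The test on the closing detects conflicts among cut edges and the HP test those among
  uncut edges; together they exclude every conflict.\<close>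

lemma good_iff: "good T \<longleftrightarrow> conflicts M = {} \<and> (\<forall>x\<in>arcs M - C. regular_arc M C x)"
proof -
  have "(\<forall>P. closing_matching T P \<longrightarrow> (\<forall>(b, l)\<in>P. \<not> (tocc T (al T b) \<and> tocc T (al T l)))) \<longleftrightarrow>
      conflicts M \<inter> C = {}"
  proof -
    have "(\<forall>(b, l)\<in>cut_pairs M C T i. \<not> (tocc T (al T b) \<and> tocc T (al T l))) \<longleftrightarrow>
      (\<forall>x\<in>C. black x \<longrightarrow> \<not> (occ M x \<and> occ M (a x)))"
    proof -
      have "tocc T (al T (e x)) = occ M x \<and> tocc T (al T (e (a x))) = occ M (a x)" if "x \<in> C" for x
        using that C_V0[OF C_a[OF that]] by (simp add: tocc_i)
      then show ?thesis unfolding cut_pairs_def by blast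
    qed
    also have "\<dots> \<longleftrightarrow> conflicts M \<inter> C = {}"
    proof -
      have "x \<in> conflicts M \<longleftrightarrow> black x \<and> occ M x \<and> occ M (a x)" if "x \<in> C" for x
        using that by (simp add: conflicts_def arcs_def)
      then show ?thesis by blast
    qed
    finally show ?thesis by (simp add: closing_iff)
  qed
  moreover have "(\<forall>w. white_inner_dart T w \<longrightarrow> HP_edge T w \<and> regular_edge T w) \<longleftrightarrow>
      (\<forall>x\<in>arcs M - C. x \<notin> conflicts M \<and> regular_arc M C x)"
    unfolding white_inner_iff using regular_iff HP_iff by auto
  moreover have "conflicts M \<subseteq> arcs M" by (auto simp: conflicts_def)
  ultimately show ?thesis unfolding good_def using blossom by auto
qed

lemma n_NHP_eq: "n_NHP T = card (conflicts M - C)"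
proof -
  have "{{x, al T x} | x. inner_edge_dart T x \<and> \<not> HP_edge T x} = (\<lambda>x. {i x, i (a x)}) ` (conflicts M - C)"
  proof (intro equalityI subsetI)
    fix c assume "c \<in> {{x, al T x} | x. inner_edge_dart T x \<and> \<not> HP_edge T x}"
    then obtain w where w: "c = {w, al T w}" "inner_edge_dart T w" "\<not> HP_edge T w" by blast
    have wD: "w < nd T" using w by (simp add: inner_edge_dart_def)
    have sym: "inner_edge_dart T (al T w)" "\<not> HP_edge T (al T w)" "c = {al T w, al T (al T w)}"
      using w wD by (auto simp: inner_edge_dart_def HP_edge_def)
    have "tblk T (al T w) \<noteq> tblk T w" using blossom w by (simp add: blossom_tree_def)
    then obtain u where u: "c = {u, al T u}" "white_inner_dart T u" "\<not> HP_edge T u"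
      using w sym by (cases "tblk T w") (auto simp: white_inner_dart_def)
    then obtain x where x: "x \<in> arcs M" "x \<notin> C" "u = i (a x)" using white_inner_iff by blast
    then have "x \<in> conflicts M - C" using HP_iff u by auto
    moreover have "c = {i x, i (a x)}" using u x al_i[of "a x"] C_a_iff[of x] by (auto simp: arcs_def)
    ultimately show "c \<in> (\<lambda>x. {i x, i (a x)}) ` (conflicts M - C)" by blast
  next
    fix c assume "c \<in> (\<lambda>x. {i x, i (a x)}) ` (conflicts M - C)"
    then obtain x where x: "x \<in> conflicts M" "x \<notin> C" "c = {i x, i (a x)}" by blast
    have xa: "x \<in> arcs M" "x < nd M" using x by (auto simp: conflicts_def arcs_def)
    then have "white_inner_dart T (i (a x))" "\<not> HP_edge T (i (a x))" using white_inner_iff HP_iff x by auto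
    moreover have "c = {i (a x), al T (i (a x))}" using x al_i[of "a x"] C_a_iff[of x] xa by auto
    ultimately show "c \<in> {{x, al T x} | x. inner_edge_dart T x \<and> \<not> HP_edge T x}"
      by (auto simp: white_inner_dart_def)
  qed
  moreover have "inj_on (\<lambda>x. {i x, i (a x)}) (conflicts M - C)"
  proof (rule inj_onI)
    fix x y assume xy: "x \<in> conflicts M - C" "y \<in> conflicts M - C" "{i x, i (a x)} = {i y, i (a y)}"
    have D: "x < nd M" "black x" "y < nd M" "black y" using xy(1,2) by (simp_all add: conflicts_def arcs_def)
    then have "x \<noteq> a y" using black_a[of y] by metis
    then have "i x \<noteq> i (a y)" using D by simp
    then have "i x = i y" using xy(3) by (metis doubleton_eq_iff)
    then show "x = y" using D by simp
  qed
  ultimately show ?thesis unfolding n_NHP_def by (simp add: card_image)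
qed

end

context opened begin

text \<open>The additional black empty vertex of the map is the root vertex, which opening dissolves
  into leaves.\<close>

lemma nverts_eq: "nverts_bm M b q = nverts_bt T b q + (if b \<and> \<not> q then 1 else 0)"
proof -
  let ?A = "{x. x < nd M \<and> x \<notin> V0 \<and> black x = b \<and> occ M x = q}"
  have t: "{orb (sg T) y | y. y < nd T \<and> inner T y \<and> tblk T y = b \<and> tocc T y = q} = (\<lambda>x. i ` orb s x) ` ?A"
  proof (intro equalityI subsetI)
    fix c assume "c \<in> {orb (sg T) y | y. y < nd T \<and> inner T y \<and> tblk T y = b \<and> tocc T y = q}"
    then obtain y where y: "c = orb (sg T) y" "y < nd T" "kind T y = Inner" "tblk T y = b" "tocc T y = q"
      by (auto simp: inner_def)
    from y(2) obtain x where x: "y = i x" "x < nd M" "x \<notin> V0"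
      by (cases rule: T_cases) (use y kind_V0 kind_e in \<open>auto split: if_splits\<close>)
    then have "x \<in> ?A" using y tblk_i tocc_i by simp
    then show "c \<in> (\<lambda>x. i ` orb s x) ` ?A" using y x orb_sgT by blast
  next
    fix c assume "c \<in> (\<lambda>x. i ` orb s x) ` ?A"
    then obtain x where x: "c = i ` orb s x" "x < nd M" "x \<notin> V0" "black x = b" "occ M x = q" by blast
    then show "c \<in> {orb (sg T) y | y. y < nd T \<and> inner T y \<and> tblk T y = b \<and> tocc T y = q}"
      using orb_sgT[of x] kind_i tblk_i tocc_i i_lt by (auto simp: inner_def intro!: exI[of _ "i x"])
  qed
  have "inj_on (image i) (orb s ` ?A)"
  proof (rule inj_onI)
    fix c d assume "c \<in> orb s ` ?A" "d \<in> orb s ` ?A" "i ` c = i ` d"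
    moreover have "orb s x \<subseteq> D" if "x < nd M" for x using orb_in[OF bij_s] that by simp
    ultimately show "c = d" using inj_on_image_eq_iff[of i D c d] by (auto simp: inj_on_def)
  qed
  then have nt: "nverts_bt T b q = card (orb s ` ?A)"
    unfolding nverts_bt_def t using card_image[of "image i" "orb s ` ?A"] by (simp add: image_image)
  have m: "{orb s x | x. x < nd M \<and> black x = b \<and> occ M x = q} =
      orb s ` ?A \<union> (if b \<and> \<not> q then {orb s r} else {})"
  proof (intro equalityI subsetI)
    fix c assume "c \<in> {orb s x | x. x < nd M \<and> black x = b \<and> occ M x = q}"
    then obtain x where x: "c = orb s x" "x < nd M" "black x = b" "occ M x = q" by blast
    show "c \<in> orb s ` ?A \<union> (if b \<and> \<not> q then {orb s r} else {})"
    proof (cases "x \<in> V0")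
      case True
      then have "x \<in> orb s r" using s_cycle[OF r_in] by (auto simp: root_darts_def)
      then have "c = orb s r" using orb_eq[OF finite_lessThan bij_s, of r x] x by simp
      then show ?thesis using True x V0_black[OF True] V0_occ[OF True] by auto
    qed (use x in blast)
  next
    fix c assume "c \<in> orb s ` ?A \<union> (if b \<and> \<not> q then {orb s r} else {})"
    then show "c \<in> {orb s x | x. x < nd M \<and> black x = b \<and> occ M x = q}"
      using r_in black_r occ_r by (auto split: if_splits)
  qed
  have rA: "orb s r \<notin> orb s ` ?A"
  proof
    assume "orb s r \<in> orb s ` ?A"
    then obtain x where "x \<notin> V0" "orb s r = orb s x" by blast
    then show False using orb_self[of x s] s_cycle[OF r_in] by (auto simp: root_darts_def)
  qed
  define B where "B = orb s ` ?A"
  have B: "finite B" "orb s r \<notin> B" unfolding B_def by (simp, rule rA)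
  have "card (B \<union> (if b \<and> \<not> q then {orb s r} else {})) = card B + (if b \<and> \<not> q then 1 else 0)"
    using B by simp
  then show ?thesis unfolding nverts_bm_def m nt B_def .
qed

end

section \<open>Constructing the opening and the closing\<close>

text \<open>The old darts keep their names, and an enumeration of the cut darts supplies fresh darts
  from \<open>nd M\<close> on as their stubs.\<close>

lemma (in bicubic_map) opens_to_exists:
  assumes cut: "cutset M C"
  obtains T i where "opens_to M C T i" "wf_cmap T"
proof -
  have C: "x < nd M" "a x \<in> C" "x \<notin> V0" if "x \<in> C" for x using that cut by (auto simp: cutset_def)
  have fin: "finite C" using cut finite_subset by (auto simp: cutset_def)
  then obtain h where h: "bij_betw h C {0..<card C}" using ex_bij_betw_finite_nat by blast
  define f where "f x = nd M + h x" for x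
  define g where "g = inv_into C f"
  have hin: "h x < card C" if "x \<in> C" for x using h that by (auto dest: bij_betwE)
  have inj: "inj_on f C" using h by (auto simp: bij_betw_def inj_on_def f_def)
  have gf: "g (f x) = x" if "x \<in> C" for x using inj that by (simp add: g_def)
  have ran: "\<exists>x\<in>C. y = f x" if "nd M \<le> y" "y < nd M + card C" for y
  proof -
    have "y - nd M \<in> h ` C" using h that by (auto simp: bij_betw_def)
    then obtain x where "x \<in> C" "y - nd M = h x" by blast
    then have "x \<in> C" "y = f x" using that by (simp_all add: f_def)
    then show ?thesis by blast
  qed
  have flt: "nd M \<le> f x \<and> f x < nd M + card C" if "x \<in> C" for x using hin[OF that] by (simp add: f_def)
  define T :: btree where "T = \<lparr>nd = nd M + card C, sg = (\<lambda>y. if y < nd M \<and> y \<notin> V0 then s y else y),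
    al = (\<lambda>y. if y < nd M then (if y \<in> C then f y else a y) else if y < nd M + card C then g y else y),
    kind = (\<lambda>y. if y < nd M then (if y \<in> V0 then Leaf else Inner) else if black (g y) then Bud else Leaf),
    tblk = blk M, tocc = occ M, rtl = r\<rparr>"
  have T: "nd T = nd M + card C" "sg T = (\<lambda>y. if y < nd M \<and> y \<notin> V0 then s y else y)"
    "al T = (\<lambda>y. if y < nd M then (if y \<in> C then f y else a y) else if y < nd M + card C then g y else y)"
    "kind T = (\<lambda>y. if y < nd M then (if y \<in> V0 then Leaf else Inner) else if black (g y) then Bud else Leaf)"
    "tblk T = blk M" "tocc T = occ M" "rtl T = r" by (simp_all add: T_def)
  have "opens_to M C T id" unfolding opens_to_def
  proof (intro conjI allI impI ballI)
    fix y assume y: "y < nd T"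
    show "y \<in> id ` D \<or> (\<exists>x\<in>C. y = al T (id x))"
    proof (cases "y < nd M")
      case False
      then obtain x where "x \<in> C" "y = f x" using ran[of y] y T by auto
      then show ?thesis using C by (auto simp: T)
    qed simp
  next
    fix x assume x: "x \<in> C"
    show "al T (id x) < nd T" "al T (id x) \<notin> id ` D" "al T (al T (id x)) = id x"
      "sg T (al T (id x)) = al T (id x)" "kind T (al T (id x)) = (if black x then Bud else Leaf)"
      using x C[OF x] flt[OF x] gf[OF x] by (auto simp: T)
  qed (auto simp: T)
  moreover have "wf_cmap T" unfolding wf_cmap_def
  proof (intro conjI allI impI)
    show "bij_betw (sg T) {..<nd T} {..<nd T}"
    proof -
      have "inj_on (sg T) {..<nd T}"
      proof (rule inj_onI)
        fix x y assume "sg T x = sg T y"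
        then show "x = y" using s_inj[of x y] V0_s[of x] V0_s[of y] s_in[of x] s_in[of y]
          by (auto simp: T split: if_splits)
      qed
      moreover have "sg T ` {..<nd T} \<subseteq> {..<nd T}" using s_in by (auto simp: T trans_less_add1)
      ultimately show ?thesis using endo_inj_surj[of "{..<nd T}" "sg T"] by (simp only: bij_betw_def finite_lessThan)
    qed
    have inv: "al T x \<in> {..<nd T} \<and> al T (al T x) = x \<and> al T x \<noteq> x" if x: "x < nd T" for x
    proof (cases "x < nd M")
      case True
      then show ?thesis
      proof (cases "x \<in> C")
        case xC: True
        then show ?thesis using C[OF xC] flt[OF xC] gf[OF xC] by (auto simp: T)
      next
        case False
        then have "a x \<notin> C" using C(2)[of "a x"] True by auto
        moreover have "a x < nd M + card C" using a_in[OF True] by simp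
        ultimately show ?thesis using False True by (simp add: T)
      qed
    next
      case False
      then obtain y where y: "y \<in> C" "x = f y" using ran[of x] x T by auto
      then show ?thesis using C[OF y(1)] flt[OF y(1)] gf[OF y(1)] by (auto simp: T)
    qed
    show "bij_betw (al T) {..<nd T} {..<nd T}" by (rule bij_betw_involution) (use inv in auto)
    show "al T (al T x) = x" "al T x \<noteq> x" if "x < nd T" for x using inv[OF that] by auto
  qed (auto simp: T)
  ultimately show thesis using that by blast
qed

text \<open>The darts of the closed map are the inner darts and the three unmatched leaves. Matched
  ends are discarded, and the two half-edges leading to a matched pair are joined.\<close>

lemma (in rooted_tree) closing_map:
  assumes "rooted_blossom_tree T"
  obtains M C i where "bicubic M" "valid_cut M C" "opens_to M C T i"
proof -
  obtain P where P: "full_matching P" using rooted_full_matching[OF assms] .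
  have nc: "noncrossing P" using P by (simp add: full_matching_def)
  have pk: "b < nd T \<and> l < nd T \<and> kind T b = Bud \<and> kind T l = Leaf \<and> l \<noteq> rtl T" if "(b, l) \<in> P" for b l
    using nc that endsD unfolding noncrossing_def by blast
  have pf: "l = l'" if "(b, l) \<in> P" "(b, l') \<in> P" for b l l' using nc that unfolding noncrossing_def by blast
  have pb: "b = b'" if "(b, l) \<in> P" "(b', l) \<in> P" for b b' l using nc that unfolding noncrossing_def by blast
  have full: "\<exists>l. (b, l) \<in> P" if "b < nd T" "kind T b = Bud" for b
    using P that by (auto simp: full_matching_def ends_def inner_def)
  define U where "U = {x. x < nd T \<and> kind T x = Leaf \<and> x \<notin> snd ` P}"
  have finU: "finite U" by (simp add: U_def)
  have rU: "rtl T \<in> U" using rtl_lt rtl_Leaf pk by (force simp: U_def)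
  have cardU: "card U = 3"
  proof -
    have fP: "fst ` P = {x. x < nd T \<and> kind T x = Bud}"
    proof (intro equalityI subsetI)
      fix b assume "b \<in> {x. x < nd T \<and> kind T x = Bud}"
      then obtain l where "(b, l) \<in> P" using full by blast
      then show "b \<in> fst ` P" by force
    qed (use pk in force)
    have "inj_on fst P" "inj_on snd P" using pf pb by (auto simp: inj_on_def)
    then have c: "card (snd ` P) = card {x. x < nd T \<and> kind T x = Bud}"
      using card_image[of fst P] card_image[of snd P] fP by simp
    have sub: "snd ` P \<subseteq> {x. x < nd T \<and> kind T x = Leaf}" using pk by force
    have "U = {x. x < nd T \<and> kind T x = Leaf} - snd ` P" by (auto simp: U_def)
    moreover have "finite (snd ` P)" using sub finite_subset[of "snd ` P" "{..<nd T}"] by auto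
    ultimately have "card U = card {x. x < nd T \<and> kind T x = Leaf} - card {x. x < nd T \<and> kind T x = Bud}"
      using card_Diff_subset[OF _ sub] c by simp
    moreover have "int (card {x. x < nd T \<and> kind T x = Leaf}) - int (card {x. x < nd T \<and> kind T x = Bud}) = 3"
      using blossom by (simp add: blossom_tree_def)
    ultimately show ?thesis by linarith
  qed
  obtain u1 u2 where u: "U = {rtl T, u1, u2}" "p u1 < p u2" "rtl T \<noteq> u1" "rtl T \<noteq> u2" "u1 \<noteq> u2"
  proof -
    have "card (U - {rtl T}) = 2" using cardU rU finU by simp
    then obtain v w where vw: "U - {rtl T} = {v, w}" "v \<noteq> w" using card_2_iff by metis
    then have U: "U = {rtl T, v, w}" "rtl T \<noteq> v" "rtl T \<noteq> w" using rU by auto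
    have "v < nd T" "w < nd T" using U by (auto simp: U_def)
    then have "p v \<noteq> p w" using cyc.pos_inj[of v w] vw by auto
    then show thesis using that[of v w] that[of w v] U vw(2) by (auto simp: insert_commute neq_iff)
  qed
  define A where "A = {x. x < nd T \<and> kind T x = Inner} \<union> U"
  have UA: "U \<subseteq> A" by (auto simp: A_def)
  have UL: "x < nd T \<and> kind T x = Leaf" if "x \<in> U" for x using that by (simp add: U_def)
  have AT: "x < nd T" if "x \<in> A" for x using that UL by (auto simp: A_def)
  have A_iff: "x \<in> A \<longleftrightarrow> kind T x = Inner \<or> x \<in> U" if "x < nd T" for x using that by (auto simp: A_def)
  have inU: "x \<notin> U" if "kind T x = Inner" for x using that UL by auto
  have s_end: "s x = x" if "x < nd T" "kind T x \<noteq> Inner" for x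
  proof -
    have "card (orb s x) = 1" using blossom that by (simp add: blossom_tree_def inner_iff deg_def)
    then obtain y where "orb s x = {y}" using card_1_singletonE by blast
    then show ?thesis using orb_self[of x s] orb_step[OF orb_self, of s x] by simp
  qed
  have s3: "s (s (s x)) = x \<and> s x \<noteq> x \<and> s (s x) \<noteq> x" if "x < nd T" "kind T x = Inner" for x
    using orb_card_3D[OF bij_s, of x] blossom that by (simp add: blossom_tree_def inner_iff deg_def)
  define mate where "mate z = (if kind T z = Bud then (SOME l. (z, l) \<in> P) else (SOME b. (b, z) \<in> P))" for z
  have mate: "mate b = l" "mate l = b" if bl: "(b, l) \<in> P" for b l
  proof -
    have "(b, SOME l. (b, l) \<in> P) \<in> P" using bl by (rule someI)
    then show "mate b = l" using pk[OF bl] pf[OF _ bl] by (simp add: mate_def)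
    have "(SOME b. (b, l) \<in> P, l) \<in> P" using bl by (rule someI)
    then show "mate l = b" using pk[OF bl] pb[OF _ bl] by (simp add: mate_def)
  qed
  have matched: "\<exists>b l. (b, l) \<in> P \<and> (z = b \<or> z = l)" if "z < nd T" "z \<notin> A" for z
  proof (cases "kind T z")
    case Bud
    then show ?thesis using full that by blast
  next
    case Leaf
    then have "z \<in> snd ` P" using that by (auto simp: A_def U_def)
    then show ?thesis by force
  qed (use that A_iff in auto)
  have pairA: "b \<notin> A \<and> l \<notin> A" if "(b, l) \<in> P" for b l
    using pk[OF that] that A_iff[of b] A_iff[of l] UL[of b] by (force simp: U_def)
  have mate_facts: "mate z < nd T \<and> mate z \<notin> A \<and> mate (mate z) = z \<and> mate z \<noteq> z \<and>
      (kind T (mate z) = Bud \<longleftrightarrow> kind T z = Leaf) \<and> (kind T (mate z) = Leaf \<longleftrightarrow> kind T z = Bud)"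
    if z: "z < nd T" "z \<notin> A" for z
  proof -
    obtain b l where bl: "(b, l) \<in> P" "z = b \<or> z = l" using matched[OF z] by blast
    then show ?thesis using mate[OF bl(1)] pk[OF bl(1)] pairA[OF bl(1)] by auto
  qed
  have end_a: "kind T (a z) = Inner" if "z < nd T" "kind T z \<noteq> Inner" for z
    using that Bud_a Leaf_a kind_cases[of z] by blast
  have notA: "kind T z \<noteq> Inner" if "z < nd T" "z \<notin> A" for z using that A_iff by blast
  \<comment> \<open>On the contour \<open>u1\<close> precedes \<open>u2\<close>. Seen from the new
    vertex the cyclic order is reversed, hence \<open>rtl T\<close>, \<open>u2\<close>,
    \<open>u1\<close>, as the last clause of \<open>valid_cut\<close> demands.\<close>
  define rot where "rot x = (if x = rtl T then u2 else if x = u2 then u1 else rtl T)" for x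
  define sA where "sA x = (if x \<in> U then rot x else s x)" for x
  \<comment> \<open>A dart that faces a discarded end is joined to the dart facing the mate of that
    end.\<close>
  define aA where "aA x = (if a x \<in> A then a x else a (mate (a x)))" for x
  have sA_in: "sA x \<in> A" "sA x \<in> U \<longleftrightarrow> x \<in> U" if "x \<in> A" for x
  proof -
    show "sA x \<in> A"
      using that u(1) UA AT[OF that] A_iff[of x] A_iff[of "s x"] by (auto simp: sA_def rot_def)
    show "sA x \<in> U \<longleftrightarrow> x \<in> U"
      using that u(1) AT[OF that] A_iff[of x] inU[of "s x"] by (auto simp: sA_def rot_def)
  qed
  have sA3: "sA (sA (sA x)) = x \<and> sA x \<noteq> x \<and> sA (sA x) \<noteq> x" if x: "x \<in> A" for x
  proof (cases "x \<in> U")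
    case True
    then show ?thesis using u by (auto simp: sA_def rot_def)
  next
    case False
    then have "kind T x = Inner" "x < nd T" using x AT A_iff by auto
    then show ?thesis using s3[of x] inU[of x] inU[of "s x"] inU[of "s (s x)"] by (simp add: sA_def)
  qed
  have aA_in: "aA x \<in> A \<and> aA (aA x) = x \<and> aA x \<noteq> x" if x: "x \<in> A" for x
  proof (cases "a x \<in> A")
    case True
    then show ?thesis using x AT[OF x] a_neq by (simp add: aA_def)
  next
    case False
    let ?z = "a x"
    have z: "?z < nd T" "?z \<notin> A" using AT[OF x] False by auto
    note m = mate_facts[OF z]
    have "kind T (a (mate ?z)) = Inner" using end_a[of "mate ?z"] notA[of "mate ?z"] m by blast
    then have "a (mate ?z) \<in> A" using A_iff[of "a (mate ?z)"] m by simp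
    moreover have "a (a (mate ?z)) = mate ?z" using m by simp
    moreover have "a (mate ?z) \<noteq> x"
    proof
      assume "a (mate ?z) = x"
      then have "mate ?z = ?z" using m by (metis aa)
      then show False using m by simp
    qed
    ultimately show ?thesis using False m AT[OF x] by (simp add: aA_def)
  qed
  define m where "m = card A"
  have finA: "finite A" using AT finite_subset[of A D] by blast
  obtain i where i: "bij_betw i {..<m} A"
    using ex_bij_betw_nat_finite[OF finA] by (auto simp: m_def lessThan_atLeast0)
  define j where "j = inv_into {..<m} i"
  have iA: "i k \<in> A" "j (i k) = k" if "k < m" for k
    using i that by (auto simp: j_def bij_betw_def dest: bij_betwE)
  have jm: "j x < m" "i (j x) = x" if "x \<in> A" for x
    using i that by (auto simp: j_def bij_betw_def inv_into_into f_inv_into_f)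
  \<comment> \<open>The values of \<open>tblk\<close> and \<open>tocc\<close> on leaves are
    arbitrary, so the vertex made of the unmatched leaves is declared black and empty
    explicitly.\<close>
  define M :: bmap where "M = \<lparr>nd = m, sg = (\<lambda>k. if k < m then j (sA (i k)) else k),
    al = (\<lambda>k. if k < m then j (aA (i k)) else k), blk = (\<lambda>k. i k \<in> U \<or> tblk T (i k)),
    occ = (\<lambda>k. i k \<notin> U \<and> tocc T (i k)), rt = j (rtl T)\<rparr>"
  have M: "nd M = m" "\<And>k. k < m \<Longrightarrow> sg M k = j (sA (i k))" "\<And>k. k < m \<Longrightarrow> al M k = j (aA (i k))"
    "\<And>k. \<not> k < m \<Longrightarrow> sg M k = k" "\<And>k. \<not> k < m \<Longrightarrow> al M k = k"
    "\<And>k. blk M k \<longleftrightarrow> i k \<in> U \<or> tblk T (i k)" "\<And>k. occ M k \<longleftrightarrow> i k \<notin> U \<and> tocc T (i k)" "rt M = j (rtl T)"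
    by (simp_all add: M_def)
  have sgM: "sg M k < m" "i (sg M k) = sA (i k)" and alM: "al M k < m" "i (al M k) = aA (i k)" if "k < m" for k
    using that M(2,3) jm sA_in(1)[OF iA(1)[OF that]] aA_in[OF iA(1)[OF that]] by auto
  have i_eq: "k = k'" if "i k = i k'" "k < m" "k' < m" for k k' using iA that by metis
  have sg3: "sg M (sg M (sg M k)) = k \<and> sg M k \<noteq> k \<and> sg M (sg M k) \<noteq> k" if k: "k < m" for k
  proof -
    have e: "i (sg M (sg M k)) = sA (sA (i k))" "i (sg M (sg M (sg M k))) = sA (sA (sA (i k)))"
      "sg M (sg M k) < m" "sg M (sg M (sg M k)) < m" using sgM k by auto
    show ?thesis using sA3[OF iA(1)[OF k]] e sgM[OF k] i_eq k by metis
  qed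
  have bij_sgM: "bij_betw (sg M) {..<m} {..<m}"
    by (rule bij_betw_byWitness[where f' = "\<lambda>k. sg M (sg M k)"]) (use sg3 sgM in auto)
  have bic: "bicubic M" unfolding bicubic_def wf_cmap_def M(1)
  proof (intro conjI allI impI)
    show "bij_betw (sg M) {..<m} {..<m}" by (rule bij_sgM)
    have al2: "al M k < m \<and> al M (al M k) = k \<and> al M k \<noteq> k" if k: "k < m" for k
    proof -
      have "i (al M (al M k)) = i k" using alM[of "al M k"] alM[of k] k aA_in[OF iA(1)[OF k]] by simp
      moreover have "i (al M k) \<noteq> i k" using alM k aA_in[OF iA(1)[OF k]] by simp
      ultimately show ?thesis using i_eq alM k by metis
    qed
    show "bij_betw (al M) {..<m} {..<m}" by (rule bij_betw_involution) (use al2 in auto)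
    show "al M (al M k) = k" "al M k \<noteq> k" if "k < m" for k using al2[OF that] by auto
    show "sg M k = k" "al M k = k" if "m \<le> k" for k using M that by auto
    show "blk M (sg M k) = blk M k" "occ M (sg M k) = occ M k" if k: "k < m" for k
    proof -
      have "sA (i k) \<in> U \<longleftrightarrow> i k \<in> U" using sA_in iA k by simp
      moreover have "i k \<notin> U \<Longrightarrow> sA (i k) = s (i k) \<and> i k < nd T" using AT iA k by (simp add: sA_def)
      ultimately show "blk M (sg M k) = blk M k" "occ M (sg M k) = occ M k"
        using M(6,7) sgM[OF k] by (metis tblk_s, metis tocc_s)
    qed
    show "deg M k = 3" if k: "k < m" for k unfolding deg_def
    proof (rule orb_card_3I)
      have "sg M (sg M k) \<noteq> sg M k" using sg3[of "sg M k"] sgM k by blast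
      then show "sg M (sg M k) \<noteq> sg M k" .
    qed (use sg3 k in auto)
    show "blk M (al M k) \<noteq> blk M k" if k: "k < m" for k
    proof -
      let ?x = "i k"
      have x: "?x \<in> A" "?x < nd T" using iA k AT by auto
      have bal: "blk M (al M k) \<longleftrightarrow> aA ?x \<in> U \<or> tblk T (aA ?x)" using M(6) alM k by simp
      show ?thesis
      proof (cases "a ?x \<in> A")
        case aA': True
        then have e: "aA ?x = a ?x" by (simp add: aA_def)
        consider "?x \<in> U" | "kind T ?x = Inner" "a ?x \<in> U" | "kind T ?x = Inner" "kind T (a ?x) = Inner"
          using x aA' A_iff[of ?x] A_iff[of "a ?x"] by auto
        then show ?thesis
        proof cases
          case 1
          then have "kind T (a ?x) = Inner" "\<not> tblk T (a ?x)" using Leaf_a[of ?x] UL[of ?x] by auto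
          then show ?thesis using bal e M(6) 1 inU by auto
        next
          case 2
          then have "\<not> tblk T ?x" using Leaf_a[of "a ?x"] UL[of "a ?x"] x by simp
          then show ?thesis using bal e M(6) 2 inU by auto
        next
          case 3
          then show ?thesis using bal e M(6) inU inner_a[of ?x] x by auto
        qed
      next
        case False
        have z: "a ?x < nd T" "a ?x \<notin> A" using x False by auto
        note mf = mate_facts[OF z]
        have xU: "?x \<notin> U" using end_a[of ?x] UL[of ?x] z A_iff by auto
        have e: "aA ?x = a (mate (a ?x))" using False by (simp add: aA_def)
        have "kind T (a (mate (a ?x))) = Inner" using end_a[of "mate (a ?x)"] notA[of "mate (a ?x)"] mf by blast
        then have bal': "blk M (al M k) \<longleftrightarrow> tblk T (a (mate (a ?x)))" using bal e inU by auto
        have bk: "blk M k \<longleftrightarrow> tblk T ?x" using M(6) xU by simp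
        show ?thesis
        proof (cases "kind T (a ?x) = Bud")
          case True
          then have "tblk T ?x" using Bud_a[OF z(1)] x by simp
          moreover have "\<not> tblk T (a (mate (a ?x)))" using Leaf_a[of "mate (a ?x)"] mf True by blast
          ultimately show ?thesis using bal' bk by simp
        next
          case F: False
          then have lf: "kind T (a ?x) = Leaf" using kind_cases[of "a ?x"] notA[OF z] by blast
          then have "\<not> tblk T ?x" using Leaf_a[OF z(1)] x by simp
          moreover have "tblk T (a (mate (a ?x)))" using Bud_a[of "mate (a ?x)"] mf lf by blast
          ultimately show ?thesis using bal' bk by simp
        qed
      qed
    qed
    show "rt M < m" "blk M (rt M)" "\<not> occ M (rt M)" using M(6,7,8) jm rU UA by auto
  qed
  interpret B: bicubic_map M by unfold_locales (rule bic)
  have rtm: "rt M < m" "i (rt M) = rtl T" using M(8) jm rU UA by auto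
  have sr: "sg M (rt M) < m" "i (sg M (rt M)) = u2" "sg M (sg M (rt M)) < m" "i (sg M (sg M (rt M))) = u1"
    using sgM rtm rU u by (auto simp: sA_def rot_def)
  have V0: "k \<in> root_darts M \<longleftrightarrow> i k \<in> U" if k: "k < m" for k
  proof
    assume "i k \<in> U"
    then have "i k = i (rt M) \<or> i k = i (sg M (rt M)) \<or> i k = i (sg M (sg M (rt M)))" using u(1) rtm sr by auto
    then show "k \<in> root_darts M" using i_eq k rtm sr unfolding root_darts_def by blast
  qed (use u(1) rtm sr in \<open>auto simp: root_darts_def\<close>)
  \<comment> \<open>An edge of the closed map counts as cut exactly if its dart faced a discarded
    end of the tree.\<close>
  define C where "C = {k. k < m \<and> a (i k) \<notin> A}"
  have CU: "i k \<notin> U" if "k \<in> C" for k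
  proof
    assume "i k \<in> U"
    then have "kind T (a (i k)) = Inner" "a (i k) < nd T" using Leaf_a[of "i k"] UL[of "i k"] by auto
    then show False using that A_iff by (auto simp: C_def)
  qed
  have C_al: "al M k \<in> C \<and> a (i (al M k)) = mate (a (i k))" if k: "k \<in> C" for k
  proof -
    have km: "k < m" and z: "a (i k) < nd T" "a (i k) \<notin> A" using k AT iA by (auto simp: C_def)
    have "i (al M k) = a (mate (a (i k)))" using alM[OF km] z by (simp add: aA_def)
    then show ?thesis using mate_facts[OF z] alM[OF km] by (simp add: C_def)
  qed
  have cut: "cutset M C" unfolding cutset_def M(1)
  proof (intro conjI ballI)
    show "C \<subseteq> {..<m}" by (auto simp: C_def)
    show "al M k \<in> C" if "k \<in> C" for k using C_al that by blast
    show "C \<inter> root_darts M = {}" using CU V0 by (auto simp: C_def)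
  qed
  have iD: "i ` {..<m} = A" using i by (simp add: bij_betw_def)
  have op: "opens_to M C T i" unfolding opens_to_def M(1) iD
  proof (intro conjI allI impI ballI)
    show "inj_on i {..<m}" using i by (simp add: bij_betw_def)
    show "i (rt M) = rtl T" by (rule rtm)
  next
    fix k assume "k < m"
    then show "i k < nd T" using iA AT by simp
  next
    fix k assume k: "k < m" "k \<notin> root_darts M"
    then have xU: "i k \<notin> U" using V0 by simp
    then show "kind T (i k) = Inner" using A_iff[of "i k"] iA(1)[OF k(1)] AT by blast
    show "s (i k) = i (sg M k)" using sgM k xU by (simp add: sA_def)
    show "tblk T (i k) = blk M k" "tocc T (i k) = occ M k" using M xU by auto
  next
    fix k assume k: "k \<in> root_darts M"
    then have "k < m" using M(1) B.V0_in by simp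
    then have "i k \<in> U" using V0 k by simp
    then show "kind T (i k) = Leaf" "s (i k) = i k" using UL[of "i k"] s_end[of "i k"] by auto
  next
    fix k assume "k < m" "k \<notin> C"
    then show "a (i k) = i (al M k)" using alM[of k] by (simp add: C_def aA_def)
  next
    fix k assume k: "k \<in> C"
    have km: "k < m" and z: "a (i k) < nd T" "a (i k) \<notin> A" using k AT iA by (auto simp: C_def)
    show "a (i k) < nd T" "a (i k) \<notin> A" by (rule z)+
    show "a (a (i k)) = i k" using AT iA km by simp
    show "s (a (i k)) = a (i k)" using s_end[OF z(1)] notA[OF z] by simp
    show "kind T (a (i k)) = (if blk M k then Bud else Leaf)"
      using Bud_a[OF z(1)] Leaf_a[OF z(1)] kind_cases[of "a (i k)"] notA[OF z] M(6)[of k] CU[OF k] AT iA km by auto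
  next
    fix y assume y: "y < nd T"
    show "y \<in> A \<or> (\<exists>x\<in>C. y = a (i x))"
    proof (cases "y \<in> A")
      case False
      then have "a y \<in> A" using end_a[of y] notA[of y] A_iff[of "a y"] y by simp
      then have "j (a y) \<in> C" "y = a (i (j (a y)))" using jm[of "a y"] y False by (auto simp: C_def)
      then show ?thesis by blast
    qed simp
  qed
  interpret O: opened_tree M C T i by unfold_locales (use cut op wf blossom in auto)
  have "cut_pairs M C T i = P"
  proof (intro equalityI subsetI)
    fix q assume "q \<in> cut_pairs M C T i"
    then obtain k where k: "k \<in> C" "blk M k" "q = (a (i k), a (i (al M k)))" by (auto simp: cut_pairs_def)
    have z: "a (i k) < nd T" "a (i k) \<notin> A" using k AT iA by (auto simp: C_def)
    have "kind T (a (i k)) = Bud" using O.kind_e[OF k(1)] k by simp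
    then obtain l where "(a (i k), l) \<in> P" using full z by blast
    then show "q \<in> P" using mate C_al[OF k(1)] k by simp
  next
    fix q assume q: "q \<in> P"
    obtain b l where bl: "q = (b, l)" by force
    have bk: "b < nd T" "kind T b = Bud" "b \<notin> A" using pk pairA q bl by auto
    then have "a b \<in> A" using Bud_a[of b] A_iff[of "a b"] by simp
    then have k: "j (a b) \<in> C" "i (j (a b)) = a b" using jm[of "a b"] bk by (auto simp: C_def)
    have "blk M (j (a b))" using M(6) k Bud_a[of b] bk by simp
    moreover have "a (i (j (a b))) = b" using k bk by simp
    moreover have "a (i (al M (j (a b)))) = l" using C_al[OF k(1)] k bk mate q bl by simp
    ultimately show "q \<in> cut_pairs M C T i" using k bl by (auto simp: cut_pairs_def intro!: exI[of _ "j (a b)"])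
  qed
  then have "full_matching (cut_pairs M C T i)" using P by simp
  then have "valid_cut M C" unfolding valid_cut_def
    using cut O.trans O.nd_M O.full_matching_iff O.pT_ii[of "sg M (sg M (rt M))" "sg M (rt M)"] u(2) sr M(1) by auto
  then show thesis using that bic op by blast
qed

section \<open>Isomorphisms\<close>

text \<open>An opening consists of the embedded darts and one stub per cut dart, so matching both
  kinds leaves no freedom.\<close>

lemma opens_to_iso:
  assumes "bicubic M" "cutset M C" "opens_to M C T i" "wf_cmap T" "opens_to M C T' i'" "wf_cmap T'"
  shows "btree_iso T T'"
proof -
  interpret A: opened M C T i by unfold_locales (use assms in auto)
  interpret B: opened M C T' i' by unfold_locales (use assms in auto)
  define n where "n = inv_into A.D i"
  have n: "n (i x) = x" if "x < nd M" for x
    unfolding n_def using that by (intro inv_into_f_f) (auto simp: inj_on_def)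
  define f where "f y = (if y \<in> i ` A.D then i' (n y) else al T' (i' (n (al T y))))" for y
  have fi: "f (i x) = i' x" if "x < nd M" for x using that n by (simp add: f_def)
  have fe: "f (A.e x) = B.e x" if "x \<in> C" for x
    using A.e_notin[OF that] n that by (simp add: f_def)
  have ndeq: "nd T = nd T'" using A.nd_T B.nd_T by simp
  have "bij_betw f {..<nd T} {..<nd T'}"
  proof -
    have "f ` {..<nd T} \<subseteq> {..<nd T}"
    proof
      fix z assume "z \<in> f ` {..<nd T}"
      then obtain y where y: "z = f y" "y < nd T" by auto
      from A.T_dart[OF y(2)] show "z \<in> {..<nd T}" using y fi fe ndeq by auto
    qed
    moreover have "inj_on f {..<nd T}"
    proof (rule inj_onI)
      fix y z assume yz: "y \<in> {..<nd T}" "z \<in> {..<nd T}" "f y = f z"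
      from yz(1,2) consider u v where "y = i u" "z = i v" "u < nd M" "v < nd M"
        | u v where "y = i u" "z = A.e v" "u < nd M" "v \<in> C"
        | u v where "y = A.e u" "z = i v" "u \<in> C" "v < nd M"
        | u v where "y = A.e u" "z = A.e v" "u \<in> C" "v \<in> C"
        unfolding A.DT_eq by blast
      then show "y = z"
        by cases (use yz(3) fi fe B.e_neq_i in auto)
    qed
    ultimately show ?thesis using endo_inj_surj[of "{..<nd T}" f] ndeq by (simp add: bij_betw_def)
  qed
  moreover have "f (sg T y) = sg T' (f y) \<and> f (al T y) = al T' (f y) \<and> kind T' (f y) = kind T y \<and>
      (inner T y \<longrightarrow> tblk T' (f y) = tblk T y \<and> tocc T' (f y) = tocc T y)" if y: "y < nd T" for y
    using y
  proof (cases rule: A.T_cases)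
    case (inner x)
    have "f (al T (i x)) = al T' (i' x)"
      using inner fi[of "al M x"] fe[of x] A.al_i[of x] B.al_i[of x] by (cases "x \<in> C") auto
    then show ?thesis
      using inner fi A.sg_i B.sg_i A.kind_i B.kind_i A.tblk_i B.tblk_i A.tocc_i B.tocc_i by simp
  next
    case (root_leaf x)
    have "f (al T (i x)) = al T' (i' x)"
      using root_leaf fi[of "al M x"] A.al_i[of x] B.al_i[of x] by auto
    then show ?thesis
      using root_leaf fi A.sg_V0 B.sg_V0 A.kind_V0 B.kind_V0 by (simp add: inner_def)
  next
    case (cut_end x)
    then show ?thesis using fe fi A.kind_e B.kind_e by (simp add: inner_def)
  qed
  moreover have "f (rtl T) = rtl T'" using fi[of "rt M"] A.i_r B.i_r by simp
  ultimately show ?thesis unfolding btree_iso_def using ndeq by blast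
qed

lemma opens_to_btree_iso:
  assumes "bicubic M" "cutset M C" "opens_to M C T i" "wf_cmap T" "btree_iso T T'"
  shows "\<exists>i'. opens_to M C T' i'"
proof -
  interpret A: opened M C T i by unfold_locales (use assms in auto)
  obtain f where ndeq: "nd T = nd T'" and f: "bij_betw f {..<nd T} {..<nd T'}" "f (rtl T) = rtl T'"
    and st: "\<And>y. y < nd T \<Longrightarrow> f (sg T y) = sg T' (f y)" "\<And>y. y < nd T \<Longrightarrow> f (al T y) = al T' (f y)"
      "\<And>y. y < nd T \<Longrightarrow> kind T' (f y) = kind T y"
      "\<And>y. y < nd T \<Longrightarrow> kind T y = Inner \<Longrightarrow> tblk T' (f y) = tblk T y \<and> tocc T' (f y) = tocc T y"
    using assms(5) unfolding btree_iso_def inner_def by blast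
  have inj: "f y = f z \<longleftrightarrow> y = z" if "y < nd T" "z < nd T" for y z
    using f(1) that by (auto simp: bij_betw_def inj_on_def)
  have ft: "f y < nd T'" if "y < nd T" for y using f(1) that by (auto dest: bij_betwE)
  have "opens_to M C T' (f \<circ> i)" unfolding opens_to_def
  proof (intro conjI allI impI ballI)
    show "inj_on (f \<circ> i) {..<nd M}" using inj by (auto simp: inj_on_def)
    show "(f \<circ> i) (rt M) = rtl T'" using A.i_r f by simp
  next
    fix x assume "x < nd M"
    then show "(f \<circ> i) x < nd T'" using ft by simp
  next
    fix x assume x: "x < nd M" "x \<notin> root_darts M"
    then show "kind T' ((f \<circ> i) x) = Inner" "sg T' ((f \<circ> i) x) = (f \<circ> i) (sg M x)"
      "tblk T' ((f \<circ> i) x) = blk M x" "tocc T' ((f \<circ> i) x) = occ M x"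
      using A.kind_i A.sg_i A.tblk_i A.tocc_i st(1)[of "i x", symmetric] st(3,4)[of "i x"] by simp_all
  next
    fix x assume x: "x \<in> root_darts M"
    then show "kind T' ((f \<circ> i) x) = Leaf" "sg T' ((f \<circ> i) x) = (f \<circ> i) x"
      using A.kind_V0 A.sg_V0 st(1)[of "i x", symmetric] st(3)[of "i x"] by simp_all
  next
    fix x assume x: "x < nd M" "x \<notin> C"
    then show "al T' ((f \<circ> i) x) = (f \<circ> i) (al M x)" using A.al_i st(2)[of "i x", symmetric] by simp
  next
    fix x assume x: "x \<in> C"
    have e: "al T' (f (i x)) = f (A.e x)" using st(2)[of "i x"] x by simp
    show "al T' ((f \<circ> i) x) < nd T'" using e ft x by simp
    show "al T' ((f \<circ> i) x) \<notin> (f \<circ> i) ` {..<nd M}"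
      using e inj A.e_neq_i[OF x] x by auto
    show "al T' (al T' ((f \<circ> i) x)) = (f \<circ> i) x" using e st(2)[of "A.e x"] x by simp
    show "sg T' (al T' ((f \<circ> i) x)) = al T' ((f \<circ> i) x)" using e st(1)[of "A.e x"] x by simp
    show "kind T' (al T' ((f \<circ> i) x)) = (if blk M x then Bud else Leaf)" using e st(3)[of "A.e x"] x A.kind_e by simp
  next
    fix y assume "y < nd T'"
    then obtain z where z: "z < nd T" "y = f z" using f(1) by (auto simp: bij_betw_def)
    from A.T_dart[OF z(1)] show "y \<in> (f \<circ> i) ` {..<nd M} \<or> (\<exists>x\<in>C. y = al T' ((f \<circ> i) x))"
    proof
      assume "\<exists>x\<in>C. z = A.e x"
      then show ?thesis using z st(2) by auto
    qed (use z in auto)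
  qed
  then show ?thesis by blast
qed

text \<open>The closing is determined by the tree: the cut pairs are the unique closing matching, and the
  cyclic order at the root vertex is the order of the unmatched leaves along the contour.\<close>
lemma closing_unique:
  assumes 1: "bicubic M" "valid_cut M C" "opens_to M C T i"
    and 2: "bicubic M'" "valid_cut M' C'" "opens_to M' C' T i'" and wf: "wf_cmap T"
  obtains f where "bij_betw f {..<nd M} {..<nd M'}"
    "\<And>x. x < nd M \<Longrightarrow> f (sg M x) = sg M' (f x) \<and> f (al M x) = al M' (f x) \<and>
        blk M' (f x) = blk M x \<and> occ M' (f x) = occ M x" "f (rt M) = rt M'"
    "\<And>x. x < nd M \<Longrightarrow> f x \<in> C' \<longleftrightarrow> x \<in> C"
proof -
  have cs: "cutset M C" "cutset M' C'" using 1 2 by (auto simp: valid_cut_def)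
  interpret A: opened_valid M C T i by unfold_locales (use 1 wf cs in auto)
  interpret B: opened_valid M' C' T i' by unfold_locales (use 2 wf cs in auto)
  have P: "cut_pairs M C T i = cut_pairs M' C' T i'"
    using A.closing_iff B.closing_iff by blast
  \<comment> \<open>The embedded darts are those outside all closing pairs. As the closing depends
    on the tree alone, both embeddings have the same range.\<close>
  have ran: "y \<in> k ` {..<nd N} \<longleftrightarrow> y < nd T \<and> y \<notin> fst ` cut_pairs N K T k \<and> y \<notin> snd ` cut_pairs N K T k"
    if "opened_valid N K T k" for N K k y
  proof -
    interpret V: opened_valid N K T k by (rule that)
    have pair: "(V.e x, V.e (al N x)) \<in> cut_pairs N K T k" if "x \<in> K" "blk N x" for x
      unfolding cut_pairs_def using that by blast
    have ends: "y \<in> fst ` cut_pairs N K T k \<or> y \<in> snd ` cut_pairs N K T k \<longleftrightarrow> (\<exists>x\<in>K. y = V.e x)"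
    proof
      assume "\<exists>x\<in>K. y = V.e x"
      then obtain x where x: "x \<in> K" "y = V.e x" by blast
      show "y \<in> fst ` cut_pairs N K T k \<or> y \<in> snd ` cut_pairs N K T k"
      proof (cases "blk N x")
        case True
        then show ?thesis using pair[of x] x by force
      next
        case False
        have "(V.e (al N x), V.e (al N (al N x))) \<in> cut_pairs N K T k"
          by (rule pair) (use x False in auto)
        then show ?thesis using x by force
      qed
    next
      assume "y \<in> fst ` cut_pairs N K T k \<or> y \<in> snd ` cut_pairs N K T k"
      then obtain x where "x \<in> K" "y = V.e x \<or> y = V.e (al N x)" by (auto simp: cut_pairs_def)
      then show "\<exists>x\<in>K. y = V.e x" using V.C_a by blast
    qed
    show ?thesis
    proof
      assume y: "y \<in> k ` {..<nd N}"
      then have "\<not> (\<exists>x\<in>K. y = V.e x)" using V.e_notin by metis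
      moreover have "y < nd T" using y by auto
      ultimately show "y < nd T \<and> y \<notin> fst ` cut_pairs N K T k \<and> y \<notin> snd ` cut_pairs N K T k"
        using ends by metis
    next
      assume "y < nd T \<and> y \<notin> fst ` cut_pairs N K T k \<and> y \<notin> snd ` cut_pairs N K T k"
      then show "y \<in> k ` {..<nd N}" using ends V.T_dart[of y] by auto
    qed
  qed
  have im: "i ` {..<nd M} = i' ` {..<nd M'}"
  proof (rule set_eqI)
    fix y show "y \<in> i ` {..<nd M} \<longleftrightarrow> y \<in> i' ` {..<nd M'}"
      unfolding ran[OF A.opened_valid_axioms] ran[OF B.opened_valid_axioms] P ..
  qed
  define f where "f x = inv_into {..<nd M'} i' (i x)" for x
  have f: "f x < nd M' \<and> i' (f x) = i x" if "x < nd M" for x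
  proof -
    have "i x \<in> i' ` {..<nd M'}" using im that by blast
    then show ?thesis unfolding f_def using inv_into_into[of "i x" i' "{..<nd M'}"] f_inv_into_f[of "i x" i' "{..<nd M'}"] by simp
  qed
  have f_eq: "f x = z" if "i x = i' z" "x < nd M" "z < nd M'" for x z
    using f[OF that(2)] B.i_inj[of "f x" z] that by simp
  have bij: "bij_betw f {..<nd M} {..<nd M'}"
  proof (rule bij_betw_imageI)
    show "inj_on f {..<nd M}"
    proof (rule inj_onI)
      fix x y assume xy: "x \<in> {..<nd M}" "y \<in> {..<nd M}" "f x = f y"
      then have "i x = i y" using f[of x] f[of y] by (metis lessThan_iff)
      then show "x = y" using A.i_inj[of x y] xy by simp
    qed
    show "f ` {..<nd M} = {..<nd M'}"
    proof (intro equalityI subsetI)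
      fix z assume "z \<in> {..<nd M'}"
      then have z: "z < nd M'" by simp
      then have "i' z \<in> i ` {..<nd M}" using im by blast
      then obtain x where x: "x < nd M" "i x = i' z" by auto
      then have "f x = z" using f_eq z by simp
      then show "z \<in> f ` {..<nd M}" using x by blast
    qed (use f in auto)
  qed
  have fV: "f x \<in> root_darts M' \<longleftrightarrow> x \<in> root_darts M" if x: "x < nd M" for x
    using A.kind_i[of x] A.kind_V0[of x] B.kind_i[of "f x"] B.kind_V0[of "f x"] f[OF x] x by force
  have fr: "f (rt M) = rt M'" using f_eq[of "rt M" "rt M'"] A.i_r B.i_r by simp
  have fC: "f x \<in> C' \<longleftrightarrow> x \<in> C" if x: "x < nd M" for x
  proof -
    have "x \<in> C \<longleftrightarrow> al T (i x) \<notin> i ` {..<nd M}" using A.e_notin[of x] A.al_i[of x] x by auto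
    moreover have "f x \<in> C' \<longleftrightarrow> al T (i' (f x)) \<notin> i' ` {..<nd M'}"
      using B.e_notin[of "f x"] B.al_i[of "f x"] f[OF x] by auto
    ultimately show ?thesis using f[OF x] im by simp
  qed
  have sroot: "f (sg M (rt M)) = sg M' (rt M') \<and> f (sg M (sg M (rt M))) = sg M' (sg M' (rt M'))"
  proof -
    let ?u = "sg M (rt M)" and ?v = "sg M (sg M (rt M))" and ?u' = "sg M' (rt M')" and ?v' = "sg M' (sg M' (rt M'))"
    have lt: "A.T.p (i ?v) < A.T.p (i ?u)" using A.pT_ii A.V.order_V0 by simp
    have lt': "A.T.p (i' ?v') < A.T.p (i' ?u')" using B.pT_ii B.V.order_V0 by simp
    have fin: "f x \<noteq> f y" if "x < nd M" "y < nd M" "x \<noteq> y" for x y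
      using bij that by (auto simp: bij_betw_def inj_on_def)
    have "f ?u \<noteq> rt M'" "f ?v \<noteq> rt M'" "f ?u \<noteq> f ?v"
      using fin[of ?u "rt M"] fin[of ?v "rt M"] fin[of ?u ?v] fr A.s_neq[OF A.r_in] A.ss_neq[OF A.r_in] A.V.ssr_ne by auto
    moreover have "f ?u \<in> root_darts M'" "f ?v \<in> root_darts M'" using fV by auto
    ultimately have "(f ?u = ?u' \<and> f ?v = ?v') \<or> (f ?u = ?v' \<and> f ?v = ?u')" by (auto simp: root_darts_def)
    moreover have "\<not> (f ?u = ?v' \<and> f ?v = ?u')"
    proof
      assume "f ?u = ?v' \<and> f ?v = ?u'"
      then have "i' ?v' = i ?u" "i' ?u' = i ?v" using f[of ?u] f[of ?v] by auto
      then show False using lt lt' by simp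
    qed
    ultimately show ?thesis by blast
  qed
  have fs: "f (sg M x) = sg M' (f x)" if x: "x < nd M" for x
  proof (cases "x \<in> root_darts M")
    case True
    then show ?thesis using sroot fr A.sss[OF A.r_in] B.sss[OF B.r_in] by (auto simp: root_darts_def)
  next
    case False
    have "i (sg M x) = sg T (i x)" using A.sg_i[OF x False] by simp
    also have "\<dots> = i' (sg M' (f x))" using B.sg_i[of "f x"] f[OF x] fV[OF x] False by simp
    finally show ?thesis using f_eq[of "sg M x"] f[OF x] x by simp
  qed
  have fa_black: "f (al M x) = al M' (f x)" if x: "x \<in> C" "blk M x" for x
  proof -
    have "(A.e x, A.e (al M x)) \<in> cut_pairs M C T i" unfolding cut_pairs_def using x by blast
    then have "(A.e x, A.e (al M x)) \<in> cut_pairs M' C' T i'" unfolding P .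
    then obtain x' where x': "x' \<in> C'" "A.e x = B.e x'" "A.e (al M x) = B.e (al M' x')"
      unfolding cut_pairs_def by blast
    have "i x = i' x'" using A.al_e[OF x(1)] B.al_e[OF x'(1)] unfolding x'(2) by metis
    then have "f x = x'" using f_eq x x' by simp
    moreover have "i (al M x) = i' (al M' x')"
      using A.al_e[OF A.C_a[OF x(1)]] B.al_e[OF B.C_a[OF x'(1)]] unfolding x'(3) by metis
    then have "f (al M x) = al M' x'" using f_eq x x' by simp
    ultimately show ?thesis by simp
  qed
  have fa: "f (al M x) = al M' (f x)" if x: "x < nd M" for x
  proof (cases "x \<in> C")
    case True
    show ?thesis
    proof (cases "blk M x")
      case False
      then have "f x = al M' (f (al M x))" using fa_black[of "al M x"] True x by simp
      then show ?thesis using f[of "al M x"] x B.aa by simp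
    qed (use fa_black True in simp)
  next
    case False
    have "i (al M x) = al T (i x)" using A.al_i[OF x False] by simp
    also have "\<dots> = i' (al M' (f x))" using B.al_i[of "f x"] f[OF x] fC[OF x] False by simp
    finally show ?thesis using f_eq[of "al M x"] f[OF x] x by simp
  qed
  have fc: "blk M' (f x) = blk M x \<and> occ M' (f x) = occ M x" if x: "x < nd M" for x
  proof (cases "x \<in> root_darts M")
    case True
    then show ?thesis using fV[OF x] A.V0_black A.V0_occ B.V0_black B.V0_occ by blast
  next
    case False
    then show ?thesis using fV[OF x] f[OF x] A.tblk_i[OF x] A.tocc_i[OF x] B.tblk_i[of "f x"] B.tocc_i[of "f x"] by auto
  qed
  show thesis by (rule that[OF bij _ fr fC]) (use fs fa fc in auto)
qed

text \<open>Allows the closing of a tree to be replaced by the chosen representative of its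
  isomorphism class; the cut set is carried along.\<close>

lemma opens_to_bmap_iso:
  assumes M: "bicubic M" "valid_cut M C" "opens_to M C T i" and M': "bicubic M'" and iso: "bmap_iso M M'"
  shows "\<exists>C' i'. valid_cut M' C' \<and> opens_to M' C' T i'"
proof -
  obtain f where ndeq: "nd M = nd M'" and bij: "bij_betw f {..<nd M} {..<nd M'}" and fr: "f (rt M) = rt M'"
    and st: "\<And>x. x < nd M \<Longrightarrow> f (sg M x) = sg M' (f x)" "\<And>x. x < nd M \<Longrightarrow> f (al M x) = al M' (f x)"
      "\<And>x. x < nd M \<Longrightarrow> blk M' (f x) = blk M x" "\<And>x. x < nd M \<Longrightarrow> occ M' (f x) = occ M x"
    using iso unfolding bmap_iso_def by blast
  interpret V: valid_map M C by unfold_locales (use M in auto)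
  interpret B: bicubic_map M' by unfold_locales (rule M')
  have inj: "f x = f y \<longleftrightarrow> x = y" if "x < nd M" "y < nd M" for x y
    using bij that by (auto simp: bij_betw_def inj_on_def)
  have ft: "f x < nd M'" if "x < nd M" for x using bij that by (auto dest: bij_betwE)
  have surj: "\<exists>x<nd M. z = f x" if "z < nd M'" for z using bij that by (auto simp: bij_betw_def)
  define C' where "C' = f ` C"
  have fC: "f x \<in> C' \<longleftrightarrow> x \<in> C" if "x < nd M" for x unfolding C'_def using inj that V.C_in by auto
  have V0: "root_darts M' = f ` root_darts M" unfolding root_darts_def using st(1) fr by simp
  have fV: "f x \<in> root_darts M' \<longleftrightarrow> x \<in> root_darts M" if "x < nd M" for x unfolding V0 using inj that V.V0_in by auto
  have ct: "contour M' C' (f x) = f (contour M C x)" if "x < nd M" for x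
    using that fC[OF that] fV[OF that] fV[of "al M x"] st(1)[of x] st(1)[of "al M x"] st(2)[of x]
    by (simp add: contour_def Let_def)
  have pw: "(contour M' C' ^^ k) (rt M') = f ((contour M C ^^ k) (rt M)) \<and> (contour M C ^^ k) (rt M) < nd M" for k
    by (induction k) (use fr ct V.psi_in in auto)
  have cp: "cpos M' C' (f x) = cpos M C x" if x: "x < nd M" for x
  proof -
    have "(contour M' C' ^^ k) (rt M') = f x \<longleftrightarrow> (contour M C ^^ k) (rt M) = x" for k using pw[of k] inj x by auto
    then show ?thesis by (simp add: pos_of_def)
  qed
  have bt: "between M' C' (f x) = f ` between M C x" if x: "x < nd M" for x
  proof (intro equalityI subsetI)
    fix z assume z: "z \<in> between M' C' (f x)"
    then obtain y where y: "y < nd M" "z = f y" using surj by (auto simp: between_def)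
    then show "z \<in> f ` between M C x" using z cp[of y] cp[of x] cp[of "al M x"] x st(2)[of x] by (auto simp: between_def)
  next
    fix z assume "z \<in> f ` between M C x"
    then show "z \<in> between M' C' (f x)" using cp cp[of x] cp[of "al M x"] x st(2)[of x] ft by (auto simp: between_def)
  qed
  have "valid_cut M' C'" unfolding valid_cut_def
  proof (intro conjI allI ballI impI)
    show "cutset M' C'" unfolding cutset_def V0
    proof (intro conjI ballI)
      show "C' \<subseteq> {..<nd M'}" unfolding C'_def using ft V.C_in by auto
      show "al M' y \<in> C'" if "y \<in> C'" for y
      proof -
        obtain x where x: "x \<in> C" "y = f x" using \<open>y \<in> C'\<close> by (auto simp: C'_def)
        then have "al M' y = f (al M x)" using st(2)[of x] by simp
        then show ?thesis using V.C_a[OF x(1)] by (auto simp: C'_def)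
      qed
      show "C' \<inter> f ` root_darts M = {}" unfolding C'_def using inj V.C_V0 V.C_in V.V0_in by fastforce
    qed
    show "z \<in> orb (contour M' C') (rt M')" if "z < nd M'" for z
    proof -
      obtain x where x: "x < nd M" "z = f x" using surj[OF \<open>z < nd M'\<close>] by blast
      have "(contour M C ^^ cpos M C x) (rt M) = x" using V.cyc.pow_pos x by simp
      then have "(contour M' C' ^^ cpos M C x) (rt M') = z" using pw x by simp
      then show ?thesis using orb_pow by metis
    qed
    have "card C' = card C" unfolding C'_def by (rule card_image) (auto simp: inj_on_def inj)
    then show "nd M' = 3 * card C' + 6" using V.card_C ndeq by simp
    show "cpos M' C' (sg M' (sg M' (rt M'))) < cpos M' C' (sg M' (rt M'))"
      using V.order_V0 cp[of "sg M (rt M)"] cp[of "sg M (sg M (rt M))"] st(1)[of "rt M"] st(1)[of "sg M (rt M)"] fr by simp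
  next
    fix z assume z: "z \<in> C'" "blk M' z"
    then obtain x where x: "x \<in> C" "z = f x" by (auto simp: C'_def)
    have xD: "x < nd M" "blk M x" using x z st(3)[of x] by auto
    have al: "al M' z = f (al M x)" using st(2) x xD by simp
    show "cpos M' C' z < cpos M' C' (al M' z)" using V.pair_less[OF x(1) xD(2)] cp xD x al by simp
    have b: "between M C x \<inter> root_darts M = {}" "\<forall>y\<in>between M C x. y \<in> C \<longrightarrow> al M y \<in> between M C x"
      using V.valid x xD by (auto simp: valid_cut_def)
    have bD: "y < nd M" if "y \<in> between M C x" for y using that by (simp add: between_def)
    show "between M' C' z \<inter> root_darts M' = {}"
      using b(1) bD fV unfolding x(2) bt[OF xD(1)] by fastforce
    fix y assume y: "y \<in> between M' C' z" "y \<in> C'"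
    then obtain u where u: "u \<in> between M C x" "y = f u" unfolding x(2) bt[OF xD(1)] by blast
    then have "u \<in> C" using fC bD y by simp
    then have "al M u \<in> between M C x" using b(2) u by blast
    then have "f (al M u) \<in> f ` between M C x" by blast
    then show "al M' y \<in> between M' C' z" unfolding x(2) bt[OF xD(1)] using u st(2)[of u] bD by simp
  qed
  moreover define n where "n = inv_into {..<nd M} f"
  have n: "n (f x) = x" if "x < nd M" for x
    unfolding n_def using that bij by (intro inv_into_f_f) (auto simp: bij_betw_def)
  have "opens_to M' C' T (i \<circ> n)"
  proof -
    have o: "inj_on i {..<nd M}" using M(3) by (simp add: opens_to_def)
    have im: "(i \<circ> n) ` {..<nd M'} = i ` {..<nd M}"
    proof (intro equalityI subsetI)
      fix y assume "y \<in> (i \<circ> n) ` {..<nd M'}"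
      then obtain z where "z < nd M'" "y = i (n z)" by auto
      then show "y \<in> i ` {..<nd M}" using surj[of z] n by auto
    next
      fix y assume "y \<in> i ` {..<nd M}"
      then obtain x where "x < nd M" "y = i x" by auto
      then show "y \<in> (i \<circ> n) ` {..<nd M'}" using n[of x] ft[of x] by (auto intro!: image_eqI[of _ _ "f x"])
    qed
    have CC: "z \<in> C' \<Longrightarrow> \<exists>x\<in>C. z = f x" for z by (auto simp: C'_def)
    have VV: "z \<in> root_darts M' \<Longrightarrow> \<exists>x\<in>root_darts M. z = f x" for z by (auto simp: V0)
    show ?thesis unfolding opens_to_def im
    proof (intro conjI allI impI ballI)
      show "inj_on (i \<circ> n) {..<nd M'}"
      proof (rule inj_onI)
        fix u v assume uv: "u \<in> {..<nd M'}" "v \<in> {..<nd M'}" "(i \<circ> n) u = (i \<circ> n) v"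
        obtain x y where "x < nd M" "u = f x" "y < nd M" "v = f y" using surj uv by (metis lessThan_iff)
        then show "u = v" using uv n o by (auto simp: inj_on_def)
      qed
      show "(i \<circ> n) (rt M') = rtl T" using fr n[of "rt M"] M(3) by (auto simp: opens_to_def)
    next
      fix z assume "z < nd M'"
      then obtain x where x: "x < nd M" "z = f x" using surj by blast
      then show "(i \<circ> n) z < nd T" using n M(3) by (auto simp: opens_to_def)
    next
      fix z assume z: "z < nd M'" "z \<notin> root_darts M'"
      then obtain x where x: "x < nd M" "z = f x" using surj by blast
      then have xV: "x \<notin> root_darts M" using fV z by simp
      have "sg M' z = f (sg M x)" using st x by simp
      then have "n (sg M' z) = sg M x" using n[of "sg M x"] x by simp
      then show "kind T ((i \<circ> n) z) = Inner" "sg T ((i \<circ> n) z) = (i \<circ> n) (sg M' z)"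
        "tblk T ((i \<circ> n) z) = blk M' z" "tocc T ((i \<circ> n) z) = occ M' z"
        using x xV n[of x] st(3,4)[of x] M(3) by (auto simp: opens_to_def)
    next
      fix z assume "z \<in> root_darts M'"
      then obtain x where x: "x \<in> root_darts M" "z = f x" using VV by blast
      then show "kind T ((i \<circ> n) z) = Leaf" "sg T ((i \<circ> n) z) = (i \<circ> n) z"
        using n[of x] M(3) by (auto simp: opens_to_def)
    next
      fix z assume z: "z < nd M'" "z \<notin> C'"
      then obtain x where x: "x < nd M" "z = f x" using surj by blast
      then have xC: "x \<notin> C" using fC z by simp
      have "al M' z = f (al M x)" using st x by simp
      then have "n (al M' z) = al M x" using n[of "al M x"] x by simp
      then show "al T ((i \<circ> n) z) = (i \<circ> n) (al M' z)"
        using x xC n[of x] M(3) by (auto simp: opens_to_def)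
    next
      fix z assume z: "z \<in> C'"
      then obtain x where x: "x \<in> C" "z = f x" using CC by blast
      then show "al T ((i \<circ> n) z) < nd T" "al T ((i \<circ> n) z) \<notin> i ` {..<nd M}" "al T (al T ((i \<circ> n) z)) = (i \<circ> n) z"
        "sg T (al T ((i \<circ> n) z)) = al T ((i \<circ> n) z)" "kind T (al T ((i \<circ> n) z)) = (if blk M' z then Bud else Leaf)"
        using n[of x] st(3)[of x] M(3) V.C_in[of x] by (auto simp: opens_to_def)
    next
      fix y assume "y < nd T"
      then have "y \<in> i ` {..<nd M} \<or> (\<exists>x\<in>C. y = al T (i x))" using M(3) by (auto simp: opens_to_def)
      then show "y \<in> i ` {..<nd M} \<or> (\<exists>z\<in>C'. y = al T ((i \<circ> n) z))"
      proof
        assume "\<exists>x\<in>C. y = al T (i x)"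
        then obtain x where "x \<in> C" "y = al T (i x)" by blast
        then show ?thesis using n[of x] V.C_in[of x]
          by (intro disjI2 bexI[of _ "f x"]) (auto simp: C'_def)
      qed simp
    qed
  qed
  ultimately show ?thesis by blast
qed

text \<open>A connected map is rigid once a dart is fixed. Hence different cut sets of one
  representative never yield isomorphic rooted trees.\<close>

lemma (in planar_bicubic) automorphism_trivial:
  assumes "\<And>x. x < nd M \<Longrightarrow> f (s x) = s (f x) \<and> f (a x) = a (f x)" "f r = r" "x < nd M"
  shows "f x = x"
proof -
  have "x \<in> {x. x < nd M \<and> f x = x}"
    by (rule connected_induct[OF _ _ assms(3)]) (use assms(1,2) in auto)
  then show ?thesis by simp
qed

section \<open>Counting classes\<close>

text \<open>Counts classes through invariants in \<open>Y\<close>. A relation serves better than a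
  function because a tree is tied to its map and cut set only by the existence of an embedding;
  \<open>compat\<close> turns the fibres of \<open>R\<close> into the classes.\<close>

lemma bij_betw_quotient:
  assumes total: "\<And>x. x \<in> X \<Longrightarrow> \<exists>y\<in>Y. R x y" and onto: "\<And>y. y \<in> Y \<Longrightarrow> \<exists>x\<in>X. R x y"
    and compat: "\<And>x x' y y'. \<lbrakk>x \<in> X; x' \<in> X; y \<in> Y; y' \<in> Y; R x y; R x' y'\<rbrakk> \<Longrightarrow> E x x' \<longleftrightarrow> y = y'"
  shows "bij_betw (\<lambda>y. {x \<in> X. R x y}) Y (X // {(x, x'). x \<in> X \<and> x' \<in> X \<and> E x x'})"
proof -
  let ?Q = "{(x, x'). x \<in> X \<and> x' \<in> X \<and> E x x'}"
  have cls: "{x \<in> X. R x y} = ?Q `` {x0}" if x0: "x0 \<in> X" "y \<in> Y" "R x0 y" for x0 y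
  proof (intro equalityI subsetI)
    fix x assume "x \<in> {x \<in> X. R x y}"
    then show "x \<in> ?Q `` {x0}" using compat[of x0 x y y] x0 by simp
  next
    fix x assume "x \<in> ?Q `` {x0}"
    then have x: "x \<in> X" "E x0 x" by auto
    then obtain y' where "y' \<in> Y" "R x y'" using total by blast
    then show "x \<in> {x \<in> X. R x y}" using compat[of x0 x y y'] x0 x by simp
  qed
  show ?thesis
  proof (rule bij_betw_imageI)
    show "inj_on (\<lambda>y. {x \<in> X. R x y}) Y"
    proof (rule inj_onI)
      fix y y' assume y: "y \<in> Y" "y' \<in> Y" "{x \<in> X. R x y} = {x \<in> X. R x y'}"
      obtain x where x: "x \<in> X" "R x y" using onto y by blast
      then have "R x y'" using y by blast
      then show "y = y'" using compat[of x x y y] compat[of x x y y'] x y by blast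
    qed
    show "(\<lambda>y. {x \<in> X. R x y}) ` Y = X // ?Q"
    proof (intro equalityI subsetI)
      fix c assume "c \<in> (\<lambda>y. {x \<in> X. R x y}) ` Y"
      then obtain y where y: "y \<in> Y" "c = {x \<in> X. R x y}" by blast
      then obtain x0 where "x0 \<in> X" "R x0 y" using onto by blast
      then show "c \<in> X // ?Q" using cls[of x0 y] y by (auto simp: quotient_def)
    next
      fix c assume "c \<in> X // ?Q"
      then obtain x0 where x0: "x0 \<in> X" "c = ?Q `` {x0}" by (auto simp: quotient_def)
      then obtain y where "y \<in> Y" "R x0 y" using total by blast
      then show "c \<in> (\<lambda>y. {x \<in> X. R x y}) ` Y" using cls[of x0 y] x0 by blast
    qed
  qed
qed

lemma bmap_iso_refl: "bmap_iso M M"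
  unfolding bmap_iso_def by (auto intro!: exI[of _ id])

lemma bmap_iso_sym:
  assumes wf: "wf_cmap M" and iso: "bmap_iso M M'" and rt: "rt M < nd M"
  shows "bmap_iso M' M"
proof -
  obtain f where ndeq: "nd M = nd M'" and bij: "bij_betw f {..<nd M} {..<nd M'}" and fr: "f (rt M) = rt M'"
    and st: "\<And>x. x < nd M \<Longrightarrow> f (sg M x) = sg M' (f x) \<and> f (al M x) = al M' (f x) \<and>
      blk M' (f x) = blk M x \<and> occ M' (f x) = occ M x"
    using iso unfolding bmap_iso_def by blast
  define g where "g = inv_into {..<nd M} f"
  have gf: "g (f x) = x" if "x < nd M" for x
    unfolding g_def using that bij by (intro inv_into_f_f) (auto simp: bij_betw_def)
  have "bij_betw g {..<nd M'} {..<nd M}" unfolding g_def using bij by (rule bij_betw_inv_into)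
  moreover have "g (sg M' z) = sg M (g z) \<and> g (al M' z) = al M (g z) \<and> blk M (g z) = blk M' z \<and> occ M (g z) = occ M' z"
    if z: "z < nd M'" for z
  proof -
    obtain x where x: "x < nd M" "z = f x" using bij z by (auto simp: bij_betw_def)
    then show ?thesis using st[OF x(1)] gf[of x] gf[of "sg M x"] gf[of "al M x"] wf_cmapD(6,7)[OF wf x(1)] by metis
  qed
  moreover have "g (rt M') = rt M" using fr gf rt by metis
  ultimately show ?thesis unfolding bmap_iso_def using ndeq by (intro conjI exI[of _ g]) auto
qed

lemma bmap_iso_trans:
  assumes "bmap_iso M M'" "bmap_iso M' M''"
  shows "bmap_iso M M''"
proof -
  obtain f where f: "nd M = nd M'" "bij_betw f {..<nd M} {..<nd M'}" "f (rt M) = rt M'"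
    "\<And>x. x < nd M \<Longrightarrow> f (sg M x) = sg M' (f x) \<and> f (al M x) = al M' (f x) \<and>
      blk M' (f x) = blk M x \<and> occ M' (f x) = occ M x"
    using assms(1) unfolding bmap_iso_def by blast
  obtain g where g: "nd M' = nd M''" "bij_betw g {..<nd M'} {..<nd M''}" "g (rt M') = rt M''"
    "\<And>x. x < nd M' \<Longrightarrow> g (sg M' x) = sg M'' (g x) \<and> g (al M' x) = al M'' (g x) \<and>
      blk M'' (g x) = blk M' x \<and> occ M'' (g x) = occ M' x"
    using assms(2) unfolding bmap_iso_def by blast
  have ft: "f x < nd M'" if "x < nd M" for x using f(2) that by (auto dest: bij_betwE)
  show ?thesis unfolding bmap_iso_def
    using f g ft bij_betw_trans[OF f(2) g(2)] by (intro conjI exI[of _ "g \<circ> f"]) auto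
qed

section \<open>Representatives of isomorphism classes of maps\<close>

definition particle_maps :: "nat \<Rightarrow> nat \<Rightarrow> nat \<Rightarrow> nat \<Rightarrow> bmap set" where
  "particle_maps be we bo wo = {M. bicubic M \<and> planar_cmap M \<and>
     nverts_bm M True False = be \<and> nverts_bm M False False = we \<and>
     nverts_bm M True True = bo \<and> nverts_bm M False True = wo}"

text \<open>Isomorphic maps satisfy the same predicate under \<open>SOME\<close> and therefore get
  the same pick, so one map stands for each class.\<close>

definition representative :: "bmap set \<Rightarrow> bmap \<Rightarrow> bmap" where
  "representative X M = (SOME M'. M' \<in> X \<and> bmap_iso M M')"

lemma nverts_nd:
  assumes "bicubic M"
  shows "nd M \<le> 3 * (nverts_bm M True False + nverts_bm M False False + nverts_bm M True True + nverts_bm M False True)"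
proof -
  interpret bicubic_map M by unfold_locales (rule assms)
  let ?V = "\<lambda>b q. {orb s x | x. x < nd M \<and> black x = b \<and> occ M x = q}"
  have "verts M = ?V True False \<union> ?V False False \<union> ?V True True \<union> ?V False True"
    unfolding verts_def by (auto intro: exI)
  moreover have "card (A \<union> B \<union> E \<union> F) \<le> card A + card B + card E + card F" for A B E F :: "nat set set"
    using card_Un_le[of "A \<union> B \<union> E" F] card_Un_le[of "A \<union> B" E] card_Un_le[of A B] by linarith
  ultimately have "card (verts M) \<le> card (?V True False) + card (?V False False) + card (?V True True) + card (?V False True)"
    by (simp only:)
  moreover have "nd M = 3 * card (verts M)"
    using card_eq_mult_orbits[OF _ bij_s, of D 3] card_orb by (auto simp: verts_eq)
  ultimately show ?thesis by (simp add: nverts_bm_def)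
qed

text \<open>The set of maps itself can be infinite, as \<open>blk\<close> and \<open>occ\<close> are
  unconstrained beyond the darts. The vertex numbers bound the darts by \<open>?K\<close>, so
  truncating all data there gives a code with finitely many values that determines the map up to
  isomorphism.\<close>

lemma finite_representatives:
  "finite (representative (particle_maps be we bo wo) ` particle_maps be we bo wo)"
proof -
  let ?X = "particle_maps be we bo wo"
  let ?K = "3 * (be + we + bo + wo)"
  define code where "code M = (nd M, map (sg M) [0..<?K], map (al M) [0..<?K], map (blk M) [0..<?K],
    map (occ M) [0..<?K], rt M)" for M :: bmap
  have nd: "nd M \<le> ?K" if "M \<in> ?X" for M
    using nverts_nd[of M] that by (simp add: particle_maps_def)
  have "code ` ?X \<subseteq> {..?K} \<times> {l. set l \<subseteq> {..<?K} \<and> length l = ?K} \<times> {l. set l \<subseteq> {..<?K} \<and> length l = ?K} \<times>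
      {l. set l \<subseteq> UNIV \<and> length l = ?K} \<times> {l. set l \<subseteq> UNIV \<and> length l = ?K} \<times> {..?K}"
  proof
    fix c assume "c \<in> code ` ?X"
    then obtain M where M: "M \<in> ?X" "c = code M" by blast
    then have wf: "wf_cmap M" and rt: "rt M < nd M" by (auto simp: particle_maps_def bicubic_def)
    have "sg M x < ?K \<and> al M x < ?K" if "x < ?K" for x
    proof (cases "x < nd M")
      case True
      then show ?thesis using wf_cmapD(6,7)[OF wf True] nd[OF M(1)] by linarith
    next
      case False
      then show ?thesis using wf that by (simp add: wf_cmap_def)
    qed
    then show "c \<in> {..?K} \<times> {l. set l \<subseteq> {..<?K} \<and> length l = ?K} \<times> {l. set l \<subseteq> {..<?K} \<and> length l = ?K} \<times>
      {l. set l \<subseteq> UNIV \<and> length l = ?K} \<times> {l. set l \<subseteq> UNIV \<and> length l = ?K} \<times> {..?K}"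
      using nd[OF M(1)] rt unfolding M(2) code_def by auto
  qed
  moreover have "finite ({..?K} \<times> {l. set l \<subseteq> {..<?K} \<and> length l = ?K} \<times> {l. set l \<subseteq> {..<?K} \<and> length l = ?K} \<times>
      {l. set l \<subseteq> (UNIV::bool set) \<and> length l = ?K} \<times> {l. set l \<subseteq> (UNIV::bool set) \<and> length l = ?K} \<times> {..?K})"
    by (intro finite_cartesian_product finite_lists_length_eq) auto
  ultimately have "finite (code ` ?X)" using finite_subset by blast
  moreover have "representative ?X M = representative ?X M'" if MM: "M \<in> ?X" "M' \<in> ?X" "code M = code M'" for M M'
  proof -
    have e: "nd M = nd M'" "rt M = rt M'" "\<And>x. x < ?K \<Longrightarrow> sg M x = sg M' x \<and> al M x = al M' x \<and> blk M x = blk M' x \<and> occ M x = occ M' x"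
      using MM(3) by (auto simp: code_def)
    have "bmap_iso M M'" unfolding bmap_iso_def
      using e nd[OF MM(1)] by (intro conjI exI[of _ id]) auto
    moreover have "bmap_iso M' M" unfolding bmap_iso_def
      using e nd[OF MM(1)] by (intro conjI exI[of _ id]) auto
    ultimately have "bmap_iso M N \<longleftrightarrow> bmap_iso M' N" for N using bmap_iso_trans by blast
    then show ?thesis by (simp add: representative_def)
  qed
  ultimately show ?thesis
  proof -
    assume fin: "finite (code ` ?X)"
    assume same: "\<And>M M'. M \<in> ?X \<Longrightarrow> M' \<in> ?X \<Longrightarrow> code M = code M' \<Longrightarrow> representative ?X M = representative ?X M'"
    have "representative ?X ` ?X \<subseteq> (\<lambda>c. representative ?X (SOME M. M \<in> ?X \<and> code M = c)) ` (code ` ?X)"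
    proof
      fix N assume "N \<in> representative ?X ` ?X"
      then obtain M where M: "M \<in> ?X" "N = representative ?X M" by blast
      have "(SOME M'. M' \<in> ?X \<and> code M' = code M) \<in> ?X \<and> code (SOME M'. M' \<in> ?X \<and> code M' = code M) = code M"
        by (rule someI[of "\<lambda>M'. M' \<in> ?X \<and> code M' = code M" M]) (use M in simp)
      then have "N = representative ?X (SOME M'. M' \<in> ?X \<and> code M' = code M)"
        unfolding M(2) by (intro same) (use M in auto)
      then show "N \<in> (\<lambda>c. representative ?X (SOME M. M \<in> ?X \<and> code M = c)) ` (code ` ?X)" using M by blast
    qed
    then show ?thesis using fin finite_subset by blast
  qed
qed

lemma representative:
  assumes "M \<in> X"
  shows "representative X M \<in> X \<and> bmap_iso M (representative X M)"
  unfolding representative_def by (rule someI[of _ M]) (use assms bmap_iso_refl in simp)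

lemma representative_eq:
  assumes "M \<in> X" "M' \<in> X" "bmap_iso M M'" "\<And>M. M \<in> X \<Longrightarrow> bicubic M"
  shows "representative X M = representative X M'"
proof -
  have "bmap_iso M' M" using bmap_iso_sym[OF _ assms(3)] assms(4)[OF assms(1)] by (simp add: bicubic_def)
  then have "bmap_iso M N \<longleftrightarrow> bmap_iso M' N" for N using bmap_iso_trans assms(3) by blast
  then show ?thesis by (simp add: representative_def)
qed

lemma rooted_bicubic_hp_iff:
  "rooted_bicubic_hp M \<longleftrightarrow> bicubic M \<and> planar_cmap M \<and> conflicts M = {}"
proof -
  have "(\<forall>x<nd M. \<not> (occ M x \<and> occ M (al M x))) \<longleftrightarrow> conflicts M = {}" if b: "bicubic M"
  proof -
    interpret bicubic_map M by unfold_locales (rule b)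
    show ?thesis
    proof
      assume e: "conflicts M = {}"
      show "\<forall>x<nd M. \<not> (occ M x \<and> occ M (a x))"
      proof (intro allI impI notI)
        fix x assume x: "x < nd M" "occ M x \<and> occ M (a x)"
        have "y \<in> conflicts M" if "y < nd M" "black y" "occ M y" "occ M (a y)" for y
          using that V0_occ[of y] by (auto simp: conflicts_def arcs_def)
        from this[of x] this[of "a x"] show False using x e by (cases "black x") auto
      qed
    qed (auto simp: conflicts_def arcs_def)
  qed
  then show ?thesis unfolding rooted_bicubic_hp_def bicubic_def planar_cmap_def by blast
qed

lemma conflicts_iso:
  assumes "bmap_iso M M'" "bicubic M" "bicubic M'"
  shows "conflicts M = {} \<longleftrightarrow> conflicts M' = {}"
proof -
  have half: "conflicts M' = {}" if iso: "bmap_iso M M'" and b: "bicubic M" "bicubic M'" and e: "conflicts M = {}" for M M'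
  proof -
    obtain f where f: "bij_betw f {..<nd M} {..<nd M'}"
      "\<And>x. x < nd M \<Longrightarrow> f (sg M x) = sg M' (f x) \<and> f (al M x) = al M' (f x) \<and>
        blk M' (f x) = blk M x \<and> occ M' (f x) = occ M x"
      using iso unfolding bmap_iso_def by blast
    interpret A: bicubic_map M by unfold_locales (rule b)
    show ?thesis
    proof (rule ccontr)
      assume "conflicts M' \<noteq> {}"
      then obtain z where z: "z < nd M'" "blk M' z" "occ M' z" "occ M' (al M' z)" by (auto simp: conflicts_def arcs_def)
      obtain x where x: "x < nd M" "z = f x" using f(1) z(1) by (auto simp: bij_betw_def)
      have "blk M x" "occ M x" "occ M (al M x)" using f(2)[OF x(1)] f(2)[of "al M x"] x z by auto
      then have "x \<in> conflicts M" using x A.V0_occ[of x] by (auto simp: conflicts_def arcs_def)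
      then show False using e by simp
    qed
  qed
  show ?thesis using half[OF assms] half[OF bmap_iso_sym assms(3,2)] assms by (auto simp: bicubic_def)
qed

section \<open>Transfer to isomorphism classes\<close>

locale counting =
  fixes nbe nwe nbo nwo :: nat
begin

definition "maps = particle_maps (nbe + 1) nwe nbo nwo"
definition "reps = representative maps ` maps"

lemma mapsD: "M \<in> maps \<Longrightarrow> bicubic M \<and> planar_cmap M"
  by (simp add: maps_def particle_maps_def)

lemma reps_maps: "M \<in> reps \<Longrightarrow> M \<in> maps"
  using representative by (auto simp: reps_def)

lemma finite_reps: "finite reps"
  unfolding reps_def maps_def by (rule finite_representatives)

lemma rep_exists: "M \<in> maps \<Longrightarrow> \<exists>M'\<in>reps. bmap_iso M M'"
  using representative[of M maps] by (auto simp: reps_def)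

lemma reps_iso_eq:
  assumes "M \<in> reps" "M' \<in> reps" "bmap_iso M M'"
  shows "M = M'"
proof -
  obtain N N' where N: "N \<in> maps" "M = representative maps N" "N' \<in> maps" "M' = representative maps N'"
    using assms by (auto simp: reps_def)
  have "bmap_iso N M" "bmap_iso N' M'" using representative N by auto
  moreover have "bmap_iso M' N'" using bmap_iso_sym[OF _ \<open>bmap_iso N' M'\<close>] mapsD[OF N(3)] by (simp add: bicubic_def)
  ultimately have "bmap_iso N N'" using assms(3) bmap_iso_trans by blast
  then show ?thesis using representative_eq[OF N(1,3)] mapsD N by blast
qed

lemma planar_bicubic_maps: "M \<in> maps \<Longrightarrow> planar_bicubic M"
  using mapsD by unfold_locales auto

lemma wf_rooted: "rooted_blossom_tree T \<Longrightarrow> wf_cmap T"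
  by (simp add: rooted_blossom_tree_def blossom_tree_def planar_cmap_def)

definition opens :: "btree \<Rightarrow> bmap \<times> nat set \<Rightarrow> bool" where
  "opens T y \<longleftrightarrow> (\<exists>i. opens_to (fst y) (snd y) T i)"

lemma opened_validI:
  assumes "M \<in> maps" "valid_cut M C" "opens_to M C T i" "wf_cmap T"
  shows "opened_valid M C T i"
  using assms mapsD by unfold_locales (auto simp: valid_cut_def)

lemma nverts_maps:
  assumes "bicubic M" "valid_cut M C" "opens_to M C T i" "wf_cmap T"
  shows "M \<in> maps \<longleftrightarrow> nverts_bt T True False = nbe \<and> nverts_bt T False False = nwe \<and>
     nverts_bt T True True = nbo \<and> nverts_bt T False True = nwo"
proof -
  interpret V: opened_valid M C T i using assms by unfold_locales (auto simp: valid_cut_def)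
  show ?thesis unfolding maps_def particle_maps_def
    using assms(1) V.V.planar V.nverts_eq by auto
qed

text \<open>A class of rooted trees amounts to a representative map with a cut set. Stating this for
  any tree property \<open>Q\<close> with a translation \<open>q\<close> to cut sets serves good and
  admissible trees alike.\<close>

lemma bij_tree_classes:
  assumes Q: "\<And>M C T i. M \<in> maps \<Longrightarrow> valid_cut M C \<Longrightarrow> opens_to M C T i \<Longrightarrow> wf_cmap T \<Longrightarrow> Q T \<longleftrightarrow> q M C"
  shows "bij_betw (\<lambda>y. {T \<in> tree_set Q nbe nwe nbo nwo. opens T y})
    (Sigma reps (\<lambda>M. {C. valid_cut M C \<and> q M C})) (tree_classes Q nbe nwe nbo nwo)"
  unfolding tree_classes_def
proof (rule bij_betw_quotient)
  fix T assume T: "T \<in> tree_set Q nbe nwe nbo nwo"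
  have rT: "rooted_blossom_tree T" "Q T" using T by (auto simp: tree_set_def)
  have wf: "wf_cmap T" using wf_rooted rT by simp
  interpret R: rooted_tree T using rT by unfold_locales (auto simp: rooted_blossom_tree_def)
  obtain M C i where M: "bicubic M" "valid_cut M C" "opens_to M C T i" using R.closing_map[OF rT(1)] .
  have "M \<in> maps" using nverts_maps[OF M wf] T by (simp add: tree_set_def)
  then obtain M' where M': "M' \<in> reps" "bmap_iso M M'" using rep_exists by blast
  have M'm: "M' \<in> maps" using M' reps_maps by simp
  then obtain C' i' where C': "valid_cut M' C'" "opens_to M' C' T i'"
    using opens_to_bmap_iso[OF M _ M'(2)] mapsD by blast
  then have "q M' C'" using Q[OF M'm C' wf] rT by simp
  then show "\<exists>y\<in>Sigma reps (\<lambda>M. {C. valid_cut M C \<and> q M C}). opens T y"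
    using M' C' by (auto simp: opens_def intro!: bexI[of _ "(M', C')"])
next
  fix y assume "y \<in> Sigma reps (\<lambda>M. {C. valid_cut M C \<and> q M C})"
  then obtain M C where y: "y = (M, C)" "M \<in> reps" "valid_cut M C" "q M C" by auto
  have Mm: "M \<in> maps" using y reps_maps by simp
  interpret B: bicubic_map M using mapsD[OF Mm] by unfold_locales auto
  have "cutset M C" using y by (simp add: valid_cut_def)
  then obtain T i where T: "opens_to M C T i" "wf_cmap T" using B.opens_to_exists by blast
  interpret V: opened_valid M C T i using opened_validI[OF Mm y(3) T] .
  have "T \<in> tree_set Q nbe nwe nbo nwo" unfolding tree_set_def
    using V.rooted Q[OF Mm y(3) T] y nverts_maps[OF B.bicubic y(3) T] Mm by simp
  then show "\<exists>T\<in>tree_set Q nbe nwe nbo nwo. opens T y" using T y by (auto simp: opens_def)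
next
  fix T T' y y'
  assume T: "T \<in> tree_set Q nbe nwe nbo nwo" "T' \<in> tree_set Q nbe nwe nbo nwo"
    and y: "y \<in> Sigma reps (\<lambda>M. {C. valid_cut M C \<and> q M C})" "y' \<in> Sigma reps (\<lambda>M. {C. valid_cut M C \<and> q M C})"
    and op: "opens T y" "opens T' y'"
  have wf: "wf_cmap T" "wf_cmap T'" using T wf_rooted by (auto simp: tree_set_def)
  obtain M C i where M: "y = (M, C)" "M \<in> reps" "valid_cut M C" "opens_to M C T i" using y op by (auto simp: opens_def)
  obtain M' C' i' where M': "y' = (M', C')" "M' \<in> reps" "valid_cut M' C'" "opens_to M' C' T' i'"
    using y op by (auto simp: opens_def)
  have b: "bicubic M" "bicubic M'" using M M' reps_maps mapsD by auto
  have cs: "cutset M C" "cutset M' C'" using M M' by (auto simp: valid_cut_def)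
  show "btree_iso T T' \<longleftrightarrow> y = y'"
  proof
    assume "btree_iso T T'"
    then obtain k where k: "opens_to M C T' k" using opens_to_btree_iso[OF b(1) cs(1) M(4) wf(1)] by blast
    obtain f where f: "bij_betw f {..<nd M} {..<nd M'}"
      "\<And>x. x < nd M \<Longrightarrow> f (sg M x) = sg M' (f x) \<and> f (al M x) = al M' (f x) \<and>
        blk M' (f x) = blk M x \<and> occ M' (f x) = occ M x" "f (rt M) = rt M'"
      "\<And>x. x < nd M \<Longrightarrow> f x \<in> C' \<longleftrightarrow> x \<in> C"
      using closing_unique[OF b(1) M(3) k b(2) M'(3,4) wf(2)] by metis
    have "nd M = nd M'" using bij_betw_same_card[OF f(1)] by simp
    then have "bmap_iso M M'" unfolding bmap_iso_def using f(1-3) by (intro conjI exI[of _ f]) auto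
    then have MM: "M = M'" using reps_iso_eq M M' by simp
    interpret P: planar_bicubic M using planar_bicubic_maps M reps_maps by blast
    have "f x = x" if "x < nd M" for x
      using P.automorphism_trivial[of f] f(2,3) that unfolding MM by blast
    then have "x \<in> C' \<longleftrightarrow> x \<in> C" if "x < nd M" for x using f(4) that by metis
    moreover have "C \<subseteq> {..<nd M}" "C' \<subseteq> {..<nd M}" using cs MM by (auto simp: cutset_def)
    ultimately have "C = C'" by blast
    then show "y = y'" using MM M M' by simp
  next
    assume "y = y'"
    then have "opens_to M C T' i'" using M M' by simp
    then show "btree_iso T T'" using opens_to_iso[OF b(1) cs(1) M(4) wf(1) _ wf(2)] by blast
  qed
qed

text \<open>The residue is a fact about charges in trees, so it is read off from some opening along
  \<open>C\<close>.\<close>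

lemma mod3:
  assumes "M \<in> maps" "valid_cut M C" "x \<in> arcs M"
  shows "3 dvd height M C (sg M x) - height M C x + 1"
proof -
  interpret B: bicubic_map M using mapsD[OF assms(1)] by unfold_locales auto
  have "cutset M C" using assms by (simp add: valid_cut_def)
  then obtain T i where T: "opens_to M C T i" "wf_cmap T" using B.opens_to_exists by blast
  interpret V: opened_valid M C T i using opened_validI[OF assms(1,2) T] .
  show ?thesis using V.height_mod3 assms by simp
qed

lemma card_bmap_classes: "card (bmap_classes (nbe + 1) nwe nbo nwo) = card {M \<in> reps. conflicts M = {}}"
proof -
  let ?X = "bmaps (nbe + 1) nwe nbo nwo" and ?Y = "{M \<in> reps. conflicts M = {}}"
  have X: "?X = {M \<in> maps. conflicts M = {}}"
    by (auto simp: bmaps_def maps_def particle_maps_def rooted_bicubic_hp_iff)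
  have "bij_betw (\<lambda>y. {x \<in> ?X. bmap_iso x y}) ?Y (bmap_classes (nbe + 1) nwe nbo nwo)"
    unfolding bmap_classes_def
  proof (rule bij_betw_quotient)
    fix M assume M: "M \<in> ?X"
    then obtain M' where M': "M' \<in> reps" "bmap_iso M M'" using rep_exists X by blast
    then have "conflicts M' = {}" using conflicts_iso[OF M'(2)] M mapsD reps_maps X by auto
    then show "\<exists>y\<in>?Y. bmap_iso M y" using M' by blast
  next
    fix y assume "y \<in> ?Y"
    then show "\<exists>x\<in>?X. bmap_iso x y" using X reps_maps bmap_iso_refl by blast
  next
    fix x x' y y'
    assume x: "x \<in> ?X" "x' \<in> ?X" and y: "y \<in> ?Y" "y' \<in> ?Y" and iso: "bmap_iso x y" "bmap_iso x' y'"
    have b: "bicubic x" "bicubic x'" using x X mapsD by auto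
    have rev: "bmap_iso y x" "bmap_iso y' x'" using bmap_iso_sym iso b by (auto simp: bicubic_def)
    show "bmap_iso x x' \<longleftrightarrow> y = y'"
    proof
      assume "bmap_iso x x'"
      then have "bmap_iso y y'" using rev iso bmap_iso_trans by blast
      then show "y = y'" using reps_iso_eq y by blast
    next
      assume "y = y'"
      then show "bmap_iso x x'" using rev iso bmap_iso_trans by blast
    qed
  qed
  then show ?thesis by (rule bij_betw_same_card[symmetric])
qed

lemma finite_valid: "finite {C. valid_cut M C \<and> q M C}"
proof (rule finite_subset)
  show "{C. valid_cut M C \<and> q M C} \<subseteq> Pow {..<nd M}" by (auto simp: valid_cut_def cutset_def)
qed simp

lemma card_good_classes: "card (tree_classes good nbe nwe nbo nwo) = card {M \<in> reps. conflicts M = {}}"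
proof -
  let ?q = "\<lambda>M C. conflicts M = {} \<and> (\<forall>x\<in>arcs M - C. regular_arc M C x)"
  have "card (tree_classes good nbe nwe nbo nwo) = card (Sigma reps (\<lambda>M. {C. valid_cut M C \<and> ?q M C}))"
  proof (rule bij_betw_same_card[symmetric], rule bij_tree_classes)
    fix M C T i assume "M \<in> maps" "valid_cut M C" "opens_to M C T i" "wf_cmap T"
    then interpret V: opened_valid M C T i by (rule opened_validI)
    show "good T \<longleftrightarrow> ?q M C" by (rule V.good_iff)
  qed
  also have "\<dots> = (\<Sum>M\<in>reps. card {C. valid_cut M C \<and> ?q M C})"
    using finite_reps by (intro card_SigmaI) (auto intro: finite_valid)
  also have "\<dots> = (\<Sum>M\<in>reps. if conflicts M = {} then 1 else 0)"
  proof (rule sum.cong)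
    fix M assume M: "M \<in> reps"
    then have Mm: "M \<in> maps" by (rule reps_maps)
    interpret P: planar_bicubic M using planar_bicubic_maps[OF Mm] .
    show "card {C. valid_cut M C \<and> ?q M C} = (if conflicts M = {} then 1 else 0)"
    proof (cases "conflicts M = {}")
      case True
      have "\<exists>!C. valid_cut M C \<and> (\<forall>x\<in>arcs M - C. regular_arc M C x)"
        by (rule P.unique_regular_cut[OF mod3[OF Mm] True])
      then obtain C where "valid_cut M C \<and> (\<forall>x\<in>arcs M - C. regular_arc M C x)"
        "\<And>C'. valid_cut M C' \<and> (\<forall>x\<in>arcs M - C'. regular_arc M C' x) \<Longrightarrow> C' = C"
        by (elim ex1E) blast
      then have "{C. valid_cut M C \<and> ?q M C} = {C}" using True by blast
      then show ?thesis using True by simp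
    qed simp
  qed simp
  also have "\<dots> = card {M \<in> reps. conflicts M = {}}"
    using finite_reps by (simp add: sum.If_cases Int_def)
  finally show ?thesis .
qed

lemma sum_admissible_classes:
  "(\<Sum>c\<in>tree_classes admissible nbe nwe nbo nwo. (- 1 :: int) ^ n_NHP (SOME T. T \<in> c)) =
     int (card {M \<in> reps. conflicts M = {}})"
proof -
  let ?q = "\<lambda>M C. \<forall>x\<in>arcs M - C. regular_arc M C x \<longleftrightarrow> x \<notin> conflicts M"
  let ?Y = "Sigma reps (\<lambda>M. {C. valid_cut M C \<and> ?q M C})"
  let ?h = "\<lambda>y. {T \<in> tree_set admissible nbe nwe nbo nwo. opens T y}"
  have bij: "bij_betw ?h ?Y (tree_classes admissible nbe nwe nbo nwo)"
  proof (rule bij_tree_classes)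
    fix M C T i assume "M \<in> maps" "valid_cut M C" "opens_to M C T i" "wf_cmap T"
    then interpret V: opened_valid M C T i by (rule opened_validI)
    show "admissible T \<longleftrightarrow> ?q M C" by (rule V.admissible_iff)
  qed
  have "(\<Sum>c\<in>tree_classes admissible nbe nwe nbo nwo. (- 1 :: int) ^ n_NHP (SOME T. T \<in> c)) =
      (\<Sum>y\<in>?Y. (- 1) ^ n_NHP (SOME T. T \<in> ?h y))"
    by (rule sum.reindex_bij_betw[OF bij, symmetric])
  \<comment> \<open>Whichever tree is picked from the class, it is an opening of the same map along
    the same cut set, so its NHP edges correspond to the uncut conflicts.\<close>
  also have "\<dots> = (\<Sum>y\<in>?Y. (- 1) ^ card (conflicts (fst y) - snd y))"
  proof (rule sum.cong)
    fix y assume y: "y \<in> ?Y"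
    then obtain M C where MC: "y = (M, C)" "M \<in> reps" "valid_cut M C" by auto
    have "?h y \<in> tree_classes admissible nbe nwe nbo nwo" using bij y by (auto dest: bij_betwE)
    then have "?h y \<noteq> {}"
    proof -
      assume c: "?h y \<in> tree_classes admissible nbe nwe nbo nwo"
      have "btree_iso T T" for T :: btree unfolding btree_iso_def by (auto intro!: exI[of _ id])
      then show "?h y \<noteq> {}" using c by (auto simp: tree_classes_def quotient_def)
    qed
    then obtain T0 where "T0 \<in> ?h y" by blast
    then have "(SOME T. T \<in> ?h y) \<in> ?h y" by (rule someI)
    then obtain i where T: "(SOME T. T \<in> ?h y) \<in> tree_set admissible nbe nwe nbo nwo" "opens_to M C (SOME T. T \<in> ?h y) i"
      unfolding MC(1) opens_def by auto
    then have wf: "wf_cmap (SOME T. T \<in> ?h y)" using wf_rooted by (simp add: tree_set_def)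
    interpret V: opened_valid M C "SOME T. T \<in> ?h y" i
      by (rule opened_validI[OF reps_maps[OF MC(2)] MC(3) T(2) wf])
    show "(- 1 :: int) ^ n_NHP (SOME T. T \<in> ?h y) = (- 1) ^ card (conflicts (fst y) - snd y)"
      using V.n_NHP_eq MC by simp
  qed simp
  also have "\<dots> = (\<Sum>M\<in>reps. \<Sum>C | valid_cut M C \<and> ?q M C. (- 1) ^ card (conflicts M - C))"
    by (subst sum.Sigma) (use finite_reps finite_valid in \<open>auto simp: case_prod_beta\<close>)
  also have "\<dots> = (\<Sum>M\<in>reps. if conflicts M = {} then 1 else 0)"
  proof (rule sum.cong)
    fix M assume M: "M \<in> reps"
    then have Mm: "M \<in> maps" by (rule reps_maps)
    interpret P: planar_bicubic M using planar_bicubic_maps[OF Mm] .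
    show "(\<Sum>C | valid_cut M C \<and> ?q M C. (- 1 :: int) ^ card (conflicts M - C)) = (if conflicts M = {} then 1 else 0)"
      using P.signed_count[OF mod3[OF Mm]] unfolding P.admissible_cut_def by simp
  qed simp
  also have "\<dots> = int (card {M \<in> reps. conflicts M = {}})"
    using finite_reps by (simp add: sum.If_cases Int_def)
  finally show ?thesis .
qed

end

theorem mainTheorem1:
  fixes nbe nwe nbo nwo :: nat
  shows "(\<Sum>C \<in> tree_classes admissible nbe nwe nbo nwo. (-1::int) ^ n_NHP (SOME T. T \<in> C))
           = int (card (bmap_classes (nbe + 1) nwe nbo nwo))
       \<and> card (bmap_classes (nbe + 1) nwe nbo nwo) = card (tree_classes good nbe nwe nbo nwo)"
  using counting.sum_admissible_classes counting.card_bmap_classes counting.card_good_classes by simp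

end
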